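(* For every $n\ge 1$ and every $Q\in GL(n,\mathbb{C})$, the compact quantum group $A_u(Q)$ is not simple.
   Context: Compact quantum groups. A Woronowicz $C^*$-algebra is a nonzero unital $C^*$-algebra $A$ with a coassociative unital $*$-homomorphism $\Delta:A\to A\otimes A$ (minimal tensor product; the coproduct) such that $\Delta(A)(1\otimes A)$ and $\Delta(A)(A\otimes 1)$ span dense subspaces of $A\otimes A$; one writes $A=A_G=C(G)$ and calls $G$ (or $A_G$ itself) a compact quantum group. A representation of $G$ of dimension $d$ is an invertible matrix $v=(v_{ij})\in M_d(A_G)$ with $\Delta(v_{ij})=\sum_k v_{ik}\otimes v_{kj}$; the $v_{ij}$ are its coefficients; the trivial representation of dimension one is $1\in A_G$. $\mathcal{A}_G$ is the canonical dense Hopf $*$-algebra spanned by coefficients of finite dimensional representations. $A_G$ is full if $\|a\|=\sup\{\|\pi(a)\|:\pi \text{ a } *\text{-representation of }\mathcal{A}_G\}$ for $a\in\mathcal{A}_G$. All Woronowicz $C^*$-algebras are assumed full unless stated otherwise. A morphism of Woronowicz $C^*$-algebras is a unital $*$-homomorphism intertwining the coproducts. Quantum subgroups. A quantum subgroup of $G$ is a pair $(N,\pi)$ with $N$ a compact quantum group and $\pi:A_G\to A_N$ a surjective morphism. Put $A_{G/N}=\{a\in A_G:(\mathrm{id}\otimes\pi)\Delta(a)=a\otimes 1\}$ and $A_{N\backslash G}=\{a\in A_G:(\pi\otimes \mathrm{id})\Delta(a)=1\otimes a\}$. $(N,\pi)$ is normal if $A_{G/N}=A_{N\backslash G}$. Two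 quantum subgroups $(N_1,\pi_1),(N_2,\pi_2)$ are regarded as the same if $\ker\pi_1=\ker\pi_2$. The trivial normal quantum subgroups are the one-element group $(\{e\},\varepsilon)$ ($\varepsilon$ the counit) and $G$ itself $(G,\mathrm{id})$. Simplicity. $G$ is connected if for every non-trivial irreducible representation $w$ of $G$ the $C^*$-subalgebra generated by the coefficients $w_{ij}$ is infinite dimensional. $G$ is simple if: (1) $A_G$ is finitely generated as a $C^*$-algebra; (2) $G$ is connected; (3) $G$ has no non-trivial connected normal quantum subgroups; (4) $G$ has no non-trivial representations of dimension one. The quantum group $A_u(Q)$. For $Q\in GL(n,\mathbb{C})$, $A_u(Q)$ is the universal $C^*$-algebra generated by $u_{ij}$ ($i,j=1,\dots,n$) subject to $u^*u=I_n=uu^*$ and $u^tQ\bar uQ^{-1}=I_n=Q\bar uQ^{-1}u^t$, where $u=(u_{ij})$, $u^t=(u_{ji})$, $\bar u=(u_{ij}^* )$, with coproduct $\Delta(u_{ij})=\sum_k u_{ik}\otimes u_{kj}$; the same symbol denotes the corresponding compact quantum group. *)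

theory Defs
  imports "HOL-Analysis.Analysis" "HOL-Algebra.Module" "HOL-Algebra.AbelCoset"
    "HOL-Library.Multiset"
begin

section \<open>C*-algebras with explicit carriers\<close>

text \<open>
  The record is also used for ``raw'' *-algebras (term algebras, formal sums of tensors), whose
  elements are only meaningful up to elements at distance 0 and which become C*-algebras after
  completion; \<open>dst\<close> below is therefore written with \<open>(-1) \<odot> y\<close> rather than with \<open>\<ominus>\<close>.
\<close>

record 'a cstar = "(complex, 'a) module" +
  star :: "'a \<Rightarrow> 'a"
  nrm :: "'a \<Rightarrow> real"

definition complex_cstar :: "complex cstar" where
  "complex_cstar = \<lparr>carrier = UNIV, mult = (*), one = 1, zero = 0, add = (+),
     smult = (*), star = cnj, nrm = cmod\<rparr>"

definition dst :: "('a, 'm) cstar_scheme \<Rightarrow> 'a \<Rightarrow> 'a \<Rightarrow> real" where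
  "dst A x y = nrm A (x \<oplus>\<^bsub>A\<^esub> ((-1) \<odot>\<^bsub>A\<^esub> y))"

definition cauchy_seq :: "('a, 'm) cstar_scheme \<Rightarrow> (nat \<Rightarrow> 'a) \<Rightarrow> bool" where
  "cauchy_seq A x \<longleftrightarrow> (\<forall>n. x n \<in> carrier A) \<and>
     (\<forall>e>0. \<exists>N. \<forall>m\<ge>N. \<forall>n\<ge>N. dst A (x m) (x n) < e)"

definition converges_to :: "('a, 'm) cstar_scheme \<Rightarrow> (nat \<Rightarrow> 'a) \<Rightarrow> 'a \<Rightarrow> bool" where
  "converges_to A x l \<longleftrightarrow> (\<lambda>n. dst A (x n) l) \<longlonglongrightarrow> 0"

locale cstar_algebra = ring A + Module.module complex_cstar A for A (structure) +
  assumes smult_mult_left: "\<lbrakk>x \<in> carrier A; y \<in> carrier A\<rbrakk> \<Longrightarrow> (c \<odot> x) \<otimes> y = c \<odot> (x \<otimes> y)"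
    and smult_mult_right: "\<lbrakk>x \<in> carrier A; y \<in> carrier A\<rbrakk> \<Longrightarrow> x \<otimes> (c \<odot> y) = c \<odot> (x \<otimes> y)"
    and star_closed: "x \<in> carrier A \<Longrightarrow> star A x \<in> carrier A"
    and star_star: "x \<in> carrier A \<Longrightarrow> star A (star A x) = x"
    and star_add: "\<lbrakk>x \<in> carrier A; y \<in> carrier A\<rbrakk> \<Longrightarrow> star A (x \<oplus> y) = star A x \<oplus> star A y"
    and star_smult: "x \<in> carrier A \<Longrightarrow> star A (c \<odot> x) = cnj c \<odot> star A x"
    and star_mult: "\<lbrakk>x \<in> carrier A; y \<in> carrier A\<rbrakk> \<Longrightarrow> star A (x \<otimes> y) = star A y \<otimes> star A x"
    and nrm_nonneg: "x \<in> carrier A \<Longrightarrow> 0 \<le> nrm A x"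
    and nrm_eq_zero: "x \<in> carrier A \<Longrightarrow> nrm A x = 0 \<longleftrightarrow> x = \<zero>"
    and nrm_add: "\<lbrakk>x \<in> carrier A; y \<in> carrier A\<rbrakk> \<Longrightarrow> nrm A (x \<oplus> y) \<le> nrm A x + nrm A y"
    and nrm_smult: "x \<in> carrier A \<Longrightarrow> nrm A (c \<odot> x) = cmod c * nrm A x"
    and nrm_mult: "\<lbrakk>x \<in> carrier A; y \<in> carrier A\<rbrakk> \<Longrightarrow> nrm A (x \<otimes> y) \<le> nrm A x * nrm A y"
    and nrm_star_self: "x \<in> carrier A \<Longrightarrow> nrm A (star A x \<otimes> x) = (nrm A x)\<^sup>2"
    and complete: "cauchy_seq A s \<Longrightarrow> \<exists>l\<in>carrier A. converges_to A s l"

definition star_hom ::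
  "('a, 'm) cstar_scheme \<Rightarrow> ('b, 'k) cstar_scheme \<Rightarrow> ('a \<Rightarrow> 'b) \<Rightarrow> bool" where
  "star_hom A B f \<longleftrightarrow>
     (\<forall>x\<in>carrier A. f x \<in> carrier B) \<and>
     (\<forall>x\<in>carrier A. \<forall>y\<in>carrier A. f (x \<oplus>\<^bsub>A\<^esub> y) = f x \<oplus>\<^bsub>B\<^esub> f y) \<and>
     (\<forall>x\<in>carrier A. \<forall>y\<in>carrier A. f (x \<otimes>\<^bsub>A\<^esub> y) = f x \<otimes>\<^bsub>B\<^esub> f y) \<and>
     (\<forall>c. \<forall>x\<in>carrier A. f (c \<odot>\<^bsub>A\<^esub> x) = c \<odot>\<^bsub>B\<^esub> f x) \<and>
     (\<forall>x\<in>carrier A. f (star A x) = star B (f x))"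

definition unital_star_hom ::
  "('a, 'm) cstar_scheme \<Rightarrow> ('b, 'k) cstar_scheme \<Rightarrow> ('a \<Rightarrow> 'b) \<Rightarrow> bool" where
  "unital_star_hom A B f \<longleftrightarrow> star_hom A B f \<and> f \<one>\<^bsub>A\<^esub> = \<one>\<^bsub>B\<^esub>"

definition lin_span :: "('a, 'm) cstar_scheme \<Rightarrow> 'a set \<Rightarrow> 'a set" where
  "lin_span A S = {finsum A (\<lambda>s. c s \<odot>\<^bsub>A\<^esub> s) F | F c. finite F \<and> F \<subseteq> S}"

definition nrm_closure :: "('a, 'm) cstar_scheme \<Rightarrow> 'a set \<Rightarrow> 'a set" where
  "nrm_closure A S = {x \<in> carrier A. \<forall>e>0. \<exists>y\<in>S. dst A x y < e}"

definition cstar_subalgebra :: "('a, 'm) cstar_scheme \<Rightarrow> 'a set \<Rightarrow> bool" where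
  "cstar_subalgebra A B \<longleftrightarrow> B \<subseteq> carrier A \<and> \<zero>\<^bsub>A\<^esub> \<in> B \<and>
     (\<forall>x\<in>B. \<forall>y\<in>B. x \<oplus>\<^bsub>A\<^esub> y \<in> B \<and> x \<otimes>\<^bsub>A\<^esub> y \<in> B) \<and>
     (\<forall>c. \<forall>x\<in>B. c \<odot>\<^bsub>A\<^esub> x \<in> B) \<and> (\<forall>x\<in>B. star A x \<in> B) \<and>
     nrm_closure A B \<subseteq> B"

definition cstar_generated :: "('a, 'm) cstar_scheme \<Rightarrow> 'a set \<Rightarrow> 'a set" where
  "cstar_generated A S = \<Inter>{B. cstar_subalgebra A B \<and> S \<subseteq> B}"

definition infinite_dimensional :: "('a, 'm) cstar_scheme \<Rightarrow> 'a set \<Rightarrow> bool" where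
  "infinite_dimensional A B \<longleftrightarrow> \<not> (\<exists>F. finite F \<and> F \<subseteq> B \<and> B \<subseteq> lin_span A F)"


section \<open>Bounded operators on \<open>l\<^sup>2\<close> of a type\<close>

text \<open>
  A bounded operator \<open>T\<close> on \<open>l\<^sup>2\<close>(UNIV :: 'i set) is represented by its matrix, with entry
  \<open>\<langle>e\<^sub>i, T e\<^sub>j\<rangle>\<close> at \<open>i j\<close>.  A matrix comes from an operator of norm \<open>\<le> C\<close> iff its sesquilinear
  form satisfies the estimate \<open>op_bound M C\<close> on finitely supported vectors.
\<close>

type_synonym 'i op = "'i \<Rightarrow> 'i \<Rightarrow> complex"

definition op_bound :: "'i op \<Rightarrow> real \<Rightarrow> bool" where
  "op_bound M C \<longleftrightarrow> 0 \<le> C \<and>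
     (\<forall>F v w. finite F \<longrightarrow>
        cmod (\<Sum>i\<in>F. \<Sum>j\<in>F. cnj (v i) * M i j * w j)
          \<le> C * L2_set (\<lambda>i. cmod (v i)) F * L2_set (\<lambda>i. cmod (w i)) F)"

definition op_norm :: "'i op \<Rightarrow> real" where
  "op_norm M = Inf {C. op_bound M C}"

definition bounded_ops :: "'i op cstar" where
  "bounded_ops = \<lparr>carrier = {M. \<exists>C. op_bound M C},
     mult = (\<lambda>M N i k. \<Sum>\<^sub>\<infinity>j. M i j * N j k),
     one = (\<lambda>i j. if i = j then 1 else 0),
     zero = (\<lambda>i j. 0),
     add = (\<lambda>M N i j. M i j + N i j),
     smult = (\<lambda>c M i j. c * M i j),
     star = (\<lambda>M i j. cnj (M j i)),
     nrm = op_norm\<rparr>"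

text \<open>
  The *-representations of a *-algebra with elements in \<open>'x\<close>, possibly degenerate, on
  \<open>l\<^sup>2\<close>(UNIV :: 'x set).  Suprema of norms over all *-representations on Hilbert spaces are already
  given by these: a cyclic representation space has a dense subset indexed by the algebra, hence
  an orthonormal basis indexed by a subset of \<open>'x\<close>, and the representation can be extended by 0.
  For the same reason every C*-algebra with elements in \<open>'x\<close> has a faithful representation here.
\<close>

definition star_reps :: "('x, 'm) cstar_scheme \<Rightarrow> ('x \<Rightarrow> 'x op) set" where
  "star_reps A = {\<pi>. star_hom A bounded_ops \<pi>}"


section \<open>Completion\<close>

definition cauchy_class :: "('x, 'm) cstar_scheme \<Rightarrow> (nat \<Rightarrow> 'x) \<Rightarrow> (nat \<Rightarrow> 'x) set" where
  "cauchy_class A x = {y. cauchy_seq A y \<and> (\<lambda>n. dst A (x n) (y n)) \<longlonglongrightarrow> 0}"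

text \<open>Hausdorff completion of a *-algebra with respect to the seminorm \<open>nrm\<close>.\<close>

definition completion :: "('x, 'm) cstar_scheme \<Rightarrow> (nat \<Rightarrow> 'x) set cstar" where
  "completion A = \<lparr>carrier = cauchy_class A ` {x. cauchy_seq A x},
     mult = (\<lambda>X Y. \<Union>x\<in>X. \<Union>y\<in>Y. cauchy_class A (\<lambda>n. x n \<otimes>\<^bsub>A\<^esub> y n)),
     one = cauchy_class A (\<lambda>n. \<one>\<^bsub>A\<^esub>),
     zero = cauchy_class A (\<lambda>n. \<zero>\<^bsub>A\<^esub>),
     add = (\<lambda>X Y. \<Union>x\<in>X. \<Union>y\<in>Y. cauchy_class A (\<lambda>n. x n \<oplus>\<^bsub>A\<^esub> y n)),
     smult = (\<lambda>c X. \<Union>x\<in>X. cauchy_class A (\<lambda>n. c \<odot>\<^bsub>A\<^esub> x n)),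
     star = (\<lambda>X. \<Union>x\<in>X. cauchy_class A (\<lambda>n. star A (x n))),
     nrm = (\<lambda>X. the_elem ((\<lambda>x. lim (\<lambda>n. nrm A (x n))) ` X))\<rparr>"

definition completion_embed :: "('x, 'm) cstar_scheme \<Rightarrow> 'x \<Rightarrow> (nat \<Rightarrow> 'x) set" where
  "completion_embed A a = cauchy_class A (\<lambda>n. a)"

text \<open>Extension of a seminorm-continuous linear map \<open>f\<close> into \<open>B\<close> to the completions.\<close>

definition completion_map ::
  "('y, 'm) cstar_scheme \<Rightarrow> ('x \<Rightarrow> 'y) \<Rightarrow> (nat \<Rightarrow> 'x) set \<Rightarrow> (nat \<Rightarrow> 'y) set" where
  "completion_map B f X = (\<Union>x\<in>X. cauchy_class B (\<lambda>n. f (x n)))"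


section \<open>The minimal tensor product\<close>

text \<open>
  A multiset of pairs \<open>(a\<^sub>k, b\<^sub>k)\<close> stands for \<open>\<Sum>\<^sub>k a\<^sub>k \<otimes> b\<^sub>k\<close>; the relations of the algebraic
  tensor product are imposed by the spatial norm, which is the norm of
  \<open>\<Sum>\<^sub>k \<pi>(a\<^sub>k) \<otimes> \<rho>(b\<^sub>k)\<close> maximised over all representations.
\<close>

definition kron_sum ::
  "('a \<Rightarrow> 'i op) \<Rightarrow> ('b \<Rightarrow> 'j op) \<Rightarrow> ('a \<times> 'b) multiset \<Rightarrow> ('i \<times> 'j) op" where
  "kron_sum \<pi> \<rho> M = (\<lambda>(i, j) (i', j'). \<Sum>(a, b)\<in>#M. \<pi> a i i' * \<rho> b j j')"

definition formal_tensor ::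
  "('a, 'm) cstar_scheme \<Rightarrow> ('b, 'k) cstar_scheme \<Rightarrow> ('a \<times> 'b) multiset cstar" where
  "formal_tensor A B = \<lparr>carrier = {M. set_mset M \<subseteq> carrier A \<times> carrier B},
     mult = (\<lambda>M N. \<Sum>(a, b)\<in>#M. image_mset (\<lambda>(a', b'). (a \<otimes>\<^bsub>A\<^esub> a', b \<otimes>\<^bsub>B\<^esub> b')) N),
     one = {#(\<one>\<^bsub>A\<^esub>, \<one>\<^bsub>B\<^esub>)#},
     zero = {#},
     add = (+),
     smult = (\<lambda>c. image_mset (\<lambda>(a, b). (c \<odot>\<^bsub>A\<^esub> a, b))),
     star = image_mset (\<lambda>(a, b). (star A a, star B b)),
     nrm = (\<lambda>M. SUP (\<pi>, \<rho>)\<in>star_reps A \<times> star_reps B. op_norm (kron_sum \<pi> \<rho> M))\<rparr>"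

type_synonym ('a, 'b) tensor = "(nat \<Rightarrow> ('a \<times> 'b) multiset) set"

definition min_tensor ::
  "('a, 'm) cstar_scheme \<Rightarrow> ('b, 'k) cstar_scheme \<Rightarrow> ('a, 'b) tensor cstar" where
  "min_tensor A B = completion (formal_tensor A B)"

definition formal_sum ::
  "('a, 'm) cstar_scheme \<Rightarrow> ('b, 'k) cstar_scheme \<Rightarrow> ('a \<times> 'b) multiset \<Rightarrow> ('a, 'b) tensor" where
  "formal_sum A B M = completion_embed (formal_tensor A B) M"

definition tens ::
  "('a, 'm) cstar_scheme \<Rightarrow> ('b, 'k) cstar_scheme \<Rightarrow> 'a \<Rightarrow> 'b \<Rightarrow> ('a, 'b) tensor" where
  "tens A B a b = formal_sum A B {#(a, b)#}"

text \<open>The map \<open>f \<otimes> g\<close> into the minimal tensor product of \<open>C\<close> and \<open>D\<close>.\<close>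

definition tensor_map ::
  "('c, 'm) cstar_scheme \<Rightarrow> ('d, 'k) cstar_scheme \<Rightarrow> ('a \<Rightarrow> 'c) \<Rightarrow> ('b \<Rightarrow> 'd) \<Rightarrow>
     ('a, 'b) tensor \<Rightarrow> ('c, 'd) tensor" where
  "tensor_map C D f g = completion_map (formal_tensor C D) (image_mset (map_prod f g))"

text \<open>
  \<open>X\<close> and \<open>Y\<close> correspond to each other under the canonical isomorphism between
  \<open>(A \<otimes> B) \<otimes> C\<close> and \<open>A \<otimes> (B \<otimes> C)\<close>.  That isomorphism is isometric, so its graph is the closure
  of its graph on algebraic tensors.
\<close>

definition tensor_assoc ::
  "('a, 'm) cstar_scheme \<Rightarrow> ('b, 'k) cstar_scheme \<Rightarrow> ('c, 'l) cstar_scheme \<Rightarrow>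
     (('a, 'b) tensor, 'c) tensor \<Rightarrow> ('a, ('b, 'c) tensor) tensor \<Rightarrow> bool" where
  "tensor_assoc A B C X Y \<longleftrightarrow>
     (\<exists>M :: nat \<Rightarrow> ('a \<times> 'b \<times> 'c) multiset.
        (\<forall>n. set_mset (M n) \<subseteq> carrier A \<times> carrier B \<times> carrier C) \<and>
        converges_to (min_tensor (min_tensor A B) C)
          (\<lambda>n. formal_sum (min_tensor A B) C (image_mset (\<lambda>(a, b, c). (tens A B a b, c)) (M n))) X \<and>
        converges_to (min_tensor A (min_tensor B C))
          (\<lambda>n. formal_sum A (min_tensor B C) (image_mset (\<lambda>(a, b, c). (a, tens B C b c)) (M n))) Y)"


section \<open>Compact quantum groups\<close>

record 'a cqg = "'a cstar" +
  comult :: "'a \<Rightarrow> ('a, 'a) tensor"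

definition mat_mult ::
  "('a, 'm) cstar_scheme \<Rightarrow> 'i set \<Rightarrow> ('i \<Rightarrow> 'i \<Rightarrow> 'a) \<Rightarrow> ('i \<Rightarrow> 'i \<Rightarrow> 'a) \<Rightarrow> 'i \<Rightarrow> 'i \<Rightarrow> 'a" where
  "mat_mult A I v w = (\<lambda>i j. finsum A (\<lambda>k. v i k \<otimes>\<^bsub>A\<^esub> w k j) I)"

definition mat_one :: "('a, 'm) cstar_scheme \<Rightarrow> 'i \<Rightarrow> 'i \<Rightarrow> 'a" where
  "mat_one A = (\<lambda>i j. if i = j then \<one>\<^bsub>A\<^esub> else \<zero>\<^bsub>A\<^esub>)"

text \<open>A matrix in \<open>M\<^sub>d(A)\<close> is a function whose values at indices below \<open>d\<close> are relevant.\<close>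

definition representation :: "('a, 'm) cqg_scheme \<Rightarrow> nat \<Rightarrow> (nat \<Rightarrow> nat \<Rightarrow> 'a) \<Rightarrow> bool" where
  "representation G d v \<longleftrightarrow>
     (\<forall>i<d. \<forall>j<d. v i j \<in> carrier G) \<and>
     (\<exists>w. (\<forall>i<d. \<forall>j<d. w i j \<in> carrier G) \<and>
        (\<forall>i<d. \<forall>j<d. mat_mult G {..<d} v w i j = mat_one G i j \<and>
                       mat_mult G {..<d} w v i j = mat_one G i j)) \<and>
     (\<forall>i<d. \<forall>j<d. comult G (v i j) =
        finsum (min_tensor G G) (\<lambda>k. tens G G (v i k) (v k j)) {..<d})"

text \<open>The *-algebra spanned by the coefficients of the finite dimensional representations.\<close>

definition coefficient_algebra :: "('a, 'm) cqg_scheme \<Rightarrow> 'a set" where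
  "coefficient_algebra G =
     lin_span G {v i j | d v i j. representation G d v \<and> i < d \<and> j < d}"

definition full :: "('a, 'm) cqg_scheme \<Rightarrow> bool" where
  "full G \<longleftrightarrow> (\<forall>a\<in>coefficient_algebra G.
     bdd_above ((\<lambda>\<pi>. op_norm (\<pi> a)) ` star_reps (G\<lparr>carrier := coefficient_algebra G\<rparr>)) \<and>
     nrm G a = (SUP \<pi>\<in>star_reps (G\<lparr>carrier := coefficient_algebra G\<rparr>). op_norm (\<pi> a)))"

text \<open>Full Woronowicz C*-algebras.\<close>

definition compact_quantum_group :: "('a, 'm) cqg_scheme \<Rightarrow> bool" where
  "compact_quantum_group G \<longleftrightarrow>
     cstar_algebra G \<and> \<one>\<^bsub>G\<^esub> \<noteq> \<zero>\<^bsub>G\<^esub> \<and>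
     unital_star_hom G (min_tensor G G) (comult G) \<and>
     (\<forall>a\<in>carrier G. tensor_assoc G G G
        (tensor_map (min_tensor G G) G (comult G) id (comult G a))
        (tensor_map G (min_tensor G G) id (comult G) (comult G a))) \<and>
     nrm_closure (min_tensor G G) (lin_span (min_tensor G G)
        {comult G a \<otimes>\<^bsub>min_tensor G G\<^esub> tens G G \<one>\<^bsub>G\<^esub> b | a b. a \<in> carrier G \<and> b \<in> carrier G})
        = carrier (min_tensor G G) \<and>
     nrm_closure (min_tensor G G) (lin_span (min_tensor G G)
        {comult G a \<otimes>\<^bsub>min_tensor G G\<^esub> tens G G b \<one>\<^bsub>G\<^esub> | a b. a \<in> carrier G \<and> b \<in> carrier G})
        = carrier (min_tensor G G) \<and>
     full G"

definition counit :: "('a, 'm) cqg_scheme \<Rightarrow> ('a \<Rightarrow> complex) \<Rightarrow> bool" where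
  "counit G \<epsilon> \<longleftrightarrow> unital_star_hom G complex_cstar \<epsilon> \<and>
     (\<forall>a\<in>carrier G.
        tensor_map G complex_cstar id \<epsilon> (comult G a) = tens G complex_cstar a 1 \<and>
        tensor_map complex_cstar G \<epsilon> id (comult G a) = tens complex_cstar G 1 a)"

definition cqg_morphism ::
  "('a, 'm) cqg_scheme \<Rightarrow> ('b, 'k) cqg_scheme \<Rightarrow> ('a \<Rightarrow> 'b) \<Rightarrow> bool" where
  "cqg_morphism G H \<pi> \<longleftrightarrow> unital_star_hom G H \<pi> \<and>
     (\<forall>a\<in>carrier G. comult H (\<pi> a) = tensor_map H H \<pi> \<pi> (comult G a))"


section \<open>Irreducibility and connectedness\<close>

definition invariant_subspace ::
  "('a, 'm) cqg_scheme \<Rightarrow> nat \<Rightarrow> (nat \<Rightarrow> nat \<Rightarrow> 'a) \<Rightarrow> (nat \<Rightarrow> complex) set \<Rightarrow> bool" where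
  "invariant_subspace G d v W \<longleftrightarrow>
     W \<subseteq> {x. \<forall>i\<ge>d. x i = 0} \<and> (\<lambda>i. 0) \<in> W \<and>
     (\<forall>x\<in>W. \<forall>y\<in>W. (\<lambda>i. x i + y i) \<in> W) \<and> (\<forall>c. \<forall>x\<in>W. (\<lambda>i. c * x i) \<in> W) \<and>
     \<comment> \<open>\<open>v (x \<otimes> 1)\<close> lies in the algebraic tensor product of \<open>W\<close> with \<open>G\<close>\<close>
     (\<forall>x\<in>W. \<exists>m (w :: nat \<Rightarrow> nat \<Rightarrow> complex) a. (\<forall>l<m. w l \<in> W \<and> a l \<in> carrier G) \<and>
        (\<forall>i<d. finsum G (\<lambda>j. x j \<odot>\<^bsub>G\<^esub> v i j) {..<d} = finsum G (\<lambda>l. w l i \<odot>\<^bsub>G\<^esub> a l) {..<m}))"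

definition irreducible_representation ::
  "('a, 'm) cqg_scheme \<Rightarrow> nat \<Rightarrow> (nat \<Rightarrow> nat \<Rightarrow> 'a) \<Rightarrow> bool" where
  "irreducible_representation G d v \<longleftrightarrow> representation G d v \<and> 0 < d \<and>
     (\<forall>W. invariant_subspace G d v W \<longrightarrow> W = {\<lambda>i. 0} \<or> W = {x. \<forall>i\<ge>d. x i = 0})"

definition trivial_representation :: "('a, 'm) cqg_scheme \<Rightarrow> nat \<Rightarrow> (nat \<Rightarrow> nat \<Rightarrow> 'a) \<Rightarrow> bool" where
  "trivial_representation G d v \<longleftrightarrow> d = 1 \<and> v 0 0 = \<one>\<^bsub>G\<^esub>"

definition connected_cqg :: "('a, 'm) cqg_scheme \<Rightarrow> bool" where
  "connected_cqg G \<longleftrightarrow> (\<forall>d w. irreducible_representation G d w \<and> \<not> trivial_representation G d w \<longrightarrow>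
     infinite_dimensional G (cstar_generated G {w i j | i j. i < d \<and> j < d}))"


section \<open>Quantum subgroups and simplicity\<close>

text \<open>
  Since \<open>\<pi>\<close> is surjective, every quantum subgroup of \<open>G\<close> has an isomorphic copy whose elements are
  taken from the element type of \<open>G\<close> (transport along a right inverse of \<open>\<pi>\<close>), with the same kernel;
  hence quantifying over \<open>N\<close> of that type in \<open>simple_cqg\<close> covers all quantum subgroups.
\<close>

definition quantum_subgroup ::
  "('a, 'm) cqg_scheme \<Rightarrow> ('b, 'k) cqg_scheme \<Rightarrow> ('a \<Rightarrow> 'b) \<Rightarrow> bool" where
  "quantum_subgroup G N \<pi> \<longleftrightarrow>
     compact_quantum_group N \<and> cqg_morphism G N \<pi> \<and> \<pi> ` carrier G = carrier N"

definition left_coset_algebra ::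
  "('a, 'm) cqg_scheme \<Rightarrow> ('b, 'k) cqg_scheme \<Rightarrow> ('a \<Rightarrow> 'b) \<Rightarrow> 'a set" where
  "left_coset_algebra G N \<pi> =
     {a \<in> carrier G. tensor_map G N id \<pi> (comult G a) = tens G N a \<one>\<^bsub>N\<^esub>}"

definition right_coset_algebra ::
  "('a, 'm) cqg_scheme \<Rightarrow> ('b, 'k) cqg_scheme \<Rightarrow> ('a \<Rightarrow> 'b) \<Rightarrow> 'a set" where
  "right_coset_algebra G N \<pi> =
     {a \<in> carrier G. tensor_map N G \<pi> id (comult G a) = tens N G \<one>\<^bsub>N\<^esub> a}"

definition normal_quantum_subgroup ::
  "('a, 'm) cqg_scheme \<Rightarrow> ('b, 'k) cqg_scheme \<Rightarrow> ('a \<Rightarrow> 'b) \<Rightarrow> bool" where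
  "normal_quantum_subgroup G N \<pi> \<longleftrightarrow>
     quantum_subgroup G N \<pi> \<and> left_coset_algebra G N \<pi> = right_coset_algebra G N \<pi>"

definition trivial_quantum_subgroup ::
  "('a, 'm) cqg_scheme \<Rightarrow> ('b, 'k) cqg_scheme \<Rightarrow> ('a \<Rightarrow> 'b) \<Rightarrow> bool" where
  "trivial_quantum_subgroup G N \<pi> \<longleftrightarrow>
     a_kernel G N \<pi> = a_kernel G G id \<or>
     (\<exists>\<epsilon>. counit G \<epsilon> \<and> a_kernel G N \<pi> = a_kernel G complex_cstar \<epsilon>)"

definition simple_cqg :: "'a cqg \<Rightarrow> bool" where
  "simple_cqg G \<longleftrightarrow>
     (\<exists>S. finite S \<and> S \<subseteq> carrier G \<and> cstar_generated G S = carrier G) \<and>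
     connected_cqg G \<and>
     (\<forall>(N :: 'a cqg) \<pi>. normal_quantum_subgroup G N \<pi> \<and> connected_cqg N \<longrightarrow>
        trivial_quantum_subgroup G N \<pi>) \<and>
     (\<forall>v. representation G 1 v \<longrightarrow> trivial_representation G 1 v)"


section \<open>Universal C*-algebras and \<open>A\<^sub>u(Q)\<close>\<close>

datatype 'g star_poly = Const_poly complex | Gen 'g | Add_poly "'g star_poly" "'g star_poly"
  | Mult_poly "'g star_poly" "'g star_poly" | Star_poly "'g star_poly"

primrec eval_poly :: "('b, 'm) cstar_scheme \<Rightarrow> ('g \<Rightarrow> 'b) \<Rightarrow> 'g star_poly \<Rightarrow> 'b" where
  "eval_poly B u (Const_poly c) = c \<odot>\<^bsub>B\<^esub> \<one>\<^bsub>B\<^esub>"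
| "eval_poly B u (Gen g) = u g"
| "eval_poly B u (Add_poly p q) = eval_poly B u p \<oplus>\<^bsub>B\<^esub> eval_poly B u q"
| "eval_poly B u (Mult_poly p q) = eval_poly B u p \<otimes>\<^bsub>B\<^esub> eval_poly B u q"
| "eval_poly B u (Star_poly p) = star B (eval_poly B u p)"

text \<open>
  The free unital *-algebra on \<open>'g\<close>, with the universal seminorm for the relations \<open>R\<close>: the supremum
  over all families of bounded operators satisfying \<open>R\<close>.  For countable \<open>'g\<close> separable Hilbert spaces
  suffice, and since finite dimensional ones can be amplified, so does \<open>l\<^sup>2(nat)\<close>.
\<close>

definition free_star_algebra :: "(('g \<Rightarrow> nat op) \<Rightarrow> bool) \<Rightarrow> 'g star_poly cstar" where
  "free_star_algebra R = \<lparr>carrier = UNIV, mult = Mult_poly, one = Const_poly 1,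
     zero = Const_poly 0, add = Add_poly, smult = (\<lambda>c. Mult_poly (Const_poly c)), star = Star_poly,
     nrm = (\<lambda>p. SUP u\<in>{u. range u \<subseteq> carrier bounded_ops \<and> R u}.
        op_norm (eval_poly bounded_ops u p))\<rparr>"

definition universal_cstar :: "(('g \<Rightarrow> nat op) \<Rightarrow> bool) \<Rightarrow> (nat \<Rightarrow> 'g star_poly) set cstar" where
  "universal_cstar R = completion (free_star_algebra R)"

definition Au_relations ::
  "complex ^ 'n ^ 'n \<Rightarrow> ('b, 'm) cstar_scheme \<Rightarrow> ('n::finite \<times> 'n \<Rightarrow> 'b) \<Rightarrow> bool" where
  "Au_relations Q B g \<longleftrightarrow>
    (let u = (\<lambda>i j. g (i, j)); ut = (\<lambda>i j. g (j, i));
         ubar = (\<lambda>i j. star B (g (i, j))); ustar = (\<lambda>i j. star B (g (j, i)));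
         q = (\<lambda>i j. (Q $ i $ j) \<odot>\<^bsub>B\<^esub> \<one>\<^bsub>B\<^esub>); qinv = (\<lambda>i j. (matrix_inv Q $ i $ j) \<odot>\<^bsub>B\<^esub> \<one>\<^bsub>B\<^esub>);
         mm = mat_mult B UNIV
     in mm ustar u = mat_one B \<and> mm u ustar = mat_one B \<and>
        mm (mm (mm ut q) ubar) qinv = mat_one B \<and>
        mm (mm (mm q ubar) qinv) ut = mat_one B)"

type_synonym 'n Au_elem = "(nat \<Rightarrow> ('n \<times> 'n) star_poly) set"

abbreviation Au_free :: "complex ^ 'n ^ 'n \<Rightarrow> ('n::finite \<times> 'n) star_poly cstar" where
  "Au_free Q \<equiv> free_star_algebra (Au_relations Q bounded_ops)"

definition Au_algebra :: "complex ^ 'n ^ 'n \<Rightarrow> ('n::finite) Au_elem cstar" where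
  "Au_algebra Q = universal_cstar (Au_relations Q bounded_ops)"

definition Au_gen :: "complex ^ 'n ^ 'n \<Rightarrow> 'n::finite \<Rightarrow> 'n \<Rightarrow> 'n Au_elem" where
  "Au_gen Q i j = completion_embed (Au_free Q) (Gen (i, j))"

text \<open>
  The coproduct substitutes \<open>\<Sum>\<^sub>k u\<^sub>i\<^sub>k \<otimes> u\<^sub>k\<^sub>j\<close> for \<open>u\<^sub>i\<^sub>j\<close> in *-polynomials and is extended
  by continuity to the completion.
\<close>

definition Au_comult ::
  "complex ^ 'n ^ 'n \<Rightarrow> ('n::finite) Au_elem \<Rightarrow> ('n Au_elem, 'n Au_elem) tensor" where
  "Au_comult Q = completion_map (formal_tensor (Au_algebra Q) (Au_algebra Q))
     (eval_poly (formal_tensor (Au_algebra Q) (Au_algebra Q))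
        (\<lambda>(i, j). image_mset (\<lambda>k. (Au_gen Q i k, Au_gen Q k j)) (mset_set UNIV)))"

definition Au :: "complex ^ 'n ^ 'n \<Rightarrow> ('n::finite) Au_elem cqg" where
  "Au Q = cstar.extend (Au_algebra Q) (cqg.fields (Au_comult Q))"

end

theory Submission
  imports Defs
begin

text \<open>
  Let \<open>z\<close> be the coordinate function of the circle \<open>\<T>\<close>. The identity
  matrix satisfies the relations of \<open>A\<^sub>u(Q)\<close>, and multiplying a solution by a number of modulus 1 gives
  another one; so \<open>\<delta>\<^sub>i\<^sub>j z\<close> solves them and there is a morphism \<open>\<pi>\<close> from
  \<open>A\<^sub>u(Q)\<close> to \<open>C(\<T>)\<close> with \<open>\<pi>(u\<^sub>i\<^sub>j) = \<delta>\<^sub>i\<^sub>j z\<close>: the circle of scalar matrices is a quantum subgroup.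
  Scalar matrices are central, which here means that \<open>(id \<otimes> \<pi>)\<Delta>(u\<^sub>i\<^sub>j) = u\<^sub>i\<^sub>j \<otimes> z\<close> and
  \<open>(\<pi> \<otimes> id)\<Delta>(u\<^sub>i\<^sub>j) = z \<otimes> u\<^sub>i\<^sub>j\<close> are exchanged by the flip of the tensor factors; hence the two coset
  algebras agree and the subgroup is normal (\<open>coset_condition\<close>, \<open>circle_normal\<close>). It is also
  connected (\<open>circle_connected\<close>).

  If \<open>A\<^sub>u(Q)\<close> were simple, then \<open>ker \<pi>\<close> would be \<open>0\<close> or the kernel of the counit \<open>\<epsilon>\<close>. In the first
  case \<open>u\<^sub>i\<^sub>j = 0\<close> for \<open>i \<noteq> j\<close>, since \<open>\<pi>\<close> annihilates these elements; then \<open>u\<^sub>i\<^sub>i\<close> is a representation of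
  dimension one, so \<open>u\<^sub>i\<^sub>i = 1\<close> by simplicity, and \<open>z = \<pi>(u\<^sub>i\<^sub>i) = 1\<close>. In the second case \<open>\<pi>\<close> annihilates
  \<open>u\<^sub>i\<^sub>i - \<epsilon>(u\<^sub>i\<^sub>i) 1\<close>, so \<open>z\<close> is a scalar. Both are absurd (\<open>not_simple\<close>).

  The bulk of the text constructs these objects as completions of algebras of formal expressions. The
  seminorms are suprema over families of representations, so a map given on expressions extends as
  soon as it is contractive (locales \<open>raw_cstar\<close> and \<open>raw_map\<close>), and contractivity is what has
  to be shown each time:

  \<^item> The families consist of representations, possibly degenerate, on \<open>l\<^sup>2\<close> of one fixed index set.
    Other index sets are reached through compressions to countable reducing sets, and degenerate
    representations by working in the corner cut out by the image of the unit
    (\<open>kron_sum_le_nrm\<close>, \<open>corner_eval_le\<close>).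
  \<^item> \<open>C(\<T>)\<close> is the completion of the *-polynomials in \<open>u\<^sub>i\<^sub>j\<close> under the supremum of their values at
    \<open>u\<^sub>i\<^sub>j = \<delta>\<^sub>i\<^sub>j e\<^sup>i\<^sup>\<theta>\<close>. That \<open>\<parallel>p(w)\<parallel> \<le> sup |p|\<close> for every unitary \<open>w\<close> (\<open>nrm_eval_diag_sup\<close>) makes it the
    universal C*-algebra of a unitary, and gives its coproduct and its fullness.
  \<^item> For the surjectivity of \<open>\<pi>\<close>, the matrix \<open>u\<close> is itself a unitary \<open>U\<close> over \<open>A\<^sub>u(Q)\<close>, and a diagonal entry
    of \<open>p(U)\<close> is a contractive lift of the trigonometric polynomial \<open>p\<close> (sublocale \<open>lift\<close>).
  \<^item> Coefficients of representations of the circle are trigonometric polynomials: the Fourier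
    coefficients of a representation show that only finitely many frequencies occur
    (\<open>circle_coefficient_in_range\<close>).
\<close>

section \<open>C*-algebras without completeness\<close>

lemma complex_cstar_sel [simp]:
  "carrier complex_cstar = UNIV" "x \<otimes>\<^bsub>complex_cstar\<^esub> y = x * y" "\<one>\<^bsub>complex_cstar\<^esub> = 1"
  "x \<oplus>\<^bsub>complex_cstar\<^esub> y = x + y" "\<zero>\<^bsub>complex_cstar\<^esub> = 0" "c \<odot>\<^bsub>complex_cstar\<^esub> x = c * x"
  "star complex_cstar x = cnj x" "nrm complex_cstar x = cmod x"
  by (simp_all add: complex_cstar_def)

lemma cring_complex: "cring complex_cstar"
proof (rule cringI)
  show "abelian_group complex_cstar"
    by (rule abelian_groupI) (auto simp: algebra_simps intro: exI[of _ "- x" for x])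
  show "comm_monoid complex_cstar"
    by (rule comm_monoidI) (auto simp: algebra_simps)
qed (auto simp: algebra_simps)

text \<open>
  The C*-axioms apart from completeness. They pass to the corners \<open>P A P\<close> of an algebra, and this
  is the form in which they are established for bounded operators.
\<close>

locale pre_cstar = ring A + V: Module.module complex_cstar A for A (structure) +
  assumes smult_mult_left: "\<lbrakk>x \<in> carrier A; y \<in> carrier A\<rbrakk> \<Longrightarrow> (c \<odot> x) \<otimes> y = c \<odot> (x \<otimes> y)"
    and smult_mult_right: "\<lbrakk>x \<in> carrier A; y \<in> carrier A\<rbrakk> \<Longrightarrow> x \<otimes> (c \<odot> y) = c \<odot> (x \<otimes> y)"
    and star_closed [simp]: "x \<in> carrier A \<Longrightarrow> star A x \<in> carrier A"
    and star_star [simp]: "x \<in> carrier A \<Longrightarrow> star A (star A x) = x"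
    and star_add: "\<lbrakk>x \<in> carrier A; y \<in> carrier A\<rbrakk> \<Longrightarrow> star A (x \<oplus> y) = star A x \<oplus> star A y"
    and star_smult: "x \<in> carrier A \<Longrightarrow> star A (c \<odot> x) = cnj c \<odot> star A x"
    and star_mult: "\<lbrakk>x \<in> carrier A; y \<in> carrier A\<rbrakk> \<Longrightarrow> star A (x \<otimes> y) = star A y \<otimes> star A x"
    and nrm_nonneg [simp]: "x \<in> carrier A \<Longrightarrow> 0 \<le> nrm A x"
    and nrm_eq_zero: "x \<in> carrier A \<Longrightarrow> nrm A x = 0 \<longleftrightarrow> x = \<zero>"
    and nrm_add: "\<lbrakk>x \<in> carrier A; y \<in> carrier A\<rbrakk> \<Longrightarrow> nrm A (x \<oplus> y) \<le> nrm A x + nrm A y"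
    and nrm_smult: "x \<in> carrier A \<Longrightarrow> nrm A (c \<odot> x) = cmod c * nrm A x"
    and nrm_mult: "\<lbrakk>x \<in> carrier A; y \<in> carrier A\<rbrakk> \<Longrightarrow> nrm A (x \<otimes> y) \<le> nrm A x * nrm A y"
    and nrm_star_self: "x \<in> carrier A \<Longrightarrow> nrm A (star A x \<otimes> x) = (nrm A x)\<^sup>2"

lemma cstar_algebra_pre: "cstar_algebra A \<Longrightarrow> pre_cstar A"
  unfolding cstar_algebra_def pre_cstar_def cstar_algebra_axioms_def pre_cstar_axioms_def by auto

context pre_cstar begin

lemma sm_closed [simp]: "x \<in> carrier A \<Longrightarrow> c \<odot> x \<in> carrier A"
  using V.smult_closed by simp

lemma sm_ladd: "x \<in> carrier A \<Longrightarrow> (a + b) \<odot> x = a \<odot> x \<oplus> b \<odot> x"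
  using V.smult_l_distr[of a b x] by simp

lemma sm_radd: "\<lbrakk>x \<in> carrier A; y \<in> carrier A\<rbrakk> \<Longrightarrow> c \<odot> (x \<oplus> y) = c \<odot> x \<oplus> c \<odot> y"
  using V.smult_r_distr[of c x y] by simp

lemma sm_assoc: "x \<in> carrier A \<Longrightarrow> a \<odot> (b \<odot> x) = (a * b) \<odot> x"
  using V.smult_assoc1[of a b x] by simp

lemma sm_one [simp]: "x \<in> carrier A \<Longrightarrow> 1 \<odot> x = x"
  using V.smult_one[of x] by simp

lemma sm_zero [simp]: "x \<in> carrier A \<Longrightarrow> 0 \<odot> x = \<zero>"
  using V.smult_l_null[of x] by simp

lemma sm_zero_right [simp]: "c \<odot> \<zero> = \<zero>"
  using V.smult_r_null[of c] by simp

lemma sm_minus: "x \<in> carrier A \<Longrightarrow> (-1) \<odot> x = \<ominus> x"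
  using minus_equality[of "(-1) \<odot> x" x] sm_ladd[of x "-1" 1] by simp

lemma star_zero [simp]: "star A \<zero> = \<zero>"
  using star_smult[of \<zero> 0] by simp

lemma star_one [simp]: "star A \<one> = \<one>"
  using star_mult[of "star A \<one>" \<one>] by simp

lemma nrm_zero [simp]: "nrm A \<zero> = 0"
  by (simp add: nrm_eq_zero)

lemma nrm_uminus: "x \<in> carrier A \<Longrightarrow> nrm A (\<ominus> x) = nrm A x"
  using nrm_smult[of x "-1"] by (simp add: sm_minus)

lemma dst_alt: "\<lbrakk>x \<in> carrier A; y \<in> carrier A\<rbrakk> \<Longrightarrow> dst A x y = nrm A (x \<ominus> y)"
  by (simp add: dst_def sm_minus minus_eq)

lemma dst_nonneg [simp]: "\<lbrakk>x \<in> carrier A; y \<in> carrier A\<rbrakk> \<Longrightarrow> 0 \<le> dst A x y"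
  by (simp add: dst_alt)

lemma dst_self [simp]: "x \<in> carrier A \<Longrightarrow> dst A x x = 0"
  by (simp add: dst_alt minus_eq r_neg)

lemma dst_zero_iff: "\<lbrakk>x \<in> carrier A; y \<in> carrier A\<rbrakk> \<Longrightarrow> dst A x y = 0 \<longleftrightarrow> x = y"
  proof -
  assume xy: "x \<in> carrier A" "y \<in> carrier A"
  then have "x \<ominus> y = \<zero> \<longleftrightarrow> x = y"
    by (metis minus_eq a_inv_closed add.inv_equality minus_minus r_neg)
  with xy show ?thesis by (simp add: dst_alt nrm_eq_zero)
qed

lemma dst_sym: "\<lbrakk>x \<in> carrier A; y \<in> carrier A\<rbrakk> \<Longrightarrow> dst A x y = dst A y x"
proof -
  assume "x \<in> carrier A" "y \<in> carrier A"
  moreover from this have "\<ominus> (x \<ominus> y) = y \<ominus> x" by (simp add: minus_eq minus_add a_comm)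
  ultimately show ?thesis using nrm_uminus[of "x \<ominus> y"] by (simp add: dst_alt)
qed

lemma dst_triangle:
  assumes "x \<in> carrier A" "y \<in> carrier A" "w \<in> carrier A"
  shows "dst A x w \<le> dst A x y + dst A y w"
proof -
  have "x \<ominus> w = (x \<ominus> y) \<oplus> (y \<ominus> w)"
    using assms by (simp add: minus_eq a_assoc r_neg1 r_neg2 l_neg)
  then show ?thesis using nrm_add[of "x \<ominus> y" "y \<ominus> w"] assms by (simp add: dst_alt)
qed

lemma dst_add:
  assumes "x \<in> carrier A" "y \<in> carrier A" "x' \<in> carrier A" "y' \<in> carrier A"
  shows "dst A (x \<oplus> y) (x' \<oplus> y') \<le> dst A x x' + dst A y y'"
proof -
  have "(x \<oplus> y) \<ominus> (x' \<oplus> y') = (x \<ominus> x') \<oplus> (y \<ominus> y')"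
    using assms by (simp add: minus_eq minus_add a_assoc a_lcomm)
  then show ?thesis using nrm_add[of "x \<ominus> x'" "y \<ominus> y'"] assms by (simp add: dst_alt)
qed

lemma dst_smult:
  "\<lbrakk>x \<in> carrier A; y \<in> carrier A\<rbrakk> \<Longrightarrow> dst A (c \<odot> x) (c \<odot> y) = cmod c * dst A x y"
  unfolding dst_def using nrm_smult[of "x \<oplus> (-1) \<odot> y" c]
  by (simp add: sm_radd sm_assoc)

lemma dst_zero_right: "x \<in> carrier A \<Longrightarrow> dst A x \<zero> = nrm A x"
  by (simp add: dst_def)

lemma nrm_diff_le: "\<lbrakk>x \<in> carrier A; y \<in> carrier A\<rbrakk> \<Longrightarrow> \<bar>nrm A x - nrm A y\<bar> \<le> dst A x y"
  using dst_triangle[of x y \<zero>] dst_triangle[of y x \<zero>] dst_sym[of x y]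
  by (simp add: dst_zero_right)

lemma nrm_star_le: "x \<in> carrier A \<Longrightarrow> nrm A x \<le> nrm A (star A x)"
  using nrm_star_self[of x] nrm_mult[of "star A x" x] nrm_nonneg[of x] nrm_nonneg[of "star A x"]
  by (cases "nrm A x = 0") (auto simp: power2_eq_square less_le)

lemma nrm_star [simp]: "x \<in> carrier A \<Longrightarrow> nrm A (star A x) = nrm A x"
  using nrm_star_le[of x] nrm_star_le[of "star A x"] by simp

lemma dst_star: "\<lbrakk>x \<in> carrier A; y \<in> carrier A\<rbrakk> \<Longrightarrow> dst A (star A x) (star A y) = dst A x y"
  unfolding dst_def using nrm_star[of "x \<oplus> (-1) \<odot> y"]
  by (simp add: star_add star_smult del: nrm_star)

lemma dst_mult_left:
  assumes "x \<in> carrier A" "y \<in> carrier A" "w \<in> carrier A"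
  shows "dst A (w \<otimes> x) (w \<otimes> y) \<le> nrm A w * dst A x y"
  unfolding dst_def using nrm_mult[of w "x \<oplus> (-1) \<odot> y"] assms
  by (simp add: r_distr smult_mult_right)

lemma dst_mult_right:
  assumes "x \<in> carrier A" "y \<in> carrier A" "w \<in> carrier A"
  shows "dst A (x \<otimes> w) (y \<otimes> w) \<le> dst A x y * nrm A w"
  unfolding dst_def using nrm_mult[of "x \<oplus> (-1) \<odot> y" w] assms
  by (simp add: l_distr smult_mult_left)

lemma dst_mult:
  assumes "x \<in> carrier A" "y \<in> carrier A" "x' \<in> carrier A" "y' \<in> carrier A"
  shows "dst A (x \<otimes> y) (x' \<otimes> y') \<le> nrm A x * dst A y y' + dst A x x' * nrm A y'"
  using dst_triangle[of "x \<otimes> y" "x \<otimes> y'" "x' \<otimes> y'"]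
    dst_mult_left[of y y' x] dst_mult_right[of x x' y'] assms by simp

lemma nrm_one_le: "nrm A \<one> \<le> 1"
proof -
  have "nrm A \<one> = (nrm A \<one>)\<^sup>2" using nrm_star_self[of \<one>] by simp
  then show ?thesis by (metis mult_cancel_left1 one_closed order.refl power2_eq_square zero_le_one nrm_nonneg)
qed

lemma star_finsum:
  "f \<in> I \<rightarrow> carrier A \<Longrightarrow> star A (finsum A f I) = finsum A (\<lambda>i. star A (f i)) I"
proof (induct I rule: infinite_finite_induct)
  case (insert x F)
  moreover from insert have "finsum A f F \<in> carrier A" "f x \<in> carrier A" "f \<in> F \<rightarrow> carrier A"
    by (auto intro: finsum_closed)
  moreover from this have "(\<lambda>i. star A (f i)) \<in> F \<rightarrow> carrier A" "star A (f x) \<in> carrier A"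
    by (auto simp: Pi_def)
  ultimately show ?case by (simp add: star_add)
qed auto

lemma smult_finsum:
  "f \<in> I \<rightarrow> carrier A \<Longrightarrow> c \<odot> finsum A f I = finsum A (\<lambda>i. c \<odot> f i) I"
  by (cases "finite I") (auto intro: V.finsum_smult_ldistr)

lemma nrm_finsum_le:
  assumes "f \<in> I \<rightarrow> carrier A" "finite I"
  shows "nrm A (finsum A f I) \<le> (\<Sum>i\<in>I. nrm A (f i))"
  using assms(2,1)
proof (induct I rule: finite_induct)
  case (insert x F)
  then have "finsum A f F \<in> carrier A" "f x \<in> carrier A" "f \<in> F \<rightarrow> carrier A"
    by (auto intro: finsum_closed)
  with insert nrm_add[of "f x" "finsum A f F"] show ?case by auto
qed auto

end

lemma pre_cstar_complex: "pre_cstar complex_cstar"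
proof -
  interpret cring complex_cstar by (rule cring_complex)
  show ?thesis
    by (unfold_locales)
      (auto simp: algebra_simps norm_triangle_ineq norm_mult power2_eq_square)
qed

section \<open>Functional calculus of a unitary\<close>

definition diag :: "('b, 'm) cstar_scheme \<Rightarrow> 'b \<Rightarrow> 'n \<times> 'n \<Rightarrow> 'b" where
  "diag B w = (\<lambda>(i, j). if i = j then w else \<zero>\<^bsub>B\<^esub>)"

definition tval :: "real \<Rightarrow> ('n \<times> 'n) star_poly \<Rightarrow> complex" where
  "tval \<theta> = eval_poly complex_cstar (diag complex_cstar (cis \<theta>))"

lemma tval_simps [simp]:
  "tval \<theta> (Const_poly c) = c" "tval \<theta> (Gen (i, j)) = (if i = j then cis \<theta> else 0)"
  "tval \<theta> (Add_poly p q) = tval \<theta> p + tval \<theta> q" "tval \<theta> (Mult_poly p q) = tval \<theta> p * tval \<theta> q"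
  "tval \<theta> (Star_poly p) = cnj (tval \<theta> p)"
  by (simp_all add: tval_def diag_def)

text \<open>
  The terms \<open>c z\<^sup>k\<close> of the Laurent polynomial that results from substituting \<open>\<delta>\<^sub>i\<^sub>j z\<close> for \<open>u\<^sub>i\<^sub>j\<close>. A list
  of terms can be evaluated in every algebra with a unitary \<open>z\<close>.
\<close>

primrec trig_list :: "('n \<times> 'n) star_poly \<Rightarrow> (complex \<times> int) list" where
  "trig_list (Const_poly c) = [(c, 0)]"
| "trig_list (Gen g) = (if fst g = snd g then [(1, 1)] else [])"
| "trig_list (Add_poly p q) = trig_list p @ trig_list q"
| "trig_list (Mult_poly p q) =
     concat (map (\<lambda>(c, k). map (\<lambda>(d, l). (c * d, k + l)) (trig_list q)) (trig_list p))"
| "trig_list (Star_poly p) = map (\<lambda>(c, k). (cnj c, - k)) (trig_list p)"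

primrec trig_deg :: "('n \<times> 'n) star_poly \<Rightarrow> nat" where
  "trig_deg (Const_poly c) = 0"
| "trig_deg (Gen g) = 1"
| "trig_deg (Add_poly p q) = trig_deg p + trig_deg q"
| "trig_deg (Mult_poly p q) = trig_deg p + trig_deg q"
| "trig_deg (Star_poly p) = trig_deg p"

lemma trig_deg_bound: "(c, k) \<in> set (trig_list p) \<Longrightarrow> \<bar>k\<bar> \<le> int (trig_deg p)"
proof (induct p arbitrary: c k)
  case (Add_poly p q)
  then have "\<bar>k\<bar> \<le> int (trig_deg p) \<or> \<bar>k\<bar> \<le> int (trig_deg q)" by auto
  then show ?case by auto
next
  case (Mult_poly p q)
  then obtain c1 k1 c2 k2 where "(c1, k1) \<in> set (trig_list p)" "(c2, k2) \<in> set (trig_list q)" "k = k1 + k2"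
    by auto
  with Mult_poly(1)[of c1 k1] Mult_poly(2)[of c2 k2] show ?case by auto
next
  case (Star_poly p)
  then obtain c' where "(c', - k) \<in> set (trig_list p)" by force
  with Star_poly(1)[of c' "- k"] show ?case by auto
qed (auto split: if_splits)

definition trig_coeff :: "('n \<times> 'n) star_poly \<Rightarrow> int \<Rightarrow> complex" where
  "trig_coeff p k = (\<Sum>(c, l)\<leftarrow>trig_list p. if l = k then c else 0)"

locale unitary_in = pre_cstar +
  fixes w
  assumes w_closed [simp]: "w \<in> carrier A"
    and ww [simp]: "star A w \<otimes> w = \<one>" "w \<otimes> star A w = \<one>"
begin

definition zpow :: "int \<Rightarrow> 'a" where
  "zpow k = (if k \<ge> 0 then w [^] nat k else star A w [^] nat (- k))"

lemma zpow_closed [simp]: "zpow k \<in> carrier A"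
  by (simp add: zpow_def del: pow_nat)

lemma zpow_0 [simp]: "zpow 0 = \<one>" and zpow_1 [simp]: "zpow 1 = w"
  by (simp_all add: zpow_def del: pow_nat)

lemma w_cancel [simp]: "x \<in> carrier A \<Longrightarrow> star A w \<otimes> (w \<otimes> x) = x"
  "x \<in> carrier A \<Longrightarrow> w \<otimes> (star A w \<otimes> x) = x"
  by (simp_all add: m_assoc[symmetric])

lemma zpow_Suc: "zpow (k + 1) = w \<otimes> zpow k"
proof (cases "k \<ge> 0")
  case True
  then have "nat (k + 1) = Suc (nat k)" by simp
  with True show ?thesis using nat_pow_Suc2[of w "nat k"] by (simp add: zpow_def del: pow_nat)
next
  case False
  then have "nat (- k) = Suc (nat (- k - 1))" by simp
  then have "zpow k = star A w \<otimes> star A w [^] nat (- k - 1)" using False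
      nat_pow_Suc2[of "star A w" "nat (- k - 1)"] by (simp add: zpow_def del: pow_nat)
  moreover have "star A w [^] nat (- k - 1) = zpow (k + 1)" using False
    by (cases "k = -1") (auto simp: zpow_def simp del: pow_nat)
  ultimately show ?thesis by simp
qed

lemma zpow_pred: "zpow (k - 1) = star A w \<otimes> zpow k"
  using zpow_Suc[of "k - 1"] by simp

lemma zpow_add: "zpow (j + k) = zpow j \<otimes> zpow k"
proof (induct j rule: int_induct[where k = 0])
  case (step1 i)
  then show ?case using zpow_Suc[of i] zpow_Suc[of "i + k"] by (simp add: m_assoc ac_simps)
next
  case (step2 i)
  then show ?case using zpow_pred[of i] zpow_pred[of "i + k"] by (simp add: m_assoc algebra_simps)
qed simp

lemma zpow_comm_w: "zpow k \<otimes> w = w \<otimes> zpow k"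
  using zpow_add[of k 1] zpow_add[of 1 k] by (simp add: add.commute)

lemma zpow_star: "star A (zpow k) = zpow (- k)"
proof (induct k rule: int_induct[where k = 0])
  case (step1 i)
  then show ?case
    using zpow_Suc[of i] zpow_pred[of "- i"] zpow_add[of "- i" "- 1"] zpow_pred[of 0] by (simp add: star_mult)
next
  case (step2 i)
  then show ?case
    using zpow_pred[of i] zpow_Suc[of "- i"] zpow_comm_w[of "- i"] by (simp add: star_mult)
qed simp

lemma zpow_inv: "zpow (- k) \<otimes> zpow k = \<one>" "zpow k \<otimes> zpow (- k) = \<one>"
  using zpow_add[of "- k" k] zpow_add[of k "- k"] by simp_all

lemma nrm_zpow: "nrm A (zpow k) \<le> 1"
  using nrm_star_self[of "zpow k"] nrm_one_le
  by (simp add: zpow_star zpow_inv power_le_one_iff abs_square_le_1)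

primrec trig_sum :: "(complex \<times> int) list \<Rightarrow> 'a" where
  "trig_sum [] = \<zero>"
| "trig_sum (x # xs) = fst x \<odot> zpow (snd x) \<oplus> trig_sum xs"

lemma trig_sum_closed [simp]: "trig_sum xs \<in> carrier A"
  by (induct xs) auto

lemma trig_sum_append: "trig_sum (xs @ ys) = trig_sum xs \<oplus> trig_sum ys"
  by (induct xs) (auto simp: a_assoc)

lemma trig_sum_shift:
  "trig_sum (map (\<lambda>(d, l). (c * d, k + l)) ys) = (c \<odot> zpow k) \<otimes> trig_sum ys"
  by (induct ys) (auto simp: r_distr smult_mult_left smult_mult_right zpow_add sm_assoc mult.commute)

lemma trig_sum_mult:
  "trig_sum (concat (map (\<lambda>(c, k). map (\<lambda>(d, l). (c * d, k + l)) ys) xs)) = trig_sum xs \<otimes> trig_sum ys"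
  by (induct xs) (auto simp: trig_sum_append trig_sum_shift l_distr)

lemma trig_sum_star: "trig_sum (map (\<lambda>(c, k). (cnj c, - k)) xs) = star A (trig_sum xs)"
  by (induct xs) (auto simp: star_add star_smult zpow_star)

lemma eval_diag: "eval_poly A (diag A w) p = trig_sum (trig_list p)"
  by (induct p) (auto simp: diag_def trig_sum_append trig_sum_mult trig_sum_star split: prod.splits)

lemma eval_diag_closed [simp]: "eval_poly A (diag A w) p \<in> carrier A"
  by (simp add: eval_diag)

lemma trig_sum_finsum:
  assumes "finite K" "snd ` set xs \<subseteq> K"
  shows "trig_sum xs = finsum A (\<lambda>k. (\<Sum>(c, l)\<leftarrow>xs. if l = k then c else 0) \<odot> zpow k) K"
  using assms(2)
proof (induct xs)
  case Nil
  then show ?case by simp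
next
  case (Cons x xs)
  obtain c l where x: "x = (c, l)" by force
  have "finsum A (\<lambda>k. (if l = k then c else 0) \<odot> zpow k) K =
      finsum A (\<lambda>k. if l = k then c \<odot> zpow k else \<zero>) K"
    by (rule finsum_cong') auto
  also have "\<dots> = c \<odot> zpow l"
    using add.finprod_singleton[of l K "\<lambda>k. c \<odot> zpow k"] Cons(2) assms(1) x by (simp add: finsum_def)
  finally have 1: "finsum A (\<lambda>k. (if l = k then c else 0) \<odot> zpow k) K = c \<odot> zpow l" .
  from Cons x have 2: "trig_sum xs = finsum A (\<lambda>k. (\<Sum>(c, l)\<leftarrow>xs. if l = k then c else 0) \<odot> zpow k) K"
    by simp
  show ?case unfolding x
    by (simp add: sm_ladd finsum_addf 2 1)
qed

lemma eval_diag_finsum: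
  "eval_poly A (diag A w) p =
     finsum A (\<lambda>k. trig_coeff p k \<odot> zpow k) {- int (trig_deg p)..int (trig_deg p)}"
  unfolding eval_diag trig_coeff_def
  by (rule trig_sum_finsum) (use trig_deg_bound[of _ _ p] in \<open>force simp: abs_le_iff\<close>)+

text \<open>
  A crude estimate by the number of terms, which is linear in the degree.
\<close>

lemma nrm_eval_diag_le:
  assumes "\<And>k. cmod (trig_coeff p k) \<le> C"
  shows "nrm A (eval_poly A (diag A w) p) \<le> (2 * real (trig_deg p) + 1) * C"
proof -
  let ?I = "{- int (trig_deg p)..int (trig_deg p)}"
  have "nrm A (eval_poly A (diag A w) p) \<le> (\<Sum>k\<in>?I. nrm A (trig_coeff p k \<odot> zpow k))"
    unfolding eval_diag_finsum by (rule nrm_finsum_le) auto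
  also have "\<dots> \<le> (\<Sum>k\<in>?I. C)"
  proof (intro sum_mono)
    fix k
    have "nrm A (trig_coeff p k \<odot> zpow k) \<le> cmod (trig_coeff p k) * 1"
      unfolding nrm_smult[OF zpow_closed] by (intro mult_left_mono nrm_zpow) simp
    then show "nrm A (trig_coeff p k \<odot> zpow k) \<le> C" using assms[of k] by simp
  qed
  also have "\<dots> = (2 * real (trig_deg p) + 1) * C" by simp
  finally show ?thesis .
qed

end

definition fourier_coeff :: "int \<Rightarrow> (real \<Rightarrow> complex) \<Rightarrow> complex" where
  "fourier_coeff k f = integral {0..2*pi} (\<lambda>\<theta>. f \<theta> * cis (- of_int k * \<theta>)) / of_real (2*pi)"

lemma fourier_coeff_bound:
  assumes "continuous_on UNIV f" "\<And>\<theta>. cmod (f \<theta>) \<le> s"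
  shows "cmod (fourier_coeff k f) \<le> s"
proof -
  have "continuous_on {0..2*pi} (\<lambda>\<theta>. f \<theta> * cis (- of_int k * \<theta>))"
    by (intro continuous_intros continuous_on_subset[OF assms(1)]) auto
  then have "cmod (integral {0..2*pi} (\<lambda>\<theta>. f \<theta> * cis (- of_int k * \<theta>))) \<le> s * (2 * pi - 0)"
    by (intro integral_bound) (auto simp: norm_mult assms)
  then show ?thesis by (simp add: fourier_coeff_def norm_divide field_simps)
qed

lemma fourier_coeff_add:
  assumes "continuous_on UNIV f" "continuous_on UNIV g"
  shows "fourier_coeff k (\<lambda>\<theta>. f \<theta> + g \<theta>) = fourier_coeff k f + fourier_coeff k g"
proof -
  have "(\<lambda>\<theta>. f \<theta> * cis (- of_int k * \<theta>)) integrable_on {0..2*pi}"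
    "(\<lambda>\<theta>. g \<theta> * cis (- of_int k * \<theta>)) integrable_on {0..2*pi}"
    by (intro integrable_continuous_interval continuous_intros
        continuous_on_subset[OF assms(1)] continuous_on_subset[OF assms(2)]; simp)+
  then show ?thesis
    by (simp add: fourier_coeff_def distrib_right integral_add add_divide_distrib)
qed

lemma fourier_coeff_cmult: "fourier_coeff k (\<lambda>\<theta>. c * f \<theta>) = c * fourier_coeff k f"
  by (simp add: fourier_coeff_def mult.assoc)

lemma fourier_coeff_cis: "fourier_coeff k (\<lambda>\<theta>. cis (of_int l * \<theta>)) = (if l = k then 1 else 0)"
proof (cases "l = k")
  case True
  have "(\<lambda>\<theta>. cis (of_int k * \<theta>) * cis (- of_int k * \<theta>)) = (\<lambda>\<theta>::real. 1)"
    by (simp add: cis_mult)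
  with True show ?thesis by (simp add: fourier_coeff_def scaleR_conv_of_real)
next
  case False
  define m where "m = (of_int (l - k) :: real)"
  have m: "m \<noteq> 0" using False by (simp add: m_def)
  have eq: "cis (of_int l * \<theta>) * cis (- of_int k * \<theta>) = cis (m * \<theta>)" for \<theta>
    by (simp add: cis_mult m_def algebra_simps)
  have "((\<lambda>\<theta>. cis (m * \<theta>)) has_integral
      (cis (m * (2*pi)) / (\<i> * of_real m) - cis (m * 0) / (\<i> * of_real m))) {0..2*pi}"
  proof (rule fundamental_theorem_of_calculus)
    fix x
    show "((\<lambda>\<theta>. cis (m * \<theta>) / (\<i> * of_real m)) has_vector_derivative cis (m * x)) (at x within {0..2*pi})"
    proof -
      have "((\<lambda>z. exp (\<i> * of_real m * z) / (\<i> * of_real m)) has_field_derivative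
          exp (\<i> * of_real m * of_real x)) (at (of_real x))"
        using m by (auto intro!: derivative_eq_intros)
      from has_vector_derivative_real_field[OF this] show ?thesis
        by (simp add: cis_conv_exp mult.assoc)
    qed
  qed simp
  moreover have "cis (m * (2*pi)) = 1"
    using cis_multiple_2pi[of "of_int (l - k)"] by (simp add: m_def mult.commute mult.left_commute)
  ultimately have "integral {0..2*pi} (\<lambda>\<theta>. cis (m * \<theta>)) = 0" by (simp add: integral_unique)
  with False show ?thesis unfolding fourier_coeff_def eq by simp
qed

lemma tval_list: "tval \<theta> p = (\<Sum>(c, k)\<leftarrow>trig_list p. c * cis (of_int k * \<theta>))"
proof -
  interpret pre_cstar complex_cstar by (rule pre_cstar_complex)
  interpret unitary_in complex_cstar "cis \<theta>"
    by unfold_locales (simp_all add: complex_norm_square[symmetric] mult.commute flip: complex_norm_square)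
  have z: "zpow k = cis (of_int k * \<theta>)" for k
  proof (induct k rule: int_induct[where k = 0])
    case (step1 i)
    then show ?case unfolding zpow_Suc by (simp add: cis_mult algebra_simps)
  next
    case (step2 i)
    then show ?case unfolding zpow_pred by (simp add: cis_mult algebra_simps cis_cnj)
  qed simp
  have "trig_sum xs = (\<Sum>(c, k)\<leftarrow>xs. c * cis (of_int k * \<theta>))" for xs
    by (induct xs) (auto simp: z)
  then show ?thesis using eval_diag[of p] by (simp add: tval_def)
qed

lemma continuous_tval: "continuous_on UNIV (\<lambda>\<theta>. tval \<theta> p)"
proof (induct p)
  case (Gen g)
  show ?case by (cases g, cases "fst g = snd g") (auto intro!: continuous_intros)
qed (auto intro!: continuous_intros)

lemma fourier_coeff_tval: "fourier_coeff k (\<lambda>\<theta>. tval \<theta> p) = trig_coeff p k"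
proof -
  have "continuous_on UNIV (\<lambda>\<theta>. \<Sum>(c, l)\<leftarrow>xs. c * cis (of_int l * \<theta>)) \<and>
      fourier_coeff k (\<lambda>\<theta>. \<Sum>(c, l)\<leftarrow>xs. c * cis (of_int l * \<theta>)) = (\<Sum>(c, l)\<leftarrow>xs. if l = k then c else 0)" for xs
  proof (induct xs)
    case Nil
    show ?case by (simp add: fourier_coeff_def)
  next
    case (Cons x xs)
    have "continuous_on UNIV (\<lambda>\<theta>. fst x * cis (of_int (snd x) * \<theta>))" by (intro continuous_intros)
    with Cons fourier_coeff_add[of "\<lambda>\<theta>. fst x * cis (of_int (snd x) * \<theta>)" "\<lambda>\<theta>. \<Sum>(c, l)\<leftarrow>xs. c * cis (of_int l * \<theta>)" k]
    show ?case unfolding sum_list.Cons list.map case_prod_unfold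
      by (auto simp: fourier_coeff_cmult fourier_coeff_cis intro: continuous_on_add)
  qed
  then show ?thesis by (simp add: tval_list trig_coeff_def)
qed

text \<open>
  The *-polynomial \<open>(p\<^sup>* p)\<close> raised to the power \<open>2\<^sup>m\<close>, by repeated squaring.
\<close>

primrec sq_iter :: "nat \<Rightarrow> 'g star_poly \<Rightarrow> 'g star_poly" where
  "sq_iter 0 p = Mult_poly (Star_poly p) p"
| "sq_iter (Suc m) p = Mult_poly (sq_iter m p) (sq_iter m p)"

lemma linear_growth_bound:
  fixes x C :: real
  assumes "0 \<le> x" and b: "\<And>m. x ^ (2 ^ m) \<le> C * 2 ^ m + 1"
  shows "x \<le> 1"
proof (rule ccontr)
  assume "\<not> x \<le> 1"
  then have x: "x > 1" by simp
  then have l1: "(\<lambda>n. real n / x ^ n) \<longlonglongrightarrow> 0" using lim_n_over_pown[of x] by simp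
  have l2: "(\<lambda>n. 1 / x ^ n) \<longlonglongrightarrow> 0"
    using LIMSEQ_inverse_realpow_zero[of x] x by (simp add: inverse_eq_divide)
  have "(\<lambda>n. C * (real n / x ^ n) + 1 / x ^ n) \<longlonglongrightarrow> C * 0 + 0"
    by (intro tendsto_intros l1 l2)
  then have "((\<lambda>n. C * (real n / x ^ n) + 1 / x ^ n) \<circ> (\<lambda>m. 2 ^ m)) \<longlonglongrightarrow> 0"
    by (intro LIMSEQ_subseq_LIMSEQ) (auto simp: strict_mono_def)
  then have "\<forall>\<^sub>F m in sequentially. C * (2 ^ m / x ^ (2 ^ m)) + 1 / x ^ (2 ^ m) < 1"
    unfolding o_def by (drule_tac order_tendstoD(2)[where a = 1]) simp_all
  then obtain m where "C * (2 ^ m / x ^ (2 ^ m)) + 1 / x ^ (2 ^ m) < 1"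
    by (auto simp: eventually_sequentially)
  with x b[of m] show False by (simp add: field_simps)
qed

text \<open>
  By the C*-identity, \<open>\<parallel>p(w)\<parallel>\<close> raised to the power \<open>2\<^sup>m\<^sup>+\<^sup>1\<close> is the norm of the iterated square
  \<open>sq_iter m p\<close> at \<open>w\<close>. The Fourier coefficients of that *-polynomial are at most \<open>s\<close> raised to the
  same power, and its degree grows like \<open>2\<^sup>m\<close>; so these powers of the ratio
  \<open>\<parallel>p(w)\<parallel> / s\<close> grow at most linearly in the exponent, and the ratio cannot exceed 1.
\<close>

theorem (in unitary_in) nrm_eval_diag_sup:
  assumes s: "\<And>\<theta>. cmod (tval \<theta> p) \<le> s"
  shows "nrm A (eval_poly A (diag A w) p) \<le> s"
proof -
  let ?e = "eval_poly A (diag A w)"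
  have sa: "star A (?e (sq_iter m p)) = ?e (sq_iter m p)" for m
    by (induct m) (simp_all add: star_mult)
  have n: "nrm A (?e (sq_iter m p)) = nrm A (?e p) ^ (2 * 2 ^ m)" for m
  proof (induct m)
    case 0
    show ?case by (simp add: nrm_star_self power2_eq_square)
  next
    case (Suc m)
    have "nrm A (?e (sq_iter (Suc m) p)) = nrm A (star A (?e (sq_iter m p)) \<otimes> ?e (sq_iter m p))"
      by (simp add: sa)
    with Suc show ?case by (simp only: nrm_star_self[OF eval_diag_closed]) (simp add: power_mult[symmetric] mult.assoc mult.commute)
  qed
  have d: "trig_deg (sq_iter m p) = 2 * 2 ^ m * trig_deg p" for m
    by (induct m) auto
  have v: "cmod (tval \<theta> (sq_iter m p)) \<le> s ^ (2 * 2 ^ m)" for \<theta> m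
  proof (induct m)
    case 0
    show ?case using mult_mono'[OF s s, of \<theta> \<theta>] by (simp add: norm_mult power2_eq_square)
  next
    case (Suc m)
    show ?case using mult_mono'[OF Suc Suc] by (simp add: norm_mult power_add[symmetric] mult_2)
  qed
  have b: "nrm A (?e p) ^ (2 * 2 ^ m) \<le> (4 * real (trig_deg p) * 2 ^ m + 1) * s ^ (2 * 2 ^ m)" for m
    using nrm_eval_diag_le[of "sq_iter m p" "s ^ (2 * 2 ^ m)"]
      fourier_coeff_bound[OF continuous_tval v, of _ m] 
    by (simp add: fourier_coeff_tval n d mult_ac)
  have s0: "0 \<le> s" using s[of 0] norm_ge_zero order_trans by blast
  show ?thesis
  proof (cases "s = 0")
    case True
    then have "nrm A (?e p) * nrm A (?e p) \<le> 0" using b[of 0] by (simp add: power2_eq_square)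
    with True show ?thesis using nrm_nonneg[of "?e p"] by (auto simp: mult_le_0_iff)
  next
    case False
    with s0 have sp: "s > 0" by simp
    have "(nrm A (?e p) / s)\<^sup>2 \<le> 1"
      by (rule linear_growth_bound[where C = "4 * real (trig_deg p)"])
        (use b sp in \<open>auto simp: power_divide power_mult[symmetric] divide_le_eq\<close>)
    then show ?thesis using sp by (simp add: power_le_one_iff abs_square_le_1)
  qed
qed

section \<open>Square summable families\<close>

lemma has_sum_finite_sum:
  fixes f :: "'i \<Rightarrow> 'x \<Rightarrow> 'b::{topological_comm_monoid_add}"
  assumes "\<And>i. i \<in> I \<Longrightarrow> (f i has_sum s i) A"
  shows "((\<lambda>x. \<Sum>i\<in>I. f i x) has_sum (\<Sum>i\<in>I. s i)) A"
  using assms by (induct I rule: infinite_finite_induct) (auto intro: has_sum_add)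

lemma infsum_single_point:
  fixes f :: "'x \<Rightarrow> 'b::{topological_comm_monoid_add, t2_space}"
  assumes "\<And>j. j \<noteq> i \<Longrightarrow> f j = 0"
  shows "infsum f UNIV = f i"
proof -
  have "infsum f UNIV = infsum f {i}"
    by (rule infsum_cong_neutral) (use assms in auto)
  then show ?thesis by simp
qed

lemma infsum_product:
  fixes f :: "'x \<Rightarrow> complex" and g :: "'y \<Rightarrow> complex"
  assumes f: "(\<lambda>x. norm (f x)) summable_on UNIV" and g: "(\<lambda>x. norm (g x)) summable_on UNIV"
  shows "(\<Sum>\<^sub>\<infinity>(x, y). f x * g y) = infsum f UNIV * infsum g UNIV"
proof -
  have "(\<lambda>z. norm ((\<lambda>(x, y). f x * g y) z)) summable_on (UNIV \<times> UNIV)"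
    using Infinite_Sum.abs_summable_on_Sigma_iff[of "\<lambda>(x, y). f x * g y" UNIV "\<lambda>_. UNIV"] f g
    by (simp add: norm_mult infsum_cmult_right' abs_mult infsum_nonneg summable_on_cmult_right summable_on_cmult_left)
  then have "(\<lambda>(x, y). f x * g y) summable_on (UNIV \<times> UNIV)"
    by (rule abs_summable_summable)
  from infsum_Sigma'_banach[OF this] show ?thesis
    by (simp add: infsum_cmult_right' infsum_cmult_left')
qed

lemma norm_square_cnj: "cnj z * z = complex_of_real ((cmod z)\<^sup>2)"
  by (simp only: complex_norm_square mult.commute)

lemma mult_rearrange_le:
  fixes q a b c :: real
  shows "q \<le> a * (c * b) \<Longrightarrow> q \<le> c * a * b" "q \<le> c * b * a \<Longrightarrow> q \<le> c * a * b"
    "q \<le> c * a * b \<Longrightarrow> q \<le> c * (a * b)" "q \<le> c * (a * b) \<Longrightarrow> q \<le> c * a * b"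
    "q \<le> c * a * a \<Longrightarrow> q \<le> c * a\<^sup>2"
  by (simp_all add: mult_ac power2_eq_square)

lemma square_cancel_le: "n\<^sup>2 \<le> c * n * b \<Longrightarrow> 0 \<le> n \<Longrightarrow> 0 \<le> c * b \<Longrightarrow> n \<le> c * b" for n b c :: real
  by (cases "n = 0") (auto simp: power2_eq_square mult_ac)

definition l2b :: "('i \<Rightarrow> complex) \<Rightarrow> real \<Rightarrow> bool" where
  "l2b x B \<longleftrightarrow> 0 \<le> B \<and> (\<forall>F. finite F \<longrightarrow> L2_set (\<lambda>i. cmod (x i)) F \<le> B)"

lemma l2b_nonneg: "l2b x B \<Longrightarrow> 0 \<le> B"
  by (simp add: l2b_def)

lemma L2_set_sq: "(L2_set f F)\<^sup>2 = (\<Sum>i\<in>F. (f i)\<^sup>2)"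
  by (simp add: L2_set_def sum_nonneg)

lemma cauchy_schwarz_finite:
  "(\<Sum>i\<in>F. cmod (x i * y i)) \<le> L2_set (\<lambda>i. cmod (x i)) F * L2_set (\<lambda>i. cmod (y i)) F"
  using L2_set_mult_ineq[of "\<lambda>i. cmod (x i)" "\<lambda>i. cmod (y i)" F] by (simp add: norm_mult)

lemma l2b_pair_summable:
  assumes "l2b x B" "l2b y C"
  shows "(\<lambda>j. norm (x j * y j)) summable_on UNIV"
  unfolding Infinite_Sum.abs_summable_iff_bdd_above
proof (rule bdd_aboveI2)
  fix F :: "'a set" assume "F \<in> {F. F \<subseteq> UNIV \<and> finite F}"
  then have "L2_set (\<lambda>i. cmod (x i)) F * L2_set (\<lambda>i. cmod (y i)) F \<le> B * C"
    using assms by (intro mult_mono) (auto simp: l2b_def)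
  with cauchy_schwarz_finite[where F = F] show "(\<Sum>j\<in>F. cmod (x j * y j)) \<le> B * C"
    using order_trans by blast
qed

lemma l2b_pair_summable':
  "l2b x B \<Longrightarrow> l2b y C \<Longrightarrow> (\<lambda>j. x j * y j) summable_on UNIV"
  by (rule abs_summable_summable[OF l2b_pair_summable])

lemma l2b_pair_bound:
  assumes "l2b x B" "l2b y C"
  shows "cmod (\<Sum>\<^sub>\<infinity>j. x j * y j) \<le> B * C"
proof -
  have "cmod (\<Sum>\<^sub>\<infinity>j. x j * y j) \<le> (\<Sum>\<^sub>\<infinity>j. cmod (x j * y j))"
    by (rule norm_infsum_bound[OF l2b_pair_summable[OF assms]])
  also have "\<dots> \<le> B * C"
  proof (rule infsum_le_finite_sums[OF l2b_pair_summable[OF assms]])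
    fix F :: "'a set" assume "finite F"
    then have "L2_set (\<lambda>i. cmod (x i)) F * L2_set (\<lambda>i. cmod (y i)) F \<le> B * C"
      using assms by (intro mult_mono) (auto simp: l2b_def)
    with cauchy_schwarz_finite[where F = F] show "(\<Sum>j\<in>F. cmod (x j * y j)) \<le> B * C"
      using order_trans by blast
  qed
  finally show ?thesis .
qed

lemma l2b_summable: "l2b x B \<Longrightarrow> (\<lambda>i. (cmod (x i))\<^sup>2) summable_on UNIV"
  using l2b_pair_summable[of x B x B] by (simp add: norm_mult power2_eq_square)

lemma l2b_finite: "l2b (\<lambda>i. if i \<in> F then x i else 0) (L2_set (\<lambda>i. cmod (x i)) F)" if "finite F"
  unfolding l2b_def
proof (intro conjI allI impI)
  fix G :: "'a set" assume G: "finite G"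
  have "L2_set (\<lambda>i. cmod (if i \<in> F then x i else 0)) G = L2_set (\<lambda>i. cmod (x i)) (G \<inter> F)"
    unfolding L2_set_def using G by (intro arg_cong[of _ _ sqrt] sum.mono_neutral_cong_right) auto
  also have "\<dots> \<le> L2_set (\<lambda>i. cmod (x i)) F"
    unfolding L2_set_def using that by (intro real_sqrt_le_mono sum_mono2) auto
  finally show "L2_set (\<lambda>i. cmod (if i \<in> F then x i else 0)) G \<le> L2_set (\<lambda>i. cmod (x i)) F" .
qed simp

lemma l2b_cnj: "l2b (\<lambda>i. cnj (x i)) B \<longleftrightarrow> l2b x B"
  by (simp add: l2b_def)

lemma l2b_tail:
  assumes "l2b x B" "0 < e"
  obtains G where "finite G" "l2b (\<lambda>i. if i \<in> G then 0 else x i) e"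
proof -
  let ?f = "\<lambda>i. (cmod (x i))\<^sup>2"
  have s: "?f summable_on UNIV" by (rule l2b_summable[OF assms(1)])
  then obtain G where G: "finite G" "dist (sum ?f G) (infsum ?f UNIV) \<le> e\<^sup>2"
    using infsum_finite_approximation[of ?f UNIV "e\<^sup>2"] assms(2) by auto
  show thesis
  proof (rule that[OF G(1)], unfold l2b_def, intro conjI allI impI)
    fix F :: "'a set" assume F: "finite F"
    have "(\<Sum>i\<in>F. (cmod (if i \<in> G then 0 else x i))\<^sup>2) = sum ?f (F - G)"
      using F by (intro sum.mono_neutral_cong_right) auto
    also have "\<dots> = sum ?f (G \<union> (F - G)) - sum ?f G"
      using sum.union_disjoint[of G "F - G" ?f] F G(1) by (simp add: Int_Diff del: Un_Diff_cancel)
    also have "\<dots> \<le> infsum ?f UNIV - sum ?f G"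
      using F G(1) s by (intro diff_right_mono finite_sum_le_infsum) auto
    also have "\<dots> \<le> e\<^sup>2" using G(2) by (simp add: dist_real_def)
    finally show "L2_set (\<lambda>i. cmod (if i \<in> G then 0 else x i)) F \<le> e"
      unfolding L2_set_def using assms(2) by (intro real_le_lsqrt) simp_all
  qed (use assms in simp)
qed

section \<open>Matrices of bounded operators\<close>

lemma op_bound_nonneg: "op_bound M C \<Longrightarrow> 0 \<le> C"
  by (simp add: op_bound_def)

lemma op_bound_rect:
  assumes "op_bound M C" "finite F" "finite G"
  shows "cmod (\<Sum>i\<in>F. \<Sum>j\<in>G. cnj (v i) * M i j * w j)
      \<le> C * L2_set (\<lambda>i. cmod (v i)) F * L2_set (\<lambda>i. cmod (w i)) G"
proof -
  let ?v = "\<lambda>i. if i \<in> F then v i else 0" and ?w = "\<lambda>i. if i \<in> G then w i else 0"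
  have "(\<Sum>i\<in>F. \<Sum>j\<in>G. cnj (v i) * M i j * w j) =
      (\<Sum>i\<in>F\<union>G. \<Sum>j\<in>F\<union>G. cnj (?v i) * M i j * ?w j)"
  proof (rule sum.mono_neutral_cong_left)
    fix i assume "i \<in> F"
    then show "(\<Sum>j\<in>G. cnj (v i) * M i j * w j) = (\<Sum>j\<in>F\<union>G. cnj (?v i) * M i j * ?w j)"
      by (intro sum.mono_neutral_cong_left) (use assms in auto)
  qed (use assms in auto)
  moreover have "L2_set (\<lambda>i. cmod (?v i)) (F \<union> G) = L2_set (\<lambda>i. cmod (v i)) F"
    unfolding L2_set_def by (intro arg_cong[of _ _ sqrt] sum.mono_neutral_cong_right) (use assms in auto)
  moreover have "L2_set (\<lambda>i. cmod (?w i)) (F \<union> G) = L2_set (\<lambda>i. cmod (w i)) G"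
    unfolding L2_set_def by (intro arg_cong[of _ _ sqrt] sum.mono_neutral_cong_right) (use assms in auto)
  moreover have "cmod (\<Sum>i\<in>F\<union>G. \<Sum>j\<in>F\<union>G. cnj (?v i) * M i j * ?w j)
      \<le> C * L2_set (\<lambda>i. cmod (?v i)) (F \<union> G) * L2_set (\<lambda>i. cmod (?w i)) (F \<union> G)"
    using assms by (intro conjunct2[OF assms(1)[unfolded op_bound_def], rule_format]) simp
  ultimately show ?thesis by (simp only:)
qed

lemma op_bound_apply:
  assumes "op_bound M C" "finite F" "finite G"
  shows "L2_set (\<lambda>i. cmod (\<Sum>j\<in>G. M i j * w j)) F \<le> C * L2_set (\<lambda>i. cmod (w i)) G"
proof -
  let ?y = "\<lambda>i. \<Sum>j\<in>G. M i j * w j" and ?n = "L2_set (\<lambda>i. cmod (\<Sum>j\<in>G. M i j * w j)) F"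
  have "(\<Sum>i\<in>F. \<Sum>j\<in>G. cnj (?y i) * M i j * w j) = (\<Sum>i\<in>F. cnj (?y i) * ?y i)"
    by (simp add: sum_distrib_left mult.assoc)
  also have "\<dots> = complex_of_real (\<Sum>i\<in>F. (cmod (?y i))\<^sup>2)"
    unfolding of_real_sum by (intro sum.cong refl norm_square_cnj)
  finally have eq: "(\<Sum>i\<in>F. \<Sum>j\<in>G. cnj (?y i) * M i j * w j) = complex_of_real (\<Sum>i\<in>F. (cmod (?y i))\<^sup>2)" .
  have "cmod (\<Sum>i\<in>F. \<Sum>j\<in>G. cnj (?y i) * M i j * w j) = ?n\<^sup>2"
    unfolding eq norm_of_real L2_set_sq by (intro abs_of_nonneg sum_nonneg) simp
  with op_bound_rect[OF assms, of ?y w] have "?n\<^sup>2 \<le> C * ?n * L2_set (\<lambda>i. cmod (w i)) G" by (simp only:)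
  then show ?thesis
    by (rule square_cancel_le[OF _ L2_set_nonneg mult_nonneg_nonneg[OF _ L2_set_nonneg]])
      (rule op_bound_nonneg[OF assms(1)])
qed

lemma op_boundI:
  assumes "0 \<le> C"
    "\<And>F G w. finite F \<Longrightarrow> finite G \<Longrightarrow>
       L2_set (\<lambda>i. cmod (\<Sum>j\<in>G. M i j * w j)) F \<le> C * L2_set (\<lambda>i. cmod (w i)) G"
  shows "op_bound M C"
  unfolding op_bound_def
proof (intro conjI allI impI)
  fix F :: "'a set" and v w :: "'a \<Rightarrow> complex" assume F: "finite F"
  have "cmod (\<Sum>i\<in>F. \<Sum>j\<in>F. cnj (v i) * M i j * w j) = cmod (\<Sum>i\<in>F. cnj (v i) * (\<Sum>j\<in>F. M i j * w j))"
    by (simp add: sum_distrib_left mult.assoc)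
  also have "\<dots> \<le> (\<Sum>i\<in>F. cmod (cnj (v i) * (\<Sum>j\<in>F. M i j * w j)))" by (rule norm_sum)
  also have "\<dots> \<le> L2_set (\<lambda>i. cmod (cnj (v i))) F * L2_set (\<lambda>i. cmod (\<Sum>j\<in>F. M i j * w j)) F"
    by (rule cauchy_schwarz_finite)
  also have "\<dots> \<le> L2_set (\<lambda>i. cmod (v i)) F * (C * L2_set (\<lambda>i. cmod (w i)) F)"
    unfolding complex_mod_cnj by (intro mult_left_mono assms(2) F L2_set_nonneg)
  finally show "cmod (\<Sum>i\<in>F. \<Sum>j\<in>F. cnj (v i) * M i j * w j)
      \<le> C * L2_set (\<lambda>i. cmod (v i)) F * L2_set (\<lambda>i. cmod (w i)) F"
    by (rule mult_rearrange_le(1))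
qed (rule assms(1))

lemma op_bound_entry: "cmod (M i j) \<le> C" if "op_bound M C"
  using op_bound_rect[OF that, of "{i}" "{j}" "\<lambda>_. 1" "\<lambda>_. 1"] by simp

lemma op_bound_star: "op_bound (\<lambda>i j. cnj (M j i)) C" if "op_bound M C"
  unfolding op_bound_def
proof (intro conjI allI impI)
  fix F :: "'a set" and v w :: "'a \<Rightarrow> complex" assume F: "finite F"
  have "(\<Sum>i\<in>F. \<Sum>j\<in>F. cnj (v i) * cnj (M j i) * w j) = (\<Sum>j\<in>F. \<Sum>i\<in>F. cnj (v i) * cnj (M j i) * w j)"
    by (rule sum.swap)
  also have "\<dots> = cnj (\<Sum>j\<in>F. \<Sum>i\<in>F. cnj (w j) * M j i * v i)"
    unfolding cnj_sum by (intro sum.cong refl) simp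
  finally have "cmod (\<Sum>i\<in>F. \<Sum>j\<in>F. cnj (v i) * cnj (M j i) * w j) =
      cmod (\<Sum>j\<in>F. \<Sum>i\<in>F. cnj (w j) * M j i * v i)"
    by (simp only: complex_mod_cnj)
  also note op_bound_rect[OF that F F, of w v]
  finally show "cmod (\<Sum>i\<in>F. \<Sum>j\<in>F. cnj (v i) * cnj (M j i) * w j)
      \<le> C * L2_set (\<lambda>i. cmod (v i)) F * L2_set (\<lambda>i. cmod (w i)) F"
    by (rule mult_rearrange_le(2))
qed (rule op_bound_nonneg[OF that])

lemma op_bound_column:
  assumes "op_bound M C" "finite G"
  shows "l2b (\<lambda>i. \<Sum>j\<in>G. M i j * w j) (C * L2_set (\<lambda>i. cmod (w i)) G)"
  using op_bound_apply[OF assms(1) _ assms(2)] op_bound_nonneg[OF assms(1)] unfolding l2b_def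
  by (intro conjI mult_nonneg_nonneg L2_set_nonneg) auto

lemma op_bound_col: "l2b (\<lambda>i. M i j) C" if "op_bound M C"
  using op_bound_column[OF that, of "{j}" "\<lambda>_. 1"] by simp

lemma op_bound_row: "l2b (\<lambda>j. M i j) C" if "op_bound M C"
  using op_bound_col[OF op_bound_star[OF that], of i] by (simp add: l2b_cnj)

lemma op_bound_row_sum:
  assumes "op_bound M C" "finite F"
  shows "l2b (\<lambda>j. \<Sum>i\<in>F. cnj (v i) * M i j) (C * L2_set (\<lambda>i. cmod (v i)) F)"
proof -
  have "l2b (\<lambda>j. cnj (\<Sum>i\<in>F. cnj (M i j) * v i)) (C * L2_set (\<lambda>i. cmod (v i)) F)"
    using op_bound_column[OF op_bound_star[OF assms(1)] assms(2), of v] by (simp only: l2b_cnj)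
  then show ?thesis by (simp add: mult.commute)
qed

lemma op_bound_apply_l2:
  assumes M: "op_bound M C" and y: "l2b y B"
  shows "l2b (\<lambda>i. \<Sum>\<^sub>\<infinity>j. M i j * y j) (C * B)"
  unfolding l2b_def
proof (intro conjI allI impI)
  show "0 \<le> C * B" by (intro mult_nonneg_nonneg op_bound_nonneg[OF M] l2b_nonneg[OF y])
  fix F :: "'a set" assume F: "finite F"
  let ?z = "\<lambda>i. \<Sum>\<^sub>\<infinity>j. M i j * y j" and ?n = "L2_set (\<lambda>i. cmod (\<Sum>\<^sub>\<infinity>j. M i j * y j)) F"
  have hs: "((\<lambda>j. M i j * y j) has_sum ?z i) UNIV" for i
    by (intro has_sum_infsum l2b_pair_summable'[OF op_bound_row[OF M] y])
  have "((\<lambda>j. \<Sum>i\<in>F. cnj (?z i) * (M i j * y j)) has_sum (\<Sum>i\<in>F. cnj (?z i) * ?z i)) UNIV"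
    by (intro has_sum_finite_sum has_sum_cmult_right hs)
  then have "(\<Sum>\<^sub>\<infinity>j. (\<Sum>i\<in>F. cnj (?z i) * M i j) * y j) = (\<Sum>i\<in>F. cnj (?z i) * ?z i)"
    by (simp add: infsumI sum_distrib_right mult.assoc)
  also have "\<dots> = complex_of_real (\<Sum>i\<in>F. (cmod (?z i))\<^sup>2)"
    unfolding of_real_sum by (intro sum.cong refl norm_square_cnj)
  finally have eq: "(\<Sum>\<^sub>\<infinity>j. (\<Sum>i\<in>F. cnj (?z i) * M i j) * y j) = complex_of_real (\<Sum>i\<in>F. (cmod (?z i))\<^sup>2)" .
  have "cmod (\<Sum>\<^sub>\<infinity>j. (\<Sum>i\<in>F. cnj (?z i) * M i j) * y j) = ?n\<^sup>2"
    unfolding eq norm_of_real L2_set_sq by (intro abs_of_nonneg sum_nonneg) simp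
  with l2b_pair_bound[OF op_bound_row_sum[OF M F] y, of ?z]
have "?n\<^sup>2 \<le> C * ?n * B" by (simp only:)
  then show "?n \<le> C * B"
    by (rule square_cancel_le[OF _ L2_set_nonneg]) (intro mult_nonneg_nonneg op_bound_nonneg[OF M] l2b_nonneg[OF y])
qed

lemma op_bound_apply_summable:
  assumes "op_bound M C" "l2b y B"
  shows "(\<lambda>j. M i j * y j) summable_on UNIV"
  by (intro l2b_pair_summable'[OF op_bound_row[OF assms(1)] assms(2)])

lemma op_bound_mult:
  assumes M: "op_bound M C" and N: "op_bound N D"
  shows "op_bound (\<lambda>i k. \<Sum>\<^sub>\<infinity>j. M i j * N j k) (C * D)"
proof (rule op_boundI)
  show "0 \<le> C * D" by (intro mult_nonneg_nonneg op_bound_nonneg[OF M] op_bound_nonneg[OF N])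
  fix F G :: "'a set" and w :: "'a \<Rightarrow> complex" assume F: "finite F" and G: "finite G"
  have "(\<Sum>k\<in>G. (\<Sum>\<^sub>\<infinity>j. M i j * N j k) * w k) = (\<Sum>\<^sub>\<infinity>j. M i j * (\<Sum>k\<in>G. N j k * w k))" for i
  proof -
    have "((\<lambda>j. \<Sum>k\<in>G. M i j * N j k * w k) has_sum (\<Sum>k\<in>G. (\<Sum>\<^sub>\<infinity>j. M i j * N j k) * w k)) UNIV"
      by (intro has_sum_finite_sum has_sum_cmult_left has_sum_infsum op_bound_apply_summable[OF M op_bound_col[OF N]])
    then show ?thesis by (simp add: infsumI sum_distrib_left mult.assoc)
  qed
  then show "L2_set (\<lambda>i. cmod (\<Sum>k\<in>G. (\<Sum>\<^sub>\<infinity>j. M i j * N j k) * w k)) F \<le> C * D * L2_set (\<lambda>i. cmod (w i)) G"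
    using op_bound_apply_l2[OF M op_bound_column[OF N G, of w]] F by (simp add: l2b_def mult.assoc)
qed

text \<open>
  Associativity of the matrix product comes down to this interchange of two sums. The double series
  need not converge absolutely; the interchange is clear if \<open>y\<close> has finite support, and in general
  \<open>y\<close> is such a vector up to a small remainder.
\<close>

lemma op_assoc:
  assumes x: "l2b x B" and N: "op_bound N D" and y: "l2b y C"
  shows "(\<Sum>\<^sub>\<infinity>j. (\<Sum>\<^sub>\<infinity>k. x k * N k j) * y j) = (\<Sum>\<^sub>\<infinity>k. x k * (\<Sum>\<^sub>\<infinity>j. N k j * y j))"
    (is "?L = ?R")
proof -
  let ?z = "\<lambda>j. \<Sum>\<^sub>\<infinity>k. x k * N k j"
  have z: "l2b ?z (D * B)"
    using op_bound_apply_l2[OF op_bound_star[OF N], of "\<lambda>k. cnj (x k)" B] x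
    by (simp add: l2b_cnj mult.commute flip: complex_cnj_mult)
  have B: "0 \<le> B" "0 \<le> D" by (rule l2b_nonneg[OF x] op_bound_nonneg[OF N])+
  have "cmod (?L - ?R) \<le> 2 * (D * B) * e" if e: "0 < e" for e
  proof -
    obtain G where G: "finite G" "l2b (\<lambda>i. if i \<in> G then 0 else y i) e"
      using l2b_tail[OF y e] .
    let ?t = "\<lambda>i. if i \<in> G then 0 else y i" and ?h = "\<lambda>i. if i \<in> G then y i else 0"
    have h: "l2b ?h (L2_set (\<lambda>i. cmod (y i)) G)" using l2b_finite[OF G(1)] .
    have fin: "infsum (\<lambda>j. f j * ?h j) UNIV = (\<Sum>j\<in>G. f j * y j)" for f :: "'a \<Rightarrow> complex"
    proof -
      have "infsum (\<lambda>j. f j * ?h j) UNIV = infsum (\<lambda>j. f j * y j) G"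
        by (rule infsum_cong_neutral) auto
      then show ?thesis using G by simp
    qed
    have L: "?L = (\<Sum>j\<in>G. ?z j * y j) + (\<Sum>\<^sub>\<infinity>j. ?z j * ?t j)"
    proof -
      have "?L = (\<Sum>\<^sub>\<infinity>j. ?z j * ?h j + ?z j * ?t j)" by (rule infsum_cong) simp
      also have "\<dots> = (\<Sum>\<^sub>\<infinity>j. ?z j * ?h j) + (\<Sum>\<^sub>\<infinity>j. ?z j * ?t j)"
        by (intro infsum_add l2b_pair_summable'[OF z h] l2b_pair_summable'[OF z G(2)])
      finally show ?thesis by (simp only: fin)
    qed
    have Ny: "(\<Sum>\<^sub>\<infinity>j. N k j * y j) = (\<Sum>\<^sub>\<infinity>j. N k j * ?h j) + (\<Sum>\<^sub>\<infinity>j. N k j * ?t j)" for k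
    proof -
      have "(\<Sum>\<^sub>\<infinity>j. N k j * y j) = (\<Sum>\<^sub>\<infinity>j. N k j * ?h j + N k j * ?t j)" by (rule infsum_cong) simp
      also have "\<dots> = (\<Sum>\<^sub>\<infinity>j. N k j * ?h j) + (\<Sum>\<^sub>\<infinity>j. N k j * ?t j)"
        by (intro infsum_add op_bound_apply_summable[OF N h] op_bound_apply_summable[OF N G(2)])
      finally show ?thesis .
    qed
    have "?R = (\<Sum>\<^sub>\<infinity>k. x k * (\<Sum>\<^sub>\<infinity>j. N k j * ?h j)) + (\<Sum>\<^sub>\<infinity>k. x k * (\<Sum>\<^sub>\<infinity>j. N k j * ?t j))"
      unfolding Ny distrib_left
      by (intro infsum_add l2b_pair_summable'[OF x op_bound_apply_l2[OF N h]]
          l2b_pair_summable'[OF x op_bound_apply_l2[OF N G(2)]])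
    also have "(\<Sum>\<^sub>\<infinity>k. x k * (\<Sum>\<^sub>\<infinity>j. N k j * ?h j)) = (\<Sum>j\<in>G. ?z j * y j)"
    proof -
      have "((\<lambda>k. \<Sum>j\<in>G. x k * N k j * y j) has_sum (\<Sum>j\<in>G. ?z j * y j)) UNIV"
        by (intro has_sum_finite_sum has_sum_cmult_left has_sum_infsum l2b_pair_summable'[OF x op_bound_col[OF N]])
      then show ?thesis unfolding fin by (simp add: infsumI sum_distrib_left mult.assoc)
    qed
    finally have "?L - ?R = (\<Sum>\<^sub>\<infinity>j. ?z j * ?t j) - (\<Sum>\<^sub>\<infinity>k. x k * (\<Sum>\<^sub>\<infinity>j. N k j * ?t j))"
      using L by simp
    then have "cmod (?L - ?R) \<le> cmod (\<Sum>\<^sub>\<infinity>j. ?z j * ?t j) + cmod (\<Sum>\<^sub>\<infinity>k. x k * (\<Sum>\<^sub>\<infinity>j. N k j * ?t j))"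
      by (simp add: norm_triangle_ineq4)
    also have "\<dots> \<le> (D * B) * e + B * (D * e)"
      by (intro add_mono l2b_pair_bound[OF z G(2)] l2b_pair_bound[OF x op_bound_apply_l2[OF N G(2)]])
    finally show ?thesis by (simp add: algebra_simps)
  qed
  note le = this
  have "cmod (?L - ?R) \<le> 0"
  proof (rule field_le_epsilon)
    fix e :: real assume e: "0 < e"
    define K where "K = 2 * (D * B)"
    have K: "0 \<le> K" using B by (simp add: K_def)
    then have "K * (e / (K + 1)) \<le> e" using e by (simp add: divide_le_eq algebra_simps)
    with le[of "e / (K + 1)"] e K show "cmod (?L - ?R) \<le> 0 + e" by (simp add: K_def[symmetric])
  qed
  then show ?thesis by simp
qed

lemma op_bound_op_norm:
  assumes "op_bound M C"
  shows "op_bound M (op_norm M)"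
  unfolding op_bound_def
proof (intro conjI allI impI)
  have ne: "{C. op_bound M C} \<noteq> {}" using assms by auto
  then show "0 \<le> op_norm M"
    unfolding op_norm_def by (intro cInf_greatest) (auto intro: op_bound_nonneg)
  fix F :: "'a set" and v w :: "'a \<Rightarrow> complex" assume F: "finite F"
  let ?a = "L2_set (\<lambda>i. cmod (v i)) F * L2_set (\<lambda>i. cmod (w i)) F"
  let ?q = "cmod (\<Sum>i\<in>F. \<Sum>j\<in>F. cnj (v i) * M i j * w j)"
  have le: "?q \<le> C * ?a" if "op_bound M C" for C
    by (rule mult_rearrange_le(3)[OF op_bound_rect[OF that F F]])
  have "?q \<le> op_norm M * ?a"
  proof (cases "?a = 0")
    case True
    with le[OF assms] show ?thesis by (simp only: mult_zero_right)
  next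
    case False
    then have a: "?a > 0" by (metis L2_set_nonneg less_le mult_nonneg_nonneg)
    have "?q / ?a \<le> op_norm M"
      unfolding op_norm_def by (intro cInf_greatest ne) (use le a in \<open>auto simp: divide_le_eq\<close>)
    with a show ?thesis by (simp add: divide_le_eq)
  qed
  then show "?q \<le> op_norm M * L2_set (\<lambda>i. cmod (v i)) F * L2_set (\<lambda>i. cmod (w i)) F"
    by (rule mult_rearrange_le(4))
qed

lemma op_norm_le: "op_bound M C \<Longrightarrow> op_norm M \<le> C"
  unfolding op_norm_def by (rule cInf_lower) (auto intro: bdd_belowI[of _ 0] op_bound_nonneg)

lemma bounded_ops_sel [simp]:
  "M \<in> carrier bounded_ops \<longleftrightarrow> (\<exists>C. op_bound M C)"
  "M \<otimes>\<^bsub>bounded_ops\<^esub> N = (\<lambda>i k. \<Sum>\<^sub>\<infinity>j. M i j * N j k)"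
  "\<one>\<^bsub>bounded_ops\<^esub> = (\<lambda>i j. if i = j then 1 else 0)"
  "\<zero>\<^bsub>bounded_ops\<^esub> = (\<lambda>i j. 0)"
  "M \<oplus>\<^bsub>bounded_ops\<^esub> N = (\<lambda>i j. M i j + N i j)"
  "c \<odot>\<^bsub>bounded_ops\<^esub> M = (\<lambda>i j. c * M i j)"
  "star bounded_ops M = (\<lambda>i j. cnj (M j i))"
  "nrm bounded_ops M = op_norm M"
  by (simp_all add: bounded_ops_def)

lemma op_bound_add:
  assumes "op_bound M C" "op_bound N D"
  shows "op_bound (\<lambda>i j. M i j + N i j) (C + D)"
  unfolding op_bound_def
proof (intro conjI allI impI)
  fix F :: "'a set" and v w :: "'a \<Rightarrow> complex" assume F: "finite F"
  have "cmod (\<Sum>i\<in>F. \<Sum>j\<in>F. cnj (v i) * (M i j + N i j) * w j) \<le>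
      cmod (\<Sum>i\<in>F. \<Sum>j\<in>F. cnj (v i) * M i j * w j) + cmod (\<Sum>i\<in>F. \<Sum>j\<in>F. cnj (v i) * N i j * w j)"
    by (simp add: distrib_left distrib_right sum.distrib norm_triangle_ineq)
  with op_bound_rect[OF assms(1) F F, of v w] op_bound_rect[OF assms(2) F F, of v w]
  show "cmod (\<Sum>i\<in>F. \<Sum>j\<in>F. cnj (v i) * (M i j + N i j) * w j)
      \<le> (C + D) * L2_set (\<lambda>i. cmod (v i)) F * L2_set (\<lambda>i. cmod (w i)) F"
    unfolding distrib_right by linarith
qed (intro add_nonneg_nonneg op_bound_nonneg[OF assms(1)] op_bound_nonneg[OF assms(2)])

lemma op_bound_smult:
  assumes "op_bound M C"
  shows "op_bound (\<lambda>i j. c * M i j) (cmod c * C)"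
  unfolding op_bound_def
proof (intro conjI allI impI)
  fix F :: "'a set" and v w :: "'a \<Rightarrow> complex" assume F: "finite F"
  have "(\<Sum>i\<in>F. \<Sum>j\<in>F. cnj (v i) * (c * M i j) * w j) = c * (\<Sum>i\<in>F. \<Sum>j\<in>F. cnj (v i) * M i j * w j)"
    unfolding sum_distrib_left by (intro sum.cong refl) simp
  then have "cmod (\<Sum>i\<in>F. \<Sum>j\<in>F. cnj (v i) * (c * M i j) * w j) =
      cmod c * cmod (\<Sum>i\<in>F. \<Sum>j\<in>F. cnj (v i) * M i j * w j)" by (simp only: norm_mult)
  also have "\<dots> \<le> cmod c * (C * L2_set (\<lambda>i. cmod (v i)) F * L2_set (\<lambda>i. cmod (w i)) F)"
    by (intro mult_left_mono op_bound_rect[OF assms F F]) simp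
  finally show "cmod (\<Sum>i\<in>F. \<Sum>j\<in>F. cnj (v i) * (c * M i j) * w j)
      \<le> cmod c * C * L2_set (\<lambda>i. cmod (v i)) F * L2_set (\<lambda>i. cmod (w i)) F"
    by (simp only: mult.assoc)
qed (intro mult_nonneg_nonneg norm_ge_zero op_bound_nonneg[OF assms])

lemma op_bound_diag:
  assumes "\<And>i. cmod (d i) \<le> C" "0 \<le> C"
  shows "op_bound (\<lambda>i j. if i = j then d i else 0) C"
proof (rule op_boundI[OF assms(2)])
  fix F G :: "'a set" and w :: "'a \<Rightarrow> complex" assume FG: "finite F" "finite G"
  have "(\<Sum>j\<in>G. (if i = j then d i else 0) * w j) = (if i \<in> G then d i * w i else 0)" for i
    using FG by (simp add: if_distrib[of "\<lambda>x. x * _"] cong: if_cong)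
  then have "(\<Sum>i\<in>F. (cmod (\<Sum>j\<in>G. (if i = j then d i else 0) * w j))\<^sup>2) =
      (\<Sum>i\<in>F \<inter> G. (cmod (d i * w i))\<^sup>2)"
    using FG by (intro sum.mono_neutral_cong_right) auto
  also have "\<dots> \<le> (\<Sum>i\<in>F \<inter> G. (C * cmod (w i))\<^sup>2)"
    using assms by (intro sum_mono power_mono) (auto simp: norm_mult intro: mult_right_mono)
  also have "\<dots> \<le> (\<Sum>i\<in>G. (C * cmod (w i))\<^sup>2)"
    using FG by (intro sum_mono2) auto
  finally show "L2_set (\<lambda>i. cmod (\<Sum>j\<in>G. (if i = j then d i else 0) * w j)) F \<le> C * L2_set (\<lambda>i. cmod (w i)) G"
    unfolding L2_set_right_distrib[OF assms(2)] by (simp add: L2_set_def)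
qed

lemma op_bound_zero: "op_bound (\<lambda>i j. 0) 0"
  using op_bound_smult[OF op_bound_diag[of "\<lambda>_. 0" 0], of 0] by simp

lemma bounded_ops_form_star_self:
  assumes "op_bound M C" "finite F"
  shows "(\<lambda>i. (cmod (\<Sum>k\<in>F. M i k * w k))\<^sup>2) summable_on UNIV"
    "(\<Sum>j\<in>F. \<Sum>k\<in>F. cnj (w j) * (\<Sum>\<^sub>\<infinity>i. cnj (M i j) * M i k) * w k) =
      complex_of_real (\<Sum>\<^sub>\<infinity>i. (cmod (\<Sum>k\<in>F. M i k * w k))\<^sup>2)"
proof -
  show s: "(\<lambda>i. (cmod (\<Sum>k\<in>F. M i k * w k))\<^sup>2) summable_on UNIV"
    by (rule l2b_summable[OF op_bound_column[OF assms]])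
  have "((\<lambda>i. \<Sum>j\<in>F. \<Sum>k\<in>F. cnj (w j) * (cnj (M i j) * M i k) * w k) has_sum
      (\<Sum>j\<in>F. \<Sum>k\<in>F. cnj (w j) * (\<Sum>\<^sub>\<infinity>i. cnj (M i j) * M i k) * w k)) UNIV"
    by (intro has_sum_finite_sum has_sum_cmult_left has_sum_cmult_right has_sum_infsum
        op_bound_apply_summable[OF op_bound_star[OF assms(1)] op_bound_col[OF assms(1)]])
  moreover have "(\<Sum>j\<in>F. \<Sum>k\<in>F. cnj (w j) * (cnj (M i j) * M i k) * w k) =
      complex_of_real ((cmod (\<Sum>k\<in>F. M i k * w k))\<^sup>2)" for i
    unfolding norm_square_cnj[symmetric] cnj_sum sum_product by (simp add: mult_ac)
  ultimately have "((\<lambda>i. complex_of_real ((cmod (\<Sum>k\<in>F. M i k * w k))\<^sup>2)) has_sum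
      (\<Sum>j\<in>F. \<Sum>k\<in>F. cnj (w j) * (\<Sum>\<^sub>\<infinity>i. cnj (M i j) * M i k) * w k)) UNIV" by (simp only:)
  moreover have "((\<lambda>i. complex_of_real ((cmod (\<Sum>k\<in>F. M i k * w k))\<^sup>2)) has_sum
      complex_of_real (\<Sum>\<^sub>\<infinity>i. (cmod (\<Sum>k\<in>F. M i k * w k))\<^sup>2)) UNIV"
    by (intro has_sum_of_real has_sum_infsum s)
  ultimately show "(\<Sum>j\<in>F. \<Sum>k\<in>F. cnj (w j) * (\<Sum>\<^sub>\<infinity>i. cnj (M i j) * M i k) * w k) =
      complex_of_real (\<Sum>\<^sub>\<infinity>i. (cmod (\<Sum>k\<in>F. M i k * w k))\<^sup>2)"
    using has_sum_unique by blast
qed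

text \<open>
  The C*-identity in the form \<open>\<parallel>M w\<parallel>\<^sup>2 = \<langle>w, M\<^sup>* M w\<rangle>\<close>.
\<close>

lemma op_bound_from_star_self:
  assumes M: "op_bound M C" and MM: "op_bound (\<lambda>j k. \<Sum>\<^sub>\<infinity>i. cnj (M i j) * M i k) D"
  shows "op_bound M (sqrt D)"
proof (rule op_boundI)
  show "0 \<le> sqrt D" using op_bound_nonneg[OF MM] by simp
  fix F G :: "'a set" and w :: "'a \<Rightarrow> complex" assume F: "finite F" and G: "finite G"
  note q = bounded_ops_form_star_self[OF M G, of w]
  have "(\<Sum>i\<in>F. (cmod (\<Sum>k\<in>G. M i k * w k))\<^sup>2) \<le> (\<Sum>\<^sub>\<infinity>i. (cmod (\<Sum>k\<in>G. M i k * w k))\<^sup>2)"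
    by (rule finite_sum_le_infsum[OF q(1) F]) auto
  also have "\<dots> \<le> D * (L2_set (\<lambda>i. cmod (w i)) G)\<^sup>2"
    using mult_rearrange_le(5)[OF op_bound_rect[OF MM G G, of w w]] unfolding q(2) by simp
  finally show "L2_set (\<lambda>i. cmod (\<Sum>j\<in>G. M i j * w j)) F \<le> sqrt D * L2_set (\<lambda>i. cmod (w i)) G"
    using real_sqrt_le_mono by (fastforce simp: L2_set_def[of _ F] real_sqrt_mult)
qed

lemma pre_cstar_bounded_ops: "pre_cstar (bounded_ops :: 'i op cstar)"
proof -
  have B: "\<exists>C. op_bound (\<lambda>i j. M i j + N i j :: complex) C" if "op_bound M C" "op_bound N D" for M N :: "'i op" and C D
    using op_bound_add[OF that] by blast
  have inv: "\<exists>C. op_bound (\<lambda>i j. - M i j) C" if "op_bound M C" for M :: "'i op" and C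
    using op_bound_smult[OF that, of "-1"] by auto
  have "abelian_group (bounded_ops :: 'i op cstar)"
  proof (rule abelian_groupI)
    fix M :: "'i op" assume "M \<in> carrier bounded_ops"
    then show "\<exists>N\<in>carrier bounded_ops. N \<oplus>\<^bsub>bounded_ops\<^esub> M = \<zero>\<^bsub>bounded_ops\<^esub>"
      using inv[of M] by (intro bexI[of _ "\<lambda>i j. - M i j"]) auto
  qed (auto intro: B op_bound_zero simp: algebra_simps)
  moreover have "Group.monoid (bounded_ops :: 'i op cstar)"
  proof (rule monoidI)
    fix L M N :: "'i op" assume "L \<in> carrier bounded_ops" "M \<in> carrier bounded_ops" "N \<in> carrier bounded_ops"
    then obtain C D E where b: "op_bound L C" "op_bound M D" "op_bound N E" by auto
    show "L \<otimes>\<^bsub>bounded_ops\<^esub> M \<otimes>\<^bsub>bounded_ops\<^esub> N = L \<otimes>\<^bsub>bounded_ops\<^esub> (M \<otimes>\<^bsub>bounded_ops\<^esub> N)"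
      using op_assoc[OF op_bound_row[OF b(1)] b(2) op_bound_col[OF b(3)]] by simp
  next
    fix M :: "'i op"
    show "\<one>\<^bsub>bounded_ops\<^esub> \<otimes>\<^bsub>bounded_ops\<^esub> M = M"
    proof (simp, intro ext)
      fix i k
      show "(\<Sum>\<^sub>\<infinity>j. (if i = j then 1 else 0) * M j k) = M i k"
        using infsum_single_point[of i "\<lambda>j. (if i = j then 1 else 0) * M j k"] by simp
    qed
    show "M \<otimes>\<^bsub>bounded_ops\<^esub> \<one>\<^bsub>bounded_ops\<^esub> = M"
    proof (simp, intro ext)
      fix i k
      show "(\<Sum>\<^sub>\<infinity>j. M i j * (if j = k then 1 else 0)) = M i k"
        using infsum_single_point[of k "\<lambda>j. M i j * (if j = k then 1 else 0)"] by simp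
    qed
  qed (auto intro: op_bound_mult op_bound_diag[of "\<lambda>_. 1" 1, simplified])
  ultimately have ring: "ring (bounded_ops :: 'i op cstar)"
  proof (rule ringI)
    fix L M N :: "'i op" assume "L \<in> carrier bounded_ops" "M \<in> carrier bounded_ops" "N \<in> carrier bounded_ops"
    then obtain C D E where b: "op_bound L C" "op_bound M D" "op_bound N E" by auto
    show "(L \<oplus>\<^bsub>bounded_ops\<^esub> M) \<otimes>\<^bsub>bounded_ops\<^esub> N =
        L \<otimes>\<^bsub>bounded_ops\<^esub> N \<oplus>\<^bsub>bounded_ops\<^esub> M \<otimes>\<^bsub>bounded_ops\<^esub> N"
      using infsum_add[OF op_bound_apply_summable[OF b(1) op_bound_col[OF b(3)]]
          op_bound_apply_summable[OF b(2) op_bound_col[OF b(3)]]] by (simp add: distrib_right)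
    show "N \<otimes>\<^bsub>bounded_ops\<^esub> (L \<oplus>\<^bsub>bounded_ops\<^esub> M) =
        N \<otimes>\<^bsub>bounded_ops\<^esub> L \<oplus>\<^bsub>bounded_ops\<^esub> N \<otimes>\<^bsub>bounded_ops\<^esub> M"
      using infsum_add[OF op_bound_apply_summable[OF b(3) op_bound_col[OF b(1)]]
          op_bound_apply_summable[OF b(3) op_bound_col[OF b(2)]]] by (simp add: distrib_left)
  qed
  interpret ring "bounded_ops :: 'i op cstar" by (rule ring)
  have module: "Module.module complex_cstar (bounded_ops :: 'i op cstar)"
    by (rule moduleI[OF cring_complex is_abelian_group]) (auto simp: algebra_simps intro: op_bound_smult)
  interpret V: Module.module complex_cstar "bounded_ops :: 'i op cstar" by (rule module)
  have nz: "op_norm M = 0 \<longleftrightarrow> M = (\<lambda>i j. 0)" if "op_bound M C" for M :: "'i op" and C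
  proof
    assume "op_norm M = 0"
    with op_bound_op_norm[OF that] have "op_bound M 0" by simp
    from op_bound_entry[OF this] show "M = (\<lambda>i j. 0)" by (intro ext) simp
  next
    assume "M = (\<lambda>i j. 0)"
    then have "op_bound M 0" by (simp add: op_bound_zero)
    from op_norm_le[OF this] op_bound_nonneg[OF op_bound_op_norm[OF this]] show "op_norm M = 0" by simp
  qed
  have ns: "op_norm (\<lambda>i j. c * M i j) = cmod c * op_norm M" if M: "op_bound M C" for M :: "'i op" and c C
  proof (cases "c = 0")
    case True
    with nz[OF op_bound_zero] show ?thesis by simp
  next
    case False
    have cM: "op_bound (\<lambda>i j. c * M i j) (cmod c * op_norm M)"
      by (rule op_bound_smult[OF op_bound_op_norm[OF M]])
    have "op_norm (\<lambda>i j. (1/c) * (c * M i j)) \<le> cmod (1/c) * op_norm (\<lambda>i j. c * M i j)"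
      by (rule op_norm_le[OF op_bound_smult[OF op_bound_op_norm[OF cM]]])
    with False have "cmod c * op_norm M \<le> op_norm (\<lambda>i j. c * M i j)"
      by (simp add: norm_divide field_simps)
    with op_norm_le[OF cM] show ?thesis by simp
  qed
  have nm: "op_norm (\<lambda>i k. \<Sum>\<^sub>\<infinity>j. M i j * N j k) \<le> op_norm M * op_norm N"
    if "op_bound M C" "op_bound N D" for M N :: "'i op" and C D
    by (intro op_norm_le op_bound_mult op_bound_op_norm[OF that(1)] op_bound_op_norm[OF that(2)])
  have nc: "op_norm (\<lambda>j k. \<Sum>\<^sub>\<infinity>i. cnj (M i j) * M i k) = (op_norm M)\<^sup>2" if M: "op_bound M C" for M :: "'i op" and C
  proof (rule antisym)
    let ?S = "\<lambda>j k. \<Sum>\<^sub>\<infinity>i. cnj (M i j) * M i k"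
    note M' = op_bound_op_norm[OF M]
    note b = op_bound_mult[OF op_bound_star[OF M'] M']
    then show "op_norm ?S \<le> (op_norm M)\<^sup>2" by (simp add: op_norm_le power2_eq_square)
    have "op_norm M \<le> sqrt (op_norm ?S)"
      by (rule op_norm_le[OF op_bound_from_star_self[OF M op_bound_op_norm[OF b]]])
    from power_mono[OF this op_bound_nonneg[OF M'], of 2] show "(op_norm M)\<^sup>2 \<le> op_norm ?S"
      using op_bound_nonneg[OF op_bound_op_norm[OF b]] by simp
  qed
  show ?thesis
  proof unfold_locales
    fix M N :: "'i op" and c assume "M \<in> carrier bounded_ops" "N \<in> carrier bounded_ops"
    then obtain C D where b: "op_bound M C" "op_bound N D" by auto
    show "(c \<odot>\<^bsub>bounded_ops\<^esub> M) \<otimes>\<^bsub>bounded_ops\<^esub> N = c \<odot>\<^bsub>bounded_ops\<^esub> (M \<otimes>\<^bsub>bounded_ops\<^esub> N)"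
      "M \<otimes>\<^bsub>bounded_ops\<^esub> (c \<odot>\<^bsub>bounded_ops\<^esub> N) = c \<odot>\<^bsub>bounded_ops\<^esub> (M \<otimes>\<^bsub>bounded_ops\<^esub> N)"
      by (simp_all add: infsum_cmult_right' mult.assoc mult.left_commute)
    show "star bounded_ops (M \<otimes>\<^bsub>bounded_ops\<^esub> N) = star bounded_ops N \<otimes>\<^bsub>bounded_ops\<^esub> star bounded_ops M"
      by (simp add: mult.commute flip: infsum_cnj)
    show "nrm bounded_ops (M \<oplus>\<^bsub>bounded_ops\<^esub> N) \<le> nrm bounded_ops M + nrm bounded_ops N"
      using op_norm_le[OF op_bound_add[OF op_bound_op_norm[OF b(1)] op_bound_op_norm[OF b(2)]]] by simp
    show "nrm bounded_ops (M \<otimes>\<^bsub>bounded_ops\<^esub> N) \<le> nrm bounded_ops M * nrm bounded_ops N"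
      using nm[OF b] by simp
  qed (auto simp: nz ns nc intro: op_bound_star op_bound_nonneg[OF op_bound_op_norm])
qed

interpretation bops: pre_cstar "bounded_ops :: 'i op cstar"
  by (rule pre_cstar_bounded_ops)

text \<open>If \<open>X\<^sup>* X + Y\<^sup>* Y = P\<^sup>* P\<close>, then \<open>\<parallel>X v\<parallel> \<le> \<parallel>P v\<parallel>\<close> for all \<open>v\<close>.\<close>

lemma op_norm_le_of_sum_squares:
  fixes X Y P :: "'i op"
  assumes "X \<in> carrier bounded_ops" "Y \<in> carrier bounded_ops" "P \<in> carrier bounded_ops"
    and eq: "star bounded_ops X \<otimes>\<^bsub>bounded_ops\<^esub> X \<oplus>\<^bsub>bounded_ops\<^esub> star bounded_ops Y \<otimes>\<^bsub>bounded_ops\<^esub> Y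
      = star bounded_ops P \<otimes>\<^bsub>bounded_ops\<^esub> P"
  shows "op_norm X \<le> op_norm P"
proof -
  obtain C D E where b: "op_bound X C" "op_bound Y D" "op_bound P E" using assms by auto
  have "op_bound X (op_norm P)"
  proof (rule op_boundI)
    show "0 \<le> op_norm P" by (rule op_bound_nonneg[OF op_bound_op_norm[OF b(3)]])
    fix F G :: "'i set" and w :: "'i \<Rightarrow> complex" assume F: "finite F" and G: "finite G"
    let ?n = "\<lambda>X i. (cmod (\<Sum>k\<in>G. X i k * w k))\<^sup>2"
    note q = bounded_ops_form_star_self[OF _ G, of _ _ w]
    have pt: "(\<Sum>\<^sub>\<infinity>i. cnj (X i j) * X i k) + (\<Sum>\<^sub>\<infinity>i. cnj (Y i j) * Y i k) = (\<Sum>\<^sub>\<infinity>i. cnj (P i j) * P i k)" for j k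
      using fun_cong[OF fun_cong[OF eq]] by simp
    have "complex_of_real (infsum (?n P) UNIV) =
        (\<Sum>j\<in>G. \<Sum>k\<in>G. cnj (w j) * ((\<Sum>\<^sub>\<infinity>i. cnj (X i j) * X i k) + (\<Sum>\<^sub>\<infinity>i. cnj (Y i j) * Y i k)) * w k)"
      unfolding pt by (rule q(2)[OF b(3), symmetric])
    also have "\<dots> = complex_of_real (infsum (?n X) UNIV) + complex_of_real (infsum (?n Y) UNIV)"
      unfolding distrib_left distrib_right sum.distrib q(2)[OF b(1)] q(2)[OF b(2)] by (rule refl)
    finally have s: "infsum (?n P) UNIV = infsum (?n X) UNIV + infsum (?n Y) UNIV"
      unfolding of_real_add[symmetric] of_real_eq_iff .
    have "(\<Sum>i\<in>F. ?n X i) \<le> infsum (?n X) UNIV"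
      by (rule finite_sum_le_infsum[OF q(1)[OF b(1)] F]) auto
    also have "\<dots> \<le> infsum (?n P) UNIV" using infsum_nonneg[of UNIV "?n Y"] by (simp add: s)
    also have "\<dots> \<le> (op_norm P * L2_set (\<lambda>i. cmod (w i)) G)\<^sup>2"
    proof (rule infsum_le_finite_sums[OF q(1)[OF b(3)]])
      fix H :: "'i set" assume "finite H"
      from op_bound_apply[OF op_bound_op_norm[OF b(3)] this G, of w]
      show "sum (?n P) H \<le> (op_norm P * L2_set (\<lambda>i. cmod (w i)) G)\<^sup>2"
        using power_mono[of _ _ 2] by (fastforce simp: L2_set_sq[symmetric])
    qed
    finally show "L2_set (\<lambda>i. cmod (\<Sum>j\<in>G. X i j * w j)) F \<le> op_norm P * L2_set (\<lambda>i. cmod (w i)) G"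
      using op_bound_nonneg[OF op_bound_op_norm[OF b(3)]] by (simp add: L2_set_def[of _ F] real_le_lsqrt sum_nonneg)
  qed
  then show ?thesis by (rule op_norm_le)
qed

section \<open>Compressions and tensor products of operators\<close>

text \<open>
  The compression to the coordinates in \<open>b ` Y\<close>, relabelled by \<open>Y\<close> and extended by 0.
\<close>

definition compress :: "'y set \<Rightarrow> ('y \<Rightarrow> 'i) \<Rightarrow> 'i op \<Rightarrow> 'y op" where
  "compress Y b M = (\<lambda>x y. if x \<in> Y \<and> y \<in> Y then M (b x) (b y) else 0)"

lemma compress_form:
  assumes b: "inj_on b Y" and F: "finite F"
  defines "G \<equiv> b ` (F \<inter> Y)" and "r \<equiv> inv_into Y b"
  shows "(\<Sum>i\<in>F. \<Sum>j\<in>F. cnj (v i) * compress Y b M i j * w j) =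
      (\<Sum>i\<in>G. \<Sum>j\<in>G. cnj (v (r i)) * M i j * w (r j))"
    "L2_set (\<lambda>i. cmod (v (r i))) G \<le> L2_set (\<lambda>i. cmod (v i)) F"
proof -
  have inj: "inj_on b (F \<inter> Y)" using b by (rule inj_on_subset) auto
  have r: "r (b x) = x" if "x \<in> Y" for x using b that by (simp add: r_def)
  have "(\<Sum>i\<in>G. \<Sum>j\<in>G. cnj (v (r i)) * M i j * w (r j)) =
      (\<Sum>i\<in>F\<inter>Y. \<Sum>j\<in>F\<inter>Y. cnj (v i) * compress Y b M i j * w j)"
    unfolding G_def sum.reindex[OF inj] by (intro sum.cong refl) (auto simp: r compress_def)
  also have "\<dots> = (\<Sum>i\<in>F. \<Sum>j\<in>F\<inter>Y. cnj (v i) * compress Y b M i j * w j)"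
    using F by (intro sum.mono_neutral_left) (auto simp: compress_def)
  also have "\<dots> = (\<Sum>i\<in>F. \<Sum>j\<in>F. cnj (v i) * compress Y b M i j * w j)"
    using F by (intro sum.cong refl sum.mono_neutral_left) (auto simp: compress_def)
  finally show "(\<Sum>i\<in>F. \<Sum>j\<in>F. cnj (v i) * compress Y b M i j * w j) =
      (\<Sum>i\<in>G. \<Sum>j\<in>G. cnj (v (r i)) * M i j * w (r j))" ..
  have "L2_set (\<lambda>i. cmod (v (r i))) G = L2_set (\<lambda>i. cmod (v i)) (F \<inter> Y)"
    unfolding G_def L2_set_def sum.reindex[OF inj] by (intro arg_cong[of _ _ sqrt] sum.cong refl) (auto simp: r)
  also have "\<dots> \<le> L2_set (\<lambda>i. cmod (v i)) F"
    unfolding L2_set_def using F by (intro real_sqrt_le_mono sum_mono2) auto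
  finally show "L2_set (\<lambda>i. cmod (v (r i))) G \<le> L2_set (\<lambda>i. cmod (v i)) F" .
qed

lemma op_bound_compress:
  fixes b :: "'y \<Rightarrow> 'i"
  assumes M: "op_bound M C" and b: "inj_on b Y"
  shows "op_bound (compress Y b M) C"
  unfolding op_bound_def
proof (intro conjI allI impI)
  fix F :: "'y set" and v w :: "'y \<Rightarrow> complex" assume F: "finite F"
  let ?G = "b ` (F \<inter> Y)" and ?r = "inv_into Y b"
  have "cmod (\<Sum>i\<in>F. \<Sum>j\<in>F. cnj (v i) * compress Y b M i j * w j) \<le>
      C * L2_set (\<lambda>i. cmod (v (?r i))) ?G * L2_set (\<lambda>i. cmod (w (?r i))) ?G"
    unfolding compress_form(1)[OF b F] using F by (intro op_bound_rect[OF M]) auto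
  also have "\<dots> \<le> C * L2_set (\<lambda>i. cmod (v i)) F * L2_set (\<lambda>i. cmod (w i)) F"
    by (intro mult_mono mult_left_mono compress_form(2)[OF b F] op_bound_nonneg[OF M] mult_nonneg_nonneg L2_set_nonneg)
  finally show "cmod (\<Sum>i\<in>F. \<Sum>j\<in>F. cnj (v i) * compress Y b M i j * w j)
      \<le> C * L2_set (\<lambda>i. cmod (v i)) F * L2_set (\<lambda>i. cmod (w i)) F" .
qed (rule op_bound_nonneg[OF M])

lemma op_norm_reindex:
  assumes "bij f"
  shows "op_norm (\<lambda>x y. M (f x) (f y)) = op_norm M"
proof -
  have "op_bound (\<lambda>x y. M (f x) (f y)) C \<longleftrightarrow> op_bound M C" for C
  proof
    assume "op_bound M C"
    from op_bound_compress[OF this, of f UNIV] assms show "op_bound (\<lambda>x y. M (f x) (f y)) C"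
      by (simp add: compress_def bij_is_inj)
  next
    assume "op_bound (\<lambda>x y. M (f x) (f y)) C"
    from op_bound_compress[OF this, of "inv_into UNIV f" UNIV] assms show "op_bound M C"
      by (simp add: compress_def surj_f_inv_f bij_is_surj bij_is_inj bij_imp_bij_inv)
  qed
  then show ?thesis by (simp add: op_norm_def)
qed

definition kron :: "'i op \<Rightarrow> 'j op \<Rightarrow> ('i \<times> 'j) op" where
  "kron S T = (\<lambda>(i, j) (i', j'). S i i' * T j j')"

text \<open>
  \<open>S \<otimes> 1\<close> acts as \<open>S\<close> on each slice with fixed second coordinate.
\<close>

lemma op_bound_kron_one:
  assumes S: "op_bound S C"
  shows "op_bound (kron S (\<lambda>i j. if i = j then 1 else 0)) C"
proof (rule op_boundI[OF op_bound_nonneg[OF S]])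
  fix F G :: "('a \<times> 'b) set" and w :: "'a \<times> 'b \<Rightarrow> complex"
  assume FG: "finite F" "finite G"
  let ?K = "kron S (\<lambda>i j. if i = j then 1 else 0)" and ?H = "F \<union> G"
  let ?I = "fst ` (F \<union> G)" and ?J = "snd ` (F \<union> G)" and ?w = "\<lambda>x. if x \<in> G then w x else 0"
  have fin: "finite ?I" "finite ?J" using FG by auto
  have sub: "x \<in> ?I \<times> ?J" if "x \<in> F \<union> G" for x
    using that by (cases x) (auto intro: rev_image_eqI)
  have ap: "(\<Sum>y\<in>G. ?K (i, j) y * w y) = (\<Sum>k\<in>?I. S i k * ?w (k, j))" if "j \<in> ?J" for i j
  proof -
    have "(\<Sum>y\<in>G. ?K (i, j) y * w y) = (\<Sum>y\<in>?I\<times>?J. ?K (i, j) y * ?w y)"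
      using sub fin by (intro sum.mono_neutral_cong_left) auto
    also have "\<dots> = (\<Sum>k\<in>?I. \<Sum>l\<in>?J. if j = l then S i k * ?w (k, l) else 0)"
      unfolding sum.cartesian_product by (intro sum.cong refl) (auto simp: kron_def)
    also have "\<dots> = (\<Sum>k\<in>?I. S i k * ?w (k, j))"
      using fin that by (simp add: sum.delta')
    finally show ?thesis .
  qed
  have "(L2_set (\<lambda>x. cmod (\<Sum>y\<in>G. ?K x y * w y)) F)\<^sup>2 \<le> (\<Sum>x\<in>?I\<times>?J. (cmod (\<Sum>y\<in>G. ?K x y * w y))\<^sup>2)"
    unfolding L2_set_sq using sub fin by (intro sum_mono2) auto
  also have "\<dots> = (\<Sum>j\<in>?J. \<Sum>i\<in>?I. (cmod (\<Sum>y\<in>G. ?K (i, j) y * w y))\<^sup>2)"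
    by (subst sum.swap) (simp add: sum.cartesian_product)
  also have "\<dots> = (\<Sum>j\<in>?J. (L2_set (\<lambda>i. cmod (\<Sum>k\<in>?I. S i k * ?w (k, j))) ?I)\<^sup>2)"
    unfolding L2_set_sq by (intro sum.cong refl arg_cong[of _ _ "\<lambda>z. (cmod z)\<^sup>2"] ap)
  also have "\<dots> \<le> (\<Sum>j\<in>?J. (C * L2_set (\<lambda>k. cmod (?w (k, j))) ?I)\<^sup>2)"
    by (intro sum_mono power_mono op_bound_apply[OF S] fin L2_set_nonneg)
  also have "\<dots> = C\<^sup>2 * (\<Sum>j\<in>?J. \<Sum>k\<in>?I. (cmod (?w (k, j)))\<^sup>2)"
    unfolding power_mult_distrib L2_set_sq by (simp only: sum_distrib_left)
  also have "(\<Sum>j\<in>?J. \<Sum>k\<in>?I. (cmod (?w (k, j)))\<^sup>2) = (\<Sum>x\<in>?I\<times>?J. (cmod (?w x))\<^sup>2)"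
    by (subst sum.swap) (simp add: sum.cartesian_product)
  also have "\<dots> = (L2_set (\<lambda>x. cmod (w x)) G)\<^sup>2"
    unfolding L2_set_sq using sub fin by (intro sum.mono_neutral_cong_right) auto
  also have "C\<^sup>2 * \<dots> = (C * L2_set (\<lambda>x. cmod (w x)) G)\<^sup>2" by (rule power_mult_distrib[symmetric])
  finally show "L2_set (\<lambda>x. cmod (\<Sum>y\<in>G. ?K x y * w y)) F \<le> C * L2_set (\<lambda>x. cmod (w x)) G"
    by (rule power2_le_imp_le) (intro mult_nonneg_nonneg L2_set_nonneg op_bound_nonneg[OF S])
qed

lemma op_bound_one_kron:
  assumes T: "op_bound T C"
  shows "op_bound (kron (\<lambda>i j. if i = j then 1 else 0) T) C"
proof -
  have eq: "kron (\<lambda>i j. if i = j then 1 else 0) T =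
      compress UNIV prod.swap (kron T (\<lambda>i j. if i = j then 1 else 0))"
    by (auto simp: kron_def compress_def fun_eq_iff)
  show ?thesis unfolding eq by (rule op_bound_compress[OF op_bound_kron_one[OF T]]) simp
qed

text \<open>
  \<open>(S \<otimes> 1)(1 \<otimes> T) = S \<otimes> T\<close>, the inner sum having a single nonzero term.
\<close>

lemma kron_split:
  fixes S :: "'i op" and T :: "'j op"
  shows "(\<lambda>x z. \<Sum>\<^sub>\<infinity>y. kron S (\<lambda>i j. if i = j then 1 else 0) x y * kron (\<lambda>i j. if i = j then 1 else 0) T y z) = kron S T"
proof (intro ext)
  fix x z :: "'i \<times> 'j"
  obtain i j i' j' where x: "x = (i, j)" and z: "z = (i', j')" by (cases x, cases z)
  show "(\<Sum>\<^sub>\<infinity>y. kron S (\<lambda>i j. if i = j then 1 else 0) x y * kron (\<lambda>i j. if i = j then 1 else 0) T y z) = kron S T x z"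
    by (subst infsum_single_point[of "(i', j)"]) (auto simp: kron_def x z split: if_splits)
qed

lemma op_bound_kron: "op_bound S C \<Longrightarrow> op_bound T D \<Longrightarrow> op_bound (kron S T) (C * D)"
  using op_bound_mult[OF op_bound_kron_one op_bound_one_kron, of S C T D] by (simp only: kron_split)

lemma kron_closed [simp]:
  "S \<in> carrier bounded_ops \<Longrightarrow> T \<in> carrier bounded_ops \<Longrightarrow> kron S T \<in> carrier bounded_ops"
  by (auto intro: op_bound_kron)

lemma op_norm_kron_le:
  "S \<in> carrier bounded_ops \<Longrightarrow> T \<in> carrier bounded_ops \<Longrightarrow> op_norm (kron S T) \<le> op_norm S * op_norm T"
  by (auto intro: op_norm_le op_bound_kron op_bound_op_norm)

lemma kron_mult:
  assumes "S \<in> carrier bounded_ops" "T \<in> carrier bounded_ops" "S' \<in> carrier bounded_ops" "T' \<in> carrier bounded_ops"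
  shows "kron S T \<otimes>\<^bsub>bounded_ops\<^esub> kron S' T' = kron (S \<otimes>\<^bsub>bounded_ops\<^esub> S') (T \<otimes>\<^bsub>bounded_ops\<^esub> T')"
proof -
  obtain C D C' D' where b: "op_bound S C" "op_bound T D" "op_bound S' C'" "op_bound T' D'"
    using assms by auto
  have "(\<Sum>\<^sub>\<infinity>y. kron S T (i, j) y * kron S' T' y (k, l)) =
      (\<Sum>\<^sub>\<infinity>m. S i m * S' m k) * (\<Sum>\<^sub>\<infinity>n. T j n * T' n l)" for i j k l
  proof -
    have "(\<Sum>\<^sub>\<infinity>y. kron S T (i, j) y * kron S' T' y (k, l)) =
        (\<Sum>\<^sub>\<infinity>(m, n). (S i m * S' m k) * (T j n * T' n l))"
      by (rule infsum_cong) (auto simp: kron_def)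
    also have "\<dots> = (\<Sum>\<^sub>\<infinity>m. S i m * S' m k) * (\<Sum>\<^sub>\<infinity>n. T j n * T' n l)"
      by (intro infsum_product l2b_pair_summable[OF op_bound_row[OF b(1)] op_bound_col[OF b(3)]]
          l2b_pair_summable[OF op_bound_row[OF b(2)] op_bound_col[OF b(4)]])
    finally show ?thesis .
  qed
  then show ?thesis by (auto simp: fun_eq_iff kron_def[of "\<lambda>i k. \<Sum>\<^sub>\<infinity>j. S i j * S' j k"])
qed

lemma kron_star: "star bounded_ops (kron S T) = kron (star bounded_ops S) (star bounded_ops T)"
  by (auto simp: kron_def fun_eq_iff)

lemma kron_zero [simp]: "kron \<zero>\<^bsub>bounded_ops\<^esub> T = \<zero>\<^bsub>bounded_ops\<^esub>" "kron S \<zero>\<^bsub>bounded_ops\<^esub> = \<zero>\<^bsub>bounded_ops\<^esub>"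
  by (auto simp: kron_def fun_eq_iff)

lemma kron_add: "kron (S \<oplus>\<^bsub>bounded_ops\<^esub> S') T = kron S T \<oplus>\<^bsub>bounded_ops\<^esub> kron S' T"
  "kron S (T \<oplus>\<^bsub>bounded_ops\<^esub> T') = kron S T \<oplus>\<^bsub>bounded_ops\<^esub> kron S T'"
  by (auto simp: kron_def fun_eq_iff algebra_simps)

lemma kron_smult: "kron (c \<odot>\<^bsub>bounded_ops\<^esub> S) T = c \<odot>\<^bsub>bounded_ops\<^esub> kron S T"
  "kron S (c \<odot>\<^bsub>bounded_ops\<^esub> T) = c \<odot>\<^bsub>bounded_ops\<^esub> kron S T"
  by (auto simp: kron_def fun_eq_iff algebra_simps)

lemma nrm_bounded_ops: "nrm bounded_ops M = op_norm M"
  by simp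

declare bounded_ops_sel [simp del]

section \<open>Completions of seminormed *-algebras\<close>

text \<open>
  The image of the unit under a representation that may be degenerate is a projection \<open>P\<close>; the
  representation is unital as a map to the corner \<open>P A P\<close>, whose unit is \<open>P\<close>.
\<close>

definition corner :: "('a, 'm) cstar_scheme \<Rightarrow> 'a \<Rightarrow> ('a, 'm) cstar_scheme" where
  "corner A P = A\<lparr>carrier := {x \<in> carrier A. P \<otimes>\<^bsub>A\<^esub> x = x \<and> x \<otimes>\<^bsub>A\<^esub> P = x}, one := P\<rparr>"

lemma corner_sel [simp]:
  "x \<in> carrier (corner A P) \<longleftrightarrow> x \<in> carrier A \<and> P \<otimes>\<^bsub>A\<^esub> x = x \<and> x \<otimes>\<^bsub>A\<^esub> P = x"
  "mult (corner A P) = mult A" "one (corner A P) = P" "zero (corner A P) = zero A"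
  "add (corner A P) = add A" "smult (corner A P) = smult A" "star (corner A P) = star A"
  "nrm (corner A P) = nrm A"
  by (auto simp: corner_def)

lemma (in pre_cstar) pre_cstar_corner:
  assumes P: "P \<in> carrier A" "P \<otimes> P = P" "star A P = P"
  shows "pre_cstar (corner A P)"
proof -
  have ag: "abelian_group (corner A P)"
  proof (rule abelian_groupI)
    fix x assume "x \<in> carrier (corner A P)"
    then show "\<exists>y\<in>carrier (corner A P). y \<oplus>\<^bsub>corner A P\<^esub> x = \<zero>\<^bsub>corner A P\<^esub>"
      using P by (intro bexI[of _ "\<ominus> x"]) (auto simp: l_neg l_minus r_minus)
  qed (use P in \<open>auto simp: a_assoc l_distr r_distr intro: a_comm\<close>)
  have st: "star A x = P \<otimes> star A x" "star A x = star A x \<otimes> P"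
    if "x \<in> carrier A" "P \<otimes> x = x" "x \<otimes> P = x" for x
    using star_mult[of P x] star_mult[of x P] that P by simp_all
  have mo: "Group.monoid (corner A P)"
    by (rule monoidI) (use P in \<open>auto simp: m_assoc, metis m_assoc\<close>)
  have ri: "ring (corner A P)"
    using ag mo by (rule ringI) (auto simp: l_distr r_distr)
  have mod: "Module.module complex_cstar (corner A P)"
    by (rule moduleI[OF cring_complex ag])
      (use P in \<open>auto simp: smult_mult_left smult_mult_right sm_ladd sm_radd sm_assoc\<close>)
  show ?thesis
    unfolding pre_cstar_def pre_cstar_axioms_def using ri mod P
    by (auto simp: smult_mult_left smult_mult_right star_add star_smult star_mult nrm_eq_zero nrm_add
        nrm_smult nrm_mult nrm_star_self dest: st(1)[symmetric] st(2)[symmetric])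
qed

lemma squeeze_zero:
  fixes f g :: "nat \<Rightarrow> real"
  assumes "g \<longlonglongrightarrow> 0" "\<And>n. f n \<le> g n" "\<And>n. 0 \<le> f n"
  shows "f \<longlonglongrightarrow> 0"
  by (rule tendsto_sandwich[OF _ _ tendsto_const assms(1)]) (use assms in auto)

text \<open>
  Formal expressions satisfy the laws of a *-algebra only after an application of the maps in
  \<open>\<Phi>\<close>. The two laws for the unit allow maps that send it to a projection different from 1.
\<close>

locale raw_cstar = B: pre_cstar B for B :: "('b, 'k) cstar_scheme" +
  fixes F :: "('x, 'm) cstar_scheme" and \<Phi> :: "('x \<Rightarrow> 'b) set"
  assumes one_in [simp]: "\<one>\<^bsub>F\<^esub> \<in> carrier F" and zero_in [simp]: "\<zero>\<^bsub>F\<^esub> \<in> carrier F"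
    and add_in [simp]: "\<lbrakk>x \<in> carrier F; y \<in> carrier F\<rbrakk> \<Longrightarrow> x \<oplus>\<^bsub>F\<^esub> y \<in> carrier F"
    and mult_in [simp]: "\<lbrakk>x \<in> carrier F; y \<in> carrier F\<rbrakk> \<Longrightarrow> x \<otimes>\<^bsub>F\<^esub> y \<in> carrier F"
    and smult_in [simp]: "x \<in> carrier F \<Longrightarrow> c \<odot>\<^bsub>F\<^esub> x \<in> carrier F"
    and star_in [simp]: "x \<in> carrier F \<Longrightarrow> star F x \<in> carrier F"
    and \<Phi>_ne: "\<Phi> \<noteq> {}"
    and \<Phi>_in [simp]: "\<lbrakk>\<phi> \<in> \<Phi>; x \<in> carrier F\<rbrakk> \<Longrightarrow> \<phi> x \<in> carrier B"
    and \<Phi>_add [simp]: "\<lbrakk>\<phi> \<in> \<Phi>; x \<in> carrier F; y \<in> carrier F\<rbrakk> \<Longrightarrow> \<phi> (x \<oplus>\<^bsub>F\<^esub> y) = \<phi> x \<oplus>\<^bsub>B\<^esub> \<phi> y"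
    and \<Phi>_mult [simp]: "\<lbrakk>\<phi> \<in> \<Phi>; x \<in> carrier F; y \<in> carrier F\<rbrakk> \<Longrightarrow> \<phi> (x \<otimes>\<^bsub>F\<^esub> y) = \<phi> x \<otimes>\<^bsub>B\<^esub> \<phi> y"
    and \<Phi>_smult [simp]: "\<lbrakk>\<phi> \<in> \<Phi>; x \<in> carrier F\<rbrakk> \<Longrightarrow> \<phi> (c \<odot>\<^bsub>F\<^esub> x) = c \<odot>\<^bsub>B\<^esub> \<phi> x"
    and \<Phi>_star [simp]: "\<lbrakk>\<phi> \<in> \<Phi>; x \<in> carrier F\<rbrakk> \<Longrightarrow> \<phi> (star F x) = star B (\<phi> x)"
    and \<Phi>_zero [simp]: "\<phi> \<in> \<Phi> \<Longrightarrow> \<phi> \<zero>\<^bsub>F\<^esub> = \<zero>\<^bsub>B\<^esub>"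
    and \<Phi>_one_left [simp]: "\<lbrakk>\<phi> \<in> \<Phi>; x \<in> carrier F\<rbrakk> \<Longrightarrow> \<phi> \<one>\<^bsub>F\<^esub> \<otimes>\<^bsub>B\<^esub> \<phi> x = \<phi> x"
    and \<Phi>_one_right [simp]: "\<lbrakk>\<phi> \<in> \<Phi>; x \<in> carrier F\<rbrakk> \<Longrightarrow> \<phi> x \<otimes>\<^bsub>B\<^esub> \<phi> \<one>\<^bsub>F\<^esub> = \<phi> x"
    and nrm_sup: "x \<in> carrier F \<Longrightarrow> nrm F x = (SUP \<phi>\<in>\<Phi>. nrm B (\<phi> x))"
    and nrm_bdd: "x \<in> carrier F \<Longrightarrow> bdd_above ((\<lambda>\<phi>. nrm B (\<phi> x)) ` \<Phi>)"
begin

lemma nrm_ge: "\<lbrakk>x \<in> carrier F; \<phi> \<in> \<Phi>\<rbrakk> \<Longrightarrow> nrm B (\<phi> x) \<le> nrm F x"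
  unfolding nrm_sup by (rule cSUP_upper[OF _ nrm_bdd])

lemma nrm_le: "\<lbrakk>x \<in> carrier F; \<And>\<phi>. \<phi> \<in> \<Phi> \<Longrightarrow> nrm B (\<phi> x) \<le> C\<rbrakk> \<Longrightarrow> nrm F x \<le> C"
  unfolding nrm_sup by (rule cSUP_least[OF \<Phi>_ne])

lemma nrm_F_nonneg [simp]: "x \<in> carrier F \<Longrightarrow> 0 \<le> nrm F x"
  using \<Phi>_ne nrm_ge[of x] by (metis B.nrm_nonneg \<Phi>_in equals0I order_trans)

lemma \<Phi>_dst: "\<lbrakk>\<phi> \<in> \<Phi>; x \<in> carrier F; y \<in> carrier F\<rbrakk> \<Longrightarrow> nrm B (\<phi> (x \<oplus>\<^bsub>F\<^esub> (-1) \<odot>\<^bsub>F\<^esub> y)) = dst B (\<phi> x) (\<phi> y)"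
  by (simp add: dst_def)

lemma dst_ge: "\<lbrakk>x \<in> carrier F; y \<in> carrier F; \<phi> \<in> \<Phi>\<rbrakk> \<Longrightarrow> dst B (\<phi> x) (\<phi> y) \<le> dst F x y"
  using nrm_ge[of "x \<oplus>\<^bsub>F\<^esub> (-1) \<odot>\<^bsub>F\<^esub> y" \<phi>] by (simp add: dst_def)

lemma dst_le: "\<lbrakk>x \<in> carrier F; y \<in> carrier F; \<And>\<phi>. \<phi> \<in> \<Phi> \<Longrightarrow> dst B (\<phi> x) (\<phi> y) \<le> C\<rbrakk> \<Longrightarrow> dst F x y \<le> C"
  using nrm_le[of "x \<oplus>\<^bsub>F\<^esub> (-1) \<odot>\<^bsub>F\<^esub> y" C] by (simp add: dst_def)

lemma dst_F_nonneg [simp]: "\<lbrakk>x \<in> carrier F; y \<in> carrier F\<rbrakk> \<Longrightarrow> 0 \<le> dst F x y"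
  by (simp add: dst_def)

lemma dst_null: "\<lbrakk>x \<in> carrier F; y \<in> carrier F; \<And>\<phi>. \<phi> \<in> \<Phi> \<Longrightarrow> \<phi> x = \<phi> y\<rbrakk> \<Longrightarrow> dst F x y = 0"
proof (rule antisym[OF dst_le])
  fix \<phi> assume "x \<in> carrier F" "y \<in> carrier F" "\<And>\<phi>. \<phi> \<in> \<Phi> \<Longrightarrow> \<phi> x = \<phi> y" "\<phi> \<in> \<Phi>"
  then show "dst B (\<phi> x) (\<phi> y) \<le> 0" using B.dst_self[of "\<phi> y"] by (metis \<Phi>_in order_refl)
qed simp_all

lemma dst_F_sym: "\<lbrakk>x \<in> carrier F; y \<in> carrier F\<rbrakk> \<Longrightarrow> dst F x y = dst F y x"
proof -
  have *: "dst F x y \<le> dst F y x" if xy: "x \<in> carrier F" "y \<in> carrier F" for x y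
  proof (rule dst_le[OF xy])
    fix \<phi> assume "\<phi> \<in> \<Phi>"
    then show "dst B (\<phi> x) (\<phi> y) \<le> dst F y x"
      using dst_ge[of y x \<phi>] B.dst_sym[of "\<phi> x" "\<phi> y"] xy by simp
  qed
  assume "x \<in> carrier F" "y \<in> carrier F"
  with *[of x y] *[of y x] show ?thesis by simp
qed

lemma dst_F_triangle: "\<lbrakk>x \<in> carrier F; y \<in> carrier F; z \<in> carrier F\<rbrakk> \<Longrightarrow> dst F x z \<le> dst F x y + dst F y z"
proof (rule dst_le)
  fix \<phi> assume "x \<in> carrier F" "y \<in> carrier F" "z \<in> carrier F" "\<phi> \<in> \<Phi>"
  then show "dst B (\<phi> x) (\<phi> z) \<le> dst F x y + dst F y z"
    using B.dst_triangle[of "\<phi> x" "\<phi> y" "\<phi> z"] dst_ge[of x y \<phi>] dst_ge[of y z \<phi>] by simp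
qed

lemma dst_F_add:
  "\<lbrakk>x \<in> carrier F; y \<in> carrier F; x' \<in> carrier F; y' \<in> carrier F\<rbrakk> \<Longrightarrow>
    dst F (x \<oplus>\<^bsub>F\<^esub> y) (x' \<oplus>\<^bsub>F\<^esub> y') \<le> dst F x x' + dst F y y'"
  by (rule dst_le) (auto intro!: order_trans[OF B.dst_add add_mono] dst_ge)

lemma dst_F_mult:
  assumes "x \<in> carrier F" "y \<in> carrier F" "x' \<in> carrier F" "y' \<in> carrier F"
  shows "dst F (x \<otimes>\<^bsub>F\<^esub> y) (x' \<otimes>\<^bsub>F\<^esub> y') \<le> nrm F x * dst F y y' + dst F x x' * nrm F y'"
  using assms by (intro dst_le) (auto intro!: order_trans[OF B.dst_mult add_mono] mult_mono dst_ge nrm_ge)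

lemma dst_F_smult:
  "\<lbrakk>x \<in> carrier F; y \<in> carrier F\<rbrakk> \<Longrightarrow> dst F (c \<odot>\<^bsub>F\<^esub> x) (c \<odot>\<^bsub>F\<^esub> y) \<le> cmod c * dst F x y"
  by (rule dst_le) (auto simp: B.dst_smult intro!: mult_left_mono dst_ge)

lemma dst_F_star:
  "\<lbrakk>x \<in> carrier F; y \<in> carrier F\<rbrakk> \<Longrightarrow> dst F (star F x) (star F y) \<le> dst F x y"
  by (rule dst_le) (auto simp: B.dst_star intro!: dst_ge)

lemma nrm_F_diff: "\<lbrakk>x \<in> carrier F; y \<in> carrier F\<rbrakk> \<Longrightarrow> \<bar>nrm F x - nrm F y\<bar> \<le> dst F x y"
proof -
  have *: "nrm F x \<le> nrm F y + dst F x y" if "x \<in> carrier F" "y \<in> carrier F" for x y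
  proof (rule nrm_le[OF that(1)])
    fix \<phi> assume \<phi>: "\<phi> \<in> \<Phi>"
    show "nrm B (\<phi> x) \<le> nrm F y + dst F x y"
      using B.nrm_diff_le[of "\<phi> x" "\<phi> y"] nrm_ge[OF that(2) \<phi>] dst_ge[OF that \<phi>] \<phi> that by simp
  qed
  assume "x \<in> carrier F" "y \<in> carrier F"
  with *[of x y] *[of y x] dst_F_sym[of x y] show ?thesis by simp
qed

lemma nrm_F_star_self: "x \<in> carrier F \<Longrightarrow> nrm F (star F x \<otimes>\<^bsub>F\<^esub> x) = (nrm F x)\<^sup>2"
proof (rule antisym)
  assume x: "x \<in> carrier F"
  then show "nrm F (star F x \<otimes>\<^bsub>F\<^esub> x) \<le> (nrm F x)\<^sup>2"
    by (intro nrm_le) (auto simp: B.nrm_star_self intro!: power_mono nrm_ge)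
  have "nrm F x \<le> sqrt (nrm F (star F x \<otimes>\<^bsub>F\<^esub> x))"
  proof (rule nrm_le[OF x])
    fix \<phi> assume \<phi>: "\<phi> \<in> \<Phi>"
    with x have "(nrm B (\<phi> x))\<^sup>2 \<le> nrm F (star F x \<otimes>\<^bsub>F\<^esub> x)"
      using nrm_ge[of "star F x \<otimes>\<^bsub>F\<^esub> x" \<phi>] by (simp add: B.nrm_star_self)
    then show "nrm B (\<phi> x) \<le> sqrt (nrm F (star F x \<otimes>\<^bsub>F\<^esub> x))" by (rule real_le_rsqrt)
  qed
  from power_mono[OF this nrm_F_nonneg[OF x], of 2] x
  show "(nrm F x)\<^sup>2 \<le> nrm F (star F x \<otimes>\<^bsub>F\<^esub> x)" by simp
qed

abbreviation "cc \<equiv> cauchy_class F"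

lemma cauchy_in [simp]: "cauchy_seq F x \<Longrightarrow> x n \<in> carrier F"
  by (simp add: cauchy_seq_def)

lemma cauchy_const [simp]: "a \<in> carrier F \<Longrightarrow> cauchy_seq F (\<lambda>n. a)"
  by (simp add: cauchy_seq_def dst_null)

lemma cauchy_bounded:
  assumes "cauchy_seq F x"
  obtains K where "0 \<le> K" "\<And>n. nrm F (x n) \<le> K"
proof -
  from assms obtain N where N: "\<And>m n. m \<ge> N \<Longrightarrow> n \<ge> N \<Longrightarrow> dst F (x m) (x n) < 1"
    unfolding cauchy_seq_def by (metis zero_less_one)
  define K where "K = Max ((\<lambda>n. nrm F (x n)) ` {..N}) + 1"
  have 1: "nrm F (x n) \<le> K - 1" if "n \<le> N" for n
    unfolding K_def using that by (auto intro: Max_ge)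
  have "nrm F (x n) \<le> K" for n
  proof (cases "n \<le> N")
    case False
    then show ?thesis using nrm_F_diff[of "x n" "x N"] N[of n N] 1[of N] assms by fastforce
  qed (use 1 in fastforce)
  moreover from this[of 0] have "0 \<le> K" using nrm_F_nonneg[OF cauchy_in[OF assms]] order_trans by blast
  ultimately show thesis using that by blast
qed

lemma cauchyI:
  assumes "\<And>n. y n \<in> carrier F" and "\<And>m n. dst F (y m) (y n) \<le> d m n"
    and "\<And>e. 0 < e \<Longrightarrow> \<exists>N. \<forall>m\<ge>N. \<forall>n\<ge>N. d m n < (e::real)"
  shows "cauchy_seq F y"
  unfolding cauchy_seq_def using assms by (meson le_less_trans)

lemma cauchy_dst: "cauchy_seq F x \<Longrightarrow> 0 < e \<Longrightarrow> \<exists>N. \<forall>m\<ge>N. \<forall>n\<ge>N. dst F (x m) (x n) < e"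
  by (simp add: cauchy_seq_def)

lemma cauchy_lin_comb:
  assumes "cauchy_seq F x" "cauchy_seq F y" "0 \<le> a" "0 \<le> b"
    and "\<And>n. z n \<in> carrier F"
    and "\<And>m n. dst F (z m) (z n) \<le> a * dst F (x m) (x n) + b * dst F (y m) (y n)"
  shows "cauchy_seq F z"
proof (rule cauchyI[OF assms(5,6)])
  fix e :: real assume e: "0 < e"
  define d where "d = e / (a + b + 1)"
  have d: "0 < d" "(a + b) * d < e" using e assms(3,4) by (simp_all add: d_def field_simps)
  obtain N1 N2 where N: "\<forall>m\<ge>N1. \<forall>n\<ge>N1. dst F (x m) (x n) < d" "\<forall>m\<ge>N2. \<forall>n\<ge>N2. dst F (y m) (y n) < d"
    using cauchy_dst[OF assms(1) d(1)] cauchy_dst[OF assms(2) d(1)] by auto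
  have "a * dst F (x m) (x n) + b * dst F (y m) (y n) < e" if "m \<ge> max N1 N2" "n \<ge> max N1 N2" for m n
  proof -
    have "a * dst F (x m) (x n) + b * dst F (y m) (y n) \<le> a * d + b * d"
      using N that assms(3,4) by (intro add_mono mult_left_mono) (auto intro: less_imp_le)
    with d(2) show ?thesis by (simp add: algebra_simps)
  qed
  then show "\<exists>N. \<forall>m\<ge>N. \<forall>n\<ge>N. a * dst F (x m) (x n) + b * dst F (y m) (y n) < e" by blast
qed

lemma cauchy_add [simp]: "\<lbrakk>cauchy_seq F x; cauchy_seq F y\<rbrakk> \<Longrightarrow> cauchy_seq F (\<lambda>n. x n \<oplus>\<^bsub>F\<^esub> y n)"
  by (rule cauchy_lin_comb[of x y 1 1]) (simp_all add: dst_F_add)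

lemma cauchy_smult [simp]: "cauchy_seq F x \<Longrightarrow> cauchy_seq F (\<lambda>n. c \<odot>\<^bsub>F\<^esub> x n)"
  by (rule cauchy_lin_comb[of x x "cmod c" 0]) (simp_all add: dst_F_smult)

lemma cauchy_star [simp]: "cauchy_seq F x \<Longrightarrow> cauchy_seq F (\<lambda>n. star F (x n))"
  by (rule cauchy_lin_comb[of x x 1 0]) (simp_all add: dst_F_star)

lemma cauchy_mult [simp]: 
  assumes x: "cauchy_seq F x" and y: "cauchy_seq F y"
  shows "cauchy_seq F (\<lambda>n. x n \<otimes>\<^bsub>F\<^esub> y n)"
proof -
  obtain K L where K: "0 \<le> K" "\<And>n. nrm F (x n) \<le> K" and L: "0 \<le> L" "\<And>n. nrm F (y n) \<le> L"
    using cauchy_bounded[OF x] cauchy_bounded[OF y] by metis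
  show ?thesis
  proof (rule cauchy_lin_comb[OF x y L(1) K(1)])
    fix m n
    have "dst F (x m \<otimes>\<^bsub>F\<^esub> y m) (x n \<otimes>\<^bsub>F\<^esub> y n) \<le> nrm F (x m) * dst F (y m) (y n) + dst F (x m) (x n) * nrm F (y n)"
      using x y by (simp add: dst_F_mult)
    also have "\<dots> \<le> K * dst F (y m) (y n) + dst F (x m) (x n) * L"
      using x y K L by (intro add_mono mult_mono) simp_all
    finally show "dst F (x m \<otimes>\<^bsub>F\<^esub> y m) (x n \<otimes>\<^bsub>F\<^esub> y n) \<le> L * dst F (x m) (x n) + K * dst F (y m) (y n)"
      by (simp add: algebra_simps)
  qed (use x y in simp)
qed

lemma cc_mem: "y \<in> cc x \<longleftrightarrow> cauchy_seq F y \<and> (\<lambda>n. dst F (x n) (y n)) \<longlonglongrightarrow> 0"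
  by (simp add: cauchy_class_def)

lemma eqv_trans:
  assumes "cauchy_seq F x" "cauchy_seq F y" "cauchy_seq F z"
    and "(\<lambda>n. dst F (x n) (y n)) \<longlonglongrightarrow> 0" "(\<lambda>n. dst F (y n) (z n)) \<longlonglongrightarrow> 0"
  shows "(\<lambda>n. dst F (x n) (z n)) \<longlonglongrightarrow> 0"
  by (rule squeeze_zero[OF tendsto_add[OF assms(4,5), simplified]]) (use assms in \<open>auto simp: dst_F_triangle\<close>)

lemma eqv_sym:
  "\<lbrakk>cauchy_seq F x; cauchy_seq F y; (\<lambda>n. dst F (x n) (y n)) \<longlonglongrightarrow> 0\<rbrakk> \<Longrightarrow> (\<lambda>n. dst F (y n) (x n)) \<longlonglongrightarrow> 0"
proof -
  assume *: "cauchy_seq F x" "cauchy_seq F y" "(\<lambda>n. dst F (x n) (y n)) \<longlonglongrightarrow> 0"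
  have "(\<lambda>n. dst F (y n) (x n)) = (\<lambda>n. dst F (x n) (y n))"
    by (rule ext, rule dst_F_sym[OF cauchy_in[OF *(2)] cauchy_in[OF *(1)]])
  with *(3) show ?thesis by (simp only:)
qed

lemma cc_self [simp]: "cauchy_seq F x \<Longrightarrow> x \<in> cc x"
  by (simp add: cc_mem dst_null)

lemma cc_eq_iff:
  assumes "cauchy_seq F x" "cauchy_seq F y"
  shows "cc x = cc y \<longleftrightarrow> (\<lambda>n. dst F (x n) (y n)) \<longlonglongrightarrow> 0"
proof
  assume "cc x = cc y"
  then have "y \<in> cc x" using assms by simp
  then show "(\<lambda>n. dst F (x n) (y n)) \<longlonglongrightarrow> 0" by (simp add: cc_mem)
next
  assume "(\<lambda>n. dst F (x n) (y n)) \<longlonglongrightarrow> 0"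
  note e = this
  note e' = eqv_sym[OF assms e]
  show "cc x = cc y"
  proof (rule Set.set_eqI, rule iffI)
    fix z assume "z \<in> cc x"
    then show "z \<in> cc y" unfolding cc_mem using eqv_trans[OF assms(2,1) _ e'] by blast
  next
    fix z assume "z \<in> cc y"
    then show "z \<in> cc x" unfolding cc_mem using eqv_trans[OF assms(1,2) _ e] by blast
  qed
qed

lemma cc_memE: "\<lbrakk>cauchy_seq F x; y \<in> cc x\<rbrakk> \<Longrightarrow> cauchy_seq F y \<and> cc y = cc x"
  using cc_eq_iff[of x y] by (auto simp: cc_mem)

lemma cc_null:
  assumes "cauchy_seq F x" "cauchy_seq F y" "\<And>n \<phi>. \<phi> \<in> \<Phi> \<Longrightarrow> \<phi> (x n) = \<phi> (y n)"
  shows "cc x = cc y"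
  using assms by (simp add: cc_eq_iff dst_null)

abbreviation "\<A> \<equiv> completion F"

lemma carrier_completion: "X \<in> carrier \<A> \<longleftrightarrow> (\<exists>x. cauchy_seq F x \<and> X = cc x)"
  by (auto simp: completion_def)

lemma cc_in [simp]: "cauchy_seq F x \<Longrightarrow> cc x \<in> carrier \<A>"
  by (auto simp: carrier_completion)

lemma carrier_completionE:
  assumes "X \<in> carrier \<A>"
  obtains x where "cauchy_seq F x" "X = cc x"
  using assms by (auto simp: carrier_completion)

lemma UN_cc:
  assumes x: "cauchy_seq F x" and "\<And>x'. cauchy_seq F x' \<Longrightarrow> cc x' = cc x \<Longrightarrow> g x' = g x"
  shows "(\<Union>x'\<in>cc x. g x') = g x"
  using assms cc_memE[OF x] cc_self[OF x] by blast

lemma UN_cc2: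
  assumes x: "cauchy_seq F x" and y: "cauchy_seq F y"
    and g: "\<And>x' y'. \<lbrakk>cauchy_seq F x'; cc x' = cc x; cauchy_seq F y'; cc y' = cc y\<rbrakk> \<Longrightarrow> g x' y' = g x y"
  shows "(\<Union>x'\<in>cc x. \<Union>y'\<in>cc y. g x' y') = g x y"
proof -
  have inner: "(\<Union>y'\<in>cc y. g x' y') = g x' y" if "cauchy_seq F x'" "cc x' = cc x" for x'
  proof (rule UN_cc[OF y])
    fix y' assume "cauchy_seq F y'" "cc y' = cc y"
    from g[OF that this] g[OF that y refl] show "g x' y' = g x' y" by (rule trans[OF _ sym])
  qed
  have "(\<Union>x'\<in>cc x. \<Union>y'\<in>cc y. g x' y') = (\<Union>y'\<in>cc y. g x y')"
  proof (rule UN_cc[OF x])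
    fix x' assume x': "cauchy_seq F x'" "cc x' = cc x"
    show "(\<Union>y'\<in>cc y. g x' y') = (\<Union>y'\<in>cc y. g x y')"
      unfolding inner[OF x'] inner[OF x refl] by (rule g[OF x' y refl])
  qed
  then show ?thesis unfolding inner[OF x refl] .
qed

lemma completion_add [simp]:
  assumes x: "cauchy_seq F x" and y: "cauchy_seq F y"
  shows "cc x \<oplus>\<^bsub>\<A>\<^esub> cc y = cc (\<lambda>n. x n \<oplus>\<^bsub>F\<^esub> y n)"
proof -
  have eq: "cc (\<lambda>n. x' n \<oplus>\<^bsub>F\<^esub> y' n) = cc (\<lambda>n. x n \<oplus>\<^bsub>F\<^esub> y n)"
    if "cauchy_seq F x'" "cc x' = cc x" "cauchy_seq F y'" "cc y' = cc y" for x' y'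
  proof -
    have d: "(\<lambda>n. dst F (x' n) (x n)) \<longlonglongrightarrow> 0" "(\<lambda>n. dst F (y' n) (y n)) \<longlonglongrightarrow> 0"
      using that x y by (simp_all add: cc_eq_iff)
    have "(\<lambda>n. dst F (x' n \<oplus>\<^bsub>F\<^esub> y' n) (x n \<oplus>\<^bsub>F\<^esub> y n)) \<longlonglongrightarrow> 0"
      by (rule squeeze_zero[OF tendsto_add[OF d, simplified]]) (use that x y in \<open>auto simp: dst_F_add\<close>)
    then show ?thesis using that x y by (simp add: cc_eq_iff)
  qed
  have "cc x \<oplus>\<^bsub>\<A>\<^esub> cc y = (\<Union>x'\<in>cc x. \<Union>y'\<in>cc y. cc (\<lambda>n. x' n \<oplus>\<^bsub>F\<^esub> y' n))"
    by (simp add: completion_def)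
  also have "\<dots> = cc (\<lambda>n. x n \<oplus>\<^bsub>F\<^esub> y n)" by (rule UN_cc2[OF x y], rule eq)
  finally show ?thesis .
qed

lemma completion_mult [simp]:
  assumes x: "cauchy_seq F x" and y: "cauchy_seq F y"
  shows "cc x \<otimes>\<^bsub>\<A>\<^esub> cc y = cc (\<lambda>n. x n \<otimes>\<^bsub>F\<^esub> y n)"
proof -
  have eq: "cc (\<lambda>n. x' n \<otimes>\<^bsub>F\<^esub> y' n) = cc (\<lambda>n. x n \<otimes>\<^bsub>F\<^esub> y n)"
    if x': "cauchy_seq F x'" "cc x' = cc x" and y': "cauchy_seq F y'" "cc y' = cc y" for x' y'
  proof -
    obtain K L where K: "0 \<le> K" "\<And>n. nrm F (x' n) \<le> K" and L: "0 \<le> L" "\<And>n. nrm F (y n) \<le> L"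
      using cauchy_bounded[OF x'(1)] cauchy_bounded[OF y] by metis
    have d: "(\<lambda>n. dst F (x' n) (x n)) \<longlonglongrightarrow> 0" "(\<lambda>n. dst F (y' n) (y n)) \<longlonglongrightarrow> 0"
      using x' y' x y by (simp_all add: cc_eq_iff)
    have le: "dst F (x' n \<otimes>\<^bsub>F\<^esub> y' n) (x n \<otimes>\<^bsub>F\<^esub> y n) \<le> K * dst F (y' n) (y n) + dst F (x' n) (x n) * L" for n
    proof -
      have "dst F (x' n \<otimes>\<^bsub>F\<^esub> y' n) (x n \<otimes>\<^bsub>F\<^esub> y n)
          \<le> nrm F (x' n) * dst F (y' n) (y n) + dst F (x' n) (x n) * nrm F (y n)"
        using x' y' x y by (simp add: dst_F_mult)
      also have "\<dots> \<le> K * dst F (y' n) (y n) + dst F (x' n) (x n) * L"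
        using x' y' x y K L by (intro add_mono mult_mono) simp_all
      finally show ?thesis .
    qed
    have "(\<lambda>n. K * dst F (y' n) (y n) + dst F (x' n) (x n) * L) \<longlonglongrightarrow> K * 0 + 0 * L"
      by (intro tendsto_intros d)
    then have l: "(\<lambda>n. K * dst F (y' n) (y n) + dst F (x' n) (x n) * L) \<longlonglongrightarrow> 0" by simp
    have "(\<lambda>n. dst F (x' n \<otimes>\<^bsub>F\<^esub> y' n) (x n \<otimes>\<^bsub>F\<^esub> y n)) \<longlonglongrightarrow> 0"
      by (rule squeeze_zero[OF l le]) (use x' y' x y in auto)
    then show ?thesis using x' y' x y by (simp add: cc_eq_iff)
  qed
  have "cc x \<otimes>\<^bsub>\<A>\<^esub> cc y = (\<Union>x'\<in>cc x. \<Union>y'\<in>cc y. cc (\<lambda>n. x' n \<otimes>\<^bsub>F\<^esub> y' n))"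
    by (simp add: completion_def)
  also have "\<dots> = cc (\<lambda>n. x n \<otimes>\<^bsub>F\<^esub> y n)" by (rule UN_cc2[OF x y], rule eq)
  finally show ?thesis .
qed

lemma completion_smult [simp]:
  assumes x: "cauchy_seq F x"
  shows "c \<odot>\<^bsub>\<A>\<^esub> cc x = cc (\<lambda>n. c \<odot>\<^bsub>F\<^esub> x n)"
proof -
  have eq: "cc (\<lambda>n. c \<odot>\<^bsub>F\<^esub> x' n) = cc (\<lambda>n. c \<odot>\<^bsub>F\<^esub> x n)" if "cauchy_seq F x'" "cc x' = cc x" for x'
  proof -
    have d: "(\<lambda>n. dst F (x' n) (x n)) \<longlonglongrightarrow> 0" using that x by (simp add: cc_eq_iff)
    have "(\<lambda>n. dst F (c \<odot>\<^bsub>F\<^esub> x' n) (c \<odot>\<^bsub>F\<^esub> x n)) \<longlonglongrightarrow> 0"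
      by (rule squeeze_zero[OF tendsto_mult_right_zero[OF d, of "cmod c"]]) (use that x in \<open>auto simp: dst_F_smult\<close>)
    then show ?thesis using that x by (simp add: cc_eq_iff)
  qed
  show ?thesis using UN_cc[OF x, of "\<lambda>x. cc (\<lambda>n. c \<odot>\<^bsub>F\<^esub> x n)"] eq by (simp add: completion_def)
qed

lemma completion_star [simp]:
  assumes x: "cauchy_seq F x"
  shows "star \<A> (cc x) = cc (\<lambda>n. star F (x n))"
proof -
  have eq: "cc (\<lambda>n. star F (x' n)) = cc (\<lambda>n. star F (x n))" if "cauchy_seq F x'" "cc x' = cc x" for x'
  proof -
    have d: "(\<lambda>n. dst F (x' n) (x n)) \<longlonglongrightarrow> 0" using that x by (simp add: cc_eq_iff)
    have "(\<lambda>n. dst F (star F (x' n)) (star F (x n))) \<longlonglongrightarrow> 0"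
      by (rule squeeze_zero[OF d]) (use that x in \<open>auto simp: dst_F_star\<close>)
    then show ?thesis using that x by (simp add: cc_eq_iff)
  qed
  show ?thesis using UN_cc[OF x, of "\<lambda>x. cc (\<lambda>n. star F (x n))"] eq by (simp add: completion_def)
qed

lemma completion_zero: "\<zero>\<^bsub>\<A>\<^esub> = cc (\<lambda>n. \<zero>\<^bsub>F\<^esub>)" and completion_one: "\<one>\<^bsub>\<A>\<^esub> = cc (\<lambda>n. \<one>\<^bsub>F\<^esub>)"
  by (simp_all add: completion_def)

lemma nrm_convergent:
  assumes "cauchy_seq F x"
  shows "convergent (\<lambda>n. nrm F (x n))"
proof -
  have "Cauchy (\<lambda>n. nrm F (x n))"
  proof (rule metric_CauchyI)
    fix e :: real assume "0 < e"
    from cauchy_dst[OF assms this] obtain N where N: "\<forall>m\<ge>N. \<forall>n\<ge>N. dst F (x m) (x n) < e" by blast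
    have "dist (nrm F (x m)) (nrm F (x n)) < e" if "m \<ge> N" "n \<ge> N" for m n
      using nrm_F_diff[of "x m" "x n"] N that assms by (fastforce simp: dist_real_def)
    then show "\<exists>M. \<forall>m\<ge>M. \<forall>n\<ge>M. dist (nrm F (x m)) (nrm F (x n)) < e" by blast
  qed
  then show ?thesis by (rule Cauchy_convergent)
qed

lemma nrm_tendsto:
  assumes x: "cauchy_seq F x"
  shows "(\<lambda>n. nrm F (x n)) \<longlonglongrightarrow> nrm \<A> (cc x)"
proof -
  have "lim (\<lambda>n. nrm F (y n)) = lim (\<lambda>n. nrm F (x n))" if "y \<in> cc x" for y
  proof -
    from that have y: "cauchy_seq F y" "(\<lambda>n. dst F (x n) (y n)) \<longlonglongrightarrow> 0" by (simp_all add: cc_mem)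
    have "(\<lambda>n. nrm F (y n) - nrm F (x n)) \<longlonglongrightarrow> 0"
      by (rule Lim_null_comparison[OF _ y(2)]) (use nrm_F_diff[of "x _" "y _"] x y in \<open>auto simp: abs_minus_commute\<close>)
    from tendsto_add[OF this convergent_LIMSEQ_iff[THEN iffD1, OF nrm_convergent[OF x]]]
    show ?thesis by (auto intro: limI)
  qed
  then have "(\<lambda>y. lim (\<lambda>n. nrm F (y n))) ` cc x = (\<lambda>y. lim (\<lambda>n. nrm F (x n))) ` cc x"
    by (intro image_cong refl)
  also have "\<dots> = {lim (\<lambda>n. nrm F (x n))}" by (rule image_constant[OF cc_self[OF x]])
  finally have "(\<lambda>y. lim (\<lambda>n. nrm F (y n))) ` cc x = {lim (\<lambda>n. nrm F (x n))}" .
  then have "nrm \<A> (cc x) = lim (\<lambda>n. nrm F (x n))" by (simp add: completion_def)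
  with convergent_LIMSEQ_iff[THEN iffD1, OF nrm_convergent[OF x]] show ?thesis by simp
qed

lemma dst_completion:
  assumes x: "cauchy_seq F x" and y: "cauchy_seq F y"
  shows "(\<lambda>n. dst F (x n) (y n)) \<longlonglongrightarrow> dst \<A> (cc x) (cc y)"
  unfolding dst_def using nrm_tendsto[of "\<lambda>n. x n \<oplus>\<^bsub>F\<^esub> (-1) \<odot>\<^bsub>F\<^esub> y n"] x y by simp

text \<open>
  An identity that holds under every map in \<open>\<Phi>\<close> holds at distance 0, hence exactly between classes;
  inequalities between norms pass to limits.
\<close>

theorem cstar_algebra_completion: "cstar_algebra \<A>"
proof -
  have ag: "abelian_group \<A>"
  proof (rule abelian_groupI)
    fix X assume "X \<in> carrier \<A>"
    then obtain x where x: "cauchy_seq F x" "X = cc x" by (elim carrier_completionE)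
    have "cc (\<lambda>n. (-1) \<odot>\<^bsub>F\<^esub> x n) \<oplus>\<^bsub>\<A>\<^esub> X = \<zero>\<^bsub>\<A>\<^esub>"
      using x by (simp add: completion_zero) (intro cc_null; simp add: B.sm_minus B.l_neg)
    then show "\<exists>Y\<in>carrier \<A>. Y \<oplus>\<^bsub>\<A>\<^esub> X = \<zero>\<^bsub>\<A>\<^esub>"
      by (rule bexI) (rule cc_in[OF cauchy_smult[OF x(1)]])
  next
    show "\<zero>\<^bsub>\<A>\<^esub> \<in> carrier \<A>" by (simp add: completion_zero)
  next
    fix X Y assume "X \<in> carrier \<A>" "Y \<in> carrier \<A>"
    then show "X \<oplus>\<^bsub>\<A>\<^esub> Y \<in> carrier \<A>" by (elim carrier_completionE) simp
  next
    fix X Y assume "X \<in> carrier \<A>" "Y \<in> carrier \<A>"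
    then show "X \<oplus>\<^bsub>\<A>\<^esub> Y = Y \<oplus>\<^bsub>\<A>\<^esub> X"
      by (elim carrier_completionE) (simp, rule cc_null; simp add: B.a_comm)
  next
    fix X Y Z assume "X \<in> carrier \<A>" "Y \<in> carrier \<A>" "Z \<in> carrier \<A>"
    then show "X \<oplus>\<^bsub>\<A>\<^esub> Y \<oplus>\<^bsub>\<A>\<^esub> Z = X \<oplus>\<^bsub>\<A>\<^esub> (Y \<oplus>\<^bsub>\<A>\<^esub> Z)"
      by (elim carrier_completionE) (simp, rule cc_null; simp add: B.a_assoc)
  next
    fix X assume "X \<in> carrier \<A>"
    then show "\<zero>\<^bsub>\<A>\<^esub> \<oplus>\<^bsub>\<A>\<^esub> X = X"
      by (elim carrier_completionE) (simp add: completion_zero, rule cc_null; simp)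
  qed
  have mo: "Group.monoid \<A>"
  proof (rule monoidI)
    show "\<one>\<^bsub>\<A>\<^esub> \<in> carrier \<A>" by (simp add: completion_one)
  next
    fix X Y assume "X \<in> carrier \<A>" "Y \<in> carrier \<A>"
    then show "X \<otimes>\<^bsub>\<A>\<^esub> Y \<in> carrier \<A>" by (elim carrier_completionE) simp
  next
    fix X Y Z assume "X \<in> carrier \<A>" "Y \<in> carrier \<A>" "Z \<in> carrier \<A>"
    then show "X \<otimes>\<^bsub>\<A>\<^esub> Y \<otimes>\<^bsub>\<A>\<^esub> Z = X \<otimes>\<^bsub>\<A>\<^esub> (Y \<otimes>\<^bsub>\<A>\<^esub> Z)"
      by (elim carrier_completionE) (simp, rule cc_null; simp add: B.m_assoc)
  next
    fix X assume "X \<in> carrier \<A>"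
    then show "\<one>\<^bsub>\<A>\<^esub> \<otimes>\<^bsub>\<A>\<^esub> X = X" "X \<otimes>\<^bsub>\<A>\<^esub> \<one>\<^bsub>\<A>\<^esub> = X"
      by - (elim carrier_completionE, simp add: completion_one, rule cc_null; simp)+
  qed
  have ri: "ring \<A>"
    by (rule ringI[OF ag mo]; elim carrier_completionE; hypsubst; simp; rule cc_null; simp add: B.l_distr B.r_distr)
  have mod: "Module.module complex_cstar \<A>"
  proof (rule moduleI[OF cring_complex ag])
    fix c X assume "X \<in> carrier \<A>"
    then show "c \<odot>\<^bsub>\<A>\<^esub> X \<in> carrier \<A>" by (elim carrier_completionE) simp
  qed (elim carrier_completionE; hypsubst; simp; rule cc_null; simp add: B.sm_ladd B.sm_radd B.sm_assoc)+
  have ze: "nrm \<A> X = 0 \<longleftrightarrow> X = \<zero>\<^bsub>\<A>\<^esub>" if X: "X \<in> carrier \<A>" for X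
  proof -
    from X obtain x where x: "cauchy_seq F x" "X = cc x" by (elim carrier_completionE)
    have "dst F (x n) \<zero>\<^bsub>F\<^esub> = nrm F (x n)" for n
      using x by (simp add: dst_def nrm_sup cong: SUP_cong_simp)
    then have "X = \<zero>\<^bsub>\<A>\<^esub> \<longleftrightarrow> (\<lambda>n. nrm F (x n)) \<longlonglongrightarrow> 0" using x by (simp add: completion_zero cc_eq_iff)
    with nrm_tendsto[OF x(1)] show ?thesis unfolding x(2) by (auto intro: LIMSEQ_unique)
  qed
  have nonneg: "0 \<le> nrm \<A> X" if X: "X \<in> carrier \<A>" for X
  proof -
    from X obtain x where x: "cauchy_seq F x" "X = cc x" by (elim carrier_completionE)
    from LIMSEQ_le_const[OF nrm_tendsto[OF x(1)]] x show ?thesis by auto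
  qed
  have nadd: "nrm \<A> (X \<oplus>\<^bsub>\<A>\<^esub> Y) \<le> nrm \<A> X + nrm \<A> Y"
    and nmult: "nrm \<A> (X \<otimes>\<^bsub>\<A>\<^esub> Y) \<le> nrm \<A> X * nrm \<A> Y" if XY: "X \<in> carrier \<A>" "Y \<in> carrier \<A>" for X Y
  proof -
    from XY obtain x y where x: "cauchy_seq F x" "X = cc x" and y: "cauchy_seq F y" "Y = cc y"
      by (elim carrier_completionE)
    have "nrm F (x n \<oplus>\<^bsub>F\<^esub> y n) \<le> nrm F (x n) + nrm F (y n)" for n
      by (intro nrm_le) (use x y in \<open>auto intro!: order_trans[OF B.nrm_add add_mono] nrm_ge\<close>)
    with LIMSEQ_le[OF nrm_tendsto tendsto_add[OF nrm_tendsto nrm_tendsto], of "\<lambda>n. x n \<oplus>\<^bsub>F\<^esub> y n" x y] x y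
    show "nrm \<A> (X \<oplus>\<^bsub>\<A>\<^esub> Y) \<le> nrm \<A> X + nrm \<A> Y" by simp
    have "nrm F (x n \<otimes>\<^bsub>F\<^esub> y n) \<le> nrm F (x n) * nrm F (y n)" for n
      by (intro nrm_le) (use x y in \<open>auto intro!: order_trans[OF B.nrm_mult mult_mono] nrm_ge\<close>)
    with LIMSEQ_le[OF nrm_tendsto tendsto_mult[OF nrm_tendsto nrm_tendsto], of "\<lambda>n. x n \<otimes>\<^bsub>F\<^esub> y n" x y] x y
    show "nrm \<A> (X \<otimes>\<^bsub>\<A>\<^esub> Y) \<le> nrm \<A> X * nrm \<A> Y" by simp
  qed
  have nsm: "nrm \<A> (c \<odot>\<^bsub>\<A>\<^esub> X) = cmod c * nrm \<A> X"
    and nst: "nrm \<A> (star \<A> X \<otimes>\<^bsub>\<A>\<^esub> X) = (nrm \<A> X)\<^sup>2" if X: "X \<in> carrier \<A>" for X c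
  proof -
    from X obtain x where x: "cauchy_seq F x" "X = cc x" by (elim carrier_completionE)
    have le: "nrm F (c \<odot>\<^bsub>F\<^esub> y) \<le> cmod c * nrm F y" if "y \<in> carrier F" for y c
      by (intro nrm_le) (use that in \<open>auto simp: B.nrm_smult intro!: mult_left_mono nrm_ge\<close>)
    have eq: "nrm F (c \<odot>\<^bsub>F\<^esub> x n) = cmod c * nrm F (x n)" for n
    proof (rule antisym)
      show "cmod c * nrm F (x n) \<le> nrm F (c \<odot>\<^bsub>F\<^esub> x n)"
      proof (cases "c = 0")
        case False
        have "nrm F ((1 / c) \<odot>\<^bsub>F\<^esub> (c \<odot>\<^bsub>F\<^esub> x n)) = nrm F (x n)"
          unfolding nrm_sup[OF smult_in[OF smult_in[OF cauchy_in[OF x(1)]]]] nrm_sup[OF cauchy_in[OF x(1)]]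
          by (intro SUP_cong refl) (use x False in \<open>simp add: B.sm_assoc\<close>)
        with le[of "c \<odot>\<^bsub>F\<^esub> x n" "1 / c"] x False show ?thesis by (simp add: norm_divide field_simps)
      qed (use x in simp)
    qed (use x le in simp)
    have "(\<lambda>n. nrm F (c \<odot>\<^bsub>F\<^esub> x n)) \<longlonglongrightarrow> cmod c * nrm \<A> (cc x)"
      unfolding eq by (intro tendsto_intros nrm_tendsto x(1))
    from LIMSEQ_unique[OF nrm_tendsto[OF cauchy_smult[OF x(1)]] this] x
    show "nrm \<A> (c \<odot>\<^bsub>\<A>\<^esub> X) = cmod c * nrm \<A> X" by simp
    have "(\<lambda>n. nrm F (star F (x n) \<otimes>\<^bsub>F\<^esub> x n)) \<longlonglongrightarrow> (nrm \<A> (cc x))\<^sup>2"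
      unfolding nrm_F_star_self[OF cauchy_in[OF x(1)]] by (intro tendsto_intros nrm_tendsto x(1))
    from LIMSEQ_unique[OF nrm_tendsto[OF cauchy_mult[OF cauchy_star[OF x(1)] x(1)]] this] x
    show "nrm \<A> (star \<A> X \<otimes>\<^bsub>\<A>\<^esub> X) = (nrm \<A> X)\<^sup>2" by simp
  qed
  have pre: "pre_cstar \<A>"
  proof (intro pre_cstar.intro pre_cstar_axioms.intro ri mod ze nonneg nadd nmult nsm nst)
    fix X assume "X \<in> carrier \<A>"
    then show "star \<A> X \<in> carrier \<A>" by (elim carrier_completionE) simp
  qed (elim carrier_completionE; hypsubst; simp; rule cc_null;
      simp add: B.smult_mult_left B.smult_mult_right B.star_add B.star_smult B.star_mult)+
  interpret C: pre_cstar \<A> by (rule pre)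
  \<comment> \<open>Completeness: replace the \<open>n\<close>-th class by an element of \<open>F\<close> at distance at most \<open>1/(n+1)\<close>.\<close>
  have compl: "\<exists>L\<in>carrier \<A>. converges_to \<A> s L" if s: "cauchy_seq \<A> s" for s
  proof -
    have emb: "dst \<A> (cc x) (cc (\<lambda>_. x k)) \<le> e"
      if x: "cauchy_seq F x" and k: "\<forall>m\<ge>k. \<forall>n\<ge>k. dst F (x m) (x n) < e" for x k e
      by (rule LIMSEQ_le_const2[OF dst_completion[OF x cauchy_const[OF cauchy_in[OF x]]]])
        (use k in \<open>auto intro!: exI[of _ k] less_imp_le\<close>)
    have "\<exists>a\<in>carrier F. dst \<A> (s n) (cc (\<lambda>_. a)) \<le> 1 / (real n + 1)" for n
    proof -
      have "s n \<in> carrier \<A>" using s by (simp add: cauchy_seq_def)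
      then obtain x where x: "cauchy_seq F x" "s n = cc x" by (elim carrier_completionE)
      from cauchy_dst[OF x(1), of "1 / (real n + 1)"] obtain k
        where "\<forall>m\<ge>k. \<forall>j\<ge>k. dst F (x m) (x j) < 1 / (real n + 1)" by auto
      from emb[OF x(1) this] x show ?thesis by (intro bexI[of _ "x k"]) auto
    qed
    then obtain a where a: "\<And>n. a n \<in> carrier F" "\<And>n. dst \<A> (s n) (cc (\<lambda>_. a n)) \<le> 1 / (real n + 1)"
      by metis
    have sc: "s n \<in> carrier \<A>" for n using s by (simp add: cauchy_seq_def)
    have ac: "cc (\<lambda>_. a n) \<in> carrier \<A>" for n using a by simp
    have dc: "dst F (a m) (a n) = dst \<A> (cc (\<lambda>_. a m)) (cc (\<lambda>_. a n))" for m n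
      using LIMSEQ_unique[OF dst_completion[of "\<lambda>_. a m" "\<lambda>_. a n"] tendsto_const] a by simp
    have lim1: "(\<lambda>n. 1 / (real n + 1)) \<longlonglongrightarrow> 0"
      using LIMSEQ_inverse_real_of_nat by (simp add: inverse_eq_divide add.commute)
    have ca: "cauchy_seq F a"
    proof (rule cauchyI[OF a(1)])
      fix m n
      show "dst F (a m) (a n) \<le> 1 / (real m + 1) + dst \<A> (s m) (s n) + 1 / (real n + 1)"
        using C.dst_triangle[OF ac[of m] sc[of m] ac[of n]] C.dst_triangle[OF sc[of m] sc[of n] ac[of n]]
          C.dst_sym[OF ac[of m] sc[of m]] a(2)[of m] a(2)[of n] unfolding dc by linarith
    next
      fix e :: real assume e: "0 < e"
      then have "0 < e / 3" by simp
      from order_tendstoD(2)[OF lim1 this] obtain N1 where N1: "\<forall>n\<ge>N1. 1 / (real n + 1) < e / 3"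
        by (auto simp: eventually_sequentially)
      from s \<open>0 < e / 3\<close> obtain N2 where N2: "\<forall>m\<ge>N2. \<forall>n\<ge>N2. dst \<A> (s m) (s n) < e / 3"
        unfolding cauchy_seq_def by metis
      have "1 / (real m + 1) + dst \<A> (s m) (s n) + 1 / (real n + 1) < e"
        if "m \<ge> max N1 N2" "n \<ge> max N1 N2" for m n
        using N1[rule_format, of m] N1[rule_format, of n] N2[rule_format, of m n] that by simp
      then show "\<exists>N. \<forall>m\<ge>N. \<forall>n\<ge>N. 1 / (real m + 1) + dst \<A> (s m) (s n) + 1 / (real n + 1) < e" by blast
    qed
    have "(\<lambda>n. dst \<A> (s n) (cc a)) \<longlonglongrightarrow> 0"
    proof (rule LIMSEQ_I)
      fix e :: real assume e: "0 < e"
      then have e2: "0 < e / 2" by simp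
      from order_tendstoD(2)[OF lim1 this] obtain N1 where N1: "\<forall>n\<ge>N1. 1 / (real n + 1) < e / 2"
        by (auto simp: eventually_sequentially)
      from cauchy_dst[OF ca e2] obtain N2 where N2: "\<forall>m\<ge>N2. \<forall>n\<ge>N2. dst F (a m) (a n) < e / 2" by blast
      have "norm (dst \<A> (s n) (cc a) - 0) < e" if n: "n \<ge> max N1 N2" for n
      proof -
        have "dst \<A> (s n) (cc a) \<le> dst \<A> (s n) (cc (\<lambda>_. a n)) + dst \<A> (cc (\<lambda>_. a n)) (cc a)"
          using C.dst_triangle sc a ca by simp
        also have "dst \<A> (cc (\<lambda>_. a n)) (cc a) = dst \<A> (cc a) (cc (\<lambda>_. a n))"
          using C.dst_sym a ca by simp
        also have "\<dots> \<le> e / 2"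
          by (rule emb[OF ca]) (use N2 n in auto)
        finally show ?thesis using a(2)[of n] N1[rule_format, of n] n C.dst_nonneg[OF sc cc_in[OF ca], of n] by simp
      qed
      then show "\<exists>no. \<forall>n\<ge>no. norm (dst \<A> (s n) (cc a) - 0) < e" by blast
    qed
    with ca show ?thesis by (auto simp: converges_to_def)
  qed
  show ?thesis
    using pre compl unfolding cstar_algebra_def pre_cstar_def cstar_algebra_axioms_def pre_cstar_axioms_def by auto
qed

lemma completion_embed_in [simp]: "a \<in> carrier F \<Longrightarrow> completion_embed F a \<in> carrier \<A>"
  by (simp add: completion_embed_def)

lemma nrm_embed: "a \<in> carrier F \<Longrightarrow> nrm \<A> (completion_embed F a) = nrm F a"
  using LIMSEQ_unique[OF nrm_tendsto[of "\<lambda>_. a"] tendsto_const] by (simp add: completion_embed_def)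

lemma cc_limit: 
  assumes x: "cauchy_seq F x"
  shows "(\<lambda>n. dst \<A> (cc x) (completion_embed F (x n))) \<longlonglongrightarrow> 0"
proof (rule LIMSEQ_I)
  interpret C: cstar_algebra \<A> by (rule cstar_algebra_completion)
  interpret C: pre_cstar \<A> by (rule cstar_algebra_pre[OF cstar_algebra_completion])
  fix e :: real assume e: "0 < e"
  then have e2: "0 < e / 2" by simp
  from cauchy_dst[OF x e2] obtain N where N: "\<forall>m\<ge>N. \<forall>n\<ge>N. dst F (x m) (x n) < e / 2" by blast
  have "norm (dst \<A> (cc x) (completion_embed F (x n)) - 0) < e" if n: "n \<ge> N" for n
  proof -
    have "dst \<A> (cc x) (completion_embed F (x n)) \<le> e / 2" unfolding completion_embed_def
      by (rule LIMSEQ_le_const2[OF dst_completion[OF x cauchy_const[OF cauchy_in[OF x]]]])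
        (use N n in \<open>auto intro!: exI[of _ N] less_imp_le\<close>)
    with e C.dst_nonneg[OF cc_in[OF x] completion_embed_in[OF cauchy_in[OF x]]] show ?thesis by simp
  qed
  then show "\<exists>no. \<forall>n\<ge>no. norm (dst \<A> (cc x) (completion_embed F (x n)) - 0) < e" by blast
qed

lemma completion_approx:
  assumes "X \<in> carrier \<A>" "0 < e"
  obtains a where "a \<in> carrier F" "dst \<A> X (completion_embed F a) < e"
proof -
  from assms obtain x where x: "cauchy_seq F x" "X = cc x" by (elim carrier_completionE)
  from order_tendstoD(2)[OF cc_limit[OF x(1)] assms(2)] obtain n where "dst \<A> (cc x) (completion_embed F (x n)) < e"
    by (auto simp: eventually_sequentially)
  then show thesis using that[of "x n"] x by simp
qed

lemma embed_eqI:
  "\<lbrakk>a \<in> carrier F; b \<in> carrier F; \<And>\<phi>. \<phi> \<in> \<Phi> \<Longrightarrow> \<phi> a = \<phi> b\<rbrakk> \<Longrightarrow> completion_embed F a = completion_embed F b"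
  unfolding completion_embed_def by (rule cc_null) auto

lemma embed_hom:
  "\<lbrakk>a \<in> carrier F; b \<in> carrier F\<rbrakk> \<Longrightarrow> completion_embed F (a \<oplus>\<^bsub>F\<^esub> b) = completion_embed F a \<oplus>\<^bsub>\<A>\<^esub> completion_embed F b"
  "\<lbrakk>a \<in> carrier F; b \<in> carrier F\<rbrakk> \<Longrightarrow> completion_embed F (a \<otimes>\<^bsub>F\<^esub> b) = completion_embed F a \<otimes>\<^bsub>\<A>\<^esub> completion_embed F b"
  "a \<in> carrier F \<Longrightarrow> completion_embed F (c \<odot>\<^bsub>F\<^esub> a) = c \<odot>\<^bsub>\<A>\<^esub> completion_embed F a"
  "a \<in> carrier F \<Longrightarrow> completion_embed F (star F a) = star \<A> (completion_embed F a)"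
  "completion_embed F \<one>\<^bsub>F\<^esub> = \<one>\<^bsub>\<A>\<^esub>" "completion_embed F \<zero>\<^bsub>F\<^esub> = \<zero>\<^bsub>\<A>\<^esub>"
  by (simp_all add: completion_embed_def completion_one completion_zero)

end

text \<open>Extension of a contractive map between seminormed algebras to their completions.\<close>

locale raw_map = F: raw_cstar B F \<Phi> + G: raw_cstar C G \<Psi>
  for B :: "('b, 'k) cstar_scheme" and F :: "('x, 'm) cstar_scheme" and \<Phi>
    and C :: "('c, 'l) cstar_scheme" and G :: "('y, 'n) cstar_scheme" and \<Psi> +
  fixes f :: "'x \<Rightarrow> 'y"
  assumes f_in [simp]: "x \<in> carrier F \<Longrightarrow> f x \<in> carrier G"
    and f_dst: "\<lbrakk>x \<in> carrier F; y \<in> carrier F\<rbrakk> \<Longrightarrow> dst G (f x) (f y) \<le> dst F x y"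
begin

lemma f_cauchy [simp]: "cauchy_seq F x \<Longrightarrow> cauchy_seq G (\<lambda>n. f (x n))"
  by (rule G.cauchyI[where d = "\<lambda>m n. dst F (x m) (x n)"]) (auto simp: f_dst F.cauchy_dst)

lemma completion_map_cc:
  assumes x: "cauchy_seq F x"
  shows "completion_map G f (cauchy_class F x) = cauchy_class G (\<lambda>n. f (x n))"
  unfolding completion_map_def
proof (rule F.UN_cc[OF x])
  fix y assume y: "cauchy_seq F y" "cauchy_class F y = cauchy_class F x"
  then have d: "(\<lambda>n. dst F (y n) (x n)) \<longlonglongrightarrow> 0" using x by (simp add: F.cc_eq_iff)
  have "(\<lambda>n. dst G (f (y n)) (f (x n))) \<longlonglongrightarrow> 0"
    by (rule squeeze_zero[OF d]) (use x y in \<open>auto simp: f_dst\<close>)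
  then show "cauchy_class G (\<lambda>n. f (y n)) = cauchy_class G (\<lambda>n. f (x n))" using x y by (simp add: G.cc_eq_iff)
qed

lemma completion_map_in:
  "X \<in> carrier (completion F) \<Longrightarrow> completion_map G f X \<in> carrier (completion G)"
  by (elim F.carrier_completionE) (simp add: completion_map_cc)

lemma completion_map_unital_star_hom:
  assumes "\<And>\<psi> x y. \<lbrakk>\<psi> \<in> \<Psi>; x \<in> carrier F; y \<in> carrier F\<rbrakk> \<Longrightarrow> \<psi> (f (x \<oplus>\<^bsub>F\<^esub> y)) = \<psi> (f x) \<oplus>\<^bsub>C\<^esub> \<psi> (f y)"
    and "\<And>\<psi> x y. \<lbrakk>\<psi> \<in> \<Psi>; x \<in> carrier F; y \<in> carrier F\<rbrakk> \<Longrightarrow> \<psi> (f (x \<otimes>\<^bsub>F\<^esub> y)) = \<psi> (f x) \<otimes>\<^bsub>C\<^esub> \<psi> (f y)"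
    and "\<And>\<psi> x c. \<lbrakk>\<psi> \<in> \<Psi>; x \<in> carrier F\<rbrakk> \<Longrightarrow> \<psi> (f (c \<odot>\<^bsub>F\<^esub> x)) = c \<odot>\<^bsub>C\<^esub> \<psi> (f x)"
    and "\<And>\<psi> x. \<lbrakk>\<psi> \<in> \<Psi>; x \<in> carrier F\<rbrakk> \<Longrightarrow> \<psi> (f (star F x)) = star C (\<psi> (f x))"
    and "\<And>\<psi>. \<psi> \<in> \<Psi> \<Longrightarrow> \<psi> (f \<one>\<^bsub>F\<^esub>) = \<psi> \<one>\<^bsub>G\<^esub>"
  shows "unital_star_hom (completion F) (completion G) (completion_map G f)"
  unfolding unital_star_hom_def star_hom_def
proof (intro conjI ballI allI)
  fix X assume X: "X \<in> carrier (completion F)"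
  then show "completion_map G f X \<in> carrier (completion G)" by (rule completion_map_in)
  from X obtain x where x: "cauchy_seq F x" "X = cauchy_class F x" by (rule F.carrier_completionE)
  show "completion_map G f (star (completion F) X) = star (completion G) (completion_map G f X)"
    using x assms(4) by (simp add: completion_map_cc) (rule G.cc_null; simp)
  show "completion_map G f (c \<odot>\<^bsub>completion F\<^esub> X) = c \<odot>\<^bsub>completion G\<^esub> completion_map G f X" for c
    using x assms(3) by (simp add: completion_map_cc) (rule G.cc_null; simp)
  fix Y assume "Y \<in> carrier (completion F)"
  then obtain y where y: "cauchy_seq F y" "Y = cauchy_class F y" by (rule F.carrier_completionE)
  show "completion_map G f (X \<oplus>\<^bsub>completion F\<^esub> Y) = completion_map G f X \<oplus>\<^bsub>completion G\<^esub> completion_map G f Y"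
    using x y assms(1) by (simp add: completion_map_cc) (rule G.cc_null; simp)
  show "completion_map G f (X \<otimes>\<^bsub>completion F\<^esub> Y) = completion_map G f X \<otimes>\<^bsub>completion G\<^esub> completion_map G f Y"
    using x y assms(2) by (simp add: completion_map_cc) (rule G.cc_null; simp)
next
  show "completion_map G f \<one>\<^bsub>completion F\<^esub> = \<one>\<^bsub>completion G\<^esub>"
    using assms(5) by (simp add: completion_map_cc F.completion_one G.completion_one) (rule G.cc_null; simp)
qed

end

section \<open>Contractivity of *-representations\<close>

lemma star_homD:
  assumes "star_hom A B f"
  shows "x \<in> carrier A \<Longrightarrow> f x \<in> carrier B"
    "x \<in> carrier A \<Longrightarrow> y \<in> carrier A \<Longrightarrow> f (x \<oplus>\<^bsub>A\<^esub> y) = f x \<oplus>\<^bsub>B\<^esub> f y"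
    "x \<in> carrier A \<Longrightarrow> y \<in> carrier A \<Longrightarrow> f (x \<otimes>\<^bsub>A\<^esub> y) = f x \<otimes>\<^bsub>B\<^esub> f y"
    "x \<in> carrier A \<Longrightarrow> f (c \<odot>\<^bsub>A\<^esub> x) = c \<odot>\<^bsub>B\<^esub> f x"
    "x \<in> carrier A \<Longrightarrow> f (star A x) = star B (f x)"
  using assms by (simp_all add: star_hom_def)

lemma star_homI:
  assumes "\<And>x. x \<in> carrier A \<Longrightarrow> f x \<in> carrier B"
    "\<And>x y. x \<in> carrier A \<Longrightarrow> y \<in> carrier A \<Longrightarrow> f (x \<oplus>\<^bsub>A\<^esub> y) = f x \<oplus>\<^bsub>B\<^esub> f y"
    "\<And>x y. x \<in> carrier A \<Longrightarrow> y \<in> carrier A \<Longrightarrow> f (x \<otimes>\<^bsub>A\<^esub> y) = f x \<otimes>\<^bsub>B\<^esub> f y"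
    "\<And>c x. x \<in> carrier A \<Longrightarrow> f (c \<odot>\<^bsub>A\<^esub> x) = c \<odot>\<^bsub>B\<^esub> f x"
    "\<And>x. x \<in> carrier A \<Longrightarrow> f (star A x) = star B (f x)"
  shows "star_hom A B f"
  using assms by (simp add: star_hom_def)

lemma star_hom_comp: "star_hom A B f \<Longrightarrow> star_hom B C g \<Longrightarrow> star_hom A C (\<lambda>x. g (f x))"
  by (simp add: star_hom_def)

context pre_cstar begin

lemma star_hom_zero_elem: "star_hom A B f \<Longrightarrow> pre_cstar B \<Longrightarrow> f \<zero> = \<zero>\<^bsub>B\<^esub>"
  using star_homD(4)[of A B f \<zero> 0] star_homD(1)[of A B f \<zero>] pre_cstar.sm_zero[of B "f \<zero>"] by simp

lemma star_hom_one:
  assumes "star_hom A B f"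
  shows "f \<one> \<otimes>\<^bsub>B\<^esub> f \<one> = f \<one>" "star B (f \<one>) = f \<one>"
    "x \<in> carrier A \<Longrightarrow> f \<one> \<otimes>\<^bsub>B\<^esub> f x = f x" "x \<in> carrier A \<Longrightarrow> f x \<otimes>\<^bsub>B\<^esub> f \<one> = f x"
  using star_homD(3)[OF assms, of \<one>] star_homD(3)[OF assms, of _ \<one>] star_homD(5)[OF assms, of \<one>] by auto

lemma limit_unique:
  assumes "converges_to A s x" "converges_to A s y" "\<And>n. s n \<in> carrier A" "x \<in> carrier A" "y \<in> carrier A"
  shows "x = y"
proof -
  have "(\<lambda>n. dst A (s n) x + dst A (s n) y) \<longlonglongrightarrow> 0"
    using tendsto_add[OF assms(1,2)[unfolded converges_to_def]] by simp
  moreover have "dst A x y \<le> dst A (s n) x + dst A (s n) y" for n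
    using dst_triangle[OF assms(4) assms(3) assms(5), of n] dst_sym[OF assms(4) assms(3), of n] by simp
  ultimately have "dst A x y \<le> 0" by (meson LIMSEQ_le_const)
  then show ?thesis using dst_zero_iff[OF assms(4,5)] dst_nonneg[OF assms(4,5)] by simp
qed

end

text \<open>
  For self-adjoint \<open>x\<close> of norm less than 1, the iteration \<open>y \<mapsto> (x + y\<^sup>2) / 2\<close> converges; its limit
  satisfies \<open>(1 - y)\<^sup>2 = 1 - x\<close>.
\<close>

lemma sqrt_one_minus:
  fixes A (structure)
  assumes A: "cstar_algebra A" and x: "x \<in> carrier A" "star A x = x" "nrm A x < 1"
  obtains k where "k \<in> carrier A" "star A k = k" "k \<otimes> k \<oplus> x = \<one>"
proof -
  interpret pre_cstar A by (rule cstar_algebra_pre[OF A])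
  define r where "r = nrm A x"
  have r: "0 \<le> r" "r < 1" using x by (simp_all add: r_def)
  define y where "y = rec_nat \<zero> (\<lambda>_ z. (1/2) \<odot> (x \<oplus> z \<otimes> z))"
  have y0: "y 0 = \<zero>" and yS: "y (Suc n) = (1/2) \<odot> (x \<oplus> y n \<otimes> y n)" for n by (simp_all add: y_def)
  have yc: "y n \<in> carrier A" for n by (induct n) (simp_all add: y0 yS x)
  have ys: "star A (y n) = y n" for n by (induct n) (simp_all add: y0 yS x yc star_smult star_add star_mult)
  have yn: "nrm A (y n) \<le> r" for n
  proof (induct n)
    case (Suc n)
    have "nrm A (y (Suc n)) = (1/2) * nrm A (x \<oplus> y n \<otimes> y n)"
      unfolding yS by (subst nrm_smult) (simp_all add: x yc)
    also have "\<dots> \<le> (1/2) * (r + nrm A (y n) * nrm A (y n))"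
      using nrm_add[OF x(1) m_closed[OF yc yc], of n n] nrm_mult[OF yc yc, of n n] by (simp add: r_def)
    also have "nrm A (y n) * nrm A (y n) \<le> r * r" using Suc yc r by (intro mult_mono) simp_all
    also have "r * r \<le> 1 * r" using r by (intro mult_right_mono) simp_all
    finally show ?case by simp
  qed (simp add: y0 r)
  have step: "dst A ((1/2) \<odot> (x \<oplus> u \<otimes> u)) ((1/2) \<odot> (x \<oplus> v \<otimes> v)) \<le> (1/2) * (nrm A u + nrm A v) * dst A u v"
    if uv: "u \<in> carrier A" "v \<in> carrier A" for u v
  proof -
    have "dst A ((1/2) \<odot> (x \<oplus> u \<otimes> u)) ((1/2) \<odot> (x \<oplus> v \<otimes> v)) = (1/2) * dst A (x \<oplus> u \<otimes> u) (x \<oplus> v \<otimes> v)"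
      by (subst dst_smult) (simp_all add: x uv)
    also have "\<dots> \<le> (1/2) * dst A (u \<otimes> u) (v \<otimes> v)"
      using dst_add[OF x(1) m_closed[OF uv(1) uv(1)] x(1) m_closed[OF uv(2) uv(2)]] x by simp
    also have "\<dots> \<le> (1/2) * (nrm A u * dst A u v + dst A u v * nrm A v)"
      using dst_mult[OF uv(1) uv(1) uv(2) uv(2)] by simp
    finally show ?thesis by (simp add: algebra_simps)
  qed
  have geo: "dst A (y n) (y (n + k)) \<le> r ^ n" for n k
  proof (induct n)
    case 0
    have "dst A (y 0) (y k) = nrm A (y k)" using dst_sym[OF yc yc, of 0 k] by (simp add: y0 dst_zero_right yc)
    with yn[of k] r show ?case by simp
  next
    case (Suc n)
    have "dst A (y (Suc n)) (y (Suc n + k)) \<le> (1/2) * (nrm A (y n) + nrm A (y (n + k))) * dst A (y n) (y (n + k))"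
      using step[OF yc[of n] yc[of "n + k"]] by (simp add: yS)
    also have "\<dots> \<le> r * r ^ n"
      using yn[of n] yn[of "n + k"] Suc r yc by (intro mult_mono) simp_all
    finally show ?case by simp
  qed
  have "cauchy_seq A y"
    unfolding cauchy_seq_def
  proof (intro conjI allI impI yc)
    fix e :: real assume "0 < e"
    with LIMSEQ_realpow_zero[OF r] have "\<forall>\<^sub>F n in sequentially. r ^ n < e" by (rule order_tendstoD(2))
    then obtain N where N: "\<And>n. n \<ge> N \<Longrightarrow> r ^ n < e" by (auto simp: eventually_sequentially)
    have "dst A (y m) (y n) < e" if "m \<ge> N" "n \<ge> N" for m n
    proof (cases "m \<le> n")
      case True
      then show ?thesis using geo[of m "n - m"] N[OF that(1)] by simp
    next
      case False
      then show ?thesis using geo[of n "m - n"] N[OF that(2)] dst_sym[OF yc yc, of m n] by simp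
    qed
    then show "\<exists>N. \<forall>m\<ge>N. \<forall>n\<ge>N. dst A (y m) (y n) < e" by blast
  qed
  then obtain l where l: "l \<in> carrier A" "converges_to A y l" using cstar_algebra.complete[OF A] by blast
  have ld: "(\<lambda>n. dst A (y n) l) \<longlonglongrightarrow> 0" using l by (simp add: converges_to_def)
  have "converges_to A y (star A l)"
    unfolding converges_to_def
  proof (rule squeeze_zero[OF ld])
    show "dst A (y n) (star A l) \<le> dst A (y n) l" for n
      using dst_star[OF yc[of n] l(1)] ys by simp
  qed (simp add: yc l)
  then have ls: "star A l = l" by (rule limit_unique[OF _ l(2) yc star_closed[OF l(1)] l(1)])
  have "converges_to A (\<lambda>n. y (Suc n)) ((1/2) \<odot> (x \<oplus> l \<otimes> l))"
    unfolding converges_to_def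
  proof (rule squeeze_zero[OF tendsto_mult_right_zero[OF ld, of "(1/2) * (r + nrm A l)"]])
    fix n
    have "dst A (y (Suc n)) ((1/2) \<odot> (x \<oplus> l \<otimes> l)) \<le> (1/2) * (nrm A (y n) + nrm A l) * dst A (y n) l"
      unfolding yS by (rule step[OF yc l(1)])
    also have "\<dots> \<le> (1/2) * (r + nrm A l) * dst A (y n) l"
      using yn[of n] yc l(1) by (intro mult_right_mono) simp_all
    finally show "dst A (y (Suc n)) ((1/2) \<odot> (x \<oplus> l \<otimes> l)) \<le> (1/2) * (r + nrm A l) * dst A (y n) l" .
  qed (simp add: yc l x)
  moreover have "converges_to A (\<lambda>n. y (Suc n)) l"
    using LIMSEQ_Suc[OF ld] by (simp add: converges_to_def)
  ultimately have le: "l = (1/2) \<odot> (x \<oplus> l \<otimes> l)"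
    by (intro limit_unique[of "\<lambda>n. y (Suc n)" l] yc l sm_closed a_closed m_closed x)
  have "l \<oplus> l = (1/2) \<odot> (x \<oplus> l \<otimes> l) \<oplus> (1/2) \<odot> (x \<oplus> l \<otimes> l)" using le by simp
  also have "\<dots> = x \<oplus> l \<otimes> l" using sm_ladd[of "x \<oplus> l \<otimes> l" "1/2" "1/2"] x l by simp
  finally have ll: "l \<oplus> l = x \<oplus> l \<otimes> l" .
  define k where "k = \<one> \<ominus> l"
  have k: "k \<in> carrier A" "star A k = k"
    using l ls star_smult[OF l(1), of "-1"] by (simp_all add: k_def minus_eq star_add sm_minus)
  have "k \<otimes> k \<oplus> (l \<oplus> l) = \<one> \<oplus> l \<otimes> l"
    using l(1) by (simp add: k_def minus_eq l_distr r_distr l_minus r_minus minus_add a_ac r_neg1 r_neg2 r_neg l_neg)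
  then have "(k \<otimes> k \<oplus> x) \<oplus> l \<otimes> l = \<one> \<oplus> l \<otimes> l"
    unfolding ll using k l x by (simp add: a_assoc)
  then have "k \<otimes> k \<oplus> x = \<one>" using k l x by (simp add: add.right_cancel)
  with k that show thesis by blast
qed

text \<open>
  If \<open>\<parallel>b\<parallel> < 1\<close>, then \<open>1 - b\<^sup>* b\<close> is the square of a self-adjoint \<open>k\<close>, so that
  \<open>\<pi>(b)\<^sup>* \<pi>(b) + \<pi>(k)\<^sup>* \<pi>(k)\<close> is a projection and \<open>\<pi>(b)\<close> is a contraction.
\<close>

theorem star_rep_contractive:
  fixes \<pi> :: "'a \<Rightarrow> 'i op"
  assumes A: "cstar_algebra A" and \<pi>: "star_hom A bounded_ops \<pi>" and a: "a \<in> carrier A"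
  shows "op_norm (\<pi> a) \<le> nrm A a"
proof -
  interpret pre_cstar A by (rule cstar_algebra_pre[OF A])
  note h = star_homD[OF \<pi>]
  let ?P = "\<pi> \<one>\<^bsub>A\<^esub>"
  have P: "?P \<in> carrier bounded_ops" "?P \<otimes>\<^bsub>bounded_ops\<^esub> ?P = ?P" "star bounded_ops ?P = ?P"
    using h(1) star_hom_one[OF \<pi>] by simp_all
  have "op_norm ?P = (op_norm ?P)\<^sup>2" using bops.nrm_star_self[OF P(1)] P by (simp add: nrm_bounded_ops)
  then have P1: "op_norm ?P \<le> 1"
    by (metis mult_cancel_left1 order.refl power2_eq_square zero_le_one)
  have 1: "op_norm (\<pi> b) \<le> 1" if b: "b \<in> carrier A" "nrm A b < 1" for b
  proof -
    have "nrm A (star A b \<otimes>\<^bsub>A\<^esub> b) < 1"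
      using b nrm_star_self[OF b(1)] by (simp add: power_less_one_iff abs_square_less_1)
    then obtain k where k: "k \<in> carrier A" "star A k = k" "k \<otimes>\<^bsub>A\<^esub> k \<oplus>\<^bsub>A\<^esub> star A b \<otimes>\<^bsub>A\<^esub> b = \<one>\<^bsub>A\<^esub>"
      using sqrt_one_minus[OF A, of "star A b \<otimes>\<^bsub>A\<^esub> b"] b by (auto simp: star_mult)
    have "star bounded_ops (\<pi> b) \<otimes>\<^bsub>bounded_ops\<^esub> \<pi> b \<oplus>\<^bsub>bounded_ops\<^esub> star bounded_ops (\<pi> k) \<otimes>\<^bsub>bounded_ops\<^esub> \<pi> k
        = \<pi> (k \<otimes>\<^bsub>A\<^esub> k \<oplus>\<^bsub>A\<^esub> star A b \<otimes>\<^bsub>A\<^esub> b)"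
      using k(1,2) b h h(5)[OF k(1)] by (simp add: bops.a_comm)
    then have "op_norm (\<pi> b) \<le> op_norm ?P"
      using op_norm_le_of_sum_squares[OF h(1)[OF b(1)] h(1)[OF k(1)] P(1)] P k(3) by simp
    with P1 show ?thesis by simp
  qed
  show ?thesis
  proof (rule field_le_epsilon)
    fix e :: real assume e: "0 < e"
    define t where "t = nrm A a + e"
    have t: "t > 0" using e nrm_nonneg[OF a] by (simp add: t_def)
    have ct: "cmod (of_real (1 / t)) = 1 / t" using t by (simp only: norm_of_real) simp
    have "nrm A (of_real (1 / t) \<odot>\<^bsub>A\<^esub> a) < 1"
      unfolding nrm_smult[OF a] ct using t e by (simp add: t_def)
    from 1[OF sm_closed[OF a] this] have "(1 / t) * op_norm (\<pi> a) \<le> 1"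
      using bops.nrm_smult[OF h(1)[OF a], of "of_real (1 / t)"] t h(4)[OF a]
      unfolding nrm_bounded_ops ct by simp
    with t show "op_norm (\<pi> a) \<le> nrm A a + e" by (simp add: t_def field_simps)
  qed
qed

section \<open>The spatial tensor product as a completion\<close>

lemma kron_sum_simps:
  "kron_sum \<pi> \<rho> {#} = \<zero>\<^bsub>bounded_ops\<^esub>"
  "kron_sum \<pi> \<rho> (add_mset (a, b) M) = kron (\<pi> a) (\<rho> b) \<oplus>\<^bsub>bounded_ops\<^esub> kron_sum \<pi> \<rho> M"
  "kron_sum \<pi> \<rho> (M + N) = kron_sum \<pi> \<rho> M \<oplus>\<^bsub>bounded_ops\<^esub> kron_sum \<pi> \<rho> N"
  by (auto simp: kron_sum_def kron_def bounded_ops_sel fun_eq_iff)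

lemma kron_sum_single [simp]: "kron_sum \<pi> \<rho> {#(a, b)#} = kron (\<pi> a) (\<rho> b)"
  by (auto simp: kron_sum_def kron_def fun_eq_iff)

lemma kron_sum_image: "kron_sum \<pi> \<rho> (image_mset (map_prod f g) M) = kron_sum (\<lambda>a. \<pi> (f a)) (\<lambda>b. \<rho> (g b)) M"
  by (simp add: kron_sum_def fun_eq_iff image_mset.compositionality comp_def case_prod_unfold)

lemma formal_tensor_sel [simp]:
  "M \<in> carrier (formal_tensor A B) \<longleftrightarrow> set_mset M \<subseteq> carrier A \<times> carrier B"
  "\<one>\<^bsub>formal_tensor A B\<^esub> = {#(\<one>\<^bsub>A\<^esub>, \<one>\<^bsub>B\<^esub>)#}" "\<zero>\<^bsub>formal_tensor A B\<^esub> = {#}"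
  "M \<oplus>\<^bsub>formal_tensor A B\<^esub> N = M + N"
  "c \<odot>\<^bsub>formal_tensor A B\<^esub> M = image_mset (\<lambda>(a, b). (c \<odot>\<^bsub>A\<^esub> a, b)) M"
  "star (formal_tensor A B) M = image_mset (\<lambda>(a, b). (star A a, star B b)) M"
  "M \<otimes>\<^bsub>formal_tensor A B\<^esub> N = (\<Sum>(a, b)\<in>#M. image_mset (\<lambda>(a', b'). (a \<otimes>\<^bsub>A\<^esub> a', b \<otimes>\<^bsub>B\<^esub> b')) N)"
  by (simp_all add: formal_tensor_def)

lemma formal_tensor_nrm:
  "nrm (formal_tensor A B) M = (SUP (\<pi>, \<rho>)\<in>star_reps A \<times> star_reps B. op_norm (kron_sum \<pi> \<rho> M))"
  by (simp add: formal_tensor_def)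

definition tensor_reps :: "('a, 'm) cstar_scheme \<Rightarrow> ('b, 'k) cstar_scheme \<Rightarrow> (('a \<times> 'b) multiset \<Rightarrow> ('a \<times> 'b) op) set" where
  "tensor_reps A B = (\<lambda>(\<pi>, \<rho>). kron_sum \<pi> \<rho>) ` (star_reps A \<times> star_reps B)"

locale cstar_pair =
  fixes A :: "('a, 'm) cstar_scheme" and B :: "('b, 'k) cstar_scheme"
  assumes cA: "cstar_algebra A" and cB: "cstar_algebra B"
begin

sublocale A: pre_cstar A by (rule cstar_algebra_pre[OF cA])
sublocale B: pre_cstar B by (rule cstar_algebra_pre[OF cB])

abbreviation "FT \<equiv> formal_tensor A B"

context
  fixes \<pi> :: "'a \<Rightarrow> 'i op" and \<rho> :: "'b \<Rightarrow> 'j op"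
  assumes \<pi>: "star_hom A bounded_ops \<pi>" and \<rho>: "star_hom B bounded_ops \<rho>"
begin

lemma kron_sum_in: "M \<in> carrier FT \<Longrightarrow> kron_sum \<pi> \<rho> M \<in> carrier bounded_ops"
proof (induct M)
  case (add x M)
  then show ?case using star_homD(1)[OF \<pi>] star_homD(1)[OF \<rho>] by (cases x) (simp add: kron_sum_simps)
qed (simp add: kron_sum_simps)

lemma kron_sum_smult: "M \<in> carrier FT \<Longrightarrow> kron_sum \<pi> \<rho> (c \<odot>\<^bsub>FT\<^esub> M) = c \<odot>\<^bsub>bounded_ops\<^esub> kron_sum \<pi> \<rho> M"
proof (induct M)
  case (add x M)
  then show ?case using star_homD(4)[OF \<pi>] star_homD(1)[OF \<pi>] star_homD(1)[OF \<rho>] kron_sum_in[of M]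
    by (cases x) (simp add: kron_sum_simps kron_smult bops.sm_radd)
qed (simp add: kron_sum_simps)

lemma kron_sum_star: "M \<in> carrier FT \<Longrightarrow> kron_sum \<pi> \<rho> (star FT M) = star bounded_ops (kron_sum \<pi> \<rho> M)"
proof (induct M)
  case (add x M)
  then show ?case using star_homD(5)[OF \<pi>] star_homD(5)[OF \<rho>] star_homD(1)[OF \<pi>] star_homD(1)[OF \<rho>] kron_sum_in[of M]
    by (cases x) (simp add: kron_sum_simps kron_star bops.star_add)
qed (simp add: kron_sum_simps)

lemma kron_sum_mult_single:
  assumes a: "a \<in> carrier A" "b \<in> carrier B" and N: "N \<in> carrier FT"
  shows "kron_sum \<pi> \<rho> (image_mset (\<lambda>(a', b'). (a \<otimes>\<^bsub>A\<^esub> a', b \<otimes>\<^bsub>B\<^esub> b')) N) =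
    kron (\<pi> a) (\<rho> b) \<otimes>\<^bsub>bounded_ops\<^esub> kron_sum \<pi> \<rho> N"
  using N
proof (induct N)
  case (add x M)
  then show ?case using star_homD(3)[OF \<pi>] star_homD(3)[OF \<rho>] star_homD(1)[OF \<pi>] star_homD(1)[OF \<rho>] kron_sum_in[of M] a
    by (cases x) (simp add: kron_sum_simps kron_mult bops.r_distr)
qed (use a star_homD(1)[OF \<pi>] star_homD(1)[OF \<rho>] in \<open>simp add: kron_sum_simps\<close>)

lemma kron_sum_mult:
  assumes "M \<in> carrier FT" and N: "N \<in> carrier FT"
  shows "kron_sum \<pi> \<rho> (M \<otimes>\<^bsub>FT\<^esub> N) = kron_sum \<pi> \<rho> M \<otimes>\<^bsub>bounded_ops\<^esub> kron_sum \<pi> \<rho> N"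
  using assms(1)
proof (induct M)
  case (add x M)
  obtain a b where x: "x = (a, b)" by force
  with add have ab: "a \<in> carrier A" "b \<in> carrier B" "M \<in> carrier FT" by auto
  have "kron_sum \<pi> \<rho> (add_mset x M \<otimes>\<^bsub>FT\<^esub> N) =
      kron (\<pi> a) (\<rho> b) \<otimes>\<^bsub>bounded_ops\<^esub> kron_sum \<pi> \<rho> N \<oplus>\<^bsub>bounded_ops\<^esub> kron_sum \<pi> \<rho> M \<otimes>\<^bsub>bounded_ops\<^esub> kron_sum \<pi> \<rho> N"
    using kron_sum_mult_single[OF ab(1,2) N] add(1)[OF ab(3)] by (simp add: x kron_sum_simps)
  with ab star_homD(1)[OF \<pi>] star_homD(1)[OF \<rho>] kron_sum_in[OF ab(3)] kron_sum_in[OF N]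
  show ?case by (simp add: x kron_sum_simps bops.l_distr)
qed (use kron_sum_in[OF N] in \<open>simp add: kron_sum_simps\<close>)

text \<open>
  The spatial seminorm is finite because representations of C*-algebras are contractive.
\<close>

lemma kron_sum_bound:
  "M \<in> carrier FT \<Longrightarrow> op_norm (kron_sum \<pi> \<rho> M) \<le> (\<Sum>(a, b)\<in>#M. nrm A a * nrm B b)"
proof (induct M)
  case empty
  then show ?case by (simp add: kron_sum_simps flip: nrm_bounded_ops)
next
  case (add x M)
  obtain a b where x: "x = (a, b)" by force
  with add have ab: "a \<in> carrier A" "b \<in> carrier B" "M \<in> carrier FT" by auto
  note c = star_homD(1)[OF \<pi> ab(1)] star_homD(1)[OF \<rho> ab(2)]
  have "op_norm (kron (\<pi> a) (\<rho> b)) \<le> op_norm (\<pi> a) * op_norm (\<rho> b)" by (rule op_norm_kron_le[OF c])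
  also have "\<dots> \<le> nrm A a * nrm B b"
    using star_rep_contractive[OF cA \<pi> ab(1)] star_rep_contractive[OF cB \<rho> ab(2)] bops.nrm_nonneg[OF c(2)] ab
    by (intro mult_mono) (simp_all add: nrm_bounded_ops)
  finally show ?case
    using bops.nrm_add[OF kron_closed[OF c] kron_sum_in[OF ab(3)]] add(1)[OF ab(3)]
    by (simp add: x kron_sum_simps nrm_bounded_ops)
qed

lemma kron_sum_unit:
  assumes "M \<in> carrier FT"
  shows "kron_sum \<pi> \<rho> \<one>\<^bsub>FT\<^esub> \<otimes>\<^bsub>bounded_ops\<^esub> kron_sum \<pi> \<rho> M = kron_sum \<pi> \<rho> M"
    "kron_sum \<pi> \<rho> M \<otimes>\<^bsub>bounded_ops\<^esub> kron_sum \<pi> \<rho> \<one>\<^bsub>FT\<^esub> = kron_sum \<pi> \<rho> M"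
  using assms
proof (induct M)
  case empty
  case 1
  show ?case using star_homD(1)[OF \<pi>] star_homD(1)[OF \<rho>] by (simp add: kron_sum_simps)
  case 2
  show ?case using star_homD(1)[OF \<pi>] star_homD(1)[OF \<rho>] by (simp add: kron_sum_simps)
next
  case (add x M)
  obtain a b where x: "x = (a, b)" by force
  {
    assume "add_mset x M \<in> carrier FT"
    with x have ab: "a \<in> carrier A" "b \<in> carrier B" "M \<in> carrier FT" by auto
    note c = star_homD(1)[OF \<pi> ab(1)] star_homD(1)[OF \<rho> ab(2)] star_homD(1)[OF \<pi> A.one_closed] star_homD(1)[OF \<rho> B.one_closed]
      kron_sum_in[OF ab(3)]
    note c ab add(1)[OF ab(3)] add(2)[OF ab(3)] A.star_hom_one[OF \<pi>] B.star_hom_one[OF \<rho>]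
  } note * = this
  case 1
  from *[OF this] show ?case by (simp add: x kron_sum_simps bops.r_distr kron_mult)
  case 2
  from *[OF this] show ?case by (simp add: x kron_sum_simps bops.l_distr kron_mult)
qed

end

lemma zero_star_rep: "(\<lambda>_. \<zero>\<^bsub>bounded_ops\<^esub>) \<in> star_reps A" "(\<lambda>_. \<zero>\<^bsub>bounded_ops\<^esub>) \<in> star_reps B"
  by (simp_all add: star_reps_def star_hom_def)

sublocale FT: raw_cstar "bounded_ops :: ('a \<times> 'b) op cstar" "formal_tensor A B" "tensor_reps A B"
proof unfold_locales
  show "tensor_reps A B \<noteq> {}" using zero_star_rep by (auto simp: tensor_reps_def)
next
  fix x y :: "('a \<times> 'b) multiset" assume "x \<in> carrier FT" "y \<in> carrier FT"
  then show "x \<otimes>\<^bsub>FT\<^esub> y \<in> carrier FT" by (auto; blast)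
next
  fix M :: "('a \<times> 'b) multiset" assume M: "M \<in> carrier FT"
  show "nrm FT M = (SUP \<phi>\<in>tensor_reps A B. nrm bounded_ops (\<phi> M))"
    unfolding tensor_reps_def image_image formal_tensor_nrm nrm_bounded_ops by (simp add: case_prod_unfold)
  show "bdd_above ((\<lambda>\<phi>. nrm bounded_ops (\<phi> M)) ` tensor_reps A B)"
    by (rule bdd_aboveI2[where M = "\<Sum>(a, b)\<in>#M. nrm A a * nrm B b"])
      (use kron_sum_bound M in \<open>auto simp: tensor_reps_def star_reps_def nrm_bounded_ops\<close>)
next
  fix \<phi> assume "\<phi> \<in> tensor_reps A B"
  then obtain \<pi> \<rho> where \<phi>: "\<phi> = kron_sum \<pi> \<rho>" and h: "star_hom A bounded_ops \<pi>" "star_hom B bounded_ops \<rho>"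
    by (auto simp: tensor_reps_def star_reps_def)
  show "\<phi> \<zero>\<^bsub>FT\<^esub> = \<zero>\<^bsub>bounded_ops\<^esub>" by (simp add: \<phi> kron_sum_simps)
  fix M :: "('a \<times> 'b) multiset" assume M: "M \<in> carrier FT"
  show "\<phi> M \<in> carrier bounded_ops" "\<phi> (c \<odot>\<^bsub>FT\<^esub> M) = c \<odot>\<^bsub>bounded_ops\<^esub> \<phi> M" "\<phi> (star FT M) = star bounded_ops (\<phi> M)"
    "\<phi> \<one>\<^bsub>FT\<^esub> \<otimes>\<^bsub>bounded_ops\<^esub> \<phi> M = \<phi> M" "\<phi> M \<otimes>\<^bsub>bounded_ops\<^esub> \<phi> \<one>\<^bsub>FT\<^esub> = \<phi> M" for c
    unfolding \<phi> by (rule kron_sum_in[OF h M] kron_sum_smult[OF h M] kron_sum_star[OF h M] kron_sum_unit[OF h M])+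
  fix N :: "('a \<times> 'b) multiset" assume N: "N \<in> carrier FT"
  show "\<phi> (M \<oplus>\<^bsub>FT\<^esub> N) = \<phi> M \<oplus>\<^bsub>bounded_ops\<^esub> \<phi> N" by (simp add: \<phi> kron_sum_simps)
  show "\<phi> (M \<otimes>\<^bsub>FT\<^esub> N) = \<phi> M \<otimes>\<^bsub>bounded_ops\<^esub> \<phi> N" unfolding \<phi> by (rule kron_sum_mult[OF h M N])
qed (auto simp: kron_sum_simps)

lemma cstar_algebra_min_tensor: "cstar_algebra (min_tensor A B)"
  unfolding min_tensor_def by (rule FT.cstar_algebra_completion)

sublocale T: pre_cstar "min_tensor A B" by (rule cstar_algebra_pre[OF cstar_algebra_min_tensor])

lemma tensor_repsE:
  assumes "\<phi> \<in> tensor_reps A B"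
  obtains \<pi> \<rho> where "\<phi> = kron_sum \<pi> \<rho>" "star_hom A bounded_ops \<pi>" "star_hom B bounded_ops \<rho>"
  using assms by (auto simp: tensor_reps_def star_reps_def)

lemma formal_sum_in [simp]: "M \<in> carrier FT \<Longrightarrow> formal_sum A B M \<in> carrier (min_tensor A B)"
  unfolding formal_sum_def min_tensor_def by (rule FT.completion_embed_in)

lemma tens_in [simp]: "a \<in> carrier A \<Longrightarrow> b \<in> carrier B \<Longrightarrow> tens A B a b \<in> carrier (min_tensor A B)"
  by (simp add: tens_def)

lemma formal_sum_eqI:
  assumes "M \<in> carrier FT" "N \<in> carrier FT"
    and "\<And>\<pi> \<rho>. star_hom A (bounded_ops :: 'a op cstar) \<pi> \<Longrightarrow> star_hom B (bounded_ops :: 'b op cstar) \<rho> \<Longrightarrow>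
      kron_sum \<pi> \<rho> M = kron_sum \<pi> \<rho> N"
  shows "formal_sum A B M = formal_sum A B N"
  unfolding formal_sum_def using assms by (intro FT.embed_eqI) (auto elim!: tensor_repsE)

lemma formal_sum_hom:
  "M \<in> carrier FT \<Longrightarrow> N \<in> carrier FT \<Longrightarrow> formal_sum A B (M + N) = formal_sum A B M \<oplus>\<^bsub>min_tensor A B\<^esub> formal_sum A B N"
  "M \<in> carrier FT \<Longrightarrow> N \<in> carrier FT \<Longrightarrow> formal_sum A B (M \<otimes>\<^bsub>FT\<^esub> N) = formal_sum A B M \<otimes>\<^bsub>min_tensor A B\<^esub> formal_sum A B N"
  "M \<in> carrier FT \<Longrightarrow> formal_sum A B (c \<odot>\<^bsub>FT\<^esub> M) = c \<odot>\<^bsub>min_tensor A B\<^esub> formal_sum A B M"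
  "formal_sum A B {#} = \<zero>\<^bsub>min_tensor A B\<^esub>"
  unfolding formal_sum_def min_tensor_def using FT.embed_hom(1)[of M N] FT.embed_hom(2)[of M N] FT.embed_hom(3)[of M] FT.embed_hom(6)
  by simp_all

lemma formal_sum_add_mset:
  "a \<in> carrier A \<Longrightarrow> b \<in> carrier B \<Longrightarrow> M \<in> carrier FT \<Longrightarrow>
    formal_sum A B (add_mset (a, b) M) = tens A B a b \<oplus>\<^bsub>min_tensor A B\<^esub> formal_sum A B M"
  using formal_sum_hom(1)[of "{#(a, b)#}" M] by (simp add: tens_def)

lemma tens_mult:
  "\<lbrakk>a \<in> carrier A; b \<in> carrier B; a' \<in> carrier A; b' \<in> carrier B\<rbrakk> \<Longrightarrow>
    tens A B a b \<otimes>\<^bsub>min_tensor A B\<^esub> tens A B a' b' = tens A B (a \<otimes>\<^bsub>A\<^esub> a') (b \<otimes>\<^bsub>B\<^esub> b')"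
  using formal_sum_hom(2)[of "{#(a, b)#}" "{#(a', b')#}"] by (simp add: tens_def)

lemma tens_star:
  "\<lbrakk>a \<in> carrier A; b \<in> carrier B\<rbrakk> \<Longrightarrow> star (min_tensor A B) (tens A B a b) = tens A B (star A a) (star B b)"
  using FT.embed_hom(4)[of "{#(a, b)#}"] by (simp add: tens_def formal_sum_def min_tensor_def)

lemma tens_one: "tens A B \<one>\<^bsub>A\<^esub> \<one>\<^bsub>B\<^esub> = \<one>\<^bsub>min_tensor A B\<^esub>"
  using FT.embed_hom(5) by (simp add: tens_def formal_sum_def min_tensor_def)

lemma tens_add_left:
  assumes "a \<in> carrier A" "a' \<in> carrier A" "b \<in> carrier B"
  shows "tens A B (a \<oplus>\<^bsub>A\<^esub> a') b = tens A B a b \<oplus>\<^bsub>min_tensor A B\<^esub> tens A B a' b"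
proof -
  have "formal_sum A B {#(a \<oplus>\<^bsub>A\<^esub> a', b)#} = formal_sum A B ({#(a, b)#} + {#(a', b)#})"
    by (rule formal_sum_eqI) (use assms in \<open>auto simp: kron_sum_simps star_homD kron_add intro!: bops.a_comm\<close>)
  with assms show ?thesis using formal_sum_hom(1)[of "{#(a, b)#}" "{#(a', b)#}"] by (simp add: tens_def)
qed

lemma tens_add_right:
  assumes "a \<in> carrier A" "b \<in> carrier B" "b' \<in> carrier B"
  shows "tens A B a (b \<oplus>\<^bsub>B\<^esub> b') = tens A B a b \<oplus>\<^bsub>min_tensor A B\<^esub> tens A B a b'"
proof -
  have "formal_sum A B {#(a, b \<oplus>\<^bsub>B\<^esub> b')#} = formal_sum A B ({#(a, b)#} + {#(a, b')#})"
    by (rule formal_sum_eqI) (use assms in \<open>auto simp: kron_sum_simps star_homD kron_add intro!: bops.a_comm\<close>)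
  with assms show ?thesis using formal_sum_hom(1)[of "{#(a, b)#}" "{#(a, b')#}"] by (simp add: tens_def)
qed

lemma tens_smult:
  assumes "a \<in> carrier A" "b \<in> carrier B"
  shows "tens A B (c \<odot>\<^bsub>A\<^esub> a) b = c \<odot>\<^bsub>min_tensor A B\<^esub> tens A B a b"
    "tens A B a (c \<odot>\<^bsub>B\<^esub> b) = c \<odot>\<^bsub>min_tensor A B\<^esub> tens A B a b"
proof -
  show 1: "tens A B (c \<odot>\<^bsub>A\<^esub> a) b = c \<odot>\<^bsub>min_tensor A B\<^esub> tens A B a b"
    using assms formal_sum_hom(3)[of "{#(a, b)#}" c] by (simp add: tens_def)
  have "tens A B a (c \<odot>\<^bsub>B\<^esub> b) = tens A B (c \<odot>\<^bsub>A\<^esub> a) b" unfolding tens_def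
    by (rule formal_sum_eqI) (use assms in \<open>auto simp: star_homD kron_smult\<close>)
  with 1 show "tens A B a (c \<odot>\<^bsub>B\<^esub> b) = c \<odot>\<^bsub>min_tensor A B\<^esub> tens A B a b" by simp
qed

lemma nrm_tens_le: "a \<in> carrier A \<Longrightarrow> b \<in> carrier B \<Longrightarrow> nrm (min_tensor A B) (tens A B a b) \<le> nrm A a * nrm B b"
  unfolding tens_def formal_sum_def min_tensor_def
  using kron_sum_bound[of _ _ "{#(a, b)#}"]
  by (subst FT.nrm_embed) (auto intro!: FT.nrm_le elim!: tensor_repsE simp: nrm_bounded_ops)

lemma dst_tens_left:
  "a \<in> carrier A \<Longrightarrow> a' \<in> carrier A \<Longrightarrow> b \<in> carrier B \<Longrightarrow> dst (min_tensor A B) (tens A B a b) (tens A B a' b) \<le> dst A a a' * nrm B b"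
  using nrm_tens_le[of "a \<oplus>\<^bsub>A\<^esub> (-1) \<odot>\<^bsub>A\<^esub> a'" b] by (simp add: dst_def tens_add_left tens_smult)

lemma dst_tens_right:
  "a \<in> carrier A \<Longrightarrow> b \<in> carrier B \<Longrightarrow> b' \<in> carrier B \<Longrightarrow> dst (min_tensor A B) (tens A B a b) (tens A B a b') \<le> nrm A a * dst B b b'"
  using nrm_tens_le[of a "b \<oplus>\<^bsub>B\<^esub> (-1) \<odot>\<^bsub>B\<^esub> b'"] by (simp add: dst_def tens_add_right tens_smult)

lemma finsum_tens:
  assumes "finite I" "\<And>k. k \<in> I \<Longrightarrow> f k \<in> carrier A" "\<And>k. k \<in> I \<Longrightarrow> g k \<in> carrier B"
  shows "finsum (min_tensor A B) (\<lambda>k. tens A B (f k) (g k)) I = formal_sum A B (image_mset (\<lambda>k. (f k, g k)) (mset_set I))"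
  using assms
proof (induct I rule: finite_induct)
  case (insert k I)
  have "image_mset (\<lambda>k. (f k, g k)) (mset_set I) \<in> carrier FT" using insert by auto
  with insert show ?case by (simp add: formal_sum_add_mset Pi_def)
qed (simp add: formal_sum_hom)

end

section \<open>Evaluation of *-polynomials under *-homomorphisms\<close>

context pre_cstar begin

lemma eval_poly_in: "(\<And>x. g x \<in> carrier A) \<Longrightarrow> eval_poly A g p \<in> carrier A"
  by (induct p) simp_all

lemma eval_poly_star_hom:
  assumes h: "star_hom A B f" and g: "\<And>x. g x \<in> carrier A"
  shows "f (eval_poly A g p) = eval_poly (corner B (f \<one>)) (\<lambda>x. f (g x)) p"
  by (induct p) (simp_all add: star_homD[OF h] eval_poly_in[OF g])

end

context raw_cstar begin

lemma eval_poly_raw_in: "(\<And>x. g x \<in> carrier F) \<Longrightarrow> eval_poly F g p \<in> carrier F"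
  by (induct p) simp_all

end

lemma (in cstar_pair) eval_poly_kron_sum:
  assumes h: "star_hom A bounded_ops \<pi>" "star_hom B bounded_ops \<rho>" and g: "\<And>x. g x \<in> carrier FT"
  shows "kron_sum \<pi> \<rho> (eval_poly FT g p) =
    eval_poly (corner bounded_ops (kron (\<pi> \<one>\<^bsub>A\<^esub>) (\<rho> \<one>\<^bsub>B\<^esub>))) (\<lambda>x. kron_sum \<pi> \<rho> (g x)) p"
proof (induct p)
  case (Add_poly p q)
  then show ?case by (simp add: kron_sum_simps)
next
  case (Mult_poly p q)
  show ?case using kron_sum_mult[OF h FT.eval_poly_raw_in[of g p, OF g] FT.eval_poly_raw_in[of g q, OF g]] Mult_poly
    by (simp del: formal_tensor_sel(7))
next
  case (Star_poly p)
  show ?case using kron_sum_star[OF h FT.eval_poly_raw_in[of g p, OF g]] Star_poly by (simp del: formal_tensor_sel)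
next
  case (Const_poly c)
  show ?case using kron_sum_smult[OF h, of "{#(\<one>\<^bsub>A\<^esub>, \<one>\<^bsub>B\<^esub>)#}" c] by simp
qed simp

section \<open>Reduction to countable index sets\<close>

text \<open>
  The span of the coordinates in \<open>J\<close> and that of the others are both invariant under \<open>M\<close>.
\<close>

definition reduces :: "'i set \<Rightarrow> 'i op \<Rightarrow> bool" where
  "reduces J M \<longleftrightarrow> (\<forall>i j. M i j \<noteq> 0 \<longrightarrow> (i \<in> J \<longleftrightarrow> j \<in> J))"

lemma l2b_countable: "l2b x B \<Longrightarrow> countable {i. x i \<noteq> 0}"
  using abs_summable_countable[of "\<lambda>i. (cmod (x i))\<^sup>2" UNIV] l2b_summable[of x B] by simp

text \<open>
  Rows and columns of bounded operators have countable support, so only countably many coordinates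
  are added when \<open>F\<close> is closed under countably many operators.
\<close>

lemma countable_reducing_set:
  assumes T: "countable T" "T \<subseteq> carrier bounded_ops" and F: "countable F"
  obtains J where "countable J" "F \<subseteq> J" "\<And>M. M \<in> T \<Longrightarrow> reduces J M"
proof -
  define st where "st S = S \<union> (\<Union>M\<in>T. \<Union>i\<in>S. {j. M i j \<noteq> 0} \<union> {j. M j i \<noteq> 0})" for S
  define J where "J = (\<Union>n. (st ^^ n) F)"
  have c: "countable {j. M i j \<noteq> 0}" "countable {j. M j i \<noteq> 0}" if M: "M \<in> T" for M i
  proof -
    from M T have "M \<in> carrier bounded_ops" by blast
    then obtain C where "op_bound M C" by (auto simp: bounded_ops_sel)
    from l2b_countable[OF op_bound_row[OF this]] l2b_countable[OF op_bound_col[OF this]]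
    show "countable {j. M i j \<noteq> 0}" "countable {j. M j i \<noteq> 0}" .
  qed
  have "countable (st S)" if "countable S" for S
    unfolding st_def using that T c by (intro countable_Un countable_UN) auto
  then have "countable ((st ^^ n) F)" for n by (induct n) (auto simp: F)
  then have "countable J" by (auto simp: J_def)
  moreover have "F \<subseteq> J" unfolding J_def using UN_upper[of 0 UNIV "\<lambda>n. (st ^^ n) F"] by simp
  moreover have "reduces J M" if M: "M \<in> T" for M
    unfolding reduces_def
  proof (intro allI impI iffI)
    fix i j assume ij: "M i j \<noteq> 0"
    { assume "i \<in> J"
      then obtain n where "i \<in> (st ^^ n) F" by (auto simp: J_def)
      with M ij have "j \<in> (st ^^ Suc n) F" by (auto simp: st_def)
      then show "j \<in> J" unfolding J_def by blast }
    { assume "j \<in> J"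
      then obtain n where "j \<in> (st ^^ n) F" by (auto simp: J_def)
      with M ij have "i \<in> (st ^^ Suc n) F" by (auto simp: st_def)
      then show "i \<in> J" unfolding J_def by blast }
  qed
  ultimately show thesis using that by blast
qed

lemma reduces_ops:
  "reduces J M \<Longrightarrow> reduces J N \<Longrightarrow> reduces J (M \<oplus>\<^bsub>bounded_ops\<^esub> N)"
  "reduces J M \<Longrightarrow> reduces J (c \<odot>\<^bsub>bounded_ops\<^esub> M)"
  "reduces J M \<Longrightarrow> reduces J (star bounded_ops M)"
  "reduces J \<one>\<^bsub>bounded_ops\<^esub>"
proof -
  show "reduces J M \<Longrightarrow> reduces J N \<Longrightarrow> reduces J (M \<oplus>\<^bsub>bounded_ops\<^esub> N)"
    unfolding reduces_def bounded_ops_sel by (metis add_0)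
qed (auto simp: reduces_def bounded_ops_sel)

lemma reduces_mult:
  assumes M: "reduces J M" and N: "reduces J N"
  shows "reduces J (M \<otimes>\<^bsub>bounded_ops\<^esub> N)"
  unfolding reduces_def
proof (intro allI impI)
  fix i k assume nz: "(M \<otimes>\<^bsub>bounded_ops\<^esub> N) i k \<noteq> 0"
  show "i \<in> J \<longleftrightarrow> k \<in> J"
  proof (rule ccontr)
    assume ne: "\<not> (i \<in> J \<longleftrightarrow> k \<in> J)"
    have "M i j * N j k = 0" for j using M N ne unfolding reduces_def by (metis mult_eq_0_iff)
    with nz show False by (simp add: bounded_ops_sel)
  qed
qed

lemma reduces_eval_poly:
  assumes "\<And>x. reduces J (g x)" "reduces J P"
  shows "reduces J (eval_poly (corner bounded_ops P) g p)"
  using assms by (induct p) (simp_all add: reduces_ops reduces_mult)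

lemma compress_ops:
  "compress Y b (M \<oplus>\<^bsub>bounded_ops\<^esub> N) = compress Y b M \<oplus>\<^bsub>bounded_ops\<^esub> compress Y b N"
  "compress Y b (c \<odot>\<^bsub>bounded_ops\<^esub> M) = c \<odot>\<^bsub>bounded_ops\<^esub> compress Y b M"
  "compress Y b (star bounded_ops M) = star bounded_ops (compress Y b M)"
  by (auto simp: compress_def bounded_ops_sel fun_eq_iff)

lemma compress_one: "inj b \<Longrightarrow> compress UNIV b \<one>\<^bsub>bounded_ops\<^esub> = \<one>\<^bsub>bounded_ops\<^esub>"
  by (auto simp: compress_def bounded_ops_sel fun_eq_iff inj_eq)

lemma compress_mult:
  assumes b: "inj_on b Y" and M: "reduces (b ` Y) M"
  shows "compress Y b (M \<otimes>\<^bsub>bounded_ops\<^esub> N) = compress Y b M \<otimes>\<^bsub>bounded_ops\<^esub> compress Y b N"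
proof (intro ext)
  fix x z
  show "compress Y b (M \<otimes>\<^bsub>bounded_ops\<^esub> N) x z = (compress Y b M \<otimes>\<^bsub>bounded_ops\<^esub> compress Y b N) x z"
  proof (cases "x \<in> Y \<and> z \<in> Y")
    case True
    then have "compress Y b (M \<otimes>\<^bsub>bounded_ops\<^esub> N) x z = (\<Sum>\<^sub>\<infinity>j. M (b x) j * N j (b z))"
      by (simp add: compress_def bounded_ops_sel)
    also have "\<dots> = infsum (\<lambda>j. M (b x) j * N j (b z)) (b ` Y)"
      using M True by (intro infsum_cong_neutral) (auto simp: reduces_def)
    also have "\<dots> = infsum (\<lambda>y. M (b x) (b y) * N (b y) (b z)) Y"
      by (simp add: infsum_reindex[OF b] comp_def)
    also have "\<dots> = (\<Sum>\<^sub>\<infinity>y. compress Y b M x y * compress Y b N y z)"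
      by (rule infsum_cong_neutral) (use True in \<open>auto simp: compress_def\<close>)
    finally show ?thesis by (simp add: bounded_ops_sel)
  next
    case False
    then have "compress Y b M x y * compress Y b N y z = 0" for y by (auto simp: compress_def)
    then have "(compress Y b M \<otimes>\<^bsub>bounded_ops\<^esub> compress Y b N) x z = 0"
      unfolding bounded_ops_sel by (intro infsum_0)
    moreover have "compress Y b (M \<otimes>\<^bsub>bounded_ops\<^esub> N) x z = 0" using False by (auto simp: compress_def)
    ultimately show ?thesis by (simp only:)
  qed
qed

lemma compress_in: "inj_on b Y \<Longrightarrow> M \<in> carrier bounded_ops \<Longrightarrow> compress Y b M \<in> carrier bounded_ops"
  by (auto simp: bounded_ops_sel intro: op_bound_compress)

lemma op_bound_by_compressions:
  assumes "0 \<le> C"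
    and "\<And>F. finite F \<Longrightarrow> \<exists>(Y :: 'y set) b. inj_on b Y \<and> F \<subseteq> b ` Y \<and> op_bound (compress Y b M) C"
  shows "op_bound M C"
  unfolding op_bound_def
proof (intro conjI allI impI)
  fix F :: "'a set" and v w :: "'a \<Rightarrow> complex" assume F: "finite F"
  then obtain Y :: "'y set" and b where b: "inj_on b Y" "F \<subseteq> b ` Y" and M: "op_bound (compress Y b M) C"
    using assms(2) by blast
  from F b(2) obtain G where G: "G \<subseteq> Y" "finite G" "F = b ` G" by (metis finite_subset_image)
  have inj: "inj_on b G" using b(1) G(1) by (rule inj_on_subset)
  have "(\<Sum>i\<in>F. \<Sum>j\<in>F. cnj (v i) * M i j * w j) =
      (\<Sum>x\<in>G. \<Sum>y\<in>G. cnj (v (b x)) * compress Y b M x y * w (b y))"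
    unfolding G(3) sum.reindex[OF inj]
    by (intro sum.cong refl) (use G(1) in \<open>auto simp: compress_def subset_iff\<close>)
  moreover have "L2_set (\<lambda>i. cmod (u i)) F = L2_set (\<lambda>x. cmod (u (b x))) G" for u :: "'a \<Rightarrow> complex"
    unfolding G(3) L2_set_def sum.reindex[OF inj] by simp
  ultimately show "cmod (\<Sum>i\<in>F. \<Sum>j\<in>F. cnj (v i) * M i j * w j)
      \<le> C * L2_set (\<lambda>i. cmod (v i)) F * L2_set (\<lambda>i. cmod (w i)) F"
    using op_bound_rect[OF M G(2) G(2), of "\<lambda>x. v (b x)" "\<lambda>x. w (b x)"] by simp
qed (rule assms(1))

lemma countable_infinite_superset:
  assumes "infinite (UNIV :: 'i set)" "finite F"
  obtains K :: "'i set" where "countable K" "infinite K" "F \<subseteq> K"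
proof -
  obtain f :: "nat \<Rightarrow> 'i" where "inj f" using infinite_countable_subset[OF assms(1)] by blast
  then have "infinite (range f)" using range_inj_infinite by blast
  with assms that[of "range f \<union> F"] show thesis by (auto intro: countable_finite)
qed

text \<open>
  A countable family is reduced by a countable infinite set of coordinates containing any given
  finite set; compression to it commutes with *-polynomials and lands in operators on
  \<open>l\<^sup>2(nat)\<close>.
\<close>

lemma op_norm_eval_poly_nat:
  fixes g :: "'g::countable \<Rightarrow> 'i op"
  assumes g: "\<And>x. g x \<in> carrier bounded_ops" and inf: "infinite (UNIV :: 'i set)"
    and C: "\<And>b :: nat \<Rightarrow> 'i. \<lbrakk>inj b; \<And>q. eval_poly bounded_ops (\<lambda>x. compress UNIV b (g x)) q =
        compress UNIV b (eval_poly bounded_ops g q)\<rbrakk> \<Longrightarrow> op_norm (compress UNIV b (eval_poly bounded_ops g p)) \<le> C"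
  shows "op_norm (eval_poly bounded_ops g p) \<le> C"
proof (rule op_norm_le)
  have e: "eval_poly bounded_ops g p \<in> carrier bounded_ops" by (rule bops.eval_poly_in[OF g])
  have ex: "\<exists>b :: nat \<Rightarrow> 'i. inj b \<and> F \<subseteq> range b \<and> op_bound (compress UNIV b (eval_poly bounded_ops g p)) C"
    if F: "finite F" for F :: "'i set"
  proof -
    obtain K where K: "countable K" "infinite K" "F \<subseteq> K" by (rule countable_infinite_superset[OF inf F])
    obtain J where J: "countable J" "K \<subseteq> J" "\<And>M. M \<in> range g \<Longrightarrow> reduces J M"
      by (rule countable_reducing_set[of "range g" K]) (use g K in auto)
    then have "infinite J" using K(2) finite_subset by blast
    then have bij: "bij_betw (from_nat_into J) UNIV J" by (rule bij_betw_from_nat_into[OF J(1)])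
    define b where "b = from_nat_into J"
    have b: "inj b" "range b = J" using bij by (auto simp: b_def bij_betw_def)
    have red: "reduces (range b) (eval_poly bounded_ops g q)" for q
      unfolding b by (induct q) (auto simp: J reduces_ops reduces_mult)
    have ev: "eval_poly bounded_ops (\<lambda>x. compress UNIV b (g x)) q = compress UNIV b (eval_poly bounded_ops g q)" for q
    proof (induct q)
      case (Mult_poly q r)
      then show ?case by (simp add: compress_mult[OF b(1) red])
    qed (simp_all add: compress_ops compress_one[OF b(1)])
    have c: "compress UNIV b (eval_poly bounded_ops g p) \<in> carrier bounded_ops" by (rule compress_in[OF b(1) e])
    then have "op_bound (compress UNIV b (eval_poly bounded_ops g p)) (op_norm (compress UNIV b (eval_poly bounded_ops g p)))"
      by (auto simp: bounded_ops_sel intro: op_bound_op_norm)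
    then have "op_bound (compress UNIV b (eval_poly bounded_ops g p)) C"
      using C[OF b(1) ev] unfolding op_bound_def
      by (meson L2_set_nonneg mult_right_mono order_trans)
    with b K J show ?thesis by (intro exI[of _ b]) auto
  qed
  have "0 \<le> C"
  proof -
    from ex[of "{}"] obtain b :: "nat \<Rightarrow> 'i" where "op_bound (compress UNIV b (eval_poly bounded_ops g p)) C" by auto
    then show ?thesis by (rule op_bound_nonneg)
  qed
  then show "op_bound (eval_poly bounded_ops g p) C"
    by (rule op_bound_by_compressions[where 'y = nat]) (use ex in blast)
qed

text \<open>Indexing the generators by a type makes their countability a sort constraint.\<close>

definition generated_by :: "('a, 'm) cstar_scheme \<Rightarrow> ('g \<Rightarrow> 'a) \<Rightarrow> bool" where
  "generated_by A \<gamma> \<longleftrightarrow> range \<gamma> \<subseteq> carrier A \<and> (\<forall>a\<in>carrier A. \<forall>e>0. \<exists>p. dst A a (eval_poly A \<gamma> p) < e)"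

text \<open>
  The representations in the spatial norm live on \<open>l\<^sup>2\<close> of the set of elements of \<open>A\<close>. A representation
  with another index set is cut down to a countable reducing set around \<open>F\<close>, which is then
  relabelled by elements of \<open>A\<close>; contractivity extends the reduction from the generators to \<open>A\<close>.
\<close>

lemma compress_star_rep:
  fixes \<gamma> :: "'g::countable \<Rightarrow> 'a" and \<sigma> :: "'a \<Rightarrow> 'i op"
  assumes A: "cstar_algebra A" and gen: "generated_by A \<gamma>" and inf: "infinite (UNIV :: 'a set)"
    and \<sigma>: "star_hom A bounded_ops \<sigma>" and F: "finite F"
  obtains Y b where "inj_on b Y" "F \<subseteq> b ` Y" "(\<lambda>a. compress Y b (\<sigma> a)) \<in> star_reps A"
proof -
  interpret pre_cstar A by (rule cstar_algebra_pre[OF A])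
  note h = star_homD[OF \<sigma>]
  have \<gamma>: "\<gamma> x \<in> carrier A" for x using gen by (auto simp: generated_by_def)
  obtain J where J: "countable J" "F \<subseteq> J"
    and red: "\<And>M. M \<in> insert (\<sigma> \<one>\<^bsub>A\<^esub>) (range (\<lambda>x. \<sigma> (\<gamma> x))) \<Longrightarrow> reduces J M"
    by (rule countable_reducing_set[of "insert (\<sigma> \<one>\<^bsub>A\<^esub>) (range (\<lambda>x. \<sigma> (\<gamma> x)))" F])
      (use h(1) \<gamma> F in \<open>auto intro: countable_finite\<close>)
  have redp: "reduces J (\<sigma> (eval_poly A \<gamma> p))" for p
    unfolding eval_poly_star_hom[OF \<sigma> \<gamma>] by (rule reduces_eval_poly) (auto intro: red)
  have reda: "reduces J (\<sigma> a)" if a: "a \<in> carrier A" for a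
    unfolding reduces_def
  proof (intro allI impI, rule ccontr)
    fix i j assume nz: "\<sigma> a i j \<noteq> 0" and ne: "\<not> (i \<in> J \<longleftrightarrow> j \<in> J)"
    then have "0 < cmod (\<sigma> a i j)" by simp
    then obtain p where p: "dst A a (eval_poly A \<gamma> p) < cmod (\<sigma> a i j)"
      using gen a unfolding generated_by_def by metis
    let ?q = "eval_poly A \<gamma> p"
    have q: "?q \<in> carrier A" by (rule eval_poly_in[OF \<gamma>])
    let ?d = "a \<oplus>\<^bsub>A\<^esub> (-1) \<odot>\<^bsub>A\<^esub> ?q"
    have d: "?d \<in> carrier A" using a q by simp
    have "\<sigma> ?q i j = 0" using redp ne by (auto simp: reduces_def)
    then have "\<sigma> ?d i j = \<sigma> a i j" using a q h by (simp add: bounded_ops_sel)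
    moreover have "cmod (\<sigma> ?d i j) \<le> op_norm (\<sigma> ?d)"
      using h(1)[OF d] by (auto simp: bounded_ops_sel intro: op_bound_entry[OF op_bound_op_norm])
    moreover have "op_norm (\<sigma> ?d) \<le> dst A a ?q"
      using star_rep_contractive[OF A \<sigma> d] by (simp add: dst_def)
    ultimately show False using p by simp
  qed
  obtain f :: "nat \<Rightarrow> 'a" where f: "inj f" using infinite_countable_subset[OF inf] by blast
  define t where "t = f \<circ> to_nat_on J"
  have t: "inj_on t J" unfolding t_def using f J(1) by (intro comp_inj_on) (auto intro: inj_on_subset)
  define Y where "Y = t ` J"
  define b where "b = inv_into J t"
  have b: "inj_on b Y" "b ` Y = J" using t by (auto simp: Y_def b_def inj_on_inv_into image_iff)
  have "star_hom A bounded_ops (\<lambda>a. compress Y b (\<sigma> a))"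
    by (rule star_homI) (simp_all add: h compress_ops compress_in[OF b(1)] compress_mult[OF b(1)] b reda)
  with that b J show thesis by (simp add: star_reps_def)
qed

text \<open>
  The spatial norm dominates representations on \<open>l\<^sup>2\<close> of arbitrary index sets: a bounded form is
  controlled on finite sets of coordinates, and around each of these both representations can be
  compressed to representations indexed by elements of the algebras.
\<close>

lemma (in cstar_pair) kron_sum_le_nrm:
  fixes \<gamma> :: "'g::countable \<Rightarrow> 'a" and \<delta> :: "'h::countable \<Rightarrow> 'b" and \<sigma> :: "'a \<Rightarrow> 'i op" and \<tau> :: "'b \<Rightarrow> 'j op"
  assumes gen: "generated_by A \<gamma>" "generated_by B \<delta>"
    and inf: "infinite (UNIV :: 'a set)" "infinite (UNIV :: 'b set)"
    and h: "star_hom A bounded_ops \<sigma>" "star_hom B bounded_ops \<tau>" and M: "M \<in> carrier FT"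
  shows "op_norm (kron_sum \<sigma> \<tau> M) \<le> nrm FT M"
proof (rule op_norm_le, rule op_bound_by_compressions[where 'y = "'a \<times> 'b"])
  show "0 \<le> nrm FT M" using FT.nrm_F_nonneg[OF M] .
  fix F :: "('i \<times> 'j) set" assume F: "finite F"
  obtain Y b where b: "inj_on b Y" "fst ` F \<subseteq> b ` Y" "(\<lambda>a. compress Y b (\<sigma> a)) \<in> star_reps A"
    by (rule compress_star_rep[OF cA gen(1) inf(1) h(1), of "fst ` F"]) (use F in auto)
  obtain Z c where c: "inj_on c Z" "snd ` F \<subseteq> c ` Z" "(\<lambda>a. compress Z c (\<tau> a)) \<in> star_reps B"
    by (rule compress_star_rep[OF cB gen(2) inf(2) h(2), of "snd ` F"]) (use F in auto)
  have eq: "kron_sum (\<lambda>a. compress Y b (\<sigma> a)) (\<lambda>a. compress Z c (\<tau> a)) M =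
      compress (Y \<times> Z) (map_prod b c) (kron_sum \<sigma> \<tau> M)"
  proof (induct M)
    case (add x M)
    then show ?case
      by (cases x) (auto simp: kron_sum_simps compress_ops kron_def compress_def fun_eq_iff bounded_ops_sel)
  qed (auto simp: kron_sum_simps compress_def fun_eq_iff bounded_ops_sel)
  have in_reps: "kron_sum (\<lambda>a. compress Y b (\<sigma> a)) (\<lambda>a. compress Z c (\<tau> a)) \<in> tensor_reps A B"
    using b(3) c(3) by (auto simp: tensor_reps_def)
  have "kron_sum (\<lambda>a. compress Y b (\<sigma> a)) (\<lambda>a. compress Z c (\<tau> a)) M \<in> carrier bounded_ops"
    by (rule FT.\<Phi>_in[OF in_reps M])
  then have "op_bound (compress (Y \<times> Z) (map_prod b c) (kron_sum \<sigma> \<tau> M))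
      (op_norm (compress (Y \<times> Z) (map_prod b c) (kron_sum \<sigma> \<tau> M)))"
    unfolding eq by (auto simp: bounded_ops_sel intro: op_bound_op_norm)
  moreover have "op_norm (compress (Y \<times> Z) (map_prod b c) (kron_sum \<sigma> \<tau> M)) \<le> nrm FT M"
    using FT.nrm_ge[OF M in_reps] by (simp add: eq nrm_bounded_ops)
  ultimately have "op_bound (compress (Y \<times> Z) (map_prod b c) (kron_sum \<sigma> \<tau> M)) (nrm FT M)"
    unfolding op_bound_def by (meson L2_set_nonneg mult_right_mono order_trans)
  moreover have "inj_on (map_prod b c) (Y \<times> Z)" using b(1) c(1) by (rule map_prod_inj_on)
  moreover have "F \<subseteq> map_prod b c ` (Y \<times> Z)"
  proof
    fix x assume x: "x \<in> F"
    from x b(2) obtain y where "y \<in> Y" "fst x = b y" by blast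
    moreover from x c(2) obtain z where "z \<in> Z" "snd x = c z" by blast
    ultimately show "x \<in> map_prod b c ` (Y \<times> Z)" by (intro image_eqI[of _ _ "(y, z)"]) (auto simp: prod_eq_iff)
  qed
  ultimately show "\<exists>(Y :: ('a \<times> 'b) set) b. inj_on b Y \<and> F \<subseteq> b ` Y \<and> op_bound (compress Y b (kron_sum \<sigma> \<tau> M)) (nrm FT M)"
    by blast
qed

section \<open>Universal C*-algebras\<close>

lemma cstar_extend_sel [simp]:
  "carrier (cstar.extend A e) = carrier A" "mult (cstar.extend A e) = mult A" "one (cstar.extend A e) = one A"
  "add (cstar.extend A e) = add A" "zero (cstar.extend A e) = zero A" "smult (cstar.extend A e) = smult A"
  "star (cstar.extend A e) = star A" "nrm (cstar.extend A e) = nrm A"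
  by (simp_all add: cstar.extend_def)

lemma cstar_algebra_extend:
  assumes A: "cstar_algebra A"
  shows "cstar_algebra (cstar.extend A e)"
proof -
  interpret pre_cstar A by (rule cstar_algebra_pre[OF A])
  let ?B = "cstar.extend A e"
  have ag: "abelian_group ?B"
  proof (rule abelian_groupI)
    fix x assume "x \<in> carrier ?B"
    then show "\<exists>y\<in>carrier ?B. y \<oplus>\<^bsub>?B\<^esub> x = \<zero>\<^bsub>?B\<^esub>" by (intro bexI[of _ "\<ominus>\<^bsub>A\<^esub> x"]) (simp_all add: l_neg)
  next
    fix x y assume "x \<in> carrier ?B" "y \<in> carrier ?B"
    then show "x \<oplus>\<^bsub>?B\<^esub> y = y \<oplus>\<^bsub>?B\<^esub> x" by (simp add: a_comm)
  qed (simp_all add: a_assoc)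
  have mo: "Group.monoid ?B" by (rule monoidI) (simp_all add: m_assoc)
  have ri: "ring ?B" using ag mo by (rule ringI) (simp_all add: l_distr r_distr)
  have mod: "Module.module complex_cstar ?B"
    by (rule moduleI[OF cring_complex ag]) (simp_all add: sm_ladd sm_radd sm_assoc)
  have "cauchy_seq ?B = cauchy_seq A" "converges_to ?B = converges_to A"
    by (simp_all add: cauchy_seq_def converges_to_def dst_def fun_eq_iff)
  then show ?thesis
    using A ri mod unfolding cstar_algebra_def cstar_algebra_axioms_def by simp
qed

lemma star_hom_extend [simp]:
  "star_hom (cstar.extend A e) B = star_hom A B" "star_hom C (cstar.extend A e) = star_hom C A"
  by (simp_all add: star_hom_def fun_eq_iff)

lemma formal_tensor_extend [simp]:
  "formal_tensor (cstar.extend A e) B = formal_tensor A B" "formal_tensor C (cstar.extend A e) = formal_tensor C A"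
  by (simp_all add: formal_tensor_def star_reps_def)

lemma finsum_extend [simp]: "finsum (cstar.extend A e) = finsum A"
  by (simp add: finsum_def finprod_def fun_eq_iff)

definition free_reps :: "(('g \<Rightarrow> nat op) \<Rightarrow> bool) \<Rightarrow> ('g star_poly \<Rightarrow> nat op) set" where
  "free_reps R = eval_poly bounded_ops ` {u. range u \<subseteq> carrier bounded_ops \<and> R u}"

lemma free_sel [simp]:
  "carrier (free_star_algebra R) = UNIV" "mult (free_star_algebra R) = Mult_poly"
  "one (free_star_algebra R) = Const_poly 1" "zero (free_star_algebra R) = Const_poly 0"
  "add (free_star_algebra R) = Add_poly" "smult (free_star_algebra R) c p = Mult_poly (Const_poly c) p"
  "star (free_star_algebra R) = Star_poly"
  by (simp_all add: free_star_algebra_def)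

text \<open>
  Relations that force the generators to be contractions thus give a finite universal seminorm.
\<close>

lemma (in pre_cstar) eval_poly_bound:
  assumes "0 \<le> K"
  shows "\<exists>D. \<forall>u. range u \<subseteq> carrier A \<and> (\<forall>x. nrm A (u x) \<le> K) \<longrightarrow> nrm A (eval_poly A u p) \<le> D"
proof (induct p)
  case (Const_poly c)
  then show ?case by auto
next
  case (Gen g)
  then show ?case by auto
next
  case (Add_poly p q)
  then obtain D E where D: "\<forall>u. range u \<subseteq> carrier A \<and> (\<forall>x. nrm A (u x) \<le> K) \<longrightarrow> nrm A (eval_poly A u p) \<le> D"
    "\<forall>u. range u \<subseteq> carrier A \<and> (\<forall>x. nrm A (u x) \<le> K) \<longrightarrow> nrm A (eval_poly A u q) \<le> E" by blast
  have "nrm A (eval_poly A u (Add_poly p q)) \<le> D + E" if u: "range u \<subseteq> carrier A \<and> (\<forall>x. nrm A (u x) \<le> K)" for u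
  proof -
    have uc: "u x \<in> carrier A" for x using u by auto
    from nrm_add[OF eval_poly_in[of u p, OF uc] eval_poly_in[of u q, OF uc]] D(1)[rule_format, OF u] D(2)[rule_format, OF u]
    show ?thesis by simp
  qed
  then show ?case by blast
next
  case (Mult_poly p q)
  then obtain D E where D: "\<forall>u. range u \<subseteq> carrier A \<and> (\<forall>x. nrm A (u x) \<le> K) \<longrightarrow> nrm A (eval_poly A u p) \<le> D"
    "\<forall>u. range u \<subseteq> carrier A \<and> (\<forall>x. nrm A (u x) \<le> K) \<longrightarrow> nrm A (eval_poly A u q) \<le> E" by blast
  have "nrm A (eval_poly A u (Mult_poly p q)) \<le> D * E" if u: "range u \<subseteq> carrier A \<and> (\<forall>x. nrm A (u x) \<le> K)" for u
  proof -
    have uc: "u x \<in> carrier A" for x using u by auto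
    have "nrm A (eval_poly A u p) * nrm A (eval_poly A u q) \<le> D * E"
      using D(1)[rule_format, OF u] D(2)[rule_format, OF u] nrm_nonneg[OF eval_poly_in[of u p, OF uc]]
        nrm_nonneg[OF eval_poly_in[of u q, OF uc]] by (intro mult_mono) auto
    with nrm_mult[OF eval_poly_in[of u p, OF uc] eval_poly_in[of u q, OF uc]] show ?thesis by simp
  qed
  then show ?case by blast
next
  case (Star_poly p)
  then obtain D where D: "\<forall>u. range u \<subseteq> carrier A \<and> (\<forall>x. nrm A (u x) \<le> K) \<longrightarrow> nrm A (eval_poly A u p) \<le> D" by blast
  have "nrm A (eval_poly A u (Star_poly p)) \<le> D" if u: "range u \<subseteq> carrier A \<and> (\<forall>x. nrm A (u x) \<le> K)" for u
  proof -
    have uc: "u x \<in> carrier A" for x using u by auto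
    from D(1)[rule_format, OF u] nrm_star[OF eval_poly_in[of u p, OF uc]] show ?thesis by simp
  qed
  then show ?case by blast
qed

lemma raw_cstar_free:
  fixes R :: "('g \<Rightarrow> nat op) \<Rightarrow> bool"
  assumes ex: "\<exists>u. range u \<subseteq> carrier bounded_ops \<and> R u"
    and bd: "\<And>u x. range u \<subseteq> carrier bounded_ops \<Longrightarrow> R u \<Longrightarrow> op_norm (u x) \<le> K"
  shows "raw_cstar (bounded_ops :: nat op cstar) (free_star_algebra R) (free_reps R)"
proof unfold_locales
  show "free_reps R \<noteq> {}" using ex by (auto simp: free_reps_def)
next
  fix p :: "'g star_poly"
  show "nrm (free_star_algebra R) p = (SUP \<phi>\<in>free_reps R. nrm bounded_ops (\<phi> p))"
    by (simp add: free_star_algebra_def free_reps_def image_image nrm_bounded_ops)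
  from ex bd have "0 \<le> K"
    by (metis bops.nrm_nonneg nrm_bounded_ops order_trans range_subsetD)
  from bops.eval_poly_bound[OF this, of p] obtain D
    where D: "\<forall>u. range u \<subseteq> carrier bounded_ops \<and> (\<forall>x. nrm bounded_ops (u x) \<le> K) \<longrightarrow>
      nrm (bounded_ops :: nat op cstar) (eval_poly bounded_ops u p) \<le> D" by blast
  show "bdd_above ((\<lambda>\<phi>. nrm bounded_ops (\<phi> p)) ` free_reps R)"
    by (rule bdd_aboveI2[where M = D]) (use D bd in \<open>auto simp: free_reps_def nrm_bounded_ops\<close>)
next
  fix \<phi> p assume "\<phi> \<in> free_reps R"
  then obtain u where u: "range u \<subseteq> carrier bounded_ops" and \<phi>: "\<phi> = eval_poly bounded_ops u"
    by (auto simp: free_reps_def)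
  have uc: "u x \<in> carrier bounded_ops" for x using u by auto
  note e = bops.eval_poly_in[of u, OF uc]
  show "\<phi> p \<in> carrier bounded_ops" "\<phi> \<one>\<^bsub>free_star_algebra R\<^esub> \<otimes>\<^bsub>bounded_ops\<^esub> \<phi> p = \<phi> p"
    "\<phi> p \<otimes>\<^bsub>bounded_ops\<^esub> \<phi> \<one>\<^bsub>free_star_algebra R\<^esub> = \<phi> p" "\<phi> \<zero>\<^bsub>free_star_algebra R\<^esub> = \<zero>\<^bsub>bounded_ops\<^esub>"
    "\<phi> (c \<odot>\<^bsub>free_star_algebra R\<^esub> p) = c \<odot>\<^bsub>bounded_ops\<^esub> \<phi> p" for c
    unfolding \<phi> using e[of p] by (simp_all add: bops.smult_mult_left)
qed (auto simp: free_reps_def)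

section \<open>The relations of \<open>A\<^sub>u(Q)\<close> as *-polynomials\<close>

text \<open>
  Finite sums have to be written as *-polynomials, and formal addition is not commutative; so the
  index type is enumerated once and for all.
\<close>

definition index_list :: "'n::finite list" where
  "index_list = (SOME xs. set xs = UNIV \<and> distinct xs)"

lemma index_list: "set (index_list :: 'n::finite list) = UNIV" "distinct (index_list :: 'n list)"
proof -
  have "\<exists>xs :: 'n list. set xs = UNIV \<and> distinct xs" using finite_distinct_list[of "UNIV :: 'n set"] by auto
  from someI_ex[OF this] show "set (index_list :: 'n list) = UNIV" "distinct (index_list :: 'n list)"
    by (simp_all add: index_list_def)
qed

definition poly_sum :: "('n::finite \<Rightarrow> 'g star_poly) \<Rightarrow> 'g star_poly" where
  "poly_sum f = foldr (\<lambda>k. Add_poly (f k)) index_list (Const_poly 0)"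

definition poly_mat_mult :: "('n::finite \<Rightarrow> 'n \<Rightarrow> 'g star_poly) \<Rightarrow> ('n \<Rightarrow> 'n \<Rightarrow> 'g star_poly) \<Rightarrow> 'n \<Rightarrow> 'n \<Rightarrow> 'g star_poly" where
  "poly_mat_mult a b = (\<lambda>i j. poly_sum (\<lambda>k. Mult_poly (a i k) (b k j)))"

definition poly_mat_one :: "'n \<Rightarrow> 'n \<Rightarrow> 'g star_poly" where
  "poly_mat_one i j = Const_poly (if i = j then 1 else 0)"

context pre_cstar begin

lemma eval_poly_sum:
  fixes f :: "'n::finite \<Rightarrow> 'g star_poly"
  assumes g: "\<And>x. g x \<in> carrier A"
  shows "eval_poly A g (poly_sum f) = finsum A (\<lambda>k. eval_poly A g (f k)) UNIV"
proof -
  have "eval_poly A g (foldr (\<lambda>k. Add_poly (f k)) xs (Const_poly 0)) = finsum A (\<lambda>k. eval_poly A g (f k)) (set xs)"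
    if "distinct xs" for xs
    using that by (induct xs) (simp_all add: eval_poly_in[OF g] Pi_def)
  from this[OF index_list(2)] show ?thesis by (simp add: poly_sum_def index_list(1))
qed

lemma eval_poly_mat_mult:
  assumes g: "\<And>x. g x \<in> carrier A"
  shows "eval_poly A g (poly_mat_mult a b i j) = mat_mult A UNIV (\<lambda>i j. eval_poly A g (a i j)) (\<lambda>i j. eval_poly A g (b i j)) i j"
  by (simp add: poly_mat_mult_def mat_mult_def eval_poly_sum[OF g])

lemma eval_poly_mat_one: "eval_poly A g (poly_mat_one i j) = mat_one A i j"
  by (simp add: poly_mat_one_def mat_one_def)

lemma mat_mult_in [simp]:
  "(\<And>i j. a i j \<in> carrier A) \<Longrightarrow> (\<And>i j. b i j \<in> carrier A) \<Longrightarrow> mat_mult A UNIV a b i j \<in> carrier A"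
  unfolding mat_mult_def by (rule finsum_closed) auto

lemma finsum_swap:
  assumes "finite I" "finite J" "\<And>i j. f i j \<in> carrier A"
  shows "(\<Oplus>i\<in>I. \<Oplus>j\<in>J. f i j) = (\<Oplus>j\<in>J. \<Oplus>i\<in>I. f i j)"
  using assms(1)
proof (induct I rule: finite_induct)
  case (insert x I)
  have c: "(\<Oplus>j\<in>J. f i j) \<in> carrier A" "(\<Oplus>i\<in>I. f i j) \<in> carrier A" for i j
    using assms(3) by (auto intro: finsum_closed)
  have "(\<Oplus>i\<in>insert x I. \<Oplus>j\<in>J. f i j) = (\<Oplus>j\<in>J. f x j) \<oplus> (\<Oplus>j\<in>J. \<Oplus>i\<in>I. f i j)"
    using insert c by (simp add: Pi_def)
  also have "\<dots> = (\<Oplus>j\<in>J. f x j \<oplus> (\<Oplus>i\<in>I. f i j))"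
    using c assms(3) by (intro finsum_addf[symmetric]) auto
  also have "\<dots> = (\<Oplus>j\<in>J. \<Oplus>i\<in>insert x I. f i j)"
    using insert c assms(3) by (intro finsum_cong') (auto simp: Pi_def)
  finally show ?case .
qed simp

lemma mat_mult_assoc:
  fixes a b c :: "'n::finite \<Rightarrow> 'n \<Rightarrow> 'a"
  assumes "\<And>i j. a i j \<in> carrier A" "\<And>i j. b i j \<in> carrier A" "\<And>i j. c i j \<in> carrier A"
  shows "mat_mult A UNIV (mat_mult A UNIV a b) c = mat_mult A UNIV a (mat_mult A UNIV b c)"
proof (intro ext)
  fix i j
  have "mat_mult A UNIV (mat_mult A UNIV a b) c i j = (\<Oplus>k\<in>UNIV. \<Oplus>l\<in>UNIV. a i l \<otimes> b l k \<otimes> c k j)"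
    unfolding mat_mult_def by (intro finsum_cong' refl finsum_ldistr) (use assms in \<open>auto intro!: finsum_closed m_closed\<close>)
  also have "\<dots> = (\<Oplus>l\<in>UNIV. \<Oplus>k\<in>UNIV. a i l \<otimes> b l k \<otimes> c k j)"
    by (rule finsum_swap) (use assms in auto)
  also have "\<dots> = mat_mult A UNIV a (mat_mult A UNIV b c) i j"
    unfolding mat_mult_def by (intro finsum_cong' refl) (use assms in \<open>auto simp: finsum_rdistr m_assoc Pi_def intro!: finsum_closed m_closed finsum_cong'\<close>)
  finally show "mat_mult A UNIV (mat_mult A UNIV a b) c i j = mat_mult A UNIV a (mat_mult A UNIV b c) i j" .
qed

lemma mat_mult_one:
  fixes a :: "'n::finite \<Rightarrow> 'n \<Rightarrow> 'a"
  assumes "\<And>i j. a i j \<in> carrier A"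
  shows "mat_mult A UNIV a (mat_one A) = a" "mat_mult A UNIV (mat_one A) a = a"
proof -
  have "mat_mult A UNIV a (mat_one A) i j = a i j" for i j
  proof -
    have "mat_mult A UNIV a (mat_one A) i j = (\<Oplus>k\<in>UNIV. if j = k then a i k else \<zero>)"
      unfolding mat_mult_def mat_one_def by (rule finsum_cong') (use assms in auto)
    also have "\<dots> = a i j" by (rule finsum_singleton) (use assms in auto)
    finally show ?thesis .
  qed
  then show "mat_mult A UNIV a (mat_one A) = a" by blast
  have "mat_mult A UNIV (mat_one A) a i j = a i j" for i j
  proof -
    have "mat_mult A UNIV (mat_one A) a i j = (\<Oplus>k\<in>UNIV. if i = k then a k j else \<zero>)"
      unfolding mat_mult_def mat_one_def by (rule finsum_cong') (use assms in auto)
    also have "\<dots> = a i j" by (rule finsum_singleton) (use assms in auto)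
    finally show ?thesis .
  qed
  then show "mat_mult A UNIV (mat_one A) a = a" by blast
qed

lemma mat_one_in [simp]: "mat_one A i j \<in> carrier A"
  by (simp add: mat_one_def)

end

definition poly_relator :: "'g star_poly \<Rightarrow> 'g star_poly \<Rightarrow> 'g star_poly" where
  "poly_relator p q = Add_poly p (Mult_poly (Const_poly (-1)) q)"

lemma (in pre_cstar) eval_poly_relator:
  "(\<And>x. g x \<in> carrier A) \<Longrightarrow> eval_poly A g (poly_relator p q) = \<zero> \<longleftrightarrow> eval_poly A g p = eval_poly A g q"
  using dst_zero_iff[of "eval_poly A g p" "eval_poly A g q"]
  by (simp add: poly_relator_def eval_poly_in smult_mult_left dst_def nrm_eq_zero)

text \<open>
  As *-polynomials that have to vanish, the relations can be transported along *-homomorphisms.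
\<close>

definition Au_relators :: "complex ^ 'n ^ 'n \<Rightarrow> ('n::finite \<times> 'n) star_poly set" where
  "Au_relators Q =
    (let u = (\<lambda>i j. Gen (i, j)); ut = (\<lambda>i j. Gen (j, i)); ubar = (\<lambda>i j. Star_poly (Gen (i, j)));
         ustar = (\<lambda>i j. Star_poly (Gen (j, i)));
         q = (\<lambda>i j. Const_poly (Q $ i $ j)); qinv = (\<lambda>i j. Const_poly (matrix_inv Q $ i $ j)); mm = poly_mat_mult
     in (\<Union>m\<in>{mm ustar u, mm u ustar, mm (mm (mm ut q) ubar) qinv, mm (mm (mm q ubar) qinv) ut}.
          {poly_relator (m i j) (poly_mat_one i j) | i j. True}))"

lemma (in pre_cstar) Au_relations_iff:
  fixes Q :: "complex ^ 'n ^ 'n"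
  assumes g: "\<And>x. g x \<in> carrier A"
  shows "Au_relations Q A g \<longleftrightarrow> (\<forall>r\<in>Au_relators Q. eval_poly A g r = \<zero>)"
proof -
  have *: "(\<forall>r\<in>{poly_relator (m i j) (poly_mat_one i j) | i j. True}. eval_poly A g r = \<zero>) \<longleftrightarrow>
      (\<lambda>i j. eval_poly A g (m i j)) = mat_one A" for m :: "'n \<Rightarrow> 'n \<Rightarrow> ('n \<times> 'n) star_poly"
  proof -
    have "(\<forall>r\<in>{poly_relator (m i j) (poly_mat_one i j) | i j. True}. eval_poly A g r = \<zero>) \<longleftrightarrow>
        (\<forall>i j. eval_poly A g (poly_relator (m i j) (poly_mat_one i j)) = \<zero>)" by blast
    then show ?thesis by (simp add: eval_poly_relator[OF g] eval_poly_mat_one fun_eq_iff)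
  qed
  show ?thesis
    unfolding Au_relators_def Au_relations_def Let_def ball_UN
    by (simp only: * ball_simps insert_iff eval_poly_mat_mult[OF g] eval_poly.simps)
      (simp add: fun_eq_iff eval_poly_mat_mult[OF g])
qed

lemma finsum_complex: "finite I \<Longrightarrow> finsum complex_cstar f I = sum f I"
proof (induct I rule: finite_induct)
  case (insert x I)
  interpret pre_cstar complex_cstar by (rule pre_cstar_complex)
  from insert show ?case by (simp add: Pi_def)
next
  case empty
  interpret pre_cstar complex_cstar by (rule pre_cstar_complex)
  show ?case by simp
qed

lemma matrix_inv_sums:
  fixes Q :: "complex ^ 'n ^ 'n"
  assumes "invertible Q"
  shows "(\<Sum>k\<in>UNIV. Q $ i $ k * matrix_inv Q $ k $ j) = (if i = j then 1 else 0)"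
    "(\<Sum>k\<in>UNIV. matrix_inv Q $ i $ k * Q $ k $ j) = (if i = j then 1 else 0)"
proof -
  have "Q ** matrix_inv Q = mat 1 \<and> matrix_inv Q ** Q = mat 1"
    using assms unfolding invertible_def matrix_inv_def by (rule someI_ex)
  then have "(Q ** matrix_inv Q) $ i $ j = mat 1 $ i $ j" "(matrix_inv Q ** Q) $ i $ j = mat 1 $ i $ j" by simp_all
  then show "(\<Sum>k\<in>UNIV. Q $ i $ k * matrix_inv Q $ k $ j) = (if i = j then 1 else 0)"
    "(\<Sum>k\<in>UNIV. matrix_inv Q $ i $ k * Q $ k $ j) = (if i = j then 1 else 0)"
    by (simp_all add: matrix_matrix_mult_def mat_def)
qed

text \<open>
  For \<open>u = e\<^sup>i\<^sup>\<theta> 1\<close> each relation pairs \<open>u\<close> with an adjoint of it, so the phases cancel.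
\<close>

lemma Au_relators_tval:
  fixes Q :: "complex ^ 'n ^ 'n"
  assumes Q: "invertible Q" and r: "r \<in> Au_relators Q"
  shows "tval \<theta> r = 0"
proof -
  interpret pre_cstar complex_cstar by (rule pre_cstar_complex)
  define c where "c = cis \<theta>"
  have c: "c * x * cnj c = x" "cnj c * x * c = x" for x
    using cis_mult[of \<theta> "- \<theta>"] by (simp_all add: c_def cis_cnj mult.commute mult.left_commute)
  have cc: "c * (cnj c * x) = x" for x using c(1)[of x] by (simp only: mult.assoc mult.commute[of x])
  define d e where "d = (\<lambda>i j :: 'n. if i = j then c else 0)" and "e = (\<lambda>i j :: 'n. if i = j then cnj c else 0)"
  have left: "(\<Sum>k\<in>UNIV. d i k * f k) = c * f i" "(\<Sum>k\<in>UNIV. e i k * f k) = cnj c * f i" for i f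
    by (simp_all add: d_def e_def if_distrib[of "\<lambda>x. x * _"] cong: if_cong)
  have right: "(\<Sum>k\<in>UNIV. f k * d k j) = f j * c" "(\<Sum>k\<in>UNIV. f k * e k j) = f j * cnj c" for f j
    by (simp_all add: d_def e_def if_distrib[of "\<lambda>x. _ * x"] cong: if_cong)
  have mm: "mat_mult complex_cstar UNIV a b = (\<lambda>i j. \<Sum>k\<in>UNIV. a i k * b k j)" for a b :: "'n \<Rightarrow> 'n \<Rightarrow> complex"
    by (simp add: mat_mult_def finsum_complex)
  have dg: "diag complex_cstar c (i, j) = d i j" for i j :: 'n by (simp add: diag_def d_def)
  have sym: "(\<lambda>i j. d j i) = d" "(\<lambda>i j. cnj (d j i)) = e" "(\<lambda>i j. cnj (d i j)) = e"
    by (auto simp: d_def e_def fun_eq_iff)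
  have one: "mat_one complex_cstar = (\<lambda>i j :: 'n. if i = j then 1 else 0)"
    by (intro ext) (simp add: mat_one_def)
  have "Au_relations Q complex_cstar (diag complex_cstar c)"
  proof -
    have "mat_mult complex_cstar UNIV e d = mat_one complex_cstar" "mat_mult complex_cstar UNIV d e = mat_one complex_cstar"
      unfolding mm left one using c[of 1] by (auto simp: d_def e_def fun_eq_iff)
    moreover have "mat_mult complex_cstar UNIV (mat_mult complex_cstar UNIV (mat_mult complex_cstar UNIV d (\<lambda>i j. Q $ i $ j)) e)
        (\<lambda>i j. matrix_inv Q $ i $ j) = mat_one complex_cstar"
      unfolding mm left right one c matrix_inv_sums[OF Q] ..
    moreover have "mat_mult complex_cstar UNIV (mat_mult complex_cstar UNIV (mat_mult complex_cstar UNIV (\<lambda>i j. Q $ i $ j) e)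
        (\<lambda>i j. matrix_inv Q $ i $ j)) d = mat_one complex_cstar"
    proof -
      have "(\<Sum>k\<in>UNIV. Q $ i $ k * cnj c * matrix_inv Q $ k $ j) * c = (if i = j then 1 else 0)" for i j
        unfolding sum_distrib_right using matrix_inv_sums(1)[OF Q, of i j]
        by (simp add: mult.assoc mult.left_commute mult.commute cc)
      then show ?thesis unfolding mm right one by simp
    qed
    ultimately show ?thesis unfolding Au_relations_def Let_def by (simp add: dg sym)
  qed
  then show ?thesis using r Au_relations_iff[of "diag complex_cstar c" Q] by (simp add: tval_def c_def)
qed

text \<open>
  The relations are stable under products of commuting families: this is why the coproduct of
  \<open>A\<^sub>u(Q)\<close> is well defined.
\<close>

lemma (in pre_cstar) Au_relations_product:
  fixes Q :: "complex ^ 'n ^ 'n"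
  assumes Q: "invertible Q"
    and a: "\<And>i j. a i j \<in> carrier A" and b: "\<And>i j. b i j \<in> carrier A"
    and ab: "\<And>i j k l. a i j \<otimes> b k l = b k l \<otimes> a i j"
    and ra: "Au_relations Q A (\<lambda>(i, j). a i j)" and rb: "Au_relations Q A (\<lambda>(i, j). b i j)"
  shows "Au_relations Q A (\<lambda>(i, j). finsum A (\<lambda>k. a i k \<otimes> b k j) UNIV)"
proof -
  let ?m = "mat_mult A UNIV"
  define q where "q = (\<lambda>i j :: 'n. (Q $ i $ j) \<odot> \<one>)"
  define r where "r = (\<lambda>i j :: 'n. (matrix_inv Q $ i $ j) \<odot> \<one>)"
  define At Bt where "At = (\<lambda>i j. a j i)" and "Bt = (\<lambda>i j. b j i)"
  define As Bs where "As = (\<lambda>i j. star A (a j i))" and "Bs = (\<lambda>i j. star A (b j i))"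
  define Ab Bb where "Ab = (\<lambda>i j. star A (a i j))" and "Bb = (\<lambda>i j. star A (b i j))"
  have c [simp]: "q i j \<in> carrier A" "r i j \<in> carrier A" "At i j \<in> carrier A" "Bt i j \<in> carrier A" "As i j \<in> carrier A"
    "Bs i j \<in> carrier A" "Ab i j \<in> carrier A" "Bb i j \<in> carrier A" "a i j \<in> carrier A" "b i j \<in> carrier A" for i j
    using a b by (simp_all add: q_def r_def At_def Bt_def As_def Bs_def Ab_def Bb_def)
  have sc: "finsum A (\<lambda>k. f k \<odot> \<one>) UNIV = (\<Sum>k\<in>UNIV. f k) \<odot> \<one>" for f :: "'n \<Rightarrow> complex"
  proof -
    have "finsum A (\<lambda>k. f k \<odot> \<one>) I = (\<Sum>k\<in>I. f k) \<odot> \<one>" if "finite I" for I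
      using that by (induct I rule: finite_induct) (simp_all add: Pi_def sm_ladd)
    then show ?thesis by simp
  qed
  have qr: "?m q r = mat_one A" "?m r q = mat_one A"
    by (intro ext; simp add: mat_mult_def q_def r_def smult_mult_left sm_assoc sc matrix_inv_sums[OF Q] mat_one_def)+
  have A: "?m As a = mat_one A" "?m a As = mat_one A" "?m (?m (?m At q) Ab) r = mat_one A" "?m (?m (?m q Ab) r) At = mat_one A"
    using ra unfolding Au_relations_def Let_def by (simp_all add: q_def r_def At_def As_def Ab_def)
  have B: "?m Bs b = mat_one A" "?m b Bs = mat_one A" "?m (?m (?m Bt q) Bb) r = mat_one A" "?m (?m (?m q Bb) r) Bt = mat_one A"
    using rb unfolding Au_relations_def Let_def by (simp_all add: q_def r_def Bt_def Bs_def Bb_def)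
  note as = mat_mult_assoc mat_mult_one
  define u where "u = ?m a b"
  have u [simp]: "u i j \<in> carrier A" for i j by (simp add: u_def)
  have us: "(\<lambda>i j. star A (u j i)) = ?m Bs As"
    by (intro ext) (simp add: u_def mat_mult_def star_finsum Pi_def star_mult As_def Bs_def)
  have ut: "(\<lambda>i j. u j i) = ?m Bt At"
    by (intro ext) (simp add: u_def mat_mult_def At_def Bt_def ab)
  have abs: "star A (b k l) \<otimes> star A (a i j) = star A (a i j) \<otimes> star A (b k l)" for i j k l
    using star_mult[OF a b, of i j k l] star_mult[OF b a, of k l i j] ab[of i j k l] by simp
  have ub: "(\<lambda>i j. star A (u i j)) = ?m Ab Bb"
    by (intro ext) (simp add: u_def mat_mult_def star_finsum Pi_def star_mult Ab_def Bb_def abs)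
  have "?m (?m Bs As) u = ?m Bs (?m (?m As a) b)" by (simp add: u_def as)
  also have "\<dots> = mat_one A" unfolding A by (simp add: as B)
  finally have 1: "?m (?m Bs As) u = mat_one A" .
  have "?m u (?m Bs As) = ?m a (?m (?m b Bs) As)" by (simp add: u_def as)
  also have "\<dots> = mat_one A" unfolding B by (simp add: as A)
  finally have 2: "?m u (?m Bs As) = mat_one A" .
  have "?m (?m At q) Ab = ?m (?m (?m (?m At q) Ab) r) q" by (simp add: as qr)
  also have "\<dots> = q" unfolding A by (simp add: as)
  finally have Aq: "?m (?m At q) Ab = q" .
  have "?m (?m (?m (?m Bt At) q) (?m Ab Bb)) r = ?m (?m (?m Bt (?m (?m At q) Ab)) Bb) r" by (simp add: as)
  also have "\<dots> = mat_one A" unfolding Aq by (rule B)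
  finally have 3: "?m (?m (?m (?m Bt At) q) (?m Ab Bb)) r = mat_one A" .
  have "?m (?m (?m q (?m Ab Bb)) r) (?m Bt At) = ?m (?m q Ab) (?m (?m (?m Bb r) Bt) At)" by (simp add: as)
  also have "?m (?m Bb r) Bt = ?m (?m r q) (?m (?m Bb r) Bt)" unfolding qr by (simp add: as)
  also have "\<dots> = ?m r (?m (?m (?m q Bb) r) Bt)" by (simp add: as)
  also have "\<dots> = r" unfolding B by (simp add: as)
  also have "?m (?m q Ab) (?m r At) = ?m (?m (?m q Ab) r) At" by (simp add: as)
  also have "\<dots> = mat_one A" by (rule A)
  finally have 4: "?m (?m (?m q (?m Ab Bb)) r) (?m Bt At) = mat_one A" .
  have eq: "(\<lambda>(i, j). finsum A (\<lambda>k. a i k \<otimes> b k j) UNIV) = (\<lambda>(i, j). u i j)" by (simp add: u_def mat_mult_def)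
  show ?thesis
    unfolding eq Au_relations_def Let_def prod.case us ut ub q_def[symmetric] r_def[symmetric]
    using 1 2 3 4 by (simp add: eta_contract_eq)
qed

section \<open>Contractivity on non-unital representations\<close>

text \<open>
  A family \<open>g\<close> in the corner \<open>P A P\<close> that satisfies relations of which \<open>\<delta>\<^sub>i\<^sub>j\<close> is a scalar solution
  becomes a family satisfying the relations in \<open>A\<close> after adding \<open>\<delta>\<^sub>i\<^sub>j (1 - P)\<close>.
\<close>

lemma (in pre_cstar) eval_poly_unitize:
  fixes g :: "'n \<times> 'n \<Rightarrow> 'a"
  assumes P: "P \<in> carrier A" "P \<otimes> P = P" "star A P = P" and g: "\<And>x. g x \<in> carrier (corner A P)"
  defines "g' \<equiv> \<lambda>x. g x \<oplus> diag A (\<one> \<ominus> P) x"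
  shows "g' x \<in> carrier A"
    "eval_poly A g' p = eval_poly (corner A P) g p \<oplus> tval 0 p \<odot> (\<one> \<ominus> P)"
    "nrm A (eval_poly (corner A P) g p) \<le> nrm A (eval_poly A g' p)"
proof -
  interpret C: pre_cstar "corner A P" by (rule pre_cstar_corner[OF P])
  define R where "R = \<one> \<ominus> P"
  have R: "R \<in> carrier A" "star A R = R" using P star_smult[OF P(1), of "-1"]
    by (simp_all add: R_def minus_eq star_add sm_minus)
  have PR: "P \<otimes> R = \<zero>" "R \<otimes> P = \<zero>" "R \<otimes> R = R"
    using P by (simp_all add: R_def minus_eq l_distr r_distr l_minus r_minus r_neg a_ac r_neg1 r_neg2)
  have one: "\<one> = P \<oplus> R" 
    using a_lcomm[of P \<one> "\<ominus> P"] P by (simp add: R_def minus_eq r_neg)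
  have ortho: "x \<otimes> R = \<zero>" "R \<otimes> x = \<zero>" if "x \<in> carrier (corner A P)" for x
  proof -
    have "x \<otimes> R = x \<otimes> (P \<otimes> R)" "R \<otimes> x = (R \<otimes> P) \<otimes> x"
      using m_assoc[of x P R] m_assoc[of R P x] that R P by simp_all
    then show "x \<otimes> R = \<zero>" "R \<otimes> x = \<zero>" using that PR by simp_all
  qed
  have gc: "g x \<in> carrier A" for x using g[of x] by simp
  show g': "g' x \<in> carrier A" for x using gc R by (cases x) (simp add: g'_def diag_def R_def)
  have e: "eval_poly (corner A P) g p \<in> carrier (corner A P)" for p by (rule C.eval_poly_in[OF g])
  then have eA: "eval_poly (corner A P) g p \<in> carrier A" for p by simp
  have main: "eval_poly A g' p = eval_poly (corner A P) g p \<oplus> tval 0 p \<odot> R" for p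
  proof (induct p)
    case (Const_poly c)
    have "c \<odot> \<one> = c \<odot> P \<oplus> c \<odot> R" using one sm_radd[OF P(1) R(1), of c] by simp
    then show ?case by simp
  next
    case (Gen x)
    show ?case using gc R by (cases x) (simp add: g'_def diag_def R_def[symmetric])
  next
    case (Add_poly p q)
    then show ?case using eA R by (simp add: sm_ladd a_ac)
  next
    case (Mult_poly p q)
    then show ?case using eA[of p] eA[of q] ortho[OF e, of p] ortho[OF e, of q] R PR
      by (simp add: l_distr r_distr smult_mult_left smult_mult_right sm_assoc mult.commute)
  next
    case (Star_poly p)
    then show ?case using eA R by (simp add: star_add star_smult)
  qed
  then show "eval_poly A g' p = eval_poly (corner A P) g p \<oplus> tval 0 p \<odot> (\<one> \<ominus> P)" unfolding R_def .
  have "P \<otimes> eval_poly A g' p = eval_poly (corner A P) g p"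
    using e[of p] P R PR unfolding main by (simp add: r_distr smult_mult_right)
  moreover have "nrm A P \<le> 1" using C.nrm_one_le by simp
  moreover have "nrm A (P \<otimes> eval_poly A g' p) \<le> nrm A P * nrm A (eval_poly A g' p)"
    by (rule nrm_mult[OF P(1) eval_poly_in[OF g']])
  moreover have "nrm A P * nrm A (eval_poly A g' p) \<le> 1 * nrm A (eval_poly A g' p)"
    using \<open>nrm A P \<le> 1\<close> by (intro mult_right_mono nrm_nonneg eval_poly_in[OF g'])
  ultimately show "nrm A (eval_poly (corner A P) g p) \<le> nrm A (eval_poly A g' p)" by simp
qed

section \<open>The C*-algebra \<open>A\<^sub>u(Q)\<close>\<close>

abbreviation Au_reps :: "complex ^ 'n ^ 'n \<Rightarrow> (('n::finite \<times> 'n) star_poly \<Rightarrow> nat op) set" where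
  "Au_reps Q \<equiv> free_reps (Au_relations Q bounded_ops)"

lemma eval_diag_scalar:
  "eval_poly bounded_ops (diag bounded_ops (cis \<theta> \<odot>\<^bsub>bounded_ops\<^esub> \<one>\<^bsub>bounded_ops\<^esub>)) p = tval \<theta> p \<odot>\<^bsub>bounded_ops\<^esub> \<one>\<^bsub>bounded_ops\<^esub>"
proof (induct p)
  case (Gen x)
  show ?case by (cases x) (simp add: diag_def)
qed (simp_all add: bops.sm_ladd bops.star_smult bops.smult_mult_left bops.sm_assoc)

lemma Au_relations_scalar:
  assumes "invertible Q"
  shows "Au_relations Q bounded_ops (diag bounded_ops (cis \<theta> \<odot>\<^bsub>bounded_ops\<^esub> \<one>\<^bsub>bounded_ops\<^esub>))"
proof (subst bops.Au_relations_iff)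
  show "diag bounded_ops (cis \<theta> \<odot>\<^bsub>bounded_ops\<^esub> \<one>\<^bsub>bounded_ops\<^esub>) x \<in> carrier bounded_ops" for x :: "'a \<times> 'a"
    by (cases x) (simp add: diag_def)
  show "\<forall>r\<in>Au_relators Q. eval_poly bounded_ops (diag bounded_ops (cis \<theta> \<odot>\<^bsub>bounded_ops\<^esub> \<one>\<^bsub>bounded_ops\<^esub>)) r = \<zero>\<^bsub>bounded_ops\<^esub>"
    using Au_relators_tval[OF assms] by (simp add: eval_diag_scalar)
qed

text \<open>
  In a column of a unitary matrix, \<open>\<Sum>\<^sub>k u\<^sub>k\<^sub>j\<^sup>* u\<^sub>k\<^sub>j = 1\<close> and all terms are positive.
\<close>

lemma Au_relations_contractive:
  assumes r: "Au_relations Q bounded_ops u" and u: "range u \<subseteq> carrier (bounded_ops :: 'i op cstar)"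
  shows "op_norm (u (i, j)) \<le> 1"
proof -
  have uc: "u x \<in> carrier bounded_ops" for x using u by auto
  have "mat_mult bounded_ops UNIV (\<lambda>i j. star bounded_ops (u (j, i))) (\<lambda>i j. u (i, j)) = mat_one bounded_ops"
    using r unfolding Au_relations_def Let_def by simp
  from fun_cong[OF fun_cong[OF this], of j j]
  have s: "finsum bounded_ops (\<lambda>k. star bounded_ops (u (k, j)) \<otimes>\<^bsub>bounded_ops\<^esub> u (k, j)) UNIV = \<one>\<^bsub>bounded_ops\<^esub>"
    by (simp add: mat_mult_def mat_one_def)
  have "\<forall>k. \<exists>C. op_bound (u (k, j)) C" using uc by (simp add: bounded_ops_sel)
  then obtain B where B: "\<And>k. op_bound (u (k, j)) (B k)" by metis
  have fin: "finsum bounded_ops (\<lambda>k. star bounded_ops (u (k, j)) \<otimes>\<^bsub>bounded_ops\<^esub> u (k, j)) I x y =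
      (\<Sum>k\<in>I. \<Sum>\<^sub>\<infinity>z. cnj (u (k, j) z x) * u (k, j) z y)" if "finite I" for I x y
    using that
  proof (induct I rule: finite_induct)
    case (insert k I)
    have "(\<lambda>k. star bounded_ops (u (k, j)) \<otimes>\<^bsub>bounded_ops\<^esub> u (k, j)) \<in> insert k I \<rightarrow> carrier bounded_ops"
      using uc by (simp add: Pi_def)
    with insert have "finsum bounded_ops (\<lambda>k. star bounded_ops (u (k, j)) \<otimes>\<^bsub>bounded_ops\<^esub> u (k, j)) (insert k I) =
        star bounded_ops (u (k, j)) \<otimes>\<^bsub>bounded_ops\<^esub> u (k, j) \<oplus>\<^bsub>bounded_ops\<^esub>
        finsum bounded_ops (\<lambda>k. star bounded_ops (u (k, j)) \<otimes>\<^bsub>bounded_ops\<^esub> u (k, j)) I"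
      by (subst bops.finsum_insert) (auto simp: Pi_def)
    with insert show ?case by (simp add: bounded_ops_sel)
  qed (simp add: bounded_ops_sel(4))
  have "op_bound (u (i, j)) 1"
  proof (rule op_boundI)
    fix F G :: "'i set" and w :: "'i \<Rightarrow> complex" assume F: "finite F" and G: "finite G"
    let ?n = "\<lambda>k x. (cmod (\<Sum>y\<in>G. u (k, j) x y * w y))\<^sup>2"
    note q = bounded_ops_form_star_self[OF B G, where w = w]
    have "complex_of_real (\<Sum>k\<in>UNIV. infsum (?n k) UNIV) =
        (\<Sum>k\<in>UNIV. \<Sum>x\<in>G. \<Sum>y\<in>G. cnj (w x) * (\<Sum>\<^sub>\<infinity>z. cnj (u (k, j) z x) * u (k, j) z y) * w y)"
      unfolding q(2) by simp
    also have "\<dots> = (\<Sum>x\<in>G. \<Sum>k\<in>UNIV. \<Sum>y\<in>G. cnj (w x) * (\<Sum>\<^sub>\<infinity>z. cnj (u (k, j) z x) * u (k, j) z y) * w y)"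
      by (rule sum.swap)
    also have "\<dots> = (\<Sum>x\<in>G. \<Sum>y\<in>G. \<Sum>k\<in>UNIV. cnj (w x) * (\<Sum>\<^sub>\<infinity>z. cnj (u (k, j) z x) * u (k, j) z y) * w y)"
      by (intro sum.cong refl sum.swap)
    also have "\<dots> = (\<Sum>x\<in>G. \<Sum>y\<in>G. cnj (w x) * \<one>\<^bsub>bounded_ops\<^esub> x y * w y)"
      unfolding s[symmetric] fin[OF finite] by (simp only: sum_distrib_left sum_distrib_right)
    also have "\<dots> = (\<Sum>x\<in>G. \<Sum>y\<in>G. if x = y then cnj (w x) * w y else 0)"
      by (intro sum.cong refl) (simp add: bounded_ops_sel(3))
    also have "\<dots> = (\<Sum>x\<in>G. cnj (w x) * w x)" using G by simp
    also have "\<dots> = complex_of_real (\<Sum>x\<in>G. (cmod (w x))\<^sup>2)" unfolding norm_square_cnj of_real_sum ..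
    finally have tot: "(\<Sum>k\<in>UNIV. infsum (?n k) UNIV) = (\<Sum>x\<in>G. (cmod (w x))\<^sup>2)"
      unfolding of_real_eq_iff .
    have "(\<Sum>x\<in>F. ?n i x) \<le> infsum (?n i) UNIV" by (rule finite_sum_le_infsum[OF q(1) F]) auto
    also have "\<dots> \<le> (\<Sum>k\<in>UNIV. infsum (?n k) UNIV)"
      by (rule member_le_sum) (auto intro!: infsum_nonneg)
    finally have "(\<Sum>x\<in>F. ?n i x) \<le> (\<Sum>x\<in>G. (cmod (w x))\<^sup>2)" unfolding tot .
    then show "L2_set (\<lambda>x. cmod (\<Sum>y\<in>G. u (i, j) x y * w y)) F \<le> 1 * L2_set (\<lambda>x. cmod (w x)) G"
      unfolding L2_set_def by (simp only: mult_1 real_sqrt_le_iff)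
  qed simp
  then show ?thesis by (rule op_norm_le)
qed

locale Au_setting =
  fixes Q :: "complex ^ 'n ^ 'n"
  assumes Q: "invertible Q"
begin

sublocale free: raw_cstar "bounded_ops :: nat op cstar" "Au_free Q" "Au_reps Q"
proof (rule raw_cstar_free)
  show "\<exists>u. range u \<subseteq> carrier (bounded_ops :: nat op cstar) \<and> Au_relations Q bounded_ops u"
    using Au_relations_scalar[OF Q, of 0]
    by (intro exI[of _ "diag bounded_ops (cis 0 \<odot>\<^bsub>bounded_ops\<^esub> \<one>\<^bsub>bounded_ops\<^esub>)"]) (auto simp: diag_def)
  show "op_norm (u x) \<le> 1" if "range u \<subseteq> carrier bounded_ops" "Au_relations Q bounded_ops u" for u :: "'n \<times> 'n \<Rightarrow> nat op" and x
    using Au_relations_contractive[OF that(2,1)] by (cases x) simp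
qed

abbreviation "AA \<equiv> Au_algebra Q"
abbreviation gen :: "'n \<times> 'n \<Rightarrow> 'n Au_elem" where "gen \<equiv> \<lambda>(i, j). Au_gen Q i j"

lemma AA_completion: "AA = completion (Au_free Q)"
  by (simp add: Au_algebra_def universal_cstar_def)

lemma cstar_algebra_AA: "cstar_algebra AA"
  unfolding AA_completion by (rule free.cstar_algebra_completion)

sublocale A: pre_cstar AA by (rule cstar_algebra_pre[OF cstar_algebra_AA])

lemma gen_in [simp]: "gen x \<in> carrier AA" "Au_gen Q i j \<in> carrier AA"
  unfolding AA_completion by (simp_all add: Au_gen_def case_prod_unfold)

lemma embed_eval: "completion_embed (Au_free Q) p = eval_poly AA gen p"
proof (induct p)
  case (Const_poly c)
  have "completion_embed (Au_free Q) (Const_poly c) = completion_embed (Au_free Q) (c \<odot>\<^bsub>Au_free Q\<^esub> \<one>\<^bsub>Au_free Q\<^esub>)"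
  proof (rule free.embed_eqI)
    fix \<phi> assume "\<phi> \<in> Au_reps Q"
    then obtain u where "\<phi> = eval_poly bounded_ops u" by (auto simp: free_reps_def)
    then show "\<phi> (Const_poly c) = \<phi> (c \<odot>\<^bsub>Au_free Q\<^esub> \<one>\<^bsub>Au_free Q\<^esub>)" by (simp add: bops.smult_mult_left)
  qed simp_all
  also have "\<dots> = c \<odot>\<^bsub>AA\<^esub> \<one>\<^bsub>AA\<^esub>"
    unfolding AA_completion using free.embed_hom(3)[OF free.one_in, of c] free.embed_hom(5) by (simp del: free_sel)
  finally show ?case by simp
next
  case (Gen x)
  show ?case by (cases x) (simp add: Au_gen_def)
next
  case (Add_poly p q)
  then show ?case using free.embed_hom(1)[of p q] by (simp add: AA_completion)
next
  case (Mult_poly p q)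
  then show ?case using free.embed_hom(2)[of p q] by (simp add: AA_completion)
next
  case (Star_poly p)
  then show ?case using free.embed_hom(4)[of p] by (simp add: AA_completion)
qed

lemma gen_relators: "r \<in> Au_relators Q \<Longrightarrow> eval_poly AA gen r = \<zero>\<^bsub>AA\<^esub>"
proof -
  assume r: "r \<in> Au_relators Q"
  have "completion_embed (Au_free Q) r = completion_embed (Au_free Q) \<zero>\<^bsub>Au_free Q\<^esub>"
  proof (rule free.embed_eqI)
    fix \<phi> assume "\<phi> \<in> Au_reps Q"
    then obtain u where u: "\<phi> = eval_poly bounded_ops u" "range u \<subseteq> carrier bounded_ops" "Au_relations Q bounded_ops u"
      by (auto simp: free_reps_def)
    then have "eval_poly bounded_ops u r = \<zero>\<^bsub>bounded_ops\<^esub>" using r bops.Au_relations_iff[of u Q] by auto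
    then show "\<phi> r = \<phi> \<zero>\<^bsub>Au_free Q\<^esub>" by (simp add: u)
  qed simp_all
  then show ?thesis unfolding embed_eval[symmetric] unfolding AA_completion free.embed_hom(6) .
qed

lemma gen_relations: "Au_relations Q AA gen"
  using A.Au_relations_iff[of gen Q, OF gen_in(1)] gen_relators by blast

text \<open>
  The universal seminorm also dominates families in corners, on any infinite index set: such a
  family is supplemented by the unit of the complementary corner and compressed to \<open>l\<^sup>2(nat)\<close>.
\<close>

lemma corner_eval_le:
  fixes g :: "'n \<times> 'n \<Rightarrow> 'i op"
  assumes inf: "infinite (UNIV :: 'i set)"
    and P: "P \<in> carrier bounded_ops" "P \<otimes>\<^bsub>bounded_ops\<^esub> P = P" "star bounded_ops P = P"
    and g: "\<And>x. g x \<in> carrier (corner bounded_ops P)"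
    and rel: "Au_relations Q (corner bounded_ops P) g"
  shows "op_norm (eval_poly (corner bounded_ops P) g p) \<le> nrm (Au_free Q) p"
proof -
  interpret C: pre_cstar "corner bounded_ops P" by (rule bops.pre_cstar_corner[OF P])
  define g' where "g' = (\<lambda>x. g x \<oplus>\<^bsub>bounded_ops\<^esub> diag bounded_ops (\<one>\<^bsub>bounded_ops\<^esub> \<ominus>\<^bsub>bounded_ops\<^esub> P) x)"
  note un = bops.eval_poly_unitize[where g = g, OF P g, folded g'_def]
  have R: "\<one>\<^bsub>bounded_ops\<^esub> \<ominus>\<^bsub>bounded_ops\<^esub> P \<in> carrier bounded_ops" using P by (simp add: bops.minus_eq)
  have rel': "eval_poly bounded_ops g' r = \<zero>\<^bsub>bounded_ops\<^esub>" if r: "r \<in> Au_relators Q" for r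
    using C.Au_relations_iff[of g Q, OF g] rel r R by (simp add: un(2) Au_relators_tval[OF Q r])
  have "op_norm (eval_poly bounded_ops g' p) \<le> nrm (Au_free Q) p"
  proof (rule op_norm_eval_poly_nat)
    show gc: "g' x \<in> carrier bounded_ops" for x using un(1)[of x] by (simp add: g'_def)
    show "infinite (UNIV :: 'i set)" by (rule inf)
    fix b :: "nat \<Rightarrow> 'i"
    assume b: "inj b" and ev: "\<And>q. eval_poly bounded_ops (\<lambda>x. compress UNIV b (g' x)) q = compress UNIV b (eval_poly bounded_ops g' q)"
    have c: "compress UNIV b (g' x) \<in> carrier bounded_ops" for x 
      using un(1)[of x] by (intro compress_in[OF b]) (simp add: g'_def)
    have "compress UNIV b \<zero>\<^bsub>bounded_ops\<^esub> = \<zero>\<^bsub>bounded_ops\<^esub>" by (simp add: compress_def bounded_ops_sel fun_eq_iff)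
    then have "Au_relations Q bounded_ops (\<lambda>x. compress UNIV b (g' x))"
      using bops.Au_relations_iff[of "\<lambda>x. compress UNIV b (g' x)" Q, OF c] rel' by (simp add: ev)
    then have "eval_poly bounded_ops (\<lambda>x. compress UNIV b (g' x)) \<in> Au_reps Q"
      using c by (auto simp: free_reps_def)
    from free.nrm_ge[OF _ this, of p] show "op_norm (compress UNIV b (eval_poly bounded_ops g' p)) \<le> nrm (Au_free Q) p"
      by (simp add: ev nrm_bounded_ops)
  qed
  with un(3)[of p] show ?thesis by (simp add: nrm_bounded_ops)
qed

end

section \<open>Functionals on completions\<close>

context raw_cstar begin

definition ext_fun :: "('x \<Rightarrow> complex) \<Rightarrow> (nat \<Rightarrow> 'x) set \<Rightarrow> complex" where
  "ext_fun f X = lim (\<lambda>n. f ((SOME x. cauchy_seq F x \<and> X = cc x) n))"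

context
  fixes f :: "'x \<Rightarrow> complex"
  assumes f: "\<And>x y. x \<in> carrier F \<Longrightarrow> y \<in> carrier F \<Longrightarrow> cmod (f x - f y) \<le> dst F x y"
begin

lemma ext_fun_tendsto:
  assumes x: "cauchy_seq F x"
  shows "(\<lambda>n. f (x n)) \<longlonglongrightarrow> ext_fun f (cc x)"
proof -
  define y where "y = (SOME y. cauchy_seq F y \<and> cc x = cc y)"
  have y: "cauchy_seq F y \<and> cc x = cc y" unfolding y_def by (rule someI[of _ x]) (simp add: x)
  have "Cauchy (\<lambda>n. f (y n))"
  proof (rule metric_CauchyI)
    fix e :: real assume "0 < e"
    from cauchy_dst[OF conjunct1[OF y] this] obtain N where N: "\<forall>m\<ge>N. \<forall>n\<ge>N. dst F (y m) (y n) < e" by blast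
    have "dist (f (y m)) (f (y n)) < e" if "m \<ge> N" "n \<ge> N" for m n
      using f[of "y m" "y n"] N that y by (fastforce simp: dist_norm)
    then show "\<exists>M. \<forall>m\<ge>M. \<forall>n\<ge>M. dist (f (y m)) (f (y n)) < e" by blast
  qed
  then have l: "(\<lambda>n. f (y n)) \<longlonglongrightarrow> ext_fun f (cc x)"
    unfolding ext_fun_def y_def[symmetric] by (simp add: Cauchy_convergent convergent_LIMSEQ_iff[symmetric])
  have "(\<lambda>n. dst F (x n) (y n)) \<longlonglongrightarrow> 0" using y x cc_eq_iff[of x y] by simp
  then have "(\<lambda>n. f (x n) - f (y n)) \<longlonglongrightarrow> 0"
    by (rule Lim_null_comparison[rotated]) (use f x y in auto)
  from tendsto_add[OF this l] show ?thesis by simp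
qed

lemma ext_fun_embed: "a \<in> carrier F \<Longrightarrow> ext_fun f (completion_embed F a) = f a"
  using LIMSEQ_unique[OF ext_fun_tendsto[of "\<lambda>_. a"] tendsto_const] by (simp add: completion_embed_def)

lemma ext_fun_dst:
  assumes "X \<in> carrier \<A>" and a: "a \<in> carrier F"
  shows "cmod (ext_fun f X - f a) \<le> dst \<A> X (completion_embed F a)"
proof -
  from assms(1) obtain x where x: "cauchy_seq F x" "X = cc x" by (rule carrier_completionE)
  have l: "(\<lambda>n. dst F (x n) a) \<longlonglongrightarrow> dst \<A> (cc x) (completion_embed F a)"
    unfolding completion_embed_def by (rule dst_completion[OF x(1) cauchy_const[OF a]])
  have "(\<lambda>n. cmod (f (x n) - f a)) \<longlonglongrightarrow> cmod (ext_fun f (cc x) - f a)"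
    by (intro tendsto_intros ext_fun_tendsto x)
  from LIMSEQ_le[OF this l] f[OF cauchy_in[OF x(1)] a] show ?thesis unfolding x(2) by blast
qed

lemma ext_fun_hom:
  assumes add: "\<And>x y. x \<in> carrier F \<Longrightarrow> y \<in> carrier F \<Longrightarrow> f (x \<oplus>\<^bsub>F\<^esub> y) = f x + f y"
    and mult: "\<And>x y. x \<in> carrier F \<Longrightarrow> y \<in> carrier F \<Longrightarrow> f (x \<otimes>\<^bsub>F\<^esub> y) = f x * f y"
    and sm: "\<And>c x. x \<in> carrier F \<Longrightarrow> f (c \<odot>\<^bsub>F\<^esub> x) = c * f x"
    and st: "\<And>x. x \<in> carrier F \<Longrightarrow> f (star F x) = cnj (f x)"
  shows "star_hom \<A> complex_cstar (ext_fun f)"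
proof (rule star_homI)
  fix X assume "X \<in> carrier \<A>"
  then obtain x where x: "cauchy_seq F x" "X = cc x" by (rule carrier_completionE)
  note lx = ext_fun_tendsto[OF x(1)]
  show "ext_fun f X \<in> carrier complex_cstar" by simp
  have "(\<lambda>n. f (c \<odot>\<^bsub>F\<^esub> x n)) \<longlonglongrightarrow> c * ext_fun f (cc x)" for c
    using tendsto_mult_left[OF lx, of c] x(1) by (simp add: sm)
  from LIMSEQ_unique[OF ext_fun_tendsto[OF cauchy_smult[OF x(1)]] this]
  show "ext_fun f (c \<odot>\<^bsub>\<A>\<^esub> X) = c \<odot>\<^bsub>complex_cstar\<^esub> ext_fun f X" for c using x by simp
  have "(\<lambda>n. f (star F (x n))) \<longlonglongrightarrow> cnj (ext_fun f (cc x))"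
    using tendsto_cnj[OF lx] x(1) by (simp add: st)
  from LIMSEQ_unique[OF ext_fun_tendsto[OF cauchy_star[OF x(1)]] this]
  show "ext_fun f (star \<A> X) = star complex_cstar (ext_fun f X)" using x by simp
  fix Y assume "Y \<in> carrier \<A>"
  then obtain y where y: "cauchy_seq F y" "Y = cc y" by (rule carrier_completionE)
  note ly = ext_fun_tendsto[OF y(1)]
  have "(\<lambda>n. f (x n \<oplus>\<^bsub>F\<^esub> y n)) \<longlonglongrightarrow> ext_fun f (cc x) + ext_fun f (cc y)"
    using tendsto_add[OF lx ly] x(1) y(1) by (simp add: add)
  from LIMSEQ_unique[OF ext_fun_tendsto[OF cauchy_add[OF x(1) y(1)]] this]
  show "ext_fun f (X \<oplus>\<^bsub>\<A>\<^esub> Y) = ext_fun f X \<oplus>\<^bsub>complex_cstar\<^esub> ext_fun f Y" using x y by simp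
  have "(\<lambda>n. f (x n \<otimes>\<^bsub>F\<^esub> y n)) \<longlonglongrightarrow> ext_fun f (cc x) * ext_fun f (cc y)"
    using tendsto_mult[OF lx ly] x(1) y(1) by (simp add: mult)
  from LIMSEQ_unique[OF ext_fun_tendsto[OF cauchy_mult[OF x(1) y(1)]] this]
  show "ext_fun f (X \<otimes>\<^bsub>\<A>\<^esub> Y) = ext_fun f X \<otimes>\<^bsub>complex_cstar\<^esub> ext_fun f Y" using x y by simp
qed

end

end

section \<open>Linear spans and closures\<close>

context pre_cstar begin

lemma lin_span_base: "S \<subseteq> carrier A \<Longrightarrow> s \<in> S \<Longrightarrow> s \<in> lin_span A S"
  unfolding lin_span_def by (intro CollectI exI[of _ "{s}"] exI[of _ "\<lambda>_. 1"]) (auto simp: Pi_def)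

lemma lin_span_zero: "\<zero> \<in> lin_span A S"
  unfolding lin_span_def by (intro CollectI exI[of _ "{}"]) auto

lemma lin_span_in: "S \<subseteq> carrier A \<Longrightarrow> x \<in> lin_span A S \<Longrightarrow> x \<in> carrier A"
  unfolding lin_span_def by (auto intro!: finsum_closed)

lemma lin_span_smult: "S \<subseteq> carrier A \<Longrightarrow> x \<in> lin_span A S \<Longrightarrow> c \<odot> x \<in> lin_span A S"
proof -
  assume S: "S \<subseteq> carrier A" and "x \<in> lin_span A S"
  then obtain F d where F: "finite F" "F \<subseteq> S" "x = finsum A (\<lambda>s. d s \<odot> s) F" by (auto simp: lin_span_def)
  have "c \<odot> x = finsum A (\<lambda>s. c \<odot> (d s \<odot> s)) F"
    unfolding F(3) by (rule smult_finsum) (use F S in auto)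
  also have "\<dots> = finsum A (\<lambda>s. (c * d s) \<odot> s) F"
    by (rule finsum_cong') (use F S in \<open>auto simp: sm_assoc\<close>)
  finally show ?thesis unfolding lin_span_def using F
    by (intro CollectI exI[of _ F] exI[of _ "\<lambda>s. c * d s"] conjI)
qed

lemma lin_span_add: "S \<subseteq> carrier A \<Longrightarrow> x \<in> lin_span A S \<Longrightarrow> y \<in> lin_span A S \<Longrightarrow> x \<oplus> y \<in> lin_span A S"
proof -
  assume S: "S \<subseteq> carrier A" and "x \<in> lin_span A S" "y \<in> lin_span A S"
  then obtain F c G d where F: "finite F" "F \<subseteq> S" "x = finsum A (\<lambda>s. c s \<odot> s) F"
    and G: "finite G" "G \<subseteq> S" "y = finsum A (\<lambda>s. d s \<odot> s) G" by (auto simp: lin_span_def)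
  have ex: "finsum A (\<lambda>s. c s \<odot> s) F = finsum A (\<lambda>s. (if s \<in> F then c s else 0) \<odot> s) (F \<union> H)"
    if "finite F" "finite H" "F \<subseteq> S" "H \<subseteq> S" for F H c
  proof (rule add.finprod_mono_neutral_cong_left)
    show "finite (F \<union> H)" "F \<subseteq> F \<union> H" using that by auto
    show "(if s \<in> F then c s else 0) \<odot> s = \<zero>" if "s \<in> F \<union> H - F" for s using that \<open>H \<subseteq> S\<close> S by auto
    show "c s \<odot> s = (if s \<in> F then c s else 0) \<odot> s" if "s \<in> F" for s using that by simp
    show "(\<lambda>s. (if s \<in> F then c s else 0) \<odot> s) \<in> F \<union> H \<rightarrow> carrier A" using that S by auto
  qed
  have "x \<oplus> y = finsum A (\<lambda>s. (if s \<in> F then c s else 0) \<odot> s \<oplus> (if s \<in> G then d s else 0) \<odot> s) (F \<union> G)"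
    unfolding F(3) G(3) ex[OF F(1) G(1) F(2) G(2)] ex[OF G(1) F(1) G(2) F(2)] Un_commute[of G F]
    by (rule finsum_addf[symmetric]) (use F G S in auto)
  also have "\<dots> = finsum A (\<lambda>s. ((if s \<in> F then c s else 0) + (if s \<in> G then d s else 0)) \<odot> s) (F \<union> G)"
    by (rule finsum_cong') (use F G S in \<open>auto simp: sm_ladd\<close>)
  finally have e: "x \<oplus> y = \<dots>" .
  have "finite (F \<union> G)" "F \<union> G \<subseteq> S" using F G by auto
  then show ?thesis unfolding lin_span_def using e
    by (intro CollectI exI[of _ "F \<union> G"] exI[of _ "\<lambda>s. (if s \<in> F then c s else 0) + (if s \<in> G then d s else 0)"] conjI)
qed

lemma nrm_closure_base: "S \<subseteq> carrier A \<Longrightarrow> x \<in> S \<Longrightarrow> x \<in> nrm_closure A S"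
proof -
  assume S: "S \<subseteq> carrier A" and x: "x \<in> S"
  then have xc: "x \<in> carrier A" by blast
  show ?thesis unfolding nrm_closure_def
    by (intro CollectI conjI allI impI xc bexI[OF _ x]) (simp add: xc)
qed

lemma nrm_closure_closed:
  assumes S: "S \<subseteq> carrier A" and x: "x \<in> carrier A" and ap: "\<And>e. 0 < e \<Longrightarrow> \<exists>y\<in>nrm_closure A S. dst A x y < e"
  shows "x \<in> nrm_closure A S"
proof -
  have "\<exists>y\<in>S. dst A x y < e" if e: "0 < e" for e
  proof -
    from e have e2: "0 < e / 2" by simp
    from ap[OF e2] obtain y where y: "y \<in> carrier A" "\<forall>e>0. \<exists>s\<in>S. dst A y s < e" "dst A x y < e / 2"
      by (auto simp: nrm_closure_def)
    from y(2) e2 obtain s where s: "s \<in> S" "dst A y s < e / 2" by blast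
    then have "s \<in> carrier A" using S by blast
    from dst_triangle[OF x y(1) this] s y(3) show ?thesis by force
  qed
  with x show ?thesis by (simp add: nrm_closure_def)
qed

lemma nrm_closure_add:
  assumes S: "S \<subseteq> carrier A" and Sa: "\<And>x y. x \<in> S \<Longrightarrow> y \<in> S \<Longrightarrow> x \<oplus> y \<in> S"
    and x: "x \<in> nrm_closure A S" and y: "y \<in> nrm_closure A S"
  shows "x \<oplus> y \<in> nrm_closure A S"
proof -
  have xy: "x \<in> carrier A" "y \<in> carrier A" using x y by (auto simp: nrm_closure_def)
  have "\<exists>s\<in>S. dst A (x \<oplus> y) s < e" if e: "0 < e" for e
  proof -
    from e have e2: "0 < e / 2" by simp
    from x e2 obtain s where s: "s \<in> S" "dst A x s < e / 2" unfolding nrm_closure_def by blast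
    from y e2 obtain t where t: "t \<in> S" "dst A y t < e / 2" unfolding nrm_closure_def by blast
    have "s \<in> carrier A" "t \<in> carrier A" using s t S by auto
    from dst_add[OF xy this] s t have "dst A (x \<oplus> y) (s \<oplus> t) < e" by simp
    with Sa[OF s(1) t(1)] show ?thesis by blast
  qed
  with xy show ?thesis by (simp add: nrm_closure_def)
qed

end

section \<open>Maps between tensor products\<close>

lemma star_hom_id: "star_hom A A id"
  by (simp add: star_hom_def)

text \<open>
  For \<open>f \<otimes> g\<close> to extend to minimal tensor products, pulled back representations have to be dominated
  by the spatial norm of the domain.
\<close>

lemma tensor_raw_map:
  fixes A :: "('a, 'm) cstar_scheme" and B :: "('b, 'k) cstar_scheme"
    and C :: "('c, 'l) cstar_scheme" and D :: "('d, 'n) cstar_scheme"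
  assumes "cstar_pair A B" "cstar_pair C D" and f: "star_hom A C f" and g: "star_hom B D g"
    and le: "\<And>\<sigma> \<tau> M. \<lbrakk>star_hom C (bounded_ops :: 'c op cstar) \<sigma>; star_hom D (bounded_ops :: 'd op cstar) \<tau>; M \<in> carrier (formal_tensor A B)\<rbrakk> \<Longrightarrow>
      op_norm (kron_sum (\<lambda>a. \<sigma> (f a)) (\<lambda>b. \<tau> (g b)) M) \<le> nrm (formal_tensor A B) M"
  shows "raw_map bounded_ops (formal_tensor A B) (tensor_reps A B) bounded_ops (formal_tensor C D) (tensor_reps C D)
    (image_mset (map_prod f g))"
proof -
  interpret AB: cstar_pair A B by (rule assms(1))
  interpret CD: cstar_pair C D by (rule assms(2))
  have im: "image_mset (map_prod f g) M \<in> carrier (formal_tensor C D)" if "M \<in> carrier (formal_tensor A B)" for M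
    using that star_homD(1)[OF f] star_homD(1)[OF g] by auto
  show ?thesis
  proof (unfold_locales, rule im)
    fix M N assume MN: "M \<in> carrier (formal_tensor A B)" "N \<in> carrier (formal_tensor A B)"
    show "dst (formal_tensor C D) (image_mset (map_prod f g) M) (image_mset (map_prod f g) N) \<le> dst (formal_tensor A B) M N"
    proof (rule CD.FT.dst_le[OF im[OF MN(1)] im[OF MN(2)]])
      fix \<phi> assume "\<phi> \<in> tensor_reps C D"
      then obtain \<sigma> \<tau> where \<phi>: "\<phi> = kron_sum \<sigma> \<tau>" and h: "star_hom C bounded_ops \<sigma>" "star_hom D bounded_ops \<tau>"
        by (rule CD.tensor_repsE)
      let ?k = "kron_sum (\<lambda>a. \<sigma> (f a)) (\<lambda>b. \<tau> (g b))"
      note h' = star_hom_comp[OF f h(1)] star_hom_comp[OF g h(2)]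
      have d: "M \<oplus>\<^bsub>formal_tensor A B\<^esub> (-1) \<odot>\<^bsub>formal_tensor A B\<^esub> N \<in> carrier (formal_tensor A B)"
        by (intro AB.FT.add_in AB.FT.smult_in MN)
      have "?k (M \<oplus>\<^bsub>formal_tensor A B\<^esub> (-1) \<odot>\<^bsub>formal_tensor A B\<^esub> N) = ?k M \<oplus>\<^bsub>bounded_ops\<^esub> (-1) \<odot>\<^bsub>bounded_ops\<^esub> ?k N"
        using AB.kron_sum_smult[OF h' MN(2), of "-1"] by (simp add: kron_sum_simps)
      then show "dst bounded_ops (\<phi> (image_mset (map_prod f g) M)) (\<phi> (image_mset (map_prod f g) N)) \<le> dst (formal_tensor A B) M N"
        using le[OF h d] unfolding \<phi> kron_sum_image dst_def nrm_bounded_ops by simp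
    qed
  qed
qed

section \<open>The algebra of continuous functions on the circle\<close>

text \<open>
  Starting from the *-polynomials of \<open>A\<^sub>u(Q)\<close> has two advantages: the elements of the completion
  have the type over which the quantum subgroups in the definition of simplicity range, and
  the quotient map is induced by the identity.
\<close>

definition circle_free :: "('n \<times> 'n) star_poly cstar" where
  "circle_free = \<lparr>carrier = UNIV, mult = Mult_poly, one = Const_poly 1,
     zero = Const_poly 0, add = Add_poly, smult = (\<lambda>c. Mult_poly (Const_poly c)), star = Star_poly,
     nrm = (\<lambda>p. SUP \<theta>. cmod (tval \<theta> p))\<rparr>"

lemma circle_free_sel [simp]:
  "carrier circle_free = UNIV" "mult circle_free = Mult_poly" "one circle_free = Const_poly 1"
  "zero circle_free = Const_poly 0" "add circle_free = Add_poly" "smult circle_free c p = Mult_poly (Const_poly c) p"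
  "star circle_free = Star_poly"
  by (simp_all add: circle_free_def)

interpretation circ: raw_cstar complex_cstar "circle_free :: ('n \<times> 'n) star_poly cstar" "range tval"
proof -
  interpret pre_cstar complex_cstar by (rule pre_cstar_complex)
  have "bdd_above (range (\<lambda>\<theta>. cmod (tval \<theta> p)))" for p :: "('n \<times> 'n) star_poly"
  proof -
    from eval_poly_bound[of 1 p] obtain D where
      D: "\<forall>u. range u \<subseteq> carrier complex_cstar \<and> (\<forall>x. nrm complex_cstar (u x) \<le> 1) \<longrightarrow> nrm complex_cstar (eval_poly complex_cstar u p) \<le> D"
      by auto
    have "cmod (tval \<theta> p) \<le> D" for \<theta>
      using D[rule_format, of "diag complex_cstar (cis \<theta>)"] by (auto simp: tval_def diag_def)
    then show ?thesis by (intro bdd_aboveI2) auto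
  qed
  then show "raw_cstar complex_cstar (circle_free :: ('n \<times> 'n) star_poly cstar) (range tval)"
    by unfold_locales (auto simp: image_image circle_free_def)
qed

definition circle_alg :: "('n::finite) Au_elem cstar" where
  "circle_alg = completion circle_free"

abbreviation CT :: "('n::finite) Au_elem cstar" where "CT \<equiv> circle_alg"

lemma cstar_algebra_CT: "cstar_algebra CT"
  unfolding circle_alg_def by (rule circ.cstar_algebra_completion)

interpretation CT: pre_cstar CT
  by (rule cstar_algebra_pre[OF cstar_algebra_CT])

interpretation CC: cstar_pair CT CT
  by (rule cstar_pair.intro[OF cstar_algebra_CT cstar_algebra_CT])

definition circle_embed :: "('n::finite \<times> 'n) star_poly \<Rightarrow> 'n Au_elem" where
  "circle_embed = completion_embed circle_free"

text \<open>
  All diagonal generators represent the same element \<open>z\<close>, so the index is arbitrary.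
\<close>

definition circle_gen :: "('n::finite) Au_elem" where
  "circle_gen = circle_embed (Gen (undefined, undefined))"

lemma circle_embed_in [simp]: "circle_embed p \<in> carrier CT"
  unfolding circle_alg_def circle_embed_def by simp

lemma circle_gen_in [simp]: "circle_gen \<in> carrier CT"
  by (simp add: circle_gen_def)

lemma circle_embed_eqI: "(\<And>\<theta>. tval \<theta> p = tval \<theta> q) \<Longrightarrow> circle_embed p = circle_embed q"
  unfolding circle_embed_def by (rule circ.embed_eqI) auto

lemma circle_embed_hom:
  fixes p q :: "('n::finite \<times> 'n) star_poly"
  shows "circle_embed (Add_poly p q) = circle_embed p \<oplus>\<^bsub>CT\<^esub> circle_embed q"
  "circle_embed (Mult_poly p q) = circle_embed p \<otimes>\<^bsub>CT\<^esub> circle_embed q"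
  "circle_embed (Star_poly p) = star CT (circle_embed p)"
  "circle_embed (Const_poly c :: ('n \<times> 'n) star_poly) = c \<odot>\<^bsub>CT\<^esub> \<one>\<^bsub>CT\<^esub>"
proof -
  show "circle_embed (Add_poly p q) = circle_embed p \<oplus>\<^bsub>CT\<^esub> circle_embed q"
    "circle_embed (Mult_poly p q) = circle_embed p \<otimes>\<^bsub>CT\<^esub> circle_embed q"
    "circle_embed (Star_poly p) = star CT (circle_embed p)"
    unfolding circle_embed_def circle_alg_def
    using circ.embed_hom(1)[of p q] circ.embed_hom(2)[of p q] circ.embed_hom(4)[of p] by simp_all
  have "circle_embed (Const_poly c :: ('n \<times> 'n) star_poly) = circle_embed (Mult_poly (Const_poly c) (Const_poly 1))"
    by (rule circle_embed_eqI) simp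
  also have "\<dots> = c \<odot>\<^bsub>CT\<^esub> circle_embed (Const_poly 1)"
    unfolding circle_embed_def circle_alg_def
    using circ.embed_hom(3)[of "Const_poly 1 :: ('n \<times> 'n) star_poly" c] by simp
  also have "circle_embed (Const_poly 1 :: ('n \<times> 'n) star_poly) = \<one>\<^bsub>CT\<^esub>"
    unfolding circle_embed_def circle_alg_def by (rule circ.embed_hom(5)[simplified])
  finally show "circle_embed (Const_poly c :: ('n \<times> 'n) star_poly) = c \<odot>\<^bsub>CT\<^esub> \<one>\<^bsub>CT\<^esub>" .
qed

interpretation circ: unitary_in CT circle_gen
proof unfold_locales
  have u: "circle_embed (Mult_poly (Star_poly (Gen (undefined, undefined))) (Gen (undefined, undefined))) = circle_embed (Const_poly 1)"
    "circle_embed (Mult_poly (Gen (undefined, undefined)) (Star_poly (Gen (undefined, undefined)))) = circle_embed (Const_poly 1)"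
    by (rule circle_embed_eqI; simp add: cis_cnj cis_mult)+
  then show "star CT circle_gen \<otimes>\<^bsub>CT\<^esub> circle_gen = \<one>\<^bsub>CT\<^esub>" "circle_gen \<otimes>\<^bsub>CT\<^esub> star CT circle_gen = \<one>\<^bsub>CT\<^esub>"
    by (simp_all add: circle_embed_hom circle_gen_def)
qed simp

abbreviation zp :: "int \<Rightarrow> ('n::finite) Au_elem" where "zp \<equiv> circ.zpow"

lemma circle_embed_Gen: "circle_embed (Gen x) = diag CT circle_gen x"
proof (cases x)
  case (Pair i j)
  have "circle_embed (Gen (i, j)) = circle_embed (if i = j then Gen (undefined, undefined) else Const_poly 0)"
    by (rule circle_embed_eqI) simp
  then show ?thesis by (simp add: Pair diag_def circle_gen_def circle_embed_hom)
qed

lemma circle_embed_eval: "circle_embed p = eval_poly CT (diag CT circle_gen) p"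
  by (induct p) (simp_all add: circle_embed_hom circle_embed_Gen)

lemma circle_approx:
  assumes "a \<in> carrier CT" "0 < e"
  obtains p where "dst CT a (circle_embed p) < e"
  using circ.completion_approx[of a e] assms unfolding circle_alg_def circle_embed_def by blast

lemma generated_by_CT: "generated_by (CT :: ('n::finite) Au_elem cstar) (diag CT circle_gen :: 'n \<times> 'n \<Rightarrow> _)"
  unfolding generated_by_def
proof (intro conjI ballI allI impI)
  show "range (diag (CT :: 'n Au_elem cstar) circle_gen :: 'n \<times> 'n \<Rightarrow> _) \<subseteq> carrier CT" by (auto simp: diag_def)
  fix a :: "'n Au_elem" and e :: real assume "a \<in> carrier CT" "0 < e"
  then obtain p where "dst CT a (circle_embed p) < e" by (rule circle_approx)
  then show "\<exists>p :: ('n \<times> 'n) star_poly. dst CT a (eval_poly CT (diag CT circle_gen) p) < e" unfolding circle_embed_eval by (rule exI)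
qed

definition val :: "('n::finite) Au_elem \<Rightarrow> real \<Rightarrow> complex" where
  "val a \<theta> = circ.ext_fun (tval \<theta>) a"

lemma tval_dst: "cmod (tval \<theta> p - tval \<theta> q) \<le> dst circle_free p q"
  using circ.dst_ge[of p q "tval \<theta>"] by (simp add: dst_def)

lemma val_embed [simp]: "val (circle_embed p) \<theta> = tval \<theta> p"
  unfolding val_def circle_embed_def by (rule circ.ext_fun_embed) (simp_all add: tval_dst)

lemma val_star_hom: "star_hom CT complex_cstar (\<lambda>a. val a \<theta>)"
  unfolding val_def circle_alg_def by (rule circ.ext_fun_hom) (simp_all add: tval_dst)

lemmas val_hom = star_homD(2-5)[OF val_star_hom, simplified]

lemma val_one [simp]: "val \<one>\<^bsub>CT\<^esub> \<theta> = 1"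
  using val_embed[of "Const_poly 1 :: ('a \<times> 'a) star_poly" \<theta>] by (simp add: circle_embed_hom)

lemma val_dst: "a \<in> carrier CT \<Longrightarrow> cmod (val a \<theta> - tval \<theta> p) \<le> dst CT a (circle_embed p)"
  unfolding val_def circle_alg_def circle_embed_def by (rule circ.ext_fun_dst) (simp_all add: tval_dst)

lemma val_zero [simp]: "val \<zero>\<^bsub>CT\<^esub> \<theta> = 0"
  using val_hom(3)[of "\<zero>\<^bsub>CT\<^esub>" 0 \<theta>] by simp

lemma val_finsum:
  "(\<And>i. i \<in> I \<Longrightarrow> f i \<in> carrier CT) \<Longrightarrow> finite I \<Longrightarrow> val (finsum CT f I) \<theta> = (\<Sum>i\<in>I. val (f i) \<theta>)"
proof (induct I rule: infinite_finite_induct)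
  case (insert i I)
  then have "f \<in> I \<rightarrow> carrier CT" "f i \<in> carrier CT" by auto
  with insert show ?case by (simp add: val_hom)
qed auto

lemma val_zp: "val (zp k :: ('n::finite) Au_elem) \<theta> = cis (of_int k * \<theta>)"
proof -
  have z: "val (circle_gen :: 'n Au_elem) \<theta> = cis \<theta>" by (simp add: circle_gen_def)
  show ?thesis
  proof (induct k rule: int_induct[where k = 0])
    case base
    show ?case by simp
  next
    case (step1 i)
    then show ?case unfolding circ.zpow_Suc by (simp add: val_hom z cis_mult algebra_simps)
  next
    case (step2 i)
    then show ?case unfolding circ.zpow_pred by (simp add: val_hom z cis_mult cis_cnj algebra_simps)
  qed
qed

lemma nrm_circle_embed_le:
  assumes "\<And>\<theta>. cmod (tval \<theta> p) \<le> s"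
  shows "nrm CT (circle_embed p) \<le> s"
proof -
  have "nrm CT (circle_embed p) = nrm circle_free p"
    unfolding circle_alg_def circle_embed_def by (rule circ.nrm_embed) simp
  also have "\<dots> \<le> s" by (rule circ.nrm_le) (use assms in auto)
  finally show ?thesis .
qed

text \<open>
  The norm of \<open>C(\<T>)\<close> is the supremum norm of functions.
\<close>

lemma nrm_CT_le:
  assumes a: "a \<in> carrier CT" and s: "\<And>\<theta>. cmod (val a \<theta>) \<le> s"
  shows "nrm CT a \<le> s"
proof (rule field_le_epsilon)
  fix e :: real assume e: "0 < e"
  then have "0 < e / 2" by simp
  with a obtain p where p: "dst CT a (circle_embed p) < e / 2" by (rule circle_approx)
  have "cmod (tval \<theta> p) \<le> s + e / 2" for \<theta>
    using val_dst[OF a, of \<theta> p] s[of \<theta>] p norm_triangle_ineq2[of "tval \<theta> p" "val a \<theta>"] by (simp add: norm_minus_commute)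
  then have "nrm CT (circle_embed p) \<le> s + e / 2" by (rule nrm_circle_embed_le)
  with CT.nrm_diff_le[OF a circle_embed_in, of p] p show "nrm CT a \<le> s + e" by simp
qed

lemma CT_eqI:
  assumes "a \<in> carrier CT" "b \<in> carrier CT" "\<And>\<theta>. val a \<theta> = val b \<theta>"
  shows "a = b"
proof -
  have "dst CT a b \<le> 0"
    unfolding dst_def by (rule nrm_CT_le) (use assms in \<open>simp_all add: val_hom\<close>)
  with CT.dst_zero_iff[OF assms(1,2)] CT.dst_nonneg[OF assms(1,2)] show ?thesis by simp
qed

lemma val_le_nrm: "a \<in> carrier CT \<Longrightarrow> cmod (val a \<theta>) \<le> nrm CT a"
  using val_dst[of a \<theta> "Const_poly 0"] by (simp add: circle_embed_hom CT.dst_zero_right)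

lemma continuous_val:
  assumes "a \<in> carrier CT"
  shows "continuous_on UNIV (val a)"
proof -
  from assms obtain x where x: "cauchy_seq circle_free x" "a = cauchy_class circle_free x"
    unfolding circle_alg_def by (rule circ.carrier_completionE)
  have l: "(\<lambda>n. dst CT a (circle_embed (x n))) \<longlonglongrightarrow> 0"
    using circ.cc_limit[OF x(1)] unfolding circle_alg_def circle_embed_def x(2) .
  have "uniform_limit UNIV (\<lambda>n \<theta>. tval \<theta> (x n)) (val a) sequentially"
  proof (rule uniform_limitI)
    fix e :: real assume "0 < e"
    from order_tendstoD(2)[OF l this] show "\<forall>\<^sub>F n in sequentially. \<forall>\<theta>\<in>UNIV. dist (tval \<theta> (x n)) (val a \<theta>) < e"
    proof eventually_elim
      case (elim n)
      show ?case
      proof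
        fix \<theta> :: real
        show "dist (tval \<theta> (x n)) (val a \<theta>) < e"
          using val_dst[OF assms, of \<theta> "x n"] elim unfolding dist_norm norm_minus_commute[of "tval \<theta> (x n)"] by linarith
      qed
    qed
  qed
  then show ?thesis by (rule uniform_limit_theorem[rotated]) (auto intro: always_eventually continuous_tval)
qed

section \<open>The compact quantum group of the circle\<close>

text \<open>The coproduct sends \<open>\<Sum>\<^sub>k c\<^sub>k z\<^sup>k\<close> to \<open>\<Sum>\<^sub>k c\<^sub>k z\<^sup>k \<otimes> z\<^sup>k\<close>.\<close>

definition circle_delta :: "('n::finite \<times> 'n) star_poly \<Rightarrow> ('n Au_elem \<times> 'n Au_elem) multiset" where
  "circle_delta p = mset (map (\<lambda>(c, k). (c \<odot>\<^bsub>CT\<^esub> zp k, zp k)) (trig_list p))"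

lemma circle_delta_in: "circle_delta p \<in> carrier (formal_tensor CT CT)"
  by (auto simp: circle_delta_def)

lemma (in unitary_in) zpow_unique:
  assumes V: "\<And>k. V k \<in> carrier A" "V 0 = \<one>" "\<And>k. V (k + 1) = w \<otimes> V k"
  shows "V k = zpow k"
proof (induct k rule: int_induct[where k = 0])
  case (step1 i)
  then show ?case by (simp add: V zpow_Suc)
next
  case (step2 i)
  have "V (i - 1) = star A w \<otimes> (w \<otimes> V (i - 1))" using V(1) by simp
  also have "w \<otimes> V (i - 1) = V i" using V(3)[of "i - 1"] by simp
  finally show ?case using step2 by (simp add: zpow_pred)
qed (simp add: V)

text \<open>
  A pair of representations maps \<open>z \<otimes> z\<close> to a unitary \<open>W\<close> of a corner, and the coproduct becomes
  functional calculus of \<open>W\<close>; this is why it is contractive and multiplicative.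
\<close>

lemma kron_unitary:
  fixes \<sigma> :: "('n::finite) Au_elem \<Rightarrow> 'i op" and \<tau> :: "'n Au_elem \<Rightarrow> 'j op"
  assumes h: "star_hom CT bounded_ops \<sigma>" "star_hom CT bounded_ops \<tau>"
  defines "P \<equiv> kron (\<sigma> \<one>\<^bsub>CT\<^esub>) (\<tau> \<one>\<^bsub>CT\<^esub>)" and "W \<equiv> kron (\<sigma> circle_gen) (\<tau> circle_gen)"
  shows "unitary_in (corner bounded_ops P) W"
    "kron (\<sigma> (zp k)) (\<tau> (zp k)) = unitary_in.zpow (corner bounded_ops P) W k"
    "kron_sum \<sigma> \<tau> (circle_delta p) = eval_poly (corner bounded_ops P) (diag (corner bounded_ops P) W) p"
proof -
  note hc = star_homD(1)[OF h(1)] star_homD(1)[OF h(2)]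
  note hm = star_homD(3)[OF h(1), symmetric] star_homD(3)[OF h(2), symmetric]
  note hs = star_homD(5)[OF h(1), symmetric] star_homD(5)[OF h(2), symmetric]
  have P: "P \<in> carrier bounded_ops" "P \<otimes>\<^bsub>bounded_ops\<^esub> P = P" "star bounded_ops P = P"
    by (simp_all add: P_def hc kron_mult kron_star hm hs)
  interpret C: pre_cstar "corner bounded_ops P" by (rule bops.pre_cstar_corner[OF P])
  have in_corner: "kron (\<sigma> a) (\<tau> b) \<in> carrier (corner bounded_ops P)" if "a \<in> carrier CT" "b \<in> carrier CT" for a b
    using that by (simp add: P_def hc kron_mult hm)
  show U: "unitary_in (corner bounded_ops P) W"
  proof unfold_locales
    show "W \<in> carrier (corner bounded_ops P)" unfolding W_def by (rule in_corner) simp_all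
  qed (simp_all add: W_def P_def hc kron_mult kron_star hm hs)
  interpret U: unitary_in "corner bounded_ops P" W by (rule U)
  show V: "kron (\<sigma> (zp k)) (\<tau> (zp k)) = U.zpow k" for k
  proof (rule U.zpow_unique)
    show "kron (\<sigma> (zp k)) (\<tau> (zp k)) \<in> carrier (corner bounded_ops P)" for k by (rule in_corner) simp_all
    show "kron (\<sigma> (zp 0)) (\<tau> (zp 0)) = \<one>\<^bsub>corner bounded_ops P\<^esub>" by (simp add: P_def)
    show "kron (\<sigma> (zp (k + 1))) (\<tau> (zp (k + 1))) = W \<otimes>\<^bsub>corner bounded_ops P\<^esub> kron (\<sigma> (zp k)) (\<tau> (zp k))" for k
      unfolding circ.zpow_Suc by (simp add: W_def hc kron_mult hm)
  qed
  have "kron_sum \<sigma> \<tau> (mset (map (\<lambda>(c, k). (c \<odot>\<^bsub>CT\<^esub> zp k, zp k)) xs)) = U.trig_sum xs" for xs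
    by (induct xs) (auto simp: kron_sum_simps V star_homD(4)[OF h(1)] kron_smult)
  then show "kron_sum \<sigma> \<tau> (circle_delta p) = eval_poly (corner bounded_ops P) (diag (corner bounded_ops P) W) p"
    by (simp add: circle_delta_def U.eval_diag)
qed

interpretation circ_delta: raw_map complex_cstar "circle_free :: ('n::finite \<times> 'n) star_poly cstar" "range tval"
  bounded_ops "formal_tensor (CT :: 'n Au_elem cstar) CT" "tensor_reps CT CT" circle_delta
proof unfold_locales
  fix p q :: "('n \<times> 'n) star_poly"
  show "circle_delta p \<in> carrier (formal_tensor CT CT)" by (rule circle_delta_in)
  show "dst (formal_tensor CT CT) (circle_delta p) (circle_delta q) \<le> dst circle_free p q"
  proof (rule CC.FT.dst_le[OF circle_delta_in circle_delta_in])
    fix \<phi> assume "\<phi> \<in> tensor_reps (CT :: 'n Au_elem cstar) (CT :: 'n Au_elem cstar)"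
    then obtain \<sigma> \<tau> where \<phi>: "\<phi> = kron_sum \<sigma> \<tau>" and h: "star_hom CT bounded_ops \<sigma>" "star_hom CT bounded_ops \<tau>"
      by (rule CC.tensor_repsE)
    note k = kron_unitary[OF h]
    interpret U: unitary_in "corner bounded_ops (kron (\<sigma> \<one>\<^bsub>CT\<^esub>) (\<tau> \<one>\<^bsub>CT\<^esub>))" "kron (\<sigma> circle_gen) (\<tau> circle_gen)"
      by (rule k(1))
    have "dst bounded_ops (\<phi> (circle_delta p)) (\<phi> (circle_delta q)) =
        nrm (corner bounded_ops (kron (\<sigma> \<one>\<^bsub>CT\<^esub>) (\<tau> \<one>\<^bsub>CT\<^esub>))) (eval_poly (corner bounded_ops (kron (\<sigma> \<one>\<^bsub>CT\<^esub>) (\<tau> \<one>\<^bsub>CT\<^esub>)))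
          (diag (corner bounded_ops (kron (\<sigma> \<one>\<^bsub>CT\<^esub>) (\<tau> \<one>\<^bsub>CT\<^esub>))) (kron (\<sigma> circle_gen) (\<tau> circle_gen))) (poly_relator p q))"
      unfolding \<phi> k(3) dst_def poly_relator_def
      using U.smult_mult_left[OF U.one_closed U.eval_diag_closed, of "-1" q] U.l_one[OF U.eval_diag_closed, of q] by simp
    also have "\<dots> \<le> dst circle_free p q"
      by (rule U.nrm_eval_diag_sup) (use tval_dst[of _ p q] in \<open>simp add: poly_relator_def\<close>)
    finally show "dst bounded_ops (\<phi> (circle_delta p)) (\<phi> (circle_delta q)) \<le> dst circle_free p q" .
  qed
qed

definition circle_comult :: "('n::finite) Au_elem \<Rightarrow> ('n Au_elem, 'n Au_elem) tensor" where
  "circle_comult = completion_map (formal_tensor CT CT) circle_delta"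

lemma circle_comult_cc:
  "cauchy_seq circle_free x \<Longrightarrow> circle_comult (cauchy_class circle_free x) = cauchy_class (formal_tensor CT CT) (\<lambda>n. circle_delta (x n))"
  unfolding circle_comult_def by (rule circ_delta.completion_map_cc)

lemma circle_comult_hom: "unital_star_hom CT (min_tensor CT CT) (circle_comult :: ('n::finite) Au_elem \<Rightarrow> _)"
  unfolding circle_comult_def min_tensor_def
proof (subst (1) circle_alg_def, rule circ_delta.completion_map_unital_star_hom)
  fix \<psi> assume "\<psi> \<in> tensor_reps (CT :: 'n Au_elem cstar) (CT :: 'n Au_elem cstar)"
  then obtain \<sigma> \<tau> where \<psi>: "\<psi> = kron_sum \<sigma> \<tau>" and h: "star_hom CT bounded_ops \<sigma>" "star_hom CT bounded_ops \<tau>"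
    by (rule CC.tensor_repsE)
  note k = kron_unitary[OF h]
  interpret U: unitary_in "corner bounded_ops (kron (\<sigma> \<one>\<^bsub>CT\<^esub>) (\<tau> \<one>\<^bsub>CT\<^esub>))" "kron (\<sigma> circle_gen) (\<tau> circle_gen)"
    by (rule k(1))
  show "\<psi> (circle_delta \<one>\<^bsub>circle_free\<^esub>) = \<psi> \<one>\<^bsub>formal_tensor CT CT\<^esub>"
    using U.sm_one[OF U.one_closed] unfolding \<psi> k(3) by simp
  fix p q :: "('n \<times> 'n) star_poly" and c
  show "\<psi> (circle_delta (p \<oplus>\<^bsub>circle_free\<^esub> q)) = \<psi> (circle_delta p) \<oplus>\<^bsub>bounded_ops\<^esub> \<psi> (circle_delta q)"
    "\<psi> (circle_delta (p \<otimes>\<^bsub>circle_free\<^esub> q)) = \<psi> (circle_delta p) \<otimes>\<^bsub>bounded_ops\<^esub> \<psi> (circle_delta q)"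
    "\<psi> (circle_delta (star circle_free p)) = star bounded_ops (\<psi> (circle_delta p))"
    unfolding \<psi> k(3) by simp_all
  show "\<psi> (circle_delta (c \<odot>\<^bsub>circle_free\<^esub> p)) = c \<odot>\<^bsub>bounded_ops\<^esub> \<psi> (circle_delta p)"
    unfolding \<psi> k(3) using U.smult_mult_left[OF U.one_closed U.eval_diag_closed, of c p]
      U.l_one[OF U.eval_diag_closed, of p] by simp
qed

lemmas circle_comult_star_hom = circle_comult_hom[unfolded unital_star_hom_def, THEN conjunct1]

lemma circle_comult_embed: "circle_comult (circle_embed p) = formal_sum CT CT (circle_delta p)"
  using circle_comult_cc[of "\<lambda>_. p"] unfolding circle_embed_def formal_sum_def completion_embed_def
  by simp

lemma tens_zp_unitary:
  "unitary_in (min_tensor CT CT) (tens CT CT circle_gen circle_gen :: (('n::finite) Au_elem, 'n Au_elem) tensor)"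
  by unfold_locales (simp_all add: CC.tens_star CC.tens_mult CC.tens_one)

lemma circle_comult_zp: "circle_comult (zp k :: ('n::finite) Au_elem) = tens CT CT (zp k) (zp k)"
proof -
  let ?t = "tens CT CT circle_gen circle_gen :: ('n Au_elem, 'n Au_elem) tensor"
  interpret U: unitary_in "min_tensor CT CT" ?t by (rule tens_zp_unitary)
  have "trig_list (Gen (undefined, undefined) :: ('n \<times> 'n) star_poly) = [(1, 1)]" by simp
  moreover have "zp 1 = (circle_gen :: 'n Au_elem)" using circ.zpow_Suc[of 0] by simp
  ultimately have "circle_comult (circle_embed (Gen (undefined, undefined) :: ('n \<times> 'n) star_poly)) =
      formal_sum CT CT {#(circle_gen, circle_gen)#}"
    unfolding circle_comult_embed by (simp add: circle_delta_def)
  then have g: "circle_comult circle_gen = ?t" unfolding circle_gen_def[symmetric] tens_def .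
  have "circle_comult (zp k :: 'n Au_elem) = U.zpow k"
  proof (rule U.zpow_unique)
    show "circle_comult (zp k :: 'n Au_elem) \<in> carrier (min_tensor CT CT)" for k
      by (rule star_homD(1)[OF circle_comult_star_hom]) simp
    show "circle_comult (zp 0 :: 'n Au_elem) = \<one>\<^bsub>min_tensor CT CT\<^esub>"
      by (simp, rule circle_comult_hom[unfolded unital_star_hom_def, THEN conjunct2])
    show "circle_comult (zp (k + 1) :: 'n Au_elem) = ?t \<otimes>\<^bsub>min_tensor CT CT\<^esub> circle_comult (zp k)" for k
      unfolding circ.zpow_Suc g[symmetric] by (rule star_homD(3)[OF circle_comult_star_hom]) simp_all
  qed
  also have "U.zpow k = tens CT CT (zp k) (zp k)"
  proof (rule U.zpow_unique[symmetric])
    show "tens CT CT (zp k) (zp k) \<in> carrier (min_tensor (CT :: 'n Au_elem cstar) CT)" for k by simp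
    show "tens CT CT (zp 0) (zp 0) = \<one>\<^bsub>min_tensor (CT :: 'n Au_elem cstar) CT\<^esub>" by (simp add: CC.tens_one)
    show "tens CT CT (zp (k + 1)) (zp (k + 1)) = ?t \<otimes>\<^bsub>min_tensor CT CT\<^esub> tens CT CT (zp k) (zp k)" for k
      unfolding circ.zpow_Suc by (simp add: CC.tens_mult)
  qed
  finally show ?thesis .
qed

lemma infinite_Au_elem: "infinite (UNIV :: ('n::finite) Au_elem set)"
proof -
  have "inj (\<lambda>c. {\<lambda>_ :: nat. Const_poly c :: ('n \<times> 'n) star_poly})" by (auto simp: inj_def fun_eq_iff)
  then have "infinite (range (\<lambda>c :: complex. {\<lambda>_ :: nat. Const_poly c :: ('n \<times> 'n) star_poly}))"
    using range_inj_infinite[of "\<lambda>c :: complex. {\<lambda>_ :: nat. Const_poly c :: ('n \<times> 'n) star_poly}"]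
      finite_imageD infinite_UNIV_char_0 by blast
  then show ?thesis by (rule infinite_super[OF subset_UNIV])
qed

lemma CT_kron_sum_le:
  fixes \<sigma> :: "('n::finite) Au_elem \<Rightarrow> 'i op" and \<tau> :: "'n Au_elem \<Rightarrow> 'j op"
  assumes "star_hom CT bounded_ops \<sigma>" "star_hom CT bounded_ops \<tau>" "M \<in> carrier (formal_tensor CT CT)"
  shows "op_norm (kron_sum \<sigma> \<tau> M) \<le> nrm (formal_tensor CT CT) M"
  by (rule CC.kron_sum_le_nrm[OF generated_by_CT generated_by_CT infinite_Au_elem infinite_Au_elem assms])

text \<open>
  Both sides are limits of the expressions \<open>\<Sum>\<^sub>k c\<^sub>k z\<^sup>k \<otimes> z\<^sup>k \<otimes> z\<^sup>k\<close>, bracketed in the two possible ways.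
\<close>

lemma circle_coassociative:
  fixes a :: "('n::finite) Au_elem"
  assumes "a \<in> carrier CT"
  shows "tensor_assoc CT CT CT (tensor_map (min_tensor CT CT) CT circle_comult id (circle_comult a))
    (tensor_map CT (min_tensor CT CT) id circle_comult (circle_comult a))"
proof -
  let ?C = "CT :: 'n Au_elem cstar"
  from assms obtain x where x: "cauchy_seq circle_free x" "a = cauchy_class circle_free x"
    unfolding circle_alg_def by (rule circ.carrier_completionE)
  note cmp = CC.cstar_algebra_min_tensor
  have pr: "cstar_pair (min_tensor ?C ?C) ?C" "cstar_pair ?C (min_tensor ?C ?C)"
    by (rule cstar_pair.intro[OF cmp cstar_algebra_CT] cstar_pair.intro[OF cstar_algebra_CT cmp])+
  interpret L: raw_map bounded_ops "formal_tensor ?C ?C" "tensor_reps ?C ?C" bounded_ops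
    "formal_tensor (min_tensor ?C ?C) ?C" "tensor_reps (min_tensor ?C ?C) ?C" "image_mset (map_prod circle_comult id)"
    by (rule tensor_raw_map[OF CC.cstar_pair_axioms pr(1) circle_comult_star_hom star_hom_id])
      (auto intro!: CT_kron_sum_le intro: star_hom_comp[OF circle_comult_star_hom])
  interpret R: raw_map bounded_ops "formal_tensor ?C ?C" "tensor_reps ?C ?C" bounded_ops
    "formal_tensor ?C (min_tensor ?C ?C)" "tensor_reps ?C (min_tensor ?C ?C)" "image_mset (map_prod id circle_comult)"
    by (rule tensor_raw_map[OF CC.cstar_pair_axioms pr(2) star_hom_id circle_comult_star_hom])
      (auto intro!: CT_kron_sum_le intro: star_hom_comp[OF circle_comult_star_hom])
  have y: "cauchy_seq (formal_tensor ?C ?C) (\<lambda>n. circle_delta (x n))" by (rule circ_delta.f_cauchy[OF x(1)])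
  define M :: "nat \<Rightarrow> ('n Au_elem \<times> 'n Au_elem \<times> 'n Au_elem) multiset" where "M = (\<lambda>n. mset (map (\<lambda>(c, k). (c \<odot>\<^bsub>?C\<^esub> zp k, zp k, zp k)) (trig_list (x n))))"
  have ch: "circle_comult (c \<odot>\<^bsub>?C\<^esub> zp k) = tens ?C ?C (c \<odot>\<^bsub>?C\<^esub> zp k) (zp k)" for c and k
    using star_homD(4)[OF circle_comult_star_hom, of "zp k" c] by (simp add: circle_comult_zp CC.tens_smult)
  have EL: "image_mset (\<lambda>(a, b, c). (tens ?C ?C a b, c)) (M n) = image_mset (map_prod circle_comult id) (circle_delta (x n))" for n
    by (simp add: M_def circle_delta_def image_mset.compositionality comp_def case_prod_unfold ch mset_map[symmetric] del: mset_map)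
  have ER: "image_mset (\<lambda>(a, b, c). (a, tens ?C ?C b c)) (M n) = image_mset (map_prod id circle_comult) (circle_delta (x n))" for n
    by (simp add: M_def circle_delta_def image_mset.compositionality comp_def case_prod_unfold circle_comult_zp mset_map[symmetric] del: mset_map)
  have 1: "tensor_map (min_tensor ?C ?C) ?C circle_comult id (circle_comult a) =
      cauchy_class (formal_tensor (min_tensor ?C ?C) ?C) (\<lambda>n. image_mset (\<lambda>(a, b, c). (tens ?C ?C a b, c)) (M n))"
    unfolding tensor_map_def x(2) circle_comult_cc[OF x(1)] EL by (rule L.completion_map_cc[OF y])
  have 2: "tensor_map ?C (min_tensor ?C ?C) id circle_comult (circle_comult a) =
      cauchy_class (formal_tensor ?C (min_tensor ?C ?C)) (\<lambda>n. image_mset (\<lambda>(a, b, c). (a, tens ?C ?C b c)) (M n))"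
    unfolding tensor_map_def x(2) circle_comult_cc[OF x(1)] ER by (rule R.completion_map_cc[OF y])
  have sets: "set_mset (M n) \<subseteq> carrier ?C \<times> carrier ?C \<times> carrier ?C" for n by (auto simp: M_def)
  have cL: "cauchy_seq (formal_tensor (min_tensor ?C ?C) ?C) (\<lambda>n. image_mset (\<lambda>(a, b, c). (tens ?C ?C a b, c)) (M n))"
    unfolding EL by (rule L.f_cauchy[OF y])
  have cR: "cauchy_seq (formal_tensor ?C (min_tensor ?C ?C)) (\<lambda>n. image_mset (\<lambda>(a, b, c). (a, tens ?C ?C b c)) (M n))"
    unfolding ER by (rule R.f_cauchy[OF y])
  interpret TL: pre_cstar "completion (formal_tensor (min_tensor ?C ?C) ?C)"
    by (rule cstar_algebra_pre[OF L.G.cstar_algebra_completion])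
  interpret TR: pre_cstar "completion (formal_tensor ?C (min_tensor ?C ?C))"
    by (rule cstar_algebra_pre[OF R.G.cstar_algebra_completion])
  have lL: "converges_to (min_tensor (min_tensor ?C ?C) ?C)
      (\<lambda>n. formal_sum (min_tensor ?C ?C) ?C (image_mset (\<lambda>(a, b, c). (tens ?C ?C a b, c)) (M n)))
      (tensor_map (min_tensor ?C ?C) ?C circle_comult id (circle_comult a))"
    unfolding 1 converges_to_def formal_sum_def min_tensor_def[of "min_tensor ?C ?C"]
    using L.G.cc_limit[OF cL] TL.dst_sym[OF L.G.cc_in[OF cL] L.G.completion_embed_in[OF L.G.cauchy_in[OF cL]]] by simp
  have lR: "converges_to (min_tensor ?C (min_tensor ?C ?C))
      (\<lambda>n. formal_sum ?C (min_tensor ?C ?C) (image_mset (\<lambda>(a, b, c). (a, tens ?C ?C b c)) (M n)))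
      (tensor_map ?C (min_tensor ?C ?C) id circle_comult (circle_comult a))"
    unfolding 2 converges_to_def formal_sum_def min_tensor_def[of ?C "min_tensor ?C ?C"]
    using R.G.cc_limit[OF cR] TR.dst_sym[OF R.G.cc_in[OF cR] R.G.completion_embed_in[OF R.G.cauchy_in[OF cR]]] by simp
  from sets lL lR show ?thesis unfolding tensor_assoc_def by blast
qed

section \<open>Functions on the circle\<close>

text \<open>Gaussian elimination: more functions than a spanning family has members are linearly dependent.\<close>

lemma linear_dependence:
  fixes h :: "'i \<Rightarrow> 'x \<Rightarrow> complex"
  assumes "finite J" "finite I" "card J < card I"
    and "\<And>i. i \<in> I \<Longrightarrow> \<exists>\<alpha>. \<forall>x. h i x = (\<Sum>j\<in>J. \<alpha> j * \<tau> j x)"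
  shows "\<exists>c. (\<exists>i\<in>I. c i \<noteq> 0) \<and> (\<forall>x. (\<Sum>i\<in>I. c i * h i x) = 0)"
  using assms
proof (induct J arbitrary: I h rule: finite_induct)
  case empty
  then have "I \<noteq> {}" by auto
  with empty show ?case by (intro exI[of _ "\<lambda>_. 1"]) auto
next
  case (insert j J)
  then have "\<forall>i\<in>I. \<exists>\<alpha>. \<forall>x. h i x = (\<Sum>j\<in>insert j J. \<alpha> j * \<tau> j x)" by blast
  then obtain \<alpha> where \<alpha>: "\<And>i x. i \<in> I \<Longrightarrow> h i x = (\<Sum>l\<in>insert j J. \<alpha> i l * \<tau> l x)"
    by (auto dest!: bchoice)
  then have h: "h i x = \<alpha> i j * \<tau> j x + (\<Sum>l\<in>J. \<alpha> i l * \<tau> l x)" if "i \<in> I" for i x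
    using that insert(1,2) by simp
  show ?case
  proof (cases "\<exists>k\<in>I. \<alpha> k j \<noteq> 0")
    case False
    have "\<exists>\<beta>. \<forall>x. h i x = (\<Sum>l\<in>J. \<beta> l * \<tau> l x)" if "i \<in> I" for i
      using False that h[OF that] by (intro exI[of _ "\<alpha> i"]) auto
    moreover have "card J < card I" using insert by simp
    ultimately show ?thesis using insert(3)[OF insert(4)] by blast
  next
    case True
    then obtain k where k: "k \<in> I" "\<alpha> k j \<noteq> 0" by blast
    \<comment> \<open>subtracting multiples of \<open>h k\<close> removes \<open>\<tau> j\<close> from the other functions\<close>
    define r where "r i = \<alpha> i j / \<alpha> k j" for i
    have "\<exists>\<beta>. \<forall>x. h i x - r i * h k x = (\<Sum>l\<in>J. \<beta> l * \<tau> l x)" if "i \<in> I - {k}" for i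
    proof (intro exI allI)
      fix x
      have "h i x - r i * h k x = (\<Sum>l\<in>J. \<alpha> i l * \<tau> l x) - r i * (\<Sum>l\<in>J. \<alpha> k l * \<tau> l x)"
        using k that h[of i x] h[of k x] by (simp add: r_def field_simps)
      also have "\<dots> = (\<Sum>l\<in>J. (\<alpha> i l - r i * \<alpha> k l) * \<tau> l x)"
        by (simp add: sum_distrib_left sum_subtractf left_diff_distrib mult.assoc)
      finally show "h i x - r i * h k x = (\<Sum>l\<in>J. (\<alpha> i l - r i * \<alpha> k l) * \<tau> l x)" .
    qed
    moreover have "card J < card (I - {k})" "finite (I - {k})" using insert k by auto
    ultimately obtain c where c: "\<exists>i\<in>I - {k}. c i \<noteq> 0" "\<forall>x. (\<Sum>i\<in>I - {k}. c i * (h i x - r i * h k x)) = 0"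
      using insert(3)[of "I - {k}" "\<lambda>i x. h i x - r i * h k x"] by blast
    define d where "d = c(k := - (\<Sum>i\<in>I - {k}. c i * r i))"
    have "(\<Sum>i\<in>I. d i * h i x) = 0" for x
    proof -
      have "(\<Sum>i\<in>I. d i * h i x) = d k * h k x + (\<Sum>i\<in>I - {k}. d i * h i x)"
        by (rule sum.remove[OF insert(4) k(1)])
      also have "(\<Sum>i\<in>I - {k}. d i * h i x) = (\<Sum>i\<in>I - {k}. c i * h i x)"
        by (rule sum.cong) (auto simp: d_def)
      also have "d k * h k x = - (\<Sum>i\<in>I - {k}. c i * (r i * h k x))"
        by (simp add: d_def sum_distrib_right mult.assoc)
      finally show ?thesis using c(2) by (simp add: right_diff_distrib sum_subtractf)
    qed
    moreover have "\<exists>i\<in>I. d i \<noteq> 0" using c(1) by (auto simp: d_def)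
    ultimately show ?thesis by blast
  qed
qed

lemma fourier_coeff_sum:
  assumes "finite I" "\<And>i. i \<in> I \<Longrightarrow> continuous_on UNIV (f i)"
  shows "fourier_coeff k (\<lambda>\<theta>. \<Sum>i\<in>I. c i * f i \<theta>) = (\<Sum>i\<in>I. c i * fourier_coeff k (f i))"
  using assms
proof (induct I rule: finite_induct)
  case empty
  show ?case by (simp add: fourier_coeff_def)
next
  case (insert i I)
  have "fourier_coeff k (\<lambda>\<theta>. c i * f i \<theta> + (\<Sum>i\<in>I. c i * f i \<theta>)) =
      fourier_coeff k (\<lambda>\<theta>. c i * f i \<theta>) + fourier_coeff k (\<lambda>\<theta>. \<Sum>i\<in>I. c i * f i \<theta>)"
    by (rule fourier_coeff_add) (intro continuous_intros; use insert in auto)+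
  with insert show ?case by (simp add: fourier_coeff_cmult)
qed

lemma continuous_cis_of_int: "continuous_on UNIV (\<lambda>\<theta>. cis (of_int k * \<theta>))"
  by (intro continuous_intros)

text \<open>
  Characters of the circle are linearly independent: the Fourier coefficients of a vanishing linear
  combination are its coefficients.
\<close>

lemma finite_frequencies:
  assumes "finite J" and K: "\<And>k. k \<in> K \<Longrightarrow> \<exists>\<alpha>. \<forall>t. cis (of_int k * t) = (\<Sum>j\<in>J. \<alpha> j * \<tau> j t)"
  shows "finite K"
proof (rule ccontr)
  assume "infinite K"
  then obtain I where I: "I \<subseteq> K" "finite I" "card I = Suc (card J)" using infinite_arbitrarily_large by blast
  have "\<exists>c. (\<exists>k\<in>I. c k \<noteq> 0) \<and> (\<forall>t. (\<Sum>k\<in>I. c k * cis (of_int k * t)) = 0)"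
    by (rule linear_dependence[where \<tau> = \<tau>, OF assms(1) I(2)]) (use I K in auto)
  then obtain c k where k: "k \<in> I" "c k \<noteq> 0" and z: "\<And>t. (\<Sum>k\<in>I. c k * cis (of_int k * t)) = 0" by blast
  have "0 = fourier_coeff k (\<lambda>t. \<Sum>l\<in>I. c l * cis (of_int l * t))" by (simp add: z fourier_coeff_def)
  also have "\<dots> = (\<Sum>l\<in>I. c l * fourier_coeff k (\<lambda>t. cis (of_int l * t)))"
    by (rule fourier_coeff_sum[OF I(2) continuous_cis_of_int])
  also have "\<dots> = c k" using k I(2) by (simp add: fourier_coeff_cis if_distrib cong: if_cong)
  finally show False using k by simp
qed

text \<open>
  Linear dependence of the powers of \<open>g\<close> is a polynomial equation for the values of \<open>g\<close>.
\<close>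

lemma finite_range_of_powers:
  fixes g :: "'x \<Rightarrow> complex"
  assumes "finite J" and g: "\<And>m. \<exists>\<alpha>. \<forall>x. g x ^ Suc m = (\<Sum>j\<in>J. \<alpha> j * \<tau> j x)"
  shows "finite (range g)"
proof -
  have "\<exists>c. (\<exists>m\<in>{1..Suc (card J)}. c m \<noteq> 0) \<and> (\<forall>x. (\<Sum>m\<in>{1..Suc (card J)}. c m * g x ^ m) = 0)"
  proof (rule linear_dependence[where \<tau> = \<tau>, OF assms(1)])
    fix m assume "m \<in> {1..Suc (card J)}"
    then show "\<exists>\<alpha>. \<forall>x. g x ^ m = (\<Sum>j\<in>J. \<alpha> j * \<tau> j x)" using g[of "m - 1"] by auto
  qed auto
  then obtain c m where c: "m \<in> {1..Suc (card J)}" "c m \<noteq> 0" "\<And>x. (\<Sum>m\<in>{1..Suc (card J)}. c m * g x ^ m) = 0"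
    by blast
  define d where "d m = (if m = 0 then 0 else c m)" for m
  have s: "{..Suc (card J)} = insert 0 {1..Suc (card J)}" by auto
  have "(\<Sum>m\<in>{1..Suc (card J)}. d m * y ^ m) = (\<Sum>m\<in>{1..Suc (card J)}. c m * y ^ m)" for y
    by (rule sum.cong) (auto simp: d_def)
  then have "(\<Sum>m\<le>Suc (card J). d m * g x ^ m) = 0" for x
    using c(3)[of x] unfolding s by (subst sum.insert) (auto simp: d_def)
  then have "range g \<subseteq> {y. (\<Sum>m\<le>Suc (card J). d m * y ^ m) = 0}" by auto
  moreover have "finite {y. (\<Sum>m\<le>Suc (card J). d m * y ^ m) = 0}"
    unfolding polyfun_finite_roots by (rule exI[of _ m]) (use c in \<open>auto simp: d_def\<close>)
  ultimately show ?thesis by (rule finite_subset)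
qed

lemma val_periodic: "a \<in> carrier CT \<Longrightarrow> val a (\<theta> + of_int m * (2 * pi)) = val a \<theta>"
proof -
  assume a: "a \<in> carrier CT"
  have t: "tval (\<theta> + of_int m * (2 * pi)) p = tval \<theta> p" for p :: "('a \<times> 'a) star_poly"
  proof (induct p)
    case (Gen g)
    have "cis (\<theta> + of_int m * (2 * pi)) = cis \<theta>"
      using cis_mult[of \<theta> "of_int m * (2 * pi)"] cis_multiple_2pi[of "of_int m"] by (simp add: mult.commute)
    then show ?case by (cases g) simp
  qed auto
  have "cmod (val a (\<theta> + of_int m * (2 * pi)) - val a \<theta>) \<le> 0"
  proof (rule field_le_epsilon)
    fix e :: real assume "0 < e"
    then have "0 < e / 2" by simp
    with a obtain p where "dst CT a (circle_embed p) < e / 2" by (rule circle_approx)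
    with val_dst[OF a, of \<theta> p] val_dst[OF a, of "\<theta> + of_int m * (2 * pi)" p]
      norm_triangle_ineq4[of "val a (\<theta> + of_int m * (2 * pi)) - tval \<theta> p" "val a \<theta> - tval \<theta> p"]
    show "cmod (val a (\<theta> + of_int m * (2 * pi)) - val a \<theta>) \<le> 0 + e" unfolding t by simp
  qed
  then show ?thesis by simp
qed

text \<open>
  \<open>a\<close> is orthogonal to all trigonometric polynomials and is uniformly approximated by them, so
  the integral of its squared modulus vanishes.
\<close>

lemma fourier_uniqueness:
  assumes a: "a \<in> carrier CT" and z: "\<And>k. fourier_coeff k (val a) = 0"
  shows "a = \<zero>\<^bsub>CT\<^esub>"
proof -
  let ?g = "val a"
  note cont = continuous_val[OF a]
  have orth: "integral {0..2*pi} (\<lambda>\<theta>. ?g \<theta> * cnj (tval \<theta> p)) = 0" for p :: "('a \<times> 'a) star_poly"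
  proof -
    have "integral {0..2*pi} (\<lambda>\<theta>. \<Sum>(c, k)\<leftarrow>xs. cnj c * (?g \<theta> * cis (- of_int k * \<theta>))) = 0 \<and>
        continuous_on UNIV (\<lambda>\<theta>. \<Sum>(c, k)\<leftarrow>xs. cnj c * (?g \<theta> * cis (- of_int k * \<theta>)))" for xs
    proof (induct xs)
      case (Cons x xs)
      obtain c k where x: "x = (c, k)" by force
      have 1: "continuous_on UNIV (\<lambda>\<theta>. cnj c * (?g \<theta> * cis (- of_int k * \<theta>)))"
        by (intro continuous_intros cont)
      have "integral {0..2*pi} (\<lambda>\<theta>. ?g \<theta> * cis (- of_int k * \<theta>)) = 0"
        using z[of k] by (simp add: fourier_coeff_def)
      then have "integral {0..2*pi} (\<lambda>\<theta>. cnj c * (?g \<theta> * cis (- of_int k * \<theta>))) = 0" by simp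
      moreover have "integral {0..2*pi} (\<lambda>\<theta>. cnj c * (?g \<theta> * cis (- of_int k * \<theta>)) +
          (\<Sum>(c, k)\<leftarrow>xs. cnj c * (?g \<theta> * cis (- of_int k * \<theta>)))) =
        integral {0..2*pi} (\<lambda>\<theta>. cnj c * (?g \<theta> * cis (- of_int k * \<theta>))) +
        integral {0..2*pi} (\<lambda>\<theta>. (\<Sum>(c, k)\<leftarrow>xs. cnj c * (?g \<theta> * cis (- of_int k * \<theta>))))"
        by (rule Henstock_Kurzweil_Integration.integral_add)
          (intro integrable_continuous_interval continuous_on_subset[OF 1] continuous_on_subset[OF conjunct2[OF Cons]] subset_UNIV)+
      ultimately show ?case using Cons 1 by (auto simp: x intro!: continuous_on_add)
    qed simp
    moreover have "?g \<theta> * cnj (tval \<theta> p) = (\<Sum>(c, k)\<leftarrow>trig_list p. cnj c * (?g \<theta> * cis (- of_int k * \<theta>)))" for \<theta>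
    proof -
      have "?g \<theta> * cnj (\<Sum>(c, k)\<leftarrow>xs. c * cis (of_int k * \<theta>)) = (\<Sum>(c, k)\<leftarrow>xs. cnj c * (?g \<theta> * cis (- of_int k * \<theta>)))" for xs
        by (induct xs) (auto simp: cis_cnj algebra_simps)
      then show ?thesis by (simp add: tval_list)
    qed
    ultimately show ?thesis by simp
  qed
  have i: "(\<lambda>\<theta>. ?g \<theta> * cnj (?g \<theta>)) integrable_on {0..2*pi}"
    by (intro integrable_continuous_interval continuous_intros continuous_on_subset[OF cont]) auto
  let ?S = "nrm CT a"
  have S: "cmod (?g \<theta>) \<le> ?S" for \<theta> by (rule val_le_nrm[OF a])
  have "cmod (integral {0..2*pi} (\<lambda>\<theta>. ?g \<theta> * cnj (?g \<theta>))) \<le> 0"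
  proof (rule field_le_epsilon)
    fix e :: real assume e: "0 < e"
    have S0: "0 \<le> ?S" by (rule CT.nrm_nonneg[OF a])
    \<comment> \<open>by orthogonality the integral is that of \<open>g\<close> times the conjugate of \<open>g - p\<close>, at most \<open>2 pi S d\<close>\<close>
    define d where "d = e / (2 * pi * (?S + 1))"
    have d: "0 < d" using e S0 by (simp add: d_def)
    with a obtain p where p: "dst CT a (circle_embed p) < d" by (rule circle_approx)
    have ip: "(\<lambda>\<theta>. ?g \<theta> * cnj (tval \<theta> p)) integrable_on {0..2*pi}"
      by (intro integrable_continuous_interval continuous_intros continuous_on_subset[OF cont] continuous_on_subset[OF continuous_tval]) auto
    have c: "continuous_on {0..2*pi} (\<lambda>\<theta>. ?g \<theta> * cnj (?g \<theta>) - ?g \<theta> * cnj (tval \<theta> p))"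
      by (intro continuous_intros continuous_on_subset[OF cont] continuous_on_subset[OF continuous_tval]) auto
    have "integral {0..2*pi} (\<lambda>\<theta>. ?g \<theta> * cnj (?g \<theta>)) =
        integral {0..2*pi} (\<lambda>\<theta>. ?g \<theta> * cnj (?g \<theta>) - ?g \<theta> * cnj (tval \<theta> p))"
      using Henstock_Kurzweil_Integration.integral_diff[OF i ip] orth[of p] by simp
    also have "cmod \<dots> \<le> ?S * d * (2 * pi - 0)"
    proof (rule integral_bound[OF _ c])
      fix \<theta> :: real
      have "cmod (?g \<theta> - tval \<theta> p) \<le> d" using val_dst[OF a, of \<theta> p] p by simp
      then have "cmod (?g \<theta>) * cmod (?g \<theta> - tval \<theta> p) \<le> ?S * d" using S[of \<theta>] S0 by (intro mult_mono) auto
      moreover have "?g \<theta> * cnj (?g \<theta>) - ?g \<theta> * cnj (tval \<theta> p) = ?g \<theta> * cnj (?g \<theta> - tval \<theta> p)"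
        by (simp add: right_diff_distrib)
      ultimately show "norm (?g \<theta> * cnj (?g \<theta>) - ?g \<theta> * cnj (tval \<theta> p)) \<le> ?S * d"
        by (simp only: norm_mult complex_mod_cnj)
    qed simp
    also have "\<dots> = e * (?S / (?S + 1))"
    proof -
      have "d * (2 * pi) = e / (?S + 1)" by (simp add: d_def)
      then show ?thesis by (simp add: mult.assoc)
    qed
    also have "\<dots> \<le> e * 1" by (rule mult_left_mono) (use S0 e in auto)
    finally show "cmod (integral {0..2*pi} (\<lambda>\<theta>. ?g \<theta> * cnj (?g \<theta>))) \<le> 0 + e" by simp
  qed
  then have "integral {0..2*pi} (\<lambda>\<theta>. of_real ((cmod (?g \<theta>))\<^sup>2)) = (0 :: complex)"
    unfolding complex_norm_square by simp
  moreover have ir: "(\<lambda>\<theta>. (cmod (?g \<theta>))\<^sup>2) integrable_on {0..2*pi}"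
    by (intro integrable_continuous_interval continuous_intros continuous_on_subset[OF cont]) auto
  ultimately have "integral {0..2*pi} (\<lambda>\<theta>. (cmod (?g \<theta>))\<^sup>2) = 0"
    using integral_linear[OF ir bounded_linear_of_real[where 'a = complex]] by (simp add: comp_def)
  then have "((\<lambda>\<theta>. (cmod (?g \<theta>))\<^sup>2) has_integral 0) (cbox 0 (2*pi))"
    using integrable_integral[OF ir] by simp
  moreover have "continuous_on (cbox 0 (2*pi)) (\<lambda>\<theta>. (cmod (?g \<theta>))\<^sup>2)"
    by (intro continuous_intros continuous_on_subset[OF cont]) auto
  moreover have pi0: "\<not> pi \<le> 0" using pi_gt_zero by linarith
  ultimately have z0: "(cmod (?g \<theta>))\<^sup>2 = 0" if "\<theta> \<in> {0..2*pi}" for \<theta>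
    by - (rule has_integral_0_cbox_imp_0[where f = "\<lambda>\<theta>. (cmod (?g \<theta>))\<^sup>2" and a = 0 and b = "2*pi"]; use that pi0 in auto)
  show ?thesis
  proof (rule CT_eqI[OF a])
    fix \<theta> :: real
    define m where "m = - \<lfloor>\<theta> / (2 * pi)\<rfloor>"
    have "\<theta> + of_int m * (2 * pi) \<in> {0..2*pi}"
      using floor_divide_lower[of "2*pi" \<theta>] floor_divide_upper[of "2*pi" \<theta>] by (auto simp: m_def algebra_simps)
    from z0[OF this] show "val a \<theta> = val \<zero>\<^bsub>CT\<^esub> \<theta>" by (simp add: val_periodic[OF a])
  qed simp
qed

text \<open>
  Evaluation at a point, as a representation by scalar multiples of the identity.
\<close>

definition val_rep :: "real \<Rightarrow> ('n::finite) Au_elem \<Rightarrow> 'i op" where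
  "val_rep \<theta> a = val a \<theta> \<odot>\<^bsub>bounded_ops\<^esub> \<one>\<^bsub>bounded_ops\<^esub>"

lemma val_rep_hom: "star_hom CT bounded_ops (val_rep \<theta>)"
  by (rule star_homI) (auto simp: val_rep_def val_hom bops.sm_ladd bops.smult_mult_left bops.sm_assoc bops.star_smult)

lemma nrm_val_rep: "nrm bounded_ops (val_rep \<theta> a :: 'b op) = cmod (val a \<theta>)"
proof -
  have "(\<one>\<^bsub>bounded_ops\<^esub> :: 'b op) \<noteq> \<zero>\<^bsub>bounded_ops\<^esub>" by (auto simp: bounded_ops_sel fun_eq_iff)
  then have "nrm bounded_ops (\<one>\<^bsub>bounded_ops\<^esub> :: 'b op) \<noteq> 0" by (simp add: bops.nrm_eq_zero)
  moreover have "(nrm bounded_ops (\<one>\<^bsub>bounded_ops\<^esub> :: 'b op))\<^sup>2 = nrm bounded_ops (\<one>\<^bsub>bounded_ops\<^esub> :: 'b op)"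
    by (subst bops.nrm_star_self[symmetric]) simp_all
  ultimately have "nrm bounded_ops (\<one>\<^bsub>bounded_ops\<^esub> :: 'b op) = 1"
    by (simp add: power2_eq_square)
  then show ?thesis by (simp add: val_rep_def bops.nrm_smult)
qed

text \<open>
  Evaluation of elements of \<open>C(\<T>) \<otimes> C(\<T>)\<close> at the point \<open>(e\<^sup>i\<^sup>s, e\<^sup>i\<^sup>t)\<close> of the torus. It comes from the
  representation \<open>val_rep s \<otimes> val_rep t\<close> by scalars, hence is contractive.
\<close>

definition torus_val :: "real \<Rightarrow> real \<Rightarrow> (('n::finite) Au_elem \<times> 'n Au_elem) multiset \<Rightarrow> complex" where
  "torus_val s t M = (\<Sum>(a, b)\<in>#M. val a s * val b t)"

lemma kron_sum_val_rep:
  "kron_sum (val_rep s) (val_rep t) M = torus_val s t M \<odot>\<^bsub>bounded_ops\<^esub> \<one>\<^bsub>bounded_ops\<^esub>"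
proof (rule ext, rule ext)
  fix x y
  have "(\<Sum>(a, b)\<in>#M. val_rep s a (fst x) (fst y) * val_rep t b (snd x) (snd y)) =
      (\<Sum>(a, b)\<in>#M. val a s * val b t) * (if x = y then 1 else 0)"
    by (induct M) (auto simp: val_rep_def bounded_ops_sel prod_eq_iff algebra_simps)
  then show "kron_sum (val_rep s) (val_rep t) M x y = (torus_val s t M \<odot>\<^bsub>bounded_ops\<^esub> \<one>\<^bsub>bounded_ops\<^esub>) x y"
    by (cases x, cases y) (simp add: kron_sum_def torus_val_def bounded_ops_sel)
qed

lemma torus_val_dst:
  fixes M N :: "(('n::finite) Au_elem \<times> 'n Au_elem) multiset"
  assumes MN: "M \<in> carrier (formal_tensor CT CT)" "N \<in> carrier (formal_tensor CT CT)"
  shows "cmod (torus_val s t M - torus_val s t N) \<le> dst (formal_tensor CT CT) M N"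
proof -
  let ?\<phi> = "kron_sum (val_rep s) (val_rep t) :: _ \<Rightarrow> ('n Au_elem \<times> 'n Au_elem) op"
  have \<phi>: "?\<phi> \<in> tensor_reps CT CT"
    unfolding tensor_reps_def star_reps_def using val_rep_hom by blast
  have "nrm bounded_ops (\<one>\<^bsub>bounded_ops\<^esub> :: ('n Au_elem \<times> 'n Au_elem) op) = 1"
    using nrm_val_rep[of 0 "\<one>\<^bsub>CT\<^esub> :: 'n Au_elem", where 'b = "'n Au_elem \<times> 'n Au_elem"] by (simp add: val_rep_def)
  moreover have "?\<phi> M \<oplus>\<^bsub>bounded_ops\<^esub> (-1) \<odot>\<^bsub>bounded_ops\<^esub> ?\<phi> N = (torus_val s t M - torus_val s t N) \<odot>\<^bsub>bounded_ops\<^esub> \<one>\<^bsub>bounded_ops\<^esub>"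
    unfolding kron_sum_val_rep by (simp add: bounded_ops_sel fun_eq_iff algebra_simps)
  ultimately have "dst bounded_ops (?\<phi> M) (?\<phi> N) = cmod (torus_val s t M - torus_val s t N)"
    by (simp add: dst_def bops.nrm_smult)
  with CC.FT.dst_ge[OF MN \<phi>] show ?thesis by simp
qed

definition val2 :: "real \<Rightarrow> real \<Rightarrow> (('n::finite) Au_elem, 'n Au_elem) tensor \<Rightarrow> complex" where
  "val2 s t = CC.FT.ext_fun (torus_val s t)"

lemma val2_comult:
  assumes "a \<in> carrier CT"
  shows "val2 s t (circle_comult a) = val a (s + t)"
proof -
  from assms obtain x where x: "cauchy_seq circle_free x" "a = cauchy_class circle_free x"
    unfolding circle_alg_def by (rule circ.carrier_completionE)
  have d: "torus_val s t (circle_delta p) = tval (s + t) p" for p :: "('a \<times> 'a) star_poly"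
  proof -
    have "torus_val s t (mset (map (\<lambda>(c, k). (c \<odot>\<^bsub>CT\<^esub> zp k :: 'a Au_elem, zp k)) xs)) = (\<Sum>(c, k)\<leftarrow>xs. c * cis (of_int k * (s + t)))" for xs
      by (induct xs) (auto simp: torus_val_def val_hom val_zp cis_mult distrib_left mult.assoc)
    then show ?thesis by (simp add: circle_delta_def tval_list)
  qed
  have "(\<lambda>n. torus_val s t (circle_delta (x n))) \<longlonglongrightarrow> val2 s t (circle_comult a)"
    unfolding val2_def x(2) circle_comult_cc[OF x(1)]
    by (rule CC.FT.ext_fun_tendsto[OF torus_val_dst circ_delta.f_cauchy[OF x(1)]])
  moreover have "(\<lambda>n. tval (s + t) (x n)) \<longlonglongrightarrow> val a (s + t)"
    unfolding val_def x(2) by (rule circ.ext_fun_tendsto[OF tval_dst x(1)])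
  ultimately show ?thesis unfolding d by (rule LIMSEQ_unique)
qed

lemma val2_finsum_tens:
  assumes "finite I" "\<And>k. k \<in> I \<Longrightarrow> f k \<in> carrier CT" "\<And>k. k \<in> I \<Longrightarrow> g k \<in> carrier CT"
  shows "val2 s t (finsum (min_tensor CT CT) (\<lambda>k. tens CT CT (f k) (g k)) I) = (\<Sum>k\<in>I. val (f k) s * val (g k) t)"
proof -
  have "image_mset (\<lambda>k. (f k, g k)) (mset_set I) \<in> carrier (formal_tensor CT CT)" using assms by auto
  moreover have "finsum (min_tensor CT CT) (\<lambda>k. tens CT CT (f k) (g k)) I = formal_sum CT CT (image_mset (\<lambda>k. (f k, g k)) (mset_set I))"
    by (rule CC.finsum_tens) (use assms in auto)
  ultimately show ?thesis
    unfolding formal_sum_def val2_def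
    by (simp only:, subst CC.FT.ext_fun_embed[OF torus_val_dst],
      simp_all add: torus_val_def image_mset.compositionality comp_def sum_unfold_sum_mset)
qed

section \<open>Representations of the circle\<close>

lemma cqg_extend_sel [simp]: "comult (cstar.extend A (cqg.fields D)) = D"
  by (simp add: cstar.extend_def cqg.fields_def)

lemma extend_simps [simp]:
  "min_tensor (cstar.extend A e) B = min_tensor A B" "min_tensor C (cstar.extend A e) = min_tensor C A"
  "formal_sum (cstar.extend A e) B = formal_sum A B" "formal_sum C (cstar.extend A e) = formal_sum C A"
  "tens (cstar.extend A e) B = tens A B" "tens C (cstar.extend A e) = tens C A"
  "tensor_map (cstar.extend A e) B = tensor_map A B" "tensor_map C (cstar.extend A e) = tensor_map C A"
  "mat_mult (cstar.extend A e) = mat_mult A" "mat_one (cstar.extend A e) = mat_one A"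
  "lin_span (cstar.extend A e) = lin_span A" "nrm_closure (cstar.extend A e) = nrm_closure A"
  "unital_star_hom (cstar.extend A e) B = unital_star_hom A B" "unital_star_hom C (cstar.extend A e) = unital_star_hom C A"
  by (simp_all add: fun_eq_iff min_tensor_def formal_sum_def tens_def tensor_map_def mat_mult_def mat_one_def
      lin_span_def nrm_closure_def dst_def unital_star_hom_def)

definition circle_cqg :: "('n::finite) Au_elem cqg" where
  "circle_cqg = cstar.extend CT (cqg.fields circle_comult)"

text \<open>
  Evaluated pointwise, a representation is a homomorphism from the real line to invertible matrices;
  the value at 0 is an invertible idempotent.
\<close>

lemma representation_circle:
  fixes v :: "nat \<Rightarrow> nat \<Rightarrow> ('n::finite) Au_elem"
  assumes v: "representation circle_cqg d v" and ij: "i < d" "j < d"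
  shows "v i j \<in> carrier CT" "val (v i j) (s + t) = (\<Sum>k<d. val (v i k) s * val (v k j) t)"
    "val (v i j) 0 = (if i = j then 1 else 0)"
proof -
  have vc: "v i j \<in> carrier CT" if "i < d" "j < d" for i j
    using v that by (simp add: representation_def circle_cqg_def)
  show "v i j \<in> carrier CT" by (rule vc[OF ij])
  have add: "val (v i j) (s + t) = (\<Sum>k<d. val (v i k) s * val (v k j) t)" if "i < d" "j < d" for i j s t
  proof -
    have "circle_comult (v i j) = finsum (min_tensor CT CT) (\<lambda>k. tens CT CT (v i k) (v k j)) {..<d}"
      using v that by (simp add: representation_def circle_cqg_def)
    then show ?thesis
      using val2_comult[OF vc[OF that], of s t] val2_finsum_tens[of "{..<d}" "\<lambda>k. v i k" "\<lambda>k. v k j" s t] vc that by simp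
  qed
  show "val (v i j) (s + t) = (\<Sum>k<d. val (v i k) s * val (v k j) t)" by (rule add[OF ij])
  from v obtain w where wc: "\<forall>i<d. \<forall>j<d. w i j \<in> carrier CT"
    and w: "\<forall>i<d. \<forall>j<d. mat_mult CT {..<d} v w i j = mat_one CT i j"
    by (auto simp: representation_def circle_cqg_def)
  have vw: "(\<Sum>k<d. val (v i k) 0 * val (w k j) 0) = (if i = j then 1 else 0)" if "i < d" "j < d" for i j
  proof -
    have "(\<Sum>k<d. val (v i k) 0 * val (w k j) 0) = val (mat_mult CT {..<d} v w i j) 0"
      unfolding mat_mult_def by (subst val_finsum) (use vc wc that in \<open>auto simp: val_hom\<close>)
    with w that show ?thesis by (simp add: mat_one_def)
  qed
  have "val (v i j) 0 = (\<Sum>l<d. val (v i l) 0 * (if l = j then 1 else 0))" using ij by (simp add: if_distrib cong: if_cong)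
  also have "\<dots> = (\<Sum>l<d. val (v i l) 0 * (\<Sum>k<d. val (v l k) 0 * val (w k j) 0))"
    by (rule sum.cong) (use vw ij in auto)
  also have "\<dots> = (\<Sum>k<d. (\<Sum>l<d. val (v i l) 0 * val (v l k) 0) * val (w k j) 0)"
    unfolding sum_distrib_left sum_distrib_right by (subst sum.swap) (simp add: mult.assoc)
  also have "\<dots> = (\<Sum>k<d. val (v i k) 0 * val (w k j) 0)"
    by (rule sum.cong) (use add[of i _ 0 0] ij in auto)
  finally show "val (v i j) 0 = (if i = j then 1 else 0)" using vw[OF ij] by simp
qed

text \<open>
  This is a substitution for trigonometric polynomials, and both sides are uniformly continuous in
  \<open>a\<close>.
\<close>

lemma fourier_coeff_translate:
  assumes a: "a \<in> carrier CT"
  shows "fourier_coeff k (\<lambda>s. val a (s + t)) = cis (of_int k * t) * fourier_coeff k (val a)"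
proof -
  have cs: "continuous_on UNIV (\<lambda>s. val b (s + t))" if "b \<in> carrier CT" for b :: "'a Au_elem" and t
    by (rule continuous_on_compose2[OF continuous_val[OF that]]) (auto intro: continuous_intros)
  have tp: "fourier_coeff k (\<lambda>s. tval (s + t) p) = cis (of_int k * t) * fourier_coeff k (\<lambda>s. tval s p)"
    for p :: "('a \<times> 'a) star_poly"
  proof -
    have s: "tval s p = (\<Sum>l\<in>{- int (trig_deg p)..int (trig_deg p)}. trig_coeff p l * cis (of_int l * s))" for s
    proof -
      have "tval s p = val (circle_embed p) s" by simp
      also have "\<dots> = (\<Sum>l\<in>{- int (trig_deg p)..int (trig_deg p)}. trig_coeff p l * cis (of_int l * s))"
        unfolding circle_embed_eval circ.eval_diag_finsum by (subst val_finsum) (simp_all add: val_hom val_zp)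
      finally show ?thesis .
    qed
    have e: "trig_coeff p l * cis (of_int l * (s + t)) = (trig_coeff p l * cis (of_int l * t)) * cis (of_int l * s)" for l s
      by (simp add: cis_mult distrib_left add.commute)
    have "fourier_coeff k (\<lambda>s. tval (s + t) p) =
        (\<Sum>l\<in>{- int (trig_deg p)..int (trig_deg p)}. (trig_coeff p l * cis (of_int l * t)) * fourier_coeff k (\<lambda>s. cis (of_int l * s)))"
      unfolding s e by (rule fourier_coeff_sum) (auto intro: continuous_cis_of_int)
    also have "\<dots> = (\<Sum>l\<in>{- int (trig_deg p)..int (trig_deg p)}. cis (of_int k * t) * (trig_coeff p l * fourier_coeff k (\<lambda>s. cis (of_int l * s))))"
      by (rule sum.cong) (auto simp: fourier_coeff_cis)
    also have "\<dots> = cis (of_int k * t) * fourier_coeff k (\<lambda>s. tval s p)"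
      unfolding s sum_distrib_left[symmetric] by (subst fourier_coeff_sum) (auto intro: continuous_cis_of_int)
    finally show ?thesis .
  qed
  have "cmod (fourier_coeff k (\<lambda>s. val a (s + t)) - cis (of_int k * t) * fourier_coeff k (val a)) \<le> 0"
  proof (rule field_le_epsilon)
    fix e :: real assume "0 < e"
    then have "0 < e / 2" by simp
    with a obtain p where p: "dst CT a (circle_embed p) < e / 2" by (rule circle_approx)
    have diff: "cmod (fourier_coeff k (\<lambda>s. val a (s + u)) - fourier_coeff k (\<lambda>s. tval (s + u) p)) \<le> e / 2" for u
    proof -
      have "fourier_coeff k (\<lambda>s. val a (s + u) + (-1) * tval (s + u) p) =
          fourier_coeff k (\<lambda>s. val a (s + u)) + (-1) * fourier_coeff k (\<lambda>s. tval (s + u) p)"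
        using cs[OF a, of u] cs[OF circle_embed_in[of p], of u]
        by (subst fourier_coeff_add) (auto simp: fourier_coeff_cmult[of k "-1", simplified] intro!: continuous_intros)
      moreover have "cmod (fourier_coeff k (\<lambda>s. val a (s + u) + (-1) * tval (s + u) p)) \<le> e / 2"
      proof (rule fourier_coeff_bound)
        show "continuous_on UNIV (\<lambda>s. val a (s + u) + (-1) * tval (s + u) p)"
          using cs[OF a, of u] cs[OF circle_embed_in[of p], of u] by (auto intro!: continuous_intros)
        show "cmod (val a (s + u) + (-1) * tval (s + u) p) \<le> e / 2" for s
          using val_dst[OF a, of "s + u" p] p by simp
      qed
      ultimately show ?thesis by simp
    qed
    have "cmod (cis (of_int k * t) * (fourier_coeff k (\<lambda>s. val a (s + 0)) - fourier_coeff k (\<lambda>s. tval (s + 0) p))) \<le> e / 2"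
      using diff[of 0] by (simp add: norm_mult)
    with diff[of t] norm_triangle_ineq4[of "fourier_coeff k (\<lambda>s. val a (s + t)) - fourier_coeff k (\<lambda>s. tval (s + t) p)"
        "cis (of_int k * t) * (fourier_coeff k (\<lambda>s. val a (s + 0)) - fourier_coeff k (\<lambda>s. tval (s + 0) p))"]
    show "cmod (fourier_coeff k (\<lambda>s. val a (s + t)) - cis (of_int k * t) * fourier_coeff k (val a)) \<le> 0 + e"
      unfolding tp by (simp add: right_diff_distrib)
  qed
  then show ?thesis by simp
qed

lemma circle_embed_range:
  fixes a b :: "('n::finite) Au_elem"
  shows "a \<in> range circle_embed \<Longrightarrow> c \<odot>\<^bsub>CT\<^esub> a \<in> range circle_embed"
    "a \<in> range circle_embed \<Longrightarrow> b \<in> range circle_embed \<Longrightarrow> a \<oplus>\<^bsub>CT\<^esub> b \<in> range circle_embed"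
    "(\<zero>\<^bsub>CT\<^esub> :: 'n Au_elem) \<in> range circle_embed" "(zp k :: 'n Au_elem) \<in> range circle_embed"
proof -
  show "c \<odot>\<^bsub>CT\<^esub> a \<in> range circle_embed" if a: "a \<in> range circle_embed"
  proof -
    from a obtain p where p: "a = circle_embed p" by blast
    have "circle_embed (Mult_poly (Const_poly c) p) = c \<odot>\<^bsub>CT\<^esub> a"
      by (simp add: p circle_embed_hom CT.smult_mult_left)
    from this[symmetric] show ?thesis by (rule range_eqI)
  qed
  show "a \<oplus>\<^bsub>CT\<^esub> b \<in> range circle_embed" if "a \<in> range circle_embed" "b \<in> range circle_embed"
  proof -
    from that obtain p q where "a = circle_embed p" "b = circle_embed q" by blast
    then have "a \<oplus>\<^bsub>CT\<^esub> b = circle_embed (Add_poly p q)" by (simp add: circle_embed_hom)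
    then show ?thesis by (rule range_eqI)
  qed
  have "(\<zero>\<^bsub>CT\<^esub> :: 'n Au_elem) = circle_embed (Const_poly 0)" by (simp add: circle_embed_hom)
  then show "(\<zero>\<^bsub>CT\<^esub> :: 'n Au_elem) \<in> range circle_embed" by (rule range_eqI)
  show "(zp k :: 'n Au_elem) \<in> range circle_embed"
  proof (induct k rule: int_induct[where k = 0])
    case base
    have "(zp 0 :: 'n Au_elem) = circle_embed (Const_poly 1)" by (simp add: circle_embed_hom)
    then show ?case by (rule range_eqI)
  next
    case (step1 i)
    then obtain p where "zp i = (circle_embed p :: 'n Au_elem)" by blast
    then have "zp (i + 1) = (circle_embed (Mult_poly (Gen (undefined, undefined)) p) :: 'n Au_elem)"
      unfolding circ.zpow_Suc by (simp add: circle_embed_hom circle_gen_def)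
    then show ?case by (rule range_eqI)
  next
    case (step2 i)
    then obtain p where "zp i = (circle_embed p :: 'n Au_elem)" by blast
    then have "zp (i - 1) = (circle_embed (Mult_poly (Star_poly (Gen (undefined, undefined))) p) :: 'n Au_elem)"
      unfolding circ.zpow_pred by (simp add: circle_embed_hom circle_gen_def)
    then show ?case by (rule range_eqI)
  qed
qed

lemma circle_embed_range_finsum:
  "finite I \<Longrightarrow> (\<And>i. i \<in> I \<Longrightarrow> f i \<in> range circle_embed) \<Longrightarrow> finsum CT f I \<in> range circle_embed"
proof (induct I rule: finite_induct)
  case (insert i I)
  have "f l \<in> carrier CT" if "l \<in> insert i I" for l using insert(4)[OF that] by auto
  then have "f \<in> I \<rightarrow> carrier CT" "f i \<in> carrier CT" by auto
  with insert show ?case by (simp add: circle_embed_range(2))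
qed (simp add: circle_embed_range)

text \<open>
  Taking Fourier coefficients in \<open>v\<^sub>i\<^sub>j(s + t) = \<Sum>\<^sub>l v\<^sub>i\<^sub>l(s) v\<^sub>l\<^sub>j(t)\<close> with respect to \<open>s\<close> exhibits the character
  \<open>e\<^sup>i\<^sup>k\<^sup>t\<close>, for every frequency \<open>k\<close> of \<open>v\<^sub>i\<^sub>j\<close>, as a combination of the \<open>d\<close> functions \<open>v\<^sub>l\<^sub>j\<close>. So there are
  finitely many frequencies, and \<open>v\<^sub>i\<^sub>j\<close> equals the trigonometric polynomial with its Fourier
  coefficients.
\<close>

lemma circle_coefficient_in_range:
  fixes v :: "nat \<Rightarrow> nat \<Rightarrow> ('n::finite) Au_elem"
  assumes v: "representation circle_cqg d v" and ij: "i < d" "j < d"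
  shows "v i j \<in> range circle_embed"
proof -
  note vc = representation_circle(1)[OF v]
  let ?E = "\<lambda>k. fourier_coeff k (val (v i j))"
  have "finite {k. ?E k \<noteq> 0}"
  proof (rule finite_frequencies[of "{..<d}" _ "\<lambda>l. val (v l j)"])
    fix k assume "k \<in> {k. ?E k \<noteq> 0}"
    then have nz: "?E k \<noteq> 0" by simp
    have "cis (of_int k * t) = (\<Sum>l<d. (fourier_coeff k (val (v i l)) / ?E k) * val (v l j) t)" for t
    proof -
      have "cis (of_int k * t) * ?E k = fourier_coeff k (\<lambda>s. val (v i j) (s + t))"
        by (rule fourier_coeff_translate[OF vc[OF ij], symmetric])
      also have "\<dots> = fourier_coeff k (\<lambda>s. \<Sum>l<d. val (v l j) t * val (v i l) s)"
        by (simp only: representation_circle(2)[OF v ij] mult.commute)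
      also have "\<dots> = (\<Sum>l<d. val (v l j) t * fourier_coeff k (val (v i l)))"
        by (rule fourier_coeff_sum) (use continuous_val vc ij in auto)
      finally have "cis (of_int k * t) = (\<Sum>l<d. val (v l j) t * fourier_coeff k (val (v i l))) / ?E k"
        using nz by (simp add: field_simps)
      then show ?thesis by (simp add: sum_divide_distrib mult.commute)
    qed
    then show "\<exists>\<alpha>. \<forall>t. cis (of_int k * t) = (\<Sum>l<d. \<alpha> l * val (v l j) t)"
      by (intro exI[of _ "\<lambda>l. fourier_coeff k (val (v i l)) / ?E k"] allI)
  qed simp
  then have fin: "finite {k. ?E k \<noteq> 0}" .
  define b :: "'n Au_elem" where "b = finsum CT (\<lambda>k. ?E k \<odot>\<^bsub>CT\<^esub> zp k) {k. ?E k \<noteq> 0}"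
  have bc: "b \<in> carrier CT" unfolding b_def by (rule CT.finsum_closed) auto
  have vb: "val b s = (\<Sum>k | ?E k \<noteq> 0. ?E k * cis (of_int k * s))" for s
    unfolding b_def by (subst val_finsum) (use fin in \<open>auto simp: val_hom val_zp\<close>)
  have Eb: "fourier_coeff k (val b) = ?E k" for k
  proof -
    have "fourier_coeff k (val b) = (\<Sum>l | ?E l \<noteq> 0. ?E l * fourier_coeff k (\<lambda>s. cis (of_int l * s)))"
      unfolding vb[abs_def] by (rule fourier_coeff_sum[OF fin continuous_cis_of_int])
    also have "\<dots> = ?E k" using fin by (simp add: fourier_coeff_cis if_distrib cong: if_cong)
    finally show ?thesis .
  qed
  have dc: "v i j \<oplus>\<^bsub>CT\<^esub> (-1) \<odot>\<^bsub>CT\<^esub> b \<in> carrier CT" using vc[OF ij] bc by simp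
  have "v i j \<oplus>\<^bsub>CT\<^esub> (-1) \<odot>\<^bsub>CT\<^esub> b = \<zero>\<^bsub>CT\<^esub>"
  proof (rule fourier_uniqueness[OF dc])
    fix k
    have "fourier_coeff k (val (v i j \<oplus>\<^bsub>CT\<^esub> (-1) \<odot>\<^bsub>CT\<^esub> b)) = fourier_coeff k (\<lambda>s. val (v i j) s + (-1) * val b s)"
      by (rule arg_cong[of _ _ "fourier_coeff k"], rule ext) (use vc[OF ij] bc in \<open>simp add: val_hom\<close>)
    also have "\<dots> = ?E k + (-1) * fourier_coeff k (val b)"
      using continuous_val[OF vc[OF ij]] continuous_val[OF bc]
      by (subst fourier_coeff_add) (auto simp: fourier_coeff_cmult[of k "-1", simplified] intro!: continuous_intros)
    finally show "fourier_coeff k (val (v i j \<oplus>\<^bsub>CT\<^esub> (-1) \<odot>\<^bsub>CT\<^esub> b)) = 0" by (simp add: Eb)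
  qed
  then have "dst CT (v i j) b = 0" by (simp add: dst_def)
  then have "v i j = b" using CT.dst_zero_iff[OF vc[OF ij] bc] by simp
  also have "b \<in> range circle_embed" unfolding b_def
    by (rule circle_embed_range_finsum[OF fin]) (intro circle_embed_range)
  finally show ?thesis .
qed

lemma representation_zp: "representation circle_cqg 1 (\<lambda>_ _. zp k)"
proof -
  have one: "{..<Suc 0} = {0}" by auto
  show ?thesis unfolding representation_def
  proof (intro conjI allI impI exI[of _ "\<lambda>_ _. zp (- k)"])
    fix i j :: nat assume "i < 1" "j < 1"
    show "comult circle_cqg (zp k) = finsum (min_tensor circle_cqg circle_cqg) (\<lambda>l. tens circle_cqg circle_cqg (zp k) (zp k)) {..<1::nat}"
      by (simp add: circle_cqg_def circle_comult_zp one)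
  qed (simp_all add: circle_cqg_def mat_mult_def mat_one_def one circ.zpow_inv)
qed

lemma coefficient_algebra_circle: "coefficient_algebra (circle_cqg :: ('n::finite) Au_elem cqg) = range circle_embed"
proof
  let ?S = "{v i j | d v i j. representation (circle_cqg :: 'n Au_elem cqg) d v \<and> i < d \<and> j < d}"
  have S: "?S \<subseteq> range circle_embed"
  proof
    fix x assume "x \<in> ?S"
    then obtain d v i j where "x = v i j" "representation circle_cqg d v" "i < d" "j < d" by blast
    then show "x \<in> range circle_embed" by (simp only: circle_coefficient_in_range)
  qed
  have e: "coefficient_algebra (circle_cqg :: 'n Au_elem cqg) = lin_span CT ?S"
    by (simp add: coefficient_algebra_def circle_cqg_def)
  show "coefficient_algebra (circle_cqg :: 'n Au_elem cqg) \<subseteq> range circle_embed"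
  proof
    fix x assume "x \<in> coefficient_algebra (circle_cqg :: 'n Au_elem cqg)"
    then obtain F c where F: "finite F" "F \<subseteq> ?S" "x = finsum CT (\<lambda>s. c s \<odot>\<^bsub>CT\<^esub> s) F"
      unfolding e lin_span_def by blast
    show "x \<in> range circle_embed" unfolding F(3)
      by (rule circle_embed_range_finsum[OF F(1)]) (use F(2) S circle_embed_range(1) in blast)
  qed
  have "range circle_embed \<subseteq> carrier (CT :: 'n Au_elem cstar)" by (rule image_subsetI) simp
  then have Sc: "?S \<subseteq> carrier CT" by (rule subset_trans[OF S])
  have z: "zp k \<in> ?S" for k
    unfolding mem_Collect_eq
    by (intro exI[of _ 1] exI[of _ "\<lambda>_ _. zp k"] exI[of _ 0] conjI refl representation_zp) simp_all
  have t: "circ.trig_sum xs \<in> lin_span CT ?S" for xs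
  proof (induct xs)
    case Nil
    show ?case by (simp only: circ.trig_sum.simps CT.lin_span_zero)
  next
    case (Cons x xs)
    then show ?case unfolding circ.trig_sum.simps
      by (intro CT.lin_span_add[OF Sc] CT.lin_span_smult[OF Sc] CT.lin_span_base[OF Sc z])
  qed
  show "range circle_embed \<subseteq> coefficient_algebra (circle_cqg :: 'n Au_elem cqg)"
    unfolding e circle_embed_eval circ.eval_diag using t by blast
qed

text \<open>
  A representation of the algebra of trigonometric polynomials is functional calculus of a unitary
  in a corner, so it is dominated by the supremum norm; evaluations attain that norm.
\<close>

lemma full_circle: "full (circle_cqg :: ('n::finite) Au_elem cqg)"
proof -
  let ?G = "(circle_cqg :: 'n Au_elem cqg)\<lparr>carrier := range circle_embed\<rparr>"
  have sel: "carrier ?G = range circle_embed" "add ?G = add CT" "mult ?G = mult CT" "smult ?G = smult CT" "star ?G = star CT"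
    by (simp_all add: circle_cqg_def)
  have up: "op_norm (\<pi> (circle_embed p)) \<le> nrm CT (circle_embed p)" if "\<pi> \<in> star_reps ?G" for \<pi> p
  proof -
    from that have \<pi>: "star_hom ?G bounded_ops \<pi>" by (simp add: star_reps_def)
    have "circle_embed q \<in> carrier ?G" for q unfolding sel by simp
    note in_G = this
    note hc = star_homD(1)[OF \<pi> in_G]
    note hom = star_homD(2)[OF \<pi> in_G in_G, unfolded sel] star_homD(3)[OF \<pi> in_G in_G, unfolded sel]
      star_homD(4)[OF \<pi> in_G, unfolded sel] star_homD(5)[OF \<pi> in_G, unfolded sel]
    define P where "P = \<pi> (circle_embed (Const_poly 1))"
    define W where "W = \<pi> (circle_embed (Gen (undefined, undefined)))"
    have eq: "circle_embed p = circle_embed q \<Longrightarrow> \<pi> (circle_embed p) = \<pi> (circle_embed q)" for p q by simp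
    have PX: "P \<otimes>\<^bsub>bounded_ops\<^esub> \<pi> (circle_embed q) = \<pi> (circle_embed q)" "\<pi> (circle_embed q) \<otimes>\<^bsub>bounded_ops\<^esub> P = \<pi> (circle_embed q)" for q
      unfolding P_def hom(2)[symmetric] circle_embed_hom(2)[symmetric]
      by (rule arg_cong[of _ _ \<pi>], rule circle_embed_eqI, simp)+
    have Ps: "star bounded_ops P = P"
      unfolding P_def hom(4)[symmetric] circle_embed_hom(3)[symmetric]
      by (rule arg_cong[of _ _ \<pi>], rule circle_embed_eqI, simp)
    have P: "P \<in> carrier bounded_ops" "P \<otimes>\<^bsub>bounded_ops\<^esub> P = P" "star bounded_ops P = P"
      using hc PX(1)[of "Const_poly 1"] Ps by (simp_all add: P_def)
    interpret C: pre_cstar "corner bounded_ops P" by (rule bops.pre_cstar_corner[OF P])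
    have in_C: "\<pi> (circle_embed q) \<in> carrier (corner bounded_ops P)" for q using hc PX by simp
    interpret U: unitary_in "corner bounded_ops P" W
    proof unfold_locales
      show "W \<in> carrier (corner bounded_ops P)" unfolding W_def by (rule in_C)
      show "star (corner bounded_ops P) W \<otimes>\<^bsub>corner bounded_ops P\<^esub> W = \<one>\<^bsub>corner bounded_ops P\<^esub>"
        "W \<otimes>\<^bsub>corner bounded_ops P\<^esub> star (corner bounded_ops P) W = \<one>\<^bsub>corner bounded_ops P\<^esub>"
        unfolding corner_sel W_def P_def hom(4)[symmetric] circle_embed_hom(3)[symmetric] hom(2)[symmetric] circle_embed_hom(2)[symmetric]
        by (rule arg_cong[of _ _ \<pi>], rule circle_embed_eqI, simp add: cis_cnj cis_mult)+
    qed
    have ev: "\<pi> (circle_embed q) = eval_poly (corner bounded_ops P) (diag (corner bounded_ops P) W) q" for q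
    proof (induct q)
      case (Const_poly c)
      have "circle_embed (Const_poly c) = c \<odot>\<^bsub>CT\<^esub> (circle_embed (Const_poly 1) :: 'n Au_elem)"
        by (simp add: circle_embed_hom)
      then show ?case by (simp add: hom(3) P_def)
    next
      case (Gen x)
      obtain i j where x: "x = (i, j)" by force
      have z: "circle_embed (Gen (i, j)) = 0 \<odot>\<^bsub>CT\<^esub> (circle_embed (Const_poly 1) :: 'n Au_elem)" if "i \<noteq> j"
        using that by (simp add: circle_embed_Gen diag_def)
      have e: "circle_embed (Gen (i, j)) = (circle_embed (Gen (undefined, undefined)) :: 'n Au_elem)" if "i = j"
        using that by (simp add: circle_embed_Gen diag_def)
      show ?case
      proof (cases "i = j")
        case True
        show ?thesis unfolding x e[OF True] using True by (simp add: diag_def W_def)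
      next
        case False
        show ?thesis unfolding x z[OF False] hom(3) using False hc by (simp add: diag_def)
      qed
    qed (simp_all add: circle_embed_hom hom)
    have "nrm (corner bounded_ops P) (\<pi> (circle_embed p)) \<le> nrm CT (circle_embed p)"
      unfolding ev by (rule U.nrm_eval_diag_sup) (use val_le_nrm[OF circle_embed_in, of p] in simp)
    then show ?thesis by (simp add: nrm_bounded_ops)
  qed
  have vr: "val_rep \<theta> \<in> star_reps ?G" for \<theta>
  proof -
    have v: "star_hom CT bounded_ops (val_rep \<theta> :: 'n Au_elem \<Rightarrow> 'n Au_elem op)" by (rule val_rep_hom)
    have "star_hom ?G bounded_ops (val_rep \<theta> :: 'n Au_elem \<Rightarrow> 'n Au_elem op)"
      unfolding star_hom_def sel using star_homD[OF v] by auto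
    then show ?thesis by (simp add: star_reps_def)
  qed
  show ?thesis unfolding full_def coefficient_algebra_circle
  proof (intro ballI conjI)
    fix a :: "'n Au_elem" assume "a \<in> range circle_embed"
    then obtain p where p: "a = circle_embed p" by blast
    show b: "bdd_above ((\<lambda>\<pi>. op_norm (\<pi> a)) ` star_reps ?G)"
      by (rule bdd_aboveI2[of _ _ "nrm CT a"]) (simp add: p up)
    have "nrm CT a = (SUP \<pi>\<in>star_reps ?G. op_norm (\<pi> a))"
    proof (rule antisym)
      show "nrm CT a \<le> (SUP \<pi>\<in>star_reps ?G. op_norm (\<pi> a))"
      proof (rule nrm_CT_le)
        fix \<theta>
        have "cmod (val a \<theta>) = op_norm (val_rep \<theta> a :: 'n Au_elem op)"
          using nrm_val_rep[of \<theta> a, where 'b = "'n Au_elem"] by (simp add: nrm_bounded_ops)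
        also have "\<dots> \<le> (SUP \<pi>\<in>star_reps ?G. op_norm (\<pi> a))" by (rule cSUP_upper[OF vr b])
        finally show "cmod (val a \<theta>) \<le> (SUP \<pi>\<in>star_reps ?G. op_norm (\<pi> a))" .
      qed (simp add: p)
      show "(SUP \<pi>\<in>star_reps ?G. op_norm (\<pi> a)) \<le> nrm CT a"
        by (rule cSUP_least) (use vr up in \<open>auto simp: p\<close>)
    qed
    then show "nrm circle_cqg a = (SUP \<pi>\<in>star_reps ?G. op_norm (\<pi> a))" by (simp add: circle_cqg_def)
  qed
qed

lemma (in cstar_pair) dense_of_tens:
  assumes S: "S \<subseteq> carrier (min_tensor A B)"
    and t: "\<And>a b. a \<in> carrier A \<Longrightarrow> b \<in> carrier B \<Longrightarrow> tens A B a b \<in> nrm_closure (min_tensor A B) (lin_span (min_tensor A B) S)"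
  shows "nrm_closure (min_tensor A B) (lin_span (min_tensor A B) S) = carrier (min_tensor A B)"
proof
  let ?L = "lin_span (min_tensor A B) S"
  have L: "?L \<subseteq> carrier (min_tensor A B)" using T.lin_span_in[OF S] by blast
  show "nrm_closure (min_tensor A B) ?L \<subseteq> carrier (min_tensor A B)" by (auto simp: nrm_closure_def)
  have f: "formal_sum A B M \<in> nrm_closure (min_tensor A B) ?L" if "M \<in> carrier FT" for M
    using that
  proof (induct M)
    case empty
    show ?case unfolding formal_sum_hom(4) by (rule T.nrm_closure_base[OF L T.lin_span_zero])
  next
    case (add x M)
    obtain a b where x: "x = (a, b)" by force
    from add(2) x have ab: "a \<in> carrier A" "b \<in> carrier B" "M \<in> carrier FT" by auto
    show ?case unfolding x formal_sum_add_mset[OF ab]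
      by (rule T.nrm_closure_add[OF L T.lin_span_add[OF S] t[OF ab(1,2)] add(1)[OF ab(3)]])
  qed
  show "carrier (min_tensor A B) \<subseteq> nrm_closure (min_tensor A B) ?L"
  proof
    fix X assume X: "X \<in> carrier (min_tensor A B)"
    show "X \<in> nrm_closure (min_tensor A B) ?L"
    proof (rule T.nrm_closure_closed[OF L X])
      fix e :: real assume "0 < e"
      with X obtain M where "M \<in> carrier FT" "dst (min_tensor A B) X (formal_sum A B M) < e"
        unfolding min_tensor_def formal_sum_def using FT.completion_approx by blast
      with f show "\<exists>y\<in>nrm_closure (min_tensor A B) ?L. dst (min_tensor A B) X y < e" by blast
    qed
  qed
qed

text \<open>
  \<open>z\<^sup>k \<otimes> b = \<Delta>(z\<^sup>k)(1 \<otimes> z\<^sup>-\<^sup>k b)\<close> and, by commutativity, \<open>b \<otimes> z\<^sup>k = \<Delta>(z\<^sup>k)(z\<^sup>-\<^sup>k b \<otimes> 1)\<close>.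
\<close>

lemma circle_density:
  defines "T \<equiv> min_tensor (CT :: ('n::finite) Au_elem cstar) (CT :: 'n Au_elem cstar)"
  shows "nrm_closure T (lin_span T {circle_comult a \<otimes>\<^bsub>T\<^esub> tens CT CT \<one>\<^bsub>CT\<^esub> b | a b. a \<in> carrier CT \<and> b \<in> carrier CT}) = carrier T"
    (is "nrm_closure T (lin_span T ?L) = _")
    and "nrm_closure T (lin_span T {circle_comult a \<otimes>\<^bsub>T\<^esub> tens CT CT b \<one>\<^bsub>CT\<^esub> | a b. a \<in> carrier CT \<and> b \<in> carrier CT}) = carrier T"
    (is "nrm_closure T (lin_span T ?R) = _")
proof -
  have cc: "circle_comult a \<in> carrier (min_tensor CT CT)" if "a \<in> carrier CT" for a :: "'n Au_elem"
    by (rule star_homD(1)[OF circle_comult_star_hom that])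
  have L: "?L \<subseteq> carrier T" and R: "?R \<subseteq> carrier T"
    unfolding T_def by (auto intro!: CC.T.m_closed cc CC.tens_in CT.one_closed)
  have zL: "tens CT CT (zp k) b \<in> ?L" if b: "b \<in> carrier CT" for k b
  proof -
    have "zp k \<otimes>\<^bsub>CT\<^esub> (zp (- k) \<otimes>\<^bsub>CT\<^esub> b) = b" using b by (simp add: CT.m_assoc[symmetric] circ.zpow_inv)
    then have "tens CT CT (zp k) b = circle_comult (zp k) \<otimes>\<^bsub>T\<^esub> tens CT CT \<one>\<^bsub>CT\<^esub> (zp (- k) \<otimes>\<^bsub>CT\<^esub> b)"
      using b by (simp add: T_def circle_comult_zp CC.tens_mult)
    with b show ?thesis by (metis (mono_tags, lifting) CT.m_closed circ.zpow_closed mem_Collect_eq)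
  qed
  have zR: "tens CT CT b (zp k) \<in> ?R" if b: "b \<in> carrier CT" for k b
  proof -
    have "zp k \<otimes>\<^bsub>CT\<^esub> (zp (- k) \<otimes>\<^bsub>CT\<^esub> b) = b" using b by (simp add: CT.m_assoc[symmetric] circ.zpow_inv)
    then have "tens CT CT b (zp k) = circle_comult (zp k) \<otimes>\<^bsub>T\<^esub> tens CT CT (zp (- k) \<otimes>\<^bsub>CT\<^esub> b) \<one>\<^bsub>CT\<^esub>"
      using b by (simp add: T_def circle_comult_zp CC.tens_mult)
    with b show ?thesis by (metis (mono_tags, lifting) CT.m_closed circ.zpow_closed mem_Collect_eq)
  qed
  have tL: "tens CT CT (circ.trig_sum xs) b \<in> lin_span T ?L" if b: "b \<in> carrier CT" for xs b
  proof (induct xs)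
    case Nil
    have "tens CT CT \<zero>\<^bsub>CT\<^esub> b = 0 \<odot>\<^bsub>T\<^esub> tens CT CT (zp 0) b"
      using CC.tens_smult(1)[of "zp 0" b 0] b by (simp add: T_def)
    then show ?case
      using CC.T.lin_span_smult[OF L[unfolded T_def] CC.T.lin_span_base[OF L[unfolded T_def] zL[OF b, of 0, unfolded T_def]], of 0]
      by (simp add: T_def)
  next
    case (Cons x xs)
    then show ?case unfolding circ.trig_sum.simps T_def using b
      by (subst CC.tens_add_left, simp, simp, simp, subst CC.tens_smult(1), simp, simp)
        (rule CC.T.lin_span_add[OF L[unfolded T_def] CC.T.lin_span_smult[OF L[unfolded T_def] CC.T.lin_span_base[OF L[unfolded T_def] zL[OF b, unfolded T_def]]]], assumption)
  qed
  have tR: "tens CT CT b (circ.trig_sum xs) \<in> lin_span T ?R" if b: "b \<in> carrier CT" for xs b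
  proof (induct xs)
    case Nil
    have "tens CT CT b \<zero>\<^bsub>CT\<^esub> = 0 \<odot>\<^bsub>T\<^esub> tens CT CT b (zp 0)"
      using CC.tens_smult(2)[of b "zp 0" 0] b by (simp add: T_def)
    then show ?case
      using CC.T.lin_span_smult[OF R[unfolded T_def] CC.T.lin_span_base[OF R[unfolded T_def] zR[OF b, of 0, unfolded T_def]], of 0]
      by (simp add: T_def)
  next
    case (Cons x xs)
    then show ?case unfolding circ.trig_sum.simps T_def using b
      by (subst CC.tens_add_right, simp, simp, simp, subst CC.tens_smult(2), simp, simp)
        (rule CC.T.lin_span_add[OF R[unfolded T_def] CC.T.lin_span_smult[OF R[unfolded T_def] CC.T.lin_span_base[OF R[unfolded T_def] zR[OF b, unfolded T_def]]]], assumption)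
  qed
  have ap: "\<exists>xs. dst CT a (circ.trig_sum xs) * nrm CT b < e" if ab: "a \<in> carrier CT" "b \<in> carrier CT" and e: "0 < e"
    for a b :: "'n Au_elem" and e
  proof -
    have n: "0 \<le> nrm CT b" by (rule CT.nrm_nonneg[OF ab(2)])
    with e have "0 < e / (nrm CT b + 1)" by simp
    with ab(1) obtain p where p: "dst CT a (circle_embed p) < e / (nrm CT b + 1)" by (rule circle_approx)
    have "dst CT a (circle_embed p) * nrm CT b \<le> dst CT a (circle_embed p) * (nrm CT b + 1)"
      by (rule mult_left_mono) (simp_all add: CT.dst_nonneg[OF ab(1) circle_embed_in])
    also have "\<dots> < e" using p n by (simp add: pos_less_divide_eq)
    finally show ?thesis unfolding circle_embed_eval circ.eval_diag by blast
  qed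
  show "nrm_closure T (lin_span T ?L) = carrier T" unfolding T_def
  proof (rule CC.dense_of_tens[OF L[unfolded T_def]])
    fix a b :: "'n Au_elem" assume ab: "a \<in> carrier CT" "b \<in> carrier CT"
    let ?S = "lin_span (min_tensor CT CT) {circle_comult a \<otimes>\<^bsub>min_tensor CT CT\<^esub> tens CT CT \<one>\<^bsub>CT\<^esub> b | a b. a \<in> carrier CT \<and> b \<in> carrier (CT :: 'n Au_elem cstar)}"
    have Sc: "?S \<subseteq> carrier (min_tensor CT CT)" using CC.T.lin_span_in[OF L[unfolded T_def]] by blast
    show "tens CT CT a b \<in> nrm_closure (min_tensor CT CT) ?S"
    proof (rule CC.T.nrm_closure_closed[OF Sc CC.tens_in[OF ab]])
      fix e :: real assume e: "0 < e"
      from ap[OF ab e] obtain xs where xs: "dst CT a (circ.trig_sum xs) * nrm CT b < e" by blast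
      have "dst (min_tensor CT CT) (tens CT CT a b) (tens CT CT (circ.trig_sum xs) b) < e"
        by (rule le_less_trans[OF CC.dst_tens_left[OF ab(1) _ ab(2)] xs]) simp
      then show "\<exists>y\<in>nrm_closure (min_tensor CT CT) ?S. dst (min_tensor CT CT) (tens CT CT a b) y < e"
        by (rule bexI) (rule CC.T.nrm_closure_base[OF Sc tL[OF ab(2), unfolded T_def]])
    qed
  qed
  show "nrm_closure T (lin_span T ?R) = carrier T" unfolding T_def
  proof (rule CC.dense_of_tens[OF R[unfolded T_def]])
    fix b a :: "'n Au_elem" assume ab: "b \<in> carrier CT" "a \<in> carrier CT"
    let ?S = "lin_span (min_tensor CT CT) {circle_comult a \<otimes>\<^bsub>min_tensor CT CT\<^esub> tens CT CT b \<one>\<^bsub>CT\<^esub> | a b. a \<in> carrier CT \<and> b \<in> carrier (CT :: 'n Au_elem cstar)}"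
    have Sc: "?S \<subseteq> carrier (min_tensor CT CT)" using CC.T.lin_span_in[OF R[unfolded T_def]] by blast
    show "tens CT CT b a \<in> nrm_closure (min_tensor CT CT) ?S"
    proof (rule CC.T.nrm_closure_closed[OF Sc CC.tens_in[OF ab]])
      fix e :: real assume e: "0 < e"
      from ap[OF ab(2,1) e] obtain xs where xs: "nrm CT b * dst CT a (circ.trig_sum xs) < e" by (auto simp: mult.commute)
      have "dst (min_tensor CT CT) (tens CT CT b a) (tens CT CT b (circ.trig_sum xs)) < e"
        by (rule le_less_trans[OF CC.dst_tens_right[OF ab] xs]) simp
      then show "\<exists>y\<in>nrm_closure (min_tensor CT CT) ?S. dst (min_tensor CT CT) (tens CT CT b a) y < e"
        by (rule bexI) (rule CC.T.nrm_closure_base[OF Sc tR[OF ab(1), unfolded T_def]])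
    qed
  qed
qed

lemma one_not_zero_CT: "\<one>\<^bsub>CT\<^esub> \<noteq> (\<zero>\<^bsub>CT\<^esub> :: ('n::finite) Au_elem)"
proof
  assume "\<one>\<^bsub>CT\<^esub> = (\<zero>\<^bsub>CT\<^esub> :: 'n Au_elem)"
  from arg_cong[OF this, of "\<lambda>a. val a 0"] show False by simp
qed

lemma compact_quantum_group_circle: "compact_quantum_group (circle_cqg :: ('n::finite) Au_elem cqg)"
proof -
  have ta: "tensor_assoc circle_cqg circle_cqg circle_cqg = tensor_assoc CT CT (CT :: 'n Au_elem cstar)"
    unfolding tensor_assoc_def converges_to_def dst_def fun_eq_iff by (simp add: circle_cqg_def)
  show ?thesis
    unfolding compact_quantum_group_def ta
    by (intro conjI ballI full_circle) (simp_all add: circle_cqg_def cstar_algebra_extend[OF cstar_algebra_CT]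
      one_not_zero_CT circle_comult_hom circle_coassociative circle_density)
qed

text \<open>
  If the coefficients of \<open>w\<close> generate a finite dimensional algebra, then each of them takes finitely
  many values, so it is constant since the line is connected. Thus \<open>w\<close> is the identity matrix, for
  which every subspace is invariant, and irreducibility leaves only the trivial representation.
\<close>

lemma circle_connected: "connected_cqg (circle_cqg :: ('n::finite) Au_elem cqg)"
  unfolding connected_cqg_def
proof (intro allI impI)
  fix d and w :: "nat \<Rightarrow> nat \<Rightarrow> 'n Au_elem"
  assume a: "irreducible_representation circle_cqg d w \<and> \<not> trivial_representation circle_cqg d w"
  then have rep: "representation circle_cqg d w" and d: "0 < d" and nt: "\<not> trivial_representation circle_cqg d w"
    and irr: "\<And>W. invariant_subspace circle_cqg d w W \<Longrightarrow> W = {\<lambda>i. 0} \<or> W = {x. \<forall>i\<ge>d. x i = 0}"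
    by (auto simp: irreducible_representation_def)
  note wc = representation_circle(1)[OF rep]
  define S where "S = {w i j | i j. i < d \<and> j < d}"
  let ?B = "cstar_generated circle_cqg S"
  have "cstar_subalgebra circle_cqg (carrier (CT :: 'n Au_elem cstar))"
    by (auto simp: cstar_subalgebra_def circle_cqg_def nrm_closure_def)
  moreover have "S \<subseteq> carrier CT" using wc by (auto simp: S_def)
  ultimately have Bc: "?B \<subseteq> carrier CT" by (auto simp: cstar_generated_def)
  show "infinite_dimensional circle_cqg (cstar_generated circle_cqg {w i j | i j. i < d \<and> j < d})"
    unfolding S_def[symmetric]
  proof (rule ccontr)
    assume "\<not> infinite_dimensional circle_cqg ?B"
    then obtain F where F: "finite F" "F \<subseteq> ?B" "?B \<subseteq> lin_span CT F"
      by (auto simp: infinite_dimensional_def circle_cqg_def)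
    have Fc: "f \<in> carrier CT" if "f \<in> F" for f using F(2) Bc that by blast
    have const: "val (w i j) \<theta> = (if i = j then 1 else 0)" if ij: "i < d" "j < d" for i j \<theta>
    proof -
      let ?a = "w i j"
      define pw where "pw = (\<lambda>m. ((\<lambda>x. x \<otimes>\<^bsub>CT\<^esub> ?a) ^^ m) ?a)"
      have pw0: "pw 0 = ?a" and pwS: "pw (Suc m) = pw m \<otimes>\<^bsub>CT\<^esub> ?a" for m by (simp_all add: pw_def)
      have aS: "?a \<in> S" using ij by (auto simp: S_def)
      have pB: "pw m \<in> ?B" for m
        unfolding cstar_generated_def
      proof (rule InterI)
        fix B assume "B \<in> {B. cstar_subalgebra circle_cqg B \<and> S \<subseteq> B}"
        then have B: "\<And>x y. x \<in> B \<Longrightarrow> y \<in> B \<Longrightarrow> x \<otimes>\<^bsub>CT\<^esub> y \<in> B" "?a \<in> B"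
          using aS by (auto simp: cstar_subalgebra_def circle_cqg_def)
        show "pw m \<in> B" by (induct m) (simp_all add: pw0 pwS B)
      qed
      have pc: "pw m \<in> carrier CT" for m using pB Bc by blast
      have pv: "val (pw m) \<theta> = val ?a \<theta> ^ Suc m" for m \<theta>
      proof (induct m)
        case 0
        show ?case by (simp only: pw0 power_Suc power_0 mult_1_right)
      next
        case (Suc m)
        have "val (pw (Suc m)) \<theta> = val (pw m) \<theta> * val ?a \<theta>"
          unfolding pwS by (rule val_hom(2)[OF pc wc[OF ij]])
        then show ?case by (simp only: Suc power_Suc2)
      qed
      have "finite (range (val ?a))"
      proof (rule finite_range_of_powers[OF F(1), where \<tau> = val])
        fix m
        have "pw m \<in> lin_span CT F" by (rule subsetD[OF F(3) pB])
        then obtain G c where G: "finite G" "G \<subseteq> F" "pw m = finsum CT (\<lambda>s. c s \<odot>\<^bsub>CT\<^esub> s) G"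
          unfolding lin_span_def by blast
        have "val ?a \<theta> ^ Suc m = (\<Sum>s\<in>F. (if s \<in> G then c s else 0) * val s \<theta>)" for \<theta>
        proof -
          have "val ?a \<theta> ^ Suc m = (\<Sum>s\<in>G. val (c s \<odot>\<^bsub>CT\<^esub> s) \<theta>)"
            unfolding pv[symmetric] G(3) by (rule val_finsum[OF _ G(1)]) (use G Fc in auto)
          also have "\<dots> = (\<Sum>s\<in>G. c s * val s \<theta>)" by (rule sum.cong) (use G Fc in \<open>auto simp: val_hom\<close>)
          also have "\<dots> = (\<Sum>s\<in>F. (if s \<in> G then c s else 0) * val s \<theta>)"
            by (rule sum.mono_neutral_cong_left[OF F(1) G(2)]) auto
          finally show ?thesis .
        qed
        then show "\<exists>\<alpha>. \<forall>\<theta>. val ?a \<theta> ^ Suc m = (\<Sum>s\<in>F. \<alpha> s * val s \<theta>)"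
          by (intro exI[of _ "\<lambda>s. if s \<in> G then c s else 0"] allI)
      qed
      then have "val ?a constant_on UNIV"
        by (rule continuous_finite_range_constant[OF connected_UNIV continuous_val[OF wc[OF ij]]])
      then have "val ?a \<theta> = val ?a 0" unfolding constant_on_def by auto
      then show ?thesis using representation_circle(3)[OF rep ij] by simp
    qed
    \<comment> \<open>a coordinate axis is invariant, which forces \<open>d = 1\<close>\<close>
    define W :: "(nat \<Rightarrow> complex) set" where "W = {x. \<forall>i\<ge>1. x i = 0}"
    have inv: "invariant_subspace circle_cqg d w W"
      unfolding invariant_subspace_def
    proof (intro conjI ballI allI)
      show "W \<subseteq> {x. \<forall>i\<ge>d. x i = 0}" using d by (auto simp: W_def)
      fix x assume x: "x \<in> W"
      have "finsum CT (\<lambda>j. x j \<odot>\<^bsub>CT\<^esub> w i j) {..<d} = finsum CT (\<lambda>l. x i \<odot>\<^bsub>CT\<^esub> \<one>\<^bsub>CT\<^esub>) {..<1 :: nat}" if i: "i < d" for i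
      proof (rule CT_eqI)
        show "finsum CT (\<lambda>j. x j \<odot>\<^bsub>CT\<^esub> w i j) {..<d} \<in> carrier CT"
          by (rule CT.finsum_closed) (use wc i in auto)
        show "finsum CT (\<lambda>l. x i \<odot>\<^bsub>CT\<^esub> \<one>\<^bsub>CT\<^esub>) {..<1 :: nat} \<in> carrier (CT :: 'n Au_elem cstar)"
          by (rule CT.finsum_closed) auto
        fix \<theta>
        have "val (finsum CT (\<lambda>j. x j \<odot>\<^bsub>CT\<^esub> w i j) {..<d}) \<theta> = (\<Sum>j<d. val (x j \<odot>\<^bsub>CT\<^esub> w i j) \<theta>)"
          by (rule val_finsum) (use wc i in auto)
        also have "\<dots> = (\<Sum>j<d. x j * (if i = j then 1 else 0))"
          by (rule sum.cong) (use wc i const in \<open>auto simp: val_hom\<close>)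
        also have "\<dots> = x i" using i by (simp add: if_distrib cong: if_cong)
        also have "\<dots> = val (finsum CT (\<lambda>l. x i \<odot>\<^bsub>CT\<^esub> (\<one>\<^bsub>CT\<^esub> :: 'n Au_elem)) {..<1 :: nat}) \<theta>"
          by (subst val_finsum) (auto simp: val_hom)
        finally show "val (finsum CT (\<lambda>j. x j \<odot>\<^bsub>CT\<^esub> w i j) {..<d}) \<theta> =
            val (finsum CT (\<lambda>l. x i \<odot>\<^bsub>CT\<^esub> (\<one>\<^bsub>CT\<^esub> :: 'n Au_elem)) {..<1 :: nat}) \<theta>" .
      qed
      then show "\<exists>m (w' :: nat \<Rightarrow> nat \<Rightarrow> complex) a. (\<forall>l<m. w' l \<in> W \<and> a l \<in> carrier circle_cqg) \<and>
          (\<forall>i<d. finsum circle_cqg (\<lambda>j. x j \<odot>\<^bsub>circle_cqg\<^esub> w i j) {..<d} =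
            finsum circle_cqg (\<lambda>l. w' l i \<odot>\<^bsub>circle_cqg\<^esub> a l) {..<m})"
        using x by (intro exI[of _ 1] exI[of _ "\<lambda>_. x"] exI[of _ "\<lambda>_. \<one>\<^bsub>CT\<^esub>"]) (simp add: circle_cqg_def)
    qed (auto simp: W_def)
    have "(\<lambda>i. if i = 0 then 1 else 0) \<in> W" by (simp add: W_def)
    moreover have "(\<lambda>i :: nat. if i = 0 then 1 else 0 :: complex) \<noteq> (\<lambda>i. 0)" by (metis zero_neq_one)
    ultimately have We: "W = {x. \<forall>i\<ge>d. x i = 0}" using irr[OF inv] by blast
    have "d = 1"
    proof (rule ccontr)
      assume "d \<noteq> 1"
      with d have "(\<lambda>i. if i = 1 then 1 else 0) \<in> {x :: nat \<Rightarrow> complex. \<forall>i\<ge>d. x i = 0}" by auto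
      then have "(\<lambda>i. if i = 1 then 1 else 0) \<in> W" unfolding We .
      then show False by (auto simp: W_def)
    qed
    moreover have "w 0 0 = \<one>\<^bsub>CT\<^esub>" by (rule CT_eqI) (use wc d const in auto)
    ultimately show False using nt by (simp add: trivial_representation_def circle_cqg_def)
  qed
qed

section \<open>Matrices of operators\<close>

text \<open>
  A matrix of operators on \<open>l\<^sup>2(I)\<close> as one operator on \<open>l\<^sup>2\<close> of the product index set.
\<close>

definition block :: "('n \<Rightarrow> 'n \<Rightarrow> 'i op) \<Rightarrow> ('n \<times> 'i) op" where
  "block M = (\<lambda>(i, k) (j, l). M i j k l)"

lemma block_in:
  fixes M :: "'n::finite \<Rightarrow> 'n \<Rightarrow> 'i op"
  assumes M: "\<And>i j. M i j \<in> carrier bounded_ops"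
  shows "block M \<in> carrier bounded_ops"
proof -
  define E :: "'n \<Rightarrow> 'n \<Rightarrow> 'n op" where "E i j = (\<lambda>x y. if x = i \<and> y = j then 1 else 0)" for i j
  define f where "f = (\<lambda>(i, j). kron (E i j) (M i j))"
  have E: "E i j \<in> carrier bounded_ops" for i j
  proof -
    have "op_bound (E i j) 1"
      unfolding op_bound_def
    proof (intro conjI allI impI)
      fix F :: "'n set" and v w :: "'n \<Rightarrow> complex" assume F: "finite F"
      have "cnj (v x) * E i j x y * w y = (if y = j then (if x = i then cnj (v i) * w j else 0) else 0)" for x y
        by (simp add: E_def)
      then have "(\<Sum>x\<in>F. \<Sum>y\<in>F. cnj (v x) * E i j x y * w y) = (\<Sum>x\<in>F. if j \<in> F then (if x = i then cnj (v i) * w j else 0) else 0)"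
        using F by simp
      also have "\<dots> = (if i \<in> F \<and> j \<in> F then cnj (v i) * w j else 0)" using F by (cases "j \<in> F") simp_all
      finally have e: "(\<Sum>x\<in>F. \<Sum>y\<in>F. cnj (v x) * E i j x y * w y) = \<dots>" .
      have le: "cmod (u k) \<le> L2_set (\<lambda>i. cmod (u i)) F" if "k \<in> F" for u :: "'n \<Rightarrow> complex" and k
        by (rule member_le_L2_set[OF F that])
      show "cmod (\<Sum>x\<in>F. \<Sum>y\<in>F. cnj (v x) * E i j x y * w y) \<le> 1 * L2_set (\<lambda>i. cmod (v i)) F * L2_set (\<lambda>i. cmod (w i)) F"
        unfolding e using le[of i v] le[of j w] by (auto simp: norm_mult intro!: mult_mono mult_nonneg_nonneg L2_set_nonneg)
    qed simp
    then show ?thesis unfolding bounded_ops_sel by blast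
  qed
  have fc: "f x \<in> carrier bounded_ops" for x using E M by (cases x) (simp add: f_def kron_closed)
  have "finsum bounded_ops f I = (\<lambda>x y. \<Sum>i\<in>I. f i x y)" if "finite I" for I
    using that
  proof (induct I rule: finite_induct)
    case empty
    show ?case by (simp add: bounded_ops_sel)
  next
    case (insert a I)
    have "f \<in> I \<rightarrow> carrier bounded_ops" using fc by blast
    with insert fc have "finsum bounded_ops f (insert a I) = f a \<oplus>\<^bsub>bounded_ops\<^esub> finsum bounded_ops f I"
      by (intro bops.finsum_insert) auto
    with insert show ?case unfolding bounded_ops_sel by (simp add: fun_eq_iff)
  qed
  from this[of UNIV] have "finsum bounded_ops f UNIV = (\<lambda>x y. \<Sum>i\<in>UNIV. f i x y)" by simp
  moreover have "block M x y = (\<Sum>i\<in>UNIV. f i x y)" for x y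
  proof -
    obtain i k j l where xy: "x = (i, k)" "y = (j, l)" by (cases x, cases y)
    have "(\<Sum>a\<in>UNIV. f a x y) = (\<Sum>a\<in>UNIV. if a = (i, j) then M i j k l else 0)"
      by (rule sum.cong) (auto simp: f_def xy kron_def E_def split: prod.splits)
    then show ?thesis by (simp add: block_def xy)
  qed
  ultimately have "block M = finsum bounded_ops f UNIV" by (simp add: fun_eq_iff)
  moreover have "finsum bounded_ops f UNIV \<in> carrier bounded_ops" by (rule bops.finsum_closed) (use fc in blast)
  ultimately show ?thesis by (simp only:)
qed

lemma block_ops:
  "block (\<lambda>i j. M i j \<oplus>\<^bsub>bounded_ops\<^esub> N i j) = block M \<oplus>\<^bsub>bounded_ops\<^esub> block N"
  "block (\<lambda>i j. star bounded_ops (M j i)) = star bounded_ops (block M)"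
  "block (\<lambda>i j. if i = j then c \<odot>\<^bsub>bounded_ops\<^esub> \<one>\<^bsub>bounded_ops\<^esub> else \<zero>\<^bsub>bounded_ops\<^esub>) = c \<odot>\<^bsub>bounded_ops\<^esub> \<one>\<^bsub>bounded_ops\<^esub>"
  by (auto simp: block_def bounded_ops_sel fun_eq_iff)

lemma block_mult:
  fixes M N :: "'n::finite \<Rightarrow> 'n \<Rightarrow> 'i op"
  assumes M: "\<And>i j. M i j \<in> carrier bounded_ops" and N: "\<And>i j. N i j \<in> carrier bounded_ops"
  shows "block (mat_mult bounded_ops UNIV M N) = block M \<otimes>\<^bsub>bounded_ops\<^esub> block N"
proof (intro ext)
  fix x y :: "'n \<times> 'i"
  obtain i k j l where xy: "x = (i, k)" "y = (j, l)" by (cases x, cases y)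
  let ?g = "\<lambda>z. block M x z * block N z y"
  have s: "((\<lambda>p. M i m k p * N m j p l) has_sum (M i m \<otimes>\<^bsub>bounded_ops\<^esub> N m j) k l) UNIV" for m
  proof -
    obtain C where C: "op_bound (M i m) C" using M[of i m] unfolding bounded_ops_sel by blast
    obtain D where D: "op_bound (N m j) D" using N[of m j] unfolding bounded_ops_sel by blast
    show ?thesis unfolding bounded_ops_sel by (rule has_sum_infsum[OF op_bound_apply_summable[OF C op_bound_col[OF D]]])
  qed
  have "(?g has_sum (\<Sum>m\<in>J. (M i m \<otimes>\<^bsub>bounded_ops\<^esub> N m j) k l)) (J \<times> UNIV)" if "finite J" for J
    using that
  proof (induct J rule: finite_induct)
    case (insert m J)
    have "(?g has_sum (M i m \<otimes>\<^bsub>bounded_ops\<^esub> N m j) k l) (Pair m ` UNIV)"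
      by (subst has_sum_reindex) (use s[of m] in \<open>auto simp: inj_on_def comp_def block_def xy\<close>)
    from has_sum_Un_disjoint[OF this insert(3)] insert(1,2)
    have "(?g has_sum (M i m \<otimes>\<^bsub>bounded_ops\<^esub> N m j) k l + (\<Sum>m\<in>J. (M i m \<otimes>\<^bsub>bounded_ops\<^esub> N m j) k l)) (Pair m ` UNIV \<union> J \<times> UNIV)"
      by auto
    moreover have "Pair m ` UNIV \<union> J \<times> UNIV = insert m J \<times> (UNIV :: 'i set)" by auto
    ultimately show ?case using insert(1,2) by simp
  qed simp
  from this[of UNIV] have "(?g has_sum (\<Sum>m\<in>UNIV. (M i m \<otimes>\<^bsub>bounded_ops\<^esub> N m j) k l)) UNIV" by simp
  then have "(block M \<otimes>\<^bsub>bounded_ops\<^esub> block N) x y = (\<Sum>m\<in>UNIV. (M i m \<otimes>\<^bsub>bounded_ops\<^esub> N m j) k l)"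
    by (subst bounded_ops_sel(2)) (rule infsumI)
  moreover have "finsum bounded_ops f J k l = (\<Sum>m\<in>J. f m k l)" if "finite J" "\<And>m. f m \<in> carrier bounded_ops" for f :: "'n \<Rightarrow> 'i op" and J
    using that(1)
  proof (induct J rule: finite_induct)
    case empty
    show ?case by (simp add: bounded_ops_sel(4))
  next
    case (insert a J)
    have "finsum bounded_ops f (insert a J) = f a \<oplus>\<^bsub>bounded_ops\<^esub> finsum bounded_ops f J"
      using insert that(2) by (intro bops.finsum_insert) auto
    with insert show ?case by (simp add: bounded_ops_sel(5))
  qed
  ultimately show "block (mat_mult bounded_ops UNIV M N) x y = (block M \<otimes>\<^bsub>bounded_ops\<^esub> block N) x y"
    using M N by (simp add: block_def xy mat_mult_def)
qed

lemma op_norm_block_entry: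
  assumes "block M \<in> carrier bounded_ops"
  shows "op_norm (M i i) \<le> op_norm (block M)"
proof -
  obtain C where "op_bound (block M) C" using assms unfolding bounded_ops_sel by blast
  then have "op_bound (block M) (op_norm (block M))" by (rule op_bound_op_norm)
  then have "op_bound (compress UNIV (Pair i) (block M)) (op_norm (block M))"
    by (rule op_bound_compress) (auto simp: inj_on_def)
  moreover have "compress UNIV (Pair i) (block M) = M i i" by (simp add: compress_def block_def fun_eq_iff)
  ultimately show ?thesis by (simp add: op_norm_le)
qed

section \<open>The circle as a quantum subgroup\<close>

text \<open>A trigonometric polynomial evaluated in the generating matrix \<open>u\<close> itself.\<close>

primrec matrix_poly :: "('n::finite \<times> 'n) star_poly \<Rightarrow> 'n \<Rightarrow> 'n \<Rightarrow> ('n \<times> 'n) star_poly" where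
  "matrix_poly (Const_poly c) = (\<lambda>i j. if i = j then Const_poly c else Const_poly 0)"
| "matrix_poly (Gen x) = (\<lambda>i j. if fst x = snd x then Gen (i, j) else Const_poly 0)"
| "matrix_poly (Add_poly p q) = (\<lambda>i j. Add_poly (matrix_poly p i j) (matrix_poly q i j))"
| "matrix_poly (Mult_poly p q) = poly_mat_mult (matrix_poly p) (matrix_poly q)"
| "matrix_poly (Star_poly p) = (\<lambda>i j. Star_poly (matrix_poly p j i))"

lemma tval_matrix_poly: "tval \<theta> (matrix_poly p i j) = (if i = j then tval \<theta> p else 0)"
proof (induct p arbitrary: i j)
  case (Gen x)
  show ?case by (cases x) auto
next
  case (Mult_poly p q)
  have "tval \<theta> (poly_mat_mult (matrix_poly p) (matrix_poly q) i j) = (\<Sum>k\<in>UNIV. tval \<theta> (matrix_poly p i k) * tval \<theta> (matrix_poly q k j))"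
    unfolding tval_def by (subst pre_cstar.eval_poly_mat_mult[OF pre_cstar_complex]) (simp_all add: mat_mult_def finsum_complex)
  also have "\<dots> = (\<Sum>k\<in>UNIV. if k = i then (if i = j then tval \<theta> p * tval \<theta> q else 0) else 0)"
    by (rule sum.cong) (auto simp: Mult_poly)
  finally show ?case by simp
qed auto

text \<open>
  An entry of \<open>p(U)\<close>, where \<open>U\<close> is the block matrix of the generators, is again a *-polynomial in the
  generators.
\<close>

lemma block_eval:
  fixes u :: "'n::finite \<times> 'n \<Rightarrow> 'i op"
  assumes u: "\<And>x. u x \<in> carrier bounded_ops"
  shows "block (\<lambda>i j. eval_poly bounded_ops u (matrix_poly p i j)) =
    eval_poly bounded_ops (diag bounded_ops (block (\<lambda>i j. u (i, j)))) p"
proof (induct p)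
  case (Const_poly c)
  have "(\<lambda>i j. eval_poly bounded_ops u (matrix_poly (Const_poly c) i j)) =
      (\<lambda>i j :: 'n. if i = j then c \<odot>\<^bsub>bounded_ops\<^esub> \<one>\<^bsub>bounded_ops\<^esub> else \<zero>\<^bsub>bounded_ops\<^esub>)"
    by (intro ext) simp
  then show ?case by (simp only: block_ops(3) eval_poly.simps)
next
  case (Gen x)
  have z: "block (\<lambda>i j. \<zero>\<^bsub>bounded_ops\<^esub>) = (\<zero>\<^bsub>bounded_ops\<^esub> :: ('n \<times> 'i) op)"
    by (auto simp: block_def bounded_ops_sel fun_eq_iff)
  obtain i j where x: "x = (i, j)" by force
  show ?case
  proof (cases "i = j")
    case False
    then show ?thesis using z by (simp add: x diag_def)
  qed (simp add: x diag_def)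
next
  case (Mult_poly p q)
  have c: "eval_poly bounded_ops u r \<in> carrier bounded_ops" for r by (rule bops.eval_poly_in[of u, OF u])
  have "(\<lambda>i j. eval_poly bounded_ops u (matrix_poly (Mult_poly p q) i j)) =
      mat_mult bounded_ops UNIV (\<lambda>i j. eval_poly bounded_ops u (matrix_poly p i j)) (\<lambda>i j. eval_poly bounded_ops u (matrix_poly q i j))"
    by (intro ext) (simp add: bops.eval_poly_mat_mult[of u, OF u])
  then show ?case using Mult_poly by (simp only: block_mult[OF c c] eval_poly.simps)
qed (simp_all add: block_ops)

context Au_setting
begin

lemma unitary_block:
  fixes u :: "'n \<times> 'n \<Rightarrow> nat op"
  assumes uc: "\<And>x. u x \<in> carrier bounded_ops" and r: "Au_relations Q bounded_ops u"
  shows "unitary_in bounded_ops (block (\<lambda>i j. u (i, j)))"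
proof unfold_locales
  let ?u = "\<lambda>i j. u (i, j)" and ?s = "\<lambda>i j. star bounded_ops (u (j, i))"
  show "block ?u \<in> carrier bounded_ops" by (rule block_in[OF uc])
  have sc: "?s i j \<in> carrier bounded_ops" for i j using uc by simp
  have m: "mat_mult bounded_ops UNIV ?s ?u = mat_one bounded_ops" "mat_mult bounded_ops UNIV ?u ?s = mat_one bounded_ops"
    using r by (simp_all add: Au_relations_def Let_def)
  have e: "mat_one bounded_ops = (\<lambda>i j :: 'n. if i = j then 1 \<odot>\<^bsub>bounded_ops\<^esub> \<one>\<^bsub>bounded_ops\<^esub> else (\<zero>\<^bsub>bounded_ops\<^esub> :: nat op))"
    by (intro ext) (simp add: mat_one_def bops.sm_one[OF bops.one_closed])
  have o: "block (mat_one bounded_ops :: 'n \<Rightarrow> 'n \<Rightarrow> nat op) = \<one>\<^bsub>bounded_ops\<^esub>"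
    unfolding e block_ops(3) by (rule bops.sm_one[OF bops.one_closed])
  show "star bounded_ops (block ?u) \<otimes>\<^bsub>bounded_ops\<^esub> block ?u = \<one>\<^bsub>bounded_ops\<^esub>"
    unfolding block_ops(2)[symmetric] block_mult[OF sc uc, symmetric] m by (rule o)
  show "block ?u \<otimes>\<^bsub>bounded_ops\<^esub> star bounded_ops (block ?u) = \<one>\<^bsub>bounded_ops\<^esub>"
    unfolding block_ops(2)[symmetric] block_mult[OF uc sc, symmetric] m by (rule o)
qed

text \<open>
  The norm of \<open>p(U)\<close> is at most the supremum of \<open>|p|\<close>, as \<open>U\<close> is unitary; so this is a contractive
  section of the quotient map onto \<open>C(\<T>)\<close>. Which diagonal entry is taken is immaterial.
\<close>

sublocale lift: raw_map complex_cstar "circle_free :: ('n \<times> 'n) star_poly cstar" "range tval"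
  "bounded_ops :: nat op cstar" "Au_free Q" "Au_reps Q" "\<lambda>p. matrix_poly p undefined undefined"
proof unfold_locales
  fix p q :: "('n \<times> 'n) star_poly"
  let ?L = "\<lambda>p. matrix_poly p undefined undefined"
  show "?L p \<in> carrier (Au_free Q)" by simp
  show "dst (Au_free Q) (?L p) (?L q) \<le> dst circle_free p q"
  proof (rule free.dst_le)
    fix \<phi> assume "\<phi> \<in> Au_reps Q"
    then obtain u where \<phi>: "\<phi> = eval_poly bounded_ops u" and u: "range u \<subseteq> carrier bounded_ops" "Au_relations Q bounded_ops u"
      by (auto simp: free_reps_def)
    have uc: "u x \<in> carrier bounded_ops" for x using u by auto
    let ?U = "block (\<lambda>i j. u (i, j))"
    interpret U: unitary_in bounded_ops ?U by (rule unitary_block[OF uc u(2)])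
    define M where "M = (\<lambda>i j. eval_poly bounded_ops u (matrix_poly p i j) \<oplus>\<^bsub>bounded_ops\<^esub>
        (-1) \<odot>\<^bsub>bounded_ops\<^esub> eval_poly bounded_ops u (matrix_poly q i j))"
    have c: "eval_poly bounded_ops u r \<in> carrier bounded_ops" for r by (rule bops.eval_poly_in[of u, OF uc])
    have bM: "block M = eval_poly bounded_ops (diag bounded_ops ?U) (poly_relator p q)"
    proof -
      have "block M = block (\<lambda>i j. eval_poly bounded_ops u (matrix_poly p i j)) \<oplus>\<^bsub>bounded_ops\<^esub>
          (-1) \<odot>\<^bsub>bounded_ops\<^esub> block (\<lambda>i j. eval_poly bounded_ops u (matrix_poly q i j))"
        by (auto simp: M_def block_def bounded_ops_sel fun_eq_iff)
      then show ?thesis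
        using bops.smult_mult_left[OF bops.one_closed U.eval_diag_closed, of "-1" q] bops.l_one[OF U.eval_diag_closed, of q]
        by (simp add: block_eval[OF uc] poly_relator_def)
    qed
    have "op_norm (M undefined undefined) \<le> op_norm (block M)"
      by (rule op_norm_block_entry) (simp only: bM U.eval_diag_closed)
    also have "\<dots> = nrm bounded_ops (eval_poly bounded_ops (diag bounded_ops ?U) (poly_relator p q))" by (simp add: bM nrm_bounded_ops)
    also have "\<dots> \<le> dst circle_free p q"
      by (rule U.nrm_eval_diag_sup) (use tval_dst[of _ p q] in \<open>simp add: poly_relator_def\<close>)
    finally show "dst bounded_ops (\<phi> (?L p)) (\<phi> (?L q)) \<le> dst circle_free p q"
      by (simp add: \<phi> dst_def M_def nrm_bounded_ops)
  qed simp_all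
qed

text \<open>The matrices \<open>\<delta>\<^sub>i\<^sub>j e\<^sup>i\<^sup>\<theta>\<close> are among the families over which the universal seminorm ranges.\<close>

sublocale proj: raw_map "bounded_ops :: nat op cstar" "Au_free Q" "Au_reps Q"
  complex_cstar "circle_free :: ('n \<times> 'n) star_poly cstar" "range tval" id
proof unfold_locales
  fix p q :: "('n \<times> 'n) star_poly"
  show "dst circle_free (id p) (id q) \<le> dst (Au_free Q) p q"
  proof (rule circ.dst_le)
    fix \<phi> :: "('n \<times> 'n) star_poly \<Rightarrow> complex" assume "\<phi> \<in> range tval"
    then obtain \<theta> where \<phi>: "\<phi> = tval \<theta>" by blast
    let ?w = "diag bounded_ops (cis \<theta> \<odot>\<^bsub>bounded_ops\<^esub> (\<one>\<^bsub>bounded_ops\<^esub> :: nat op))"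
    have "eval_poly bounded_ops ?w \<in> Au_reps Q"
      using Au_relations_scalar[OF Q, of \<theta>] by (auto simp: free_reps_def diag_def)
    from free.dst_ge[OF _ _ this, of p q]
    have "nrm bounded_ops ((tval \<theta> p - tval \<theta> q) \<odot>\<^bsub>bounded_ops\<^esub> (\<one>\<^bsub>bounded_ops\<^esub> :: nat op)) \<le> dst (Au_free Q) p q"
      unfolding dst_def[of bounded_ops] eval_diag_scalar by (simp add: bounded_ops_sel algebra_simps)
    moreover have "nrm bounded_ops (\<one>\<^bsub>bounded_ops\<^esub> :: nat op) = 1"
      using nrm_val_rep[of 0 "\<one>\<^bsub>CT\<^esub> :: 'n Au_elem", where 'b = nat] by (simp add: val_rep_def)
    ultimately show "dst complex_cstar (\<phi> (id p)) (\<phi> (id q)) \<le> dst (Au_free Q) p q"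
      by (simp add: \<phi> dst_def bops.nrm_smult)
  qed simp_all
qed simp

definition proj :: "'n Au_elem \<Rightarrow> 'n Au_elem" where
  "proj = completion_map circle_free id"

lemma proj_cc: "cauchy_seq (Au_free Q) x \<Longrightarrow> proj (cauchy_class (Au_free Q) x) = cauchy_class circle_free x"
  unfolding proj_def by (subst proj.completion_map_cc) simp_all

lemma proj_unital_hom: "unital_star_hom AA CT proj"
  unfolding proj_def circle_alg_def AA_completion
  by (rule proj.completion_map_unital_star_hom) auto

lemmas proj_hom = proj_unital_hom[unfolded unital_star_hom_def, THEN conjunct1]
  and proj_one = proj_unital_hom[unfolded unital_star_hom_def, THEN conjunct2]

lemma proj_gen: "proj (gen x) = diag CT circle_gen x"
proof (cases x)
  case (Pair i j)
  have "proj (Au_gen Q i j) = circle_embed (Gen (i, j))"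
    unfolding Au_gen_def completion_embed_def circle_embed_def by (rule proj_cc) simp
  then show ?thesis by (simp add: Pair circle_embed_Gen)
qed

text \<open>
  A Cauchy sequence of trigonometric polynomials is lifted to \<open>A\<^sub>u(Q)\<close> by the contractive section.
\<close>

lemma proj_surj: "proj ` carrier AA = carrier CT"
proof
  show "proj ` carrier AA \<subseteq> carrier CT" using star_homD(1)[OF proj_hom] by blast
  show "carrier CT \<subseteq> proj ` carrier AA"
  proof
    fix X :: "'n Au_elem" assume "X \<in> carrier CT"
    then obtain x where x: "cauchy_seq circle_free x" "X = cauchy_class circle_free x"
      unfolding circle_alg_def by (rule circ.carrier_completionE)
    let ?y = "\<lambda>n. matrix_poly (x n) undefined undefined"
    have y: "cauchy_seq (Au_free Q) ?y" by (rule lift.f_cauchy[OF x(1)])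
    have y': "cauchy_seq circle_free ?y" using proj.f_cauchy[OF y] by simp
    have "proj (cauchy_class (Au_free Q) ?y) = X"
      unfolding proj_cc[OF y] x(2) by (rule circ.cc_null[OF y' x(1)]) (auto simp: tval_matrix_poly)
    moreover have "cauchy_class (Au_free Q) ?y \<in> carrier AA" unfolding AA_completion by (rule free.cc_in[OF y])
    ultimately show "X \<in> proj ` carrier AA" by blast
  qed
qed

section \<open>The coproduct of the universal quantum group\<close>

sublocale GG: cstar_pair AA AA by (rule cstar_pair.intro[OF cstar_algebra_AA cstar_algebra_AA])
sublocale GN: cstar_pair AA "CT :: 'n Au_elem cstar" by (rule cstar_pair.intro[OF cstar_algebra_AA cstar_algebra_CT])
sublocale NG: cstar_pair "CT :: 'n Au_elem cstar" AA by (rule cstar_pair.intro[OF cstar_algebra_CT cstar_algebra_AA])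

lemma generated_by_AA: "generated_by AA gen"
  unfolding generated_by_def
proof (intro conjI ballI allI impI)
  show "range gen \<subseteq> carrier AA" using gen_in by blast
  fix a and e :: real assume "a \<in> carrier AA" "0 < e"
  then obtain p where "dst AA a (completion_embed (Au_free Q) p) < e"
    unfolding AA_completion by (rule free.completion_approx)
  then show "\<exists>p. dst AA a (eval_poly AA gen p) < e" unfolding embed_eval by (rule exI)
qed

lemma AA_kron_sum_le:
  assumes "star_hom AA bounded_ops \<sigma>" "star_hom AA bounded_ops \<tau>" "M \<in> carrier (formal_tensor AA AA)"
  shows "op_norm (kron_sum \<sigma> \<tau> M) \<le> nrm (formal_tensor AA AA) M"
  by (rule GG.kron_sum_le_nrm[OF generated_by_AA generated_by_AA infinite_Au_elem infinite_Au_elem assms])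

definition comult_gen :: "'n \<times> 'n \<Rightarrow> ('n Au_elem \<times> 'n Au_elem) multiset" where
  "comult_gen = (\<lambda>(i, j). image_mset (\<lambda>k. (Au_gen Q i k, Au_gen Q k j)) (mset_set UNIV))"

definition comult_poly :: "('n \<times> 'n) star_poly \<Rightarrow> ('n Au_elem \<times> 'n Au_elem) multiset" where
  "comult_poly = eval_poly (formal_tensor AA AA) comult_gen"

lemma comult_gen_in: "comult_gen x \<in> carrier (formal_tensor AA AA)"
  by (cases x) (auto simp: comult_gen_def)

lemma comult_poly_in: "comult_poly p \<in> carrier (formal_tensor AA AA)"
  unfolding comult_poly_def by (rule GG.FT.eval_poly_raw_in[of comult_gen, OF comult_gen_in])

lemma Au_comult_eq: "Au_comult Q = completion_map (formal_tensor AA AA) comult_poly"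
  by (simp add: Au_comult_def comult_poly_def comult_gen_def)

context
  fixes \<sigma> :: "'n Au_elem \<Rightarrow> 'i op" and \<tau> :: "'n Au_elem \<Rightarrow> 'j op"
  assumes h: "star_hom AA bounded_ops \<sigma>" "star_hom AA bounded_ops \<tau>"
begin

abbreviation "unit_proj \<equiv> kron (\<sigma> \<one>\<^bsub>AA\<^esub>) (\<tau> \<one>\<^bsub>AA\<^esub>)"

lemma kron_in_corner: "a \<in> carrier AA \<Longrightarrow> b \<in> carrier AA \<Longrightarrow> kron (\<sigma> a) (\<tau> b) \<in> carrier (corner bounded_ops unit_proj)"
  using star_homD(1)[OF h(1)] star_homD(1)[OF h(2)] A.star_hom_one(3,4)[OF h(1)] A.star_hom_one(3,4)[OF h(2)]
  by (simp add: kron_closed kron_mult)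

lemma unit_proj: "unit_proj \<in> carrier bounded_ops" "unit_proj \<otimes>\<^bsub>bounded_ops\<^esub> unit_proj = unit_proj" "star bounded_ops unit_proj = unit_proj"
  using star_homD(1)[OF h(1)] star_homD(1)[OF h(2)] A.star_hom_one(1,2)[OF h(1)] A.star_hom_one(1,2)[OF h(2)]
  by (simp_all add: kron_closed kron_mult kron_star)

lemma kron_comult_poly:
  "kron_sum \<sigma> \<tau> (comult_poly p) = eval_poly (corner bounded_ops unit_proj) (\<lambda>x. kron_sum \<sigma> \<tau> (comult_gen x)) p"
  unfolding comult_poly_def by (rule GG.eval_poly_kron_sum[OF h comult_gen_in])

lemma kron_comult_gen:
  "kron_sum \<sigma> \<tau> (comult_gen (i, j)) =
    finsum (corner bounded_ops unit_proj) (\<lambda>k. kron (\<sigma> (Au_gen Q i k)) (\<tau> (Au_gen Q k j))) UNIV"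
proof -
  interpret C: pre_cstar "corner bounded_ops unit_proj" by (rule bops.pre_cstar_corner[OF unit_proj])
  have "kron_sum \<sigma> \<tau> (image_mset (\<lambda>k. (Au_gen Q i k, Au_gen Q k j)) (mset_set I)) =
    finsum (corner bounded_ops unit_proj) (\<lambda>k. kron (\<sigma> (Au_gen Q i k)) (\<tau> (Au_gen Q k j))) I" if "finite I" for I
    using that
  proof (induct I rule: finite_induct)
    case empty
    show ?case using C.finsum_empty by (simp add: kron_sum_simps)
  next
    case (insert k I)
    have "(\<lambda>k. kron (\<sigma> (Au_gen Q i k)) (\<tau> (Au_gen Q k j))) \<in> I \<rightarrow> carrier (corner bounded_ops unit_proj)"
      using kron_in_corner[OF gen_in(2) gen_in(2)] by blast
    from C.finsum_insert[OF insert(1,2) this kron_in_corner[OF gen_in(2) gen_in(2)]] insert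
    show ?case by (simp add: kron_sum_simps)
  qed
  then show ?thesis by (simp add: comult_gen_def)
qed

text \<open>
  \<open>\<Sum>\<^sub>k \<sigma>(u\<^sub>i\<^sub>k) \<otimes> \<tau>(u\<^sub>k\<^sub>j)\<close> is the product of two commuting solutions \<open>\<sigma>(u) \<otimes> \<tau>(1)\<close> and \<open>\<sigma>(1) \<otimes> \<tau>(u)\<close>
  of the relations in the corner of \<open>\<sigma>(1) \<otimes> \<tau>(1)\<close>.
\<close>

lemma kron_comult_relations:
  "Au_relations Q (corner bounded_ops unit_proj) (\<lambda>x. kron_sum \<sigma> \<tau> (comult_gen x))"
  "kron_sum \<sigma> \<tau> (comult_gen x) \<in> carrier (corner bounded_ops unit_proj)"
proof -
  note hc = star_homD(1)[OF h(1)] star_homD(1)[OF h(2)]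
  note one = A.star_hom_one(3,4)[OF h(1)] A.star_hom_one(3,4)[OF h(2)]
  let ?C = "corner bounded_ops unit_proj"
  interpret C: pre_cstar ?C by (rule bops.pre_cstar_corner[OF unit_proj])
  define a where "a = (\<lambda>i j. kron (\<sigma> (Au_gen Q i j)) (\<tau> \<one>\<^bsub>AA\<^esub>))"
  define b where "b = (\<lambda>i j. kron (\<sigma> \<one>\<^bsub>AA\<^esub>) (\<tau> (Au_gen Q i j)))"
  have ac: "a i j \<in> carrier ?C" and bc: "b i j \<in> carrier ?C" for i j
    unfolding a_def b_def by (intro kron_in_corner gen_in A.one_closed)+
  have ha: "star_hom AA bounded_ops (\<lambda>x. kron (\<sigma> x) (\<tau> \<one>\<^bsub>AA\<^esub>))" and hb: "star_hom AA bounded_ops (\<lambda>x. kron (\<sigma> \<one>\<^bsub>AA\<^esub>) (\<tau> x))"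
    by (rule star_homI; use hc star_homD(2-5)[OF h(1)] star_homD(2-5)[OF h(2)] A.star_hom_one[OF h(1)] A.star_hom_one[OF h(2)]
      in \<open>simp add: kron_closed kron_mult kron_star kron_add kron_smult\<close>)+
  have "eval_poly ?C (\<lambda>(i, j). a i j) r = \<zero>\<^bsub>?C\<^esub>" if r: "r \<in> Au_relators Q" for r
  proof -
    have "eval_poly ?C (\<lambda>(i, j). a i j) r = kron (\<sigma> (eval_poly AA gen r)) (\<tau> \<one>\<^bsub>AA\<^esub>)"
      unfolding A.eval_poly_star_hom[OF ha gen_in(1)] by (simp add: a_def case_prod_unfold)
    then show ?thesis using A.star_hom_zero_elem[OF h(1) bops.pre_cstar_axioms] by (simp add: gen_relators[OF r] kron_zero)
  qed
  then have ra: "Au_relations Q ?C (\<lambda>(i, j). a i j)"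
    using C.Au_relations_iff[of "\<lambda>(i, j). a i j" Q] ac by (simp add: case_prod_unfold)
  have "eval_poly ?C (\<lambda>(i, j). b i j) r = \<zero>\<^bsub>?C\<^esub>" if r: "r \<in> Au_relators Q" for r
  proof -
    have "eval_poly ?C (\<lambda>(i, j). b i j) r = kron (\<sigma> \<one>\<^bsub>AA\<^esub>) (\<tau> (eval_poly AA gen r))"
      unfolding A.eval_poly_star_hom[OF hb gen_in(1)] by (simp add: b_def case_prod_unfold)
    then show ?thesis using A.star_hom_zero_elem[OF h(2) bops.pre_cstar_axioms] by (simp add: gen_relators[OF r] kron_zero)
  qed
  then have rb: "Au_relations Q ?C (\<lambda>(i, j). b i j)"
    using C.Au_relations_iff[of "\<lambda>(i, j). b i j" Q] bc by (simp add: case_prod_unfold)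
  have ab: "a i j \<otimes>\<^bsub>?C\<^esub> b k l = kron (\<sigma> (Au_gen Q i j)) (\<tau> (Au_gen Q k l))" "b k l \<otimes>\<^bsub>?C\<^esub> a i j = kron (\<sigma> (Au_gen Q i j)) (\<tau> (Au_gen Q k l))" for i j k l
    using hc one by (simp_all add: a_def b_def kron_mult)
  have eq: "kron_sum \<sigma> \<tau> (comult_gen (i, j)) = finsum ?C (\<lambda>k. a i k \<otimes>\<^bsub>?C\<^esub> b k j) UNIV" for i j
    unfolding kron_comult_gen ab ..
  have "Au_relations Q ?C (\<lambda>(i, j). finsum ?C (\<lambda>k. a i k \<otimes>\<^bsub>?C\<^esub> b k j) UNIV)"
    by (rule C.Au_relations_product[OF Q ac bc _ ra rb]) (simp only: ab)
  moreover have "(\<lambda>(i, j). finsum ?C (\<lambda>k. a i k \<otimes>\<^bsub>?C\<^esub> b k j) UNIV) = (\<lambda>x. kron_sum \<sigma> \<tau> (comult_gen x))"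
    by (auto simp: eq)
  ultimately show "Au_relations Q ?C (\<lambda>x. kron_sum \<sigma> \<tau> (comult_gen x))" by (simp only:)
  show "kron_sum \<sigma> \<tau> (comult_gen x) \<in> carrier ?C"
    by (cases x) (simp only: eq, intro C.finsum_closed Pi_I C.m_closed ac bc)
qed

end

lemma infinite_pair: "infinite (UNIV :: ('n Au_elem \<times> 'n Au_elem) set)"
  using infinite_Au_elem finite_cartesian_productD1[of "UNIV :: 'n Au_elem set" "UNIV :: 'n Au_elem set"] by auto

sublocale comult: raw_map "bounded_ops :: nat op cstar" "Au_free Q" "Au_reps Q"
  "bounded_ops :: ('n Au_elem \<times> 'n Au_elem) op cstar" "formal_tensor AA AA" "tensor_reps AA AA" comult_poly
proof unfold_locales
  fix p q :: "('n \<times> 'n) star_poly"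
  show "comult_poly p \<in> carrier (formal_tensor AA AA)" by (rule comult_poly_in)
  show "dst (formal_tensor AA AA) (comult_poly p) (comult_poly q) \<le> dst (Au_free Q) p q"
  proof (rule GG.FT.dst_le[OF comult_poly_in comult_poly_in])
    fix \<phi> assume "\<phi> \<in> tensor_reps AA AA"
    then obtain \<sigma> \<tau> where \<phi>: "\<phi> = kron_sum \<sigma> \<tau>" and h: "star_hom AA bounded_ops \<sigma>" "star_hom AA bounded_ops \<tau>"
      by (rule GG.tensor_repsE)
    let ?P = "kron (\<sigma> \<one>\<^bsub>AA\<^esub>) (\<tau> \<one>\<^bsub>AA\<^esub>)" and ?g = "\<lambda>x. kron_sum \<sigma> \<tau> (comult_gen x)"
    interpret C: pre_cstar "corner bounded_ops ?P" by (rule bops.pre_cstar_corner[OF unit_proj[OF h]])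
    note gc = kron_comult_relations(2)[OF h]
    have ec: "eval_poly (corner bounded_ops ?P) ?g r \<in> carrier (corner bounded_ops ?P)" for r
      by (rule C.eval_poly_in[of ?g, OF gc])
    have "dst bounded_ops (\<phi> (comult_poly p)) (\<phi> (comult_poly q)) = op_norm (eval_poly (corner bounded_ops ?P) ?g (poly_relator p q))"
      using C.smult_mult_left[OF C.one_closed ec, of "-1" q] C.l_one[OF ec, of q]
      by (simp add: \<phi> dst_def kron_comult_poly[OF h] poly_relator_def nrm_bounded_ops)
    also have "\<dots> \<le> nrm (Au_free Q) (poly_relator p q)"
      by (rule corner_eval_le[OF infinite_pair unit_proj[OF h] gc kron_comult_relations(1)[OF h]])
    finally show "dst bounded_ops (\<phi> (comult_poly p)) (\<phi> (comult_poly q)) \<le> dst (Au_free Q) p q"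
      by (simp add: dst_def poly_relator_def)
  qed
qed

lemma Au_comult_cc:
  "cauchy_seq (Au_free Q) x \<Longrightarrow> Au_comult Q (cauchy_class (Au_free Q) x) = cauchy_class (formal_tensor AA AA) (\<lambda>n. comult_poly (x n))"
  unfolding Au_comult_eq by (rule comult.completion_map_cc)

lemma Au_comult_gen: "Au_comult Q (Au_gen Q i j) = finsum (min_tensor AA AA) (\<lambda>k. tens AA AA (Au_gen Q i k) (Au_gen Q k j)) UNIV"
proof -
  have "Au_comult Q (Au_gen Q i j) = formal_sum AA AA (comult_gen (i, j))"
    unfolding Au_gen_def completion_embed_def formal_sum_def
    by (subst Au_comult_cc) (simp_all add: comult_poly_def)
  then show ?thesis by (subst GG.finsum_tens) (simp_all add: comult_gen_def)
qed

end

section \<open>Normality of the circle\<close>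

definition flip :: "('i \<times> 'j) op \<Rightarrow> ('j \<times> 'i) op" where
  "flip M = (\<lambda>x y. M (prod.swap x) (prod.swap y))"

lemma flip_ops:
  "flip (S \<oplus>\<^bsub>bounded_ops\<^esub> T) = flip S \<oplus>\<^bsub>bounded_ops\<^esub> flip T" "flip (c \<odot>\<^bsub>bounded_ops\<^esub> S) = c \<odot>\<^bsub>bounded_ops\<^esub> flip S"
  "flip (star bounded_ops S) = star bounded_ops (flip S)" "flip \<zero>\<^bsub>bounded_ops\<^esub> = \<zero>\<^bsub>bounded_ops\<^esub>"
  by (simp_all add: flip_def bounded_ops_sel)

lemma flip_mult: "flip (S \<otimes>\<^bsub>bounded_ops\<^esub> T) = flip S \<otimes>\<^bsub>bounded_ops\<^esub> flip T"
proof (intro ext)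
  fix x y
  have "infsum (\<lambda>z. S (prod.swap x) (prod.swap z) * T (prod.swap z) (prod.swap y)) UNIV =
      infsum (\<lambda>z. S (prod.swap x) z * T z (prod.swap y)) UNIV"
    by (rule infsum_reindex_bij_betw[OF bij_swap])
  then show "flip (S \<otimes>\<^bsub>bounded_ops\<^esub> T) x y = (flip S \<otimes>\<^bsub>bounded_ops\<^esub> flip T) x y"
    by (simp add: flip_def bounded_ops_sel(2))
qed

lemma flip_kron: "flip (kron S T) = kron T S"
  by (auto simp: flip_def kron_def fun_eq_iff)

lemma op_norm_flip: "op_norm (flip M) = op_norm M"
  unfolding flip_def by (rule op_norm_reindex[OF bij_swap])

lemma dst_flip: "dst bounded_ops (flip S) (flip T) = dst bounded_ops S T"
  unfolding dst_def flip_ops(1,2)[symmetric] nrm_bounded_ops by (rule op_norm_flip)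

lemma flip_eval: "flip (eval_poly (corner bounded_ops P) g p) = eval_poly (corner bounded_ops (flip P)) (\<lambda>x. flip (g x)) p"
  by (induct p) (simp_all add: flip_ops flip_mult)

context Au_setting
begin

lemma proj_gen_entry: "proj (Au_gen Q i j) = (if i = j then circle_gen else \<zero>\<^bsub>CT\<^esub>)"
  using proj_gen[of "(i, j)"] by (simp add: diag_def)

text \<open>In representations of \<open>A \<otimes> C(\<T>)\<close> the restricted coproduct multiplies the generators by \<open>z\<close>.\<close>

lemma kron_sum_proj:
  fixes \<sigma> :: "'n Au_elem \<Rightarrow> 'i op" and \<tau> :: "'n Au_elem \<Rightarrow> 'j op"
  assumes h: "star_hom AA bounded_ops \<sigma>" "star_hom CT bounded_ops \<tau>"
  shows "kron_sum \<sigma> \<tau> (image_mset (map_prod id proj) (comult_poly p)) =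
      eval_poly (corner bounded_ops (kron (\<sigma> \<one>\<^bsub>AA\<^esub>) (\<tau> \<one>\<^bsub>CT\<^esub>))) (\<lambda>x. kron (\<sigma> (gen x)) (\<tau> circle_gen)) p"
    and "kron_sum \<tau> \<sigma> (image_mset (map_prod proj id) (comult_poly p)) =
      eval_poly (corner bounded_ops (kron (\<tau> \<one>\<^bsub>CT\<^esub>) (\<sigma> \<one>\<^bsub>AA\<^esub>))) (\<lambda>x. kron (\<tau> circle_gen) (\<sigma> (gen x))) p"
proof -
  have h2: "star_hom AA bounded_ops (\<lambda>b. \<tau> (proj b))" by (rule star_hom_comp[OF proj_hom h(2)])
  have \<tau>0: "\<tau> \<zero>\<^bsub>CT\<^esub> = \<zero>\<^bsub>bounded_ops\<^esub>" by (rule CT.star_hom_zero_elem[OF h(2) bops.pre_cstar_axioms])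
  have z: "\<tau> circle_gen = \<tau> (proj (Au_gen Q j j))" for j by (simp add: proj_gen_entry)
  have 1: "kron_sum \<sigma> (\<lambda>b. \<tau> (proj b)) (comult_gen x) = kron (\<sigma> (gen x)) (\<tau> circle_gen)" for x
  proof -
    obtain i j where x: "x = (i, j)" by force
    let ?C = "corner bounded_ops (kron (\<sigma> \<one>\<^bsub>AA\<^esub>) (\<tau> (proj \<one>\<^bsub>AA\<^esub>)))"
    interpret C: pre_cstar ?C by (rule bops.pre_cstar_corner[OF unit_proj[OF h(1) h2]])
    have c: "kron (\<sigma> (Au_gen Q i k)) (\<tau> circle_gen) \<in> carrier ?C" for k
      unfolding z[of j] by (rule kron_in_corner[OF h(1) h2 gen_in(2) gen_in(2)])
    have "kron (\<sigma> (Au_gen Q i k)) (\<tau> (proj (Au_gen Q k j))) = (if j = k then kron (\<sigma> (Au_gen Q i k)) (\<tau> circle_gen) else \<zero>\<^bsub>?C\<^esub>)" for k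
      by (simp add: proj_gen_entry \<tau>0)
    then have "finsum ?C (\<lambda>k. kron (\<sigma> (Au_gen Q i k)) (\<tau> (proj (Au_gen Q k j)))) UNIV = kron (\<sigma> (Au_gen Q i j)) (\<tau> circle_gen)"
      using C.finsum_singleton[of j UNIV "\<lambda>k. kron (\<sigma> (Au_gen Q i k)) (\<tau> circle_gen)"] c by (simp only:) (simp add: Pi_def)
    then show ?thesis unfolding x kron_comult_gen[OF h(1) h2] by simp
  qed
  show "kron_sum \<sigma> \<tau> (image_mset (map_prod id proj) (comult_poly p)) =
      eval_poly (corner bounded_ops (kron (\<sigma> \<one>\<^bsub>AA\<^esub>) (\<tau> \<one>\<^bsub>CT\<^esub>))) (\<lambda>x. kron (\<sigma> (gen x)) (\<tau> circle_gen)) p"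
    using kron_comult_poly[OF h(1) h2, of p] unfolding kron_sum_image 1 proj_one by simp
  have 2: "kron_sum (\<lambda>b. \<tau> (proj b)) \<sigma> (comult_gen x) = kron (\<tau> circle_gen) (\<sigma> (gen x))" for x
  proof -
    obtain i j where x: "x = (i, j)" by force
    let ?C = "corner bounded_ops (kron (\<tau> (proj \<one>\<^bsub>AA\<^esub>)) (\<sigma> \<one>\<^bsub>AA\<^esub>))"
    interpret C: pre_cstar ?C by (rule bops.pre_cstar_corner[OF unit_proj[OF h2 h(1)]])
    have c: "kron (\<tau> circle_gen) (\<sigma> (Au_gen Q k j)) \<in> carrier ?C" for k
      unfolding z[of j] by (rule kron_in_corner[OF h2 h(1) gen_in(2) gen_in(2)])
    have "kron (\<tau> (proj (Au_gen Q i k))) (\<sigma> (Au_gen Q k j)) = (if i = k then kron (\<tau> circle_gen) (\<sigma> (Au_gen Q k j)) else \<zero>\<^bsub>?C\<^esub>)" for k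
      by (simp add: proj_gen_entry \<tau>0)
    then have "finsum ?C (\<lambda>k. kron (\<tau> (proj (Au_gen Q i k))) (\<sigma> (Au_gen Q k j))) UNIV = kron (\<tau> circle_gen) (\<sigma> (Au_gen Q i j))"
      using C.finsum_singleton[of i UNIV "\<lambda>k. kron (\<tau> circle_gen) (\<sigma> (Au_gen Q k j))"] c by (simp only:) (simp add: Pi_def)
    then show ?thesis unfolding x kron_comult_gen[OF h2 h(1)] by simp
  qed
  show "kron_sum \<tau> \<sigma> (image_mset (map_prod proj id) (comult_poly p)) =
      eval_poly (corner bounded_ops (kron (\<tau> \<one>\<^bsub>CT\<^esub>) (\<sigma> \<one>\<^bsub>AA\<^esub>))) (\<lambda>x. kron (\<tau> circle_gen) (\<sigma> (gen x))) p"
    using kron_comult_poly[OF h2 h(1), of p] unfolding kron_sum_image 2 proj_one by simp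
qed

lemma proj_tensor_raw_maps:
  "raw_map bounded_ops (formal_tensor AA AA) (tensor_reps AA AA) bounded_ops (formal_tensor CT CT) (tensor_reps CT CT) (image_mset (map_prod proj proj))"
  "raw_map bounded_ops (formal_tensor AA AA) (tensor_reps AA AA) bounded_ops (formal_tensor AA CT) (tensor_reps AA CT) (image_mset (map_prod id proj))"
  "raw_map bounded_ops (formal_tensor AA AA) (tensor_reps AA AA) bounded_ops (formal_tensor CT AA) (tensor_reps CT AA) (image_mset (map_prod proj id))"
proof -
  have i: "star_hom AA B (\<lambda>a. \<sigma> (id a))" if "star_hom AA B \<sigma>" for B :: "'n Au_elem op cstar" and \<sigma> using that by simp
  show "raw_map bounded_ops (formal_tensor AA AA) (tensor_reps AA AA) bounded_ops (formal_tensor CT CT) (tensor_reps CT CT) (image_mset (map_prod proj proj))"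
    by (rule tensor_raw_map[OF GG.cstar_pair_axioms CC.cstar_pair_axioms proj_hom proj_hom])
      (rule AA_kron_sum_le[OF star_hom_comp[OF proj_hom] star_hom_comp[OF proj_hom]])
  show "raw_map bounded_ops (formal_tensor AA AA) (tensor_reps AA AA) bounded_ops (formal_tensor AA CT) (tensor_reps AA CT) (image_mset (map_prod id proj))"
    by (rule tensor_raw_map[OF GG.cstar_pair_axioms GN.cstar_pair_axioms star_hom_id proj_hom])
      (rule AA_kron_sum_le[OF i star_hom_comp[OF proj_hom]])
  show "raw_map bounded_ops (formal_tensor AA AA) (tensor_reps AA AA) bounded_ops (formal_tensor CT AA) (tensor_reps CT AA) (image_mset (map_prod proj id))"
    by (rule tensor_raw_map[OF GG.cstar_pair_axioms NG.cstar_pair_axioms proj_hom star_hom_id])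
      (rule AA_kron_sum_le[OF star_hom_comp[OF proj_hom] i])
qed

sublocale PP: raw_map bounded_ops "formal_tensor AA AA" "tensor_reps AA AA" bounded_ops
  "formal_tensor (CT :: 'n Au_elem cstar) CT" "tensor_reps CT CT" "image_mset (map_prod proj proj)"
  by (rule proj_tensor_raw_maps(1))
sublocale IP: raw_map bounded_ops "formal_tensor AA AA" "tensor_reps AA AA" bounded_ops
  "formal_tensor AA (CT :: 'n Au_elem cstar)" "tensor_reps AA CT" "image_mset (map_prod id proj)"
  by (rule proj_tensor_raw_maps(2))
sublocale PI: raw_map bounded_ops "formal_tensor AA AA" "tensor_reps AA AA" bounded_ops
  "formal_tensor (CT :: 'n Au_elem cstar) AA" "tensor_reps CT AA" "image_mset (map_prod proj id)"
  by (rule proj_tensor_raw_maps(3))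

text \<open>
  Under a pair of representations of \<open>C(\<T>)\<close>, both sides become functional calculus of the unitary
  that represents \<open>z \<otimes> z\<close>.
\<close>

lemma proj_comult:
  assumes "a \<in> carrier AA"
  shows "circle_comult (proj a) = tensor_map CT CT proj proj (Au_comult Q a)"
proof -
  from assms obtain x where x: "cauchy_seq (Au_free Q) x" "a = cauchy_class (Au_free Q) x"
    unfolding AA_completion by (rule free.carrier_completionE)
  have x': "cauchy_seq circle_free x" using proj.f_cauchy[OF x(1)] by simp
  note y = comult.f_cauchy[OF x(1)]
  have l: "circle_comult (proj a) = cauchy_class (formal_tensor CT CT) (\<lambda>n. circle_delta (x n))"
    unfolding x(2) proj_cc[OF x(1)] by (rule circle_comult_cc[OF x'])
  have r: "tensor_map CT CT proj proj (Au_comult Q a) =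
      cauchy_class (formal_tensor CT CT) (\<lambda>n. image_mset (map_prod proj proj) (comult_poly (x n)))"
    unfolding x(2) Au_comult_cc[OF x(1)] tensor_map_def by (rule PP.completion_map_cc[OF y])
  show ?thesis unfolding l r
  proof (rule CC.FT.cc_null[OF circ_delta.f_cauchy[OF x'] PP.f_cauchy[OF y]])
    fix n \<phi> assume "\<phi> \<in> tensor_reps (CT :: 'n Au_elem cstar) (CT :: 'n Au_elem cstar)"
    then obtain \<sigma> \<tau> where \<phi>: "\<phi> = kron_sum \<sigma> \<tau>" and h: "star_hom CT bounded_ops \<sigma>" "star_hom CT bounded_ops \<tau>"
      by (rule CC.tensor_repsE)
    have h1: "star_hom AA bounded_ops (\<lambda>a. \<sigma> (proj a))" by (rule star_hom_comp[OF proj_hom h(1)])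
    have \<sigma>0: "\<sigma> \<zero>\<^bsub>CT\<^esub> = \<zero>\<^bsub>bounded_ops\<^esub>" by (rule CT.star_hom_zero_elem[OF h(1) bops.pre_cstar_axioms])
    let ?P = "kron (\<sigma> \<one>\<^bsub>CT\<^esub>) (\<tau> \<one>\<^bsub>CT\<^esub>)"
    have g: "(\<lambda>x. kron (\<sigma> (proj (gen x))) (\<tau> circle_gen)) = diag (corner bounded_ops ?P) (kron (\<sigma> circle_gen) (\<tau> circle_gen))"
      by (auto simp: fun_eq_iff diag_def proj_gen_entry \<sigma>0)
    have "kron_sum \<sigma> \<tau> (image_mset (map_prod proj proj) (comult_poly (x n))) =
        kron_sum (\<lambda>a. \<sigma> (proj a)) \<tau> (image_mset (map_prod id proj) (comult_poly (x n)))"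
      unfolding kron_sum_image by simp
    also have "\<dots> = kron_sum \<sigma> \<tau> (circle_delta (x n))"
      unfolding kron_sum_proj(1)[OF h1 h(2)] g kron_unitary(3)[OF h] proj_one ..
    finally show "\<phi> (circle_delta (x n)) = \<phi> (image_mset (map_prod proj proj) (comult_poly (x n)))"
      unfolding \<phi> ..
  qed
qed

text \<open>Exchanging the tensor factors carries one coset condition into the other.\<close>

lemma coset_flip:
  assumes a: "a \<in> carrier AA"
  shows "dst (formal_tensor AA CT) (image_mset (map_prod id proj) (comult_poly p)) {#(a, \<one>\<^bsub>CT\<^esub>)#} =
    dst (formal_tensor CT AA) (image_mset (map_prod proj id) (comult_poly p)) {#(\<one>\<^bsub>CT\<^esub>, a)#}"
proof -
  have in1: "image_mset (map_prod id proj) (comult_poly p) \<in> carrier (formal_tensor AA CT)" "{#(a, \<one>\<^bsub>CT\<^esub>)#} \<in> carrier (formal_tensor AA (CT :: 'n Au_elem cstar))"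
    using IP.f_in[OF comult_poly_in] a by simp_all
  have in2: "image_mset (map_prod proj id) (comult_poly p) \<in> carrier (formal_tensor CT AA)" "{#(\<one>\<^bsub>CT\<^esub>, a)#} \<in> carrier (formal_tensor (CT :: 'n Au_elem cstar) AA)"
    using PI.f_in[OF comult_poly_in] a by simp_all
  have eq: "dst bounded_ops (kron_sum \<sigma> \<tau> (image_mset (map_prod id proj) (comult_poly p))) (kron_sum \<sigma> \<tau> {#(a, \<one>\<^bsub>CT\<^esub>)#}) =
      dst bounded_ops (kron_sum \<tau> \<sigma> (image_mset (map_prod proj id) (comult_poly p))) (kron_sum \<tau> \<sigma> {#(\<one>\<^bsub>CT\<^esub>, a)#})"
    if h: "star_hom AA bounded_ops \<sigma>" "star_hom CT bounded_ops \<tau>" for \<sigma> \<tau> :: "'n Au_elem \<Rightarrow> 'n Au_elem op"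
  proof -
    have "kron_sum \<tau> \<sigma> (image_mset (map_prod proj id) (comult_poly p)) = flip (kron_sum \<sigma> \<tau> (image_mset (map_prod id proj) (comult_poly p)))"
      unfolding kron_sum_proj[OF h] flip_eval flip_kron ..
    moreover have "kron_sum \<tau> \<sigma> {#(\<one>\<^bsub>CT\<^esub>, a)#} = flip (kron_sum \<sigma> \<tau> {#(a, \<one>\<^bsub>CT\<^esub>)#})" by (simp add: flip_kron)
    ultimately show ?thesis by (simp only: dst_flip)
  qed
  show ?thesis
  proof (rule antisym)
    show "dst (formal_tensor AA CT) (image_mset (map_prod id proj) (comult_poly p)) {#(a, \<one>\<^bsub>CT\<^esub>)#} \<le>
      dst (formal_tensor CT AA) (image_mset (map_prod proj id) (comult_poly p)) {#(\<one>\<^bsub>CT\<^esub>, a)#}"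
    proof (rule GN.FT.dst_le[OF in1])
      fix \<phi> assume "\<phi> \<in> tensor_reps AA (CT :: 'n Au_elem cstar)"
      then obtain \<sigma> \<tau> where \<phi>: "\<phi> = kron_sum \<sigma> \<tau>" and h: "star_hom AA bounded_ops \<sigma>" "star_hom CT bounded_ops \<tau>"
        by (rule GN.tensor_repsE)
      have "kron_sum \<tau> \<sigma> \<in> tensor_reps CT AA" using h by (auto simp: tensor_reps_def star_reps_def)
      from NG.FT.dst_ge[OF in2 this]
      show "dst bounded_ops (\<phi> (image_mset (map_prod id proj) (comult_poly p))) (\<phi> {#(a, \<one>\<^bsub>CT\<^esub>)#}) \<le>
          dst (formal_tensor CT AA) (image_mset (map_prod proj id) (comult_poly p)) {#(\<one>\<^bsub>CT\<^esub>, a)#}"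
        unfolding \<phi> eq[OF h] .
    qed
    show "dst (formal_tensor CT AA) (image_mset (map_prod proj id) (comult_poly p)) {#(\<one>\<^bsub>CT\<^esub>, a)#} \<le>
      dst (formal_tensor AA CT) (image_mset (map_prod id proj) (comult_poly p)) {#(a, \<one>\<^bsub>CT\<^esub>)#}"
    proof (rule NG.FT.dst_le[OF in2])
      fix \<phi> assume "\<phi> \<in> tensor_reps (CT :: 'n Au_elem cstar) AA"
      then obtain \<tau> \<sigma> where \<phi>: "\<phi> = kron_sum \<tau> \<sigma>" and h: "star_hom CT bounded_ops \<tau>" "star_hom AA bounded_ops \<sigma>"
        by (rule NG.tensor_repsE)
      have "kron_sum \<sigma> \<tau> \<in> tensor_reps AA CT" using h by (auto simp: tensor_reps_def star_reps_def)
      from GN.FT.dst_ge[OF in1 this]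
      show "dst bounded_ops (\<phi> (image_mset (map_prod proj id) (comult_poly p))) (\<phi> {#(\<one>\<^bsub>CT\<^esub>, a)#}) \<le>
          dst (formal_tensor AA CT) (image_mset (map_prod id proj) (comult_poly p)) {#(a, \<one>\<^bsub>CT\<^esub>)#}"
        unfolding \<phi> eq[OF h(2,1)] .
    qed
  qed
qed

lemma coset_condition:
  assumes a: "a \<in> carrier AA"
  shows "tensor_map AA CT id proj (Au_comult Q a) = tens AA CT a \<one>\<^bsub>CT\<^esub> \<longleftrightarrow>
    tensor_map CT AA proj id (Au_comult Q a) = tens CT AA \<one>\<^bsub>CT\<^esub> a"
proof -
  from a obtain x where x: "cauchy_seq (Au_free Q) x" "a = cauchy_class (Au_free Q) x"
    unfolding AA_completion by (rule free.carrier_completionE)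
  note y = comult.f_cauchy[OF x(1)]
  have s1: "{#(a, \<one>\<^bsub>CT\<^esub>)#} \<in> carrier (formal_tensor AA (CT :: 'n Au_elem cstar))" and s2: "{#(\<one>\<^bsub>CT\<^esub>, a)#} \<in> carrier (formal_tensor (CT :: 'n Au_elem cstar) AA)"
    using a by simp_all
  have 1: "tensor_map AA CT id proj (Au_comult Q a) =
      cauchy_class (formal_tensor AA CT) (\<lambda>n. image_mset (map_prod id proj) (comult_poly (x n)))"
    unfolding x(2) Au_comult_cc[OF x(1)] tensor_map_def by (rule IP.completion_map_cc[OF y])
  have 2: "tensor_map CT AA proj id (Au_comult Q a) =
      cauchy_class (formal_tensor CT AA) (\<lambda>n. image_mset (map_prod proj id) (comult_poly (x n)))"
    unfolding x(2) Au_comult_cc[OF x(1)] tensor_map_def by (rule PI.completion_map_cc[OF y])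
  show ?thesis
    unfolding 1 2 tens_def formal_sum_def completion_embed_def
      GN.FT.cc_eq_iff[OF IP.f_cauchy[OF y] GN.FT.cauchy_const[OF s1]]
      NG.FT.cc_eq_iff[OF PI.f_cauchy[OF y] NG.FT.cauchy_const[OF s2]] coset_flip[OF a] ..
qed

lemma circle_normal: "normal_quantum_subgroup (Au Q) circle_cqg proj"
  unfolding normal_quantum_subgroup_def quantum_subgroup_def cqg_morphism_def
proof (intro conjI ballI compact_quantum_group_circle)
  show "unital_star_hom (Au Q) circle_cqg proj" by (simp add: Au_def circle_cqg_def proj_unital_hom)
  show "proj ` carrier (Au Q) = carrier circle_cqg" by (simp add: Au_def circle_cqg_def proj_surj)
  show "comult circle_cqg (proj a) = tensor_map circle_cqg circle_cqg proj proj (comult (Au Q) a)" if "a \<in> carrier (Au Q)" for a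
    using that by (simp add: Au_def circle_cqg_def proj_comult)
  show "left_coset_algebra (Au Q) circle_cqg proj = right_coset_algebra (Au Q) circle_cqg proj"
    unfolding left_coset_algebra_def right_coset_algebra_def
    by (rule Collect_cong) (simp add: Au_def circle_cqg_def coset_condition cong: conj_cong)
qed

section \<open>Non-simplicity\<close>

text \<open>
  A diagonal unitary matrix has unitary entries, and \<open>\<Delta>(u\<^sub>l\<^sub>l)\<close> reduces to the single term
  \<open>u\<^sub>l\<^sub>l \<otimes> u\<^sub>l\<^sub>l\<close>.
\<close>

lemma generator_one_dimensional:
  assumes off: "\<And>i j. i \<noteq> j \<Longrightarrow> Au_gen Q i j = \<zero>\<^bsub>AA\<^esub>"
  shows "representation (Au Q) 1 (\<lambda>_ _. Au_gen Q l l)"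
proof -
  let ?u = "Au_gen Q l l"
  have one: "{..<Suc 0} = {0}" by auto
  have m: "mat_mult AA UNIV (\<lambda>i j. star AA (Au_gen Q j i)) (Au_gen Q) = mat_one AA"
    "mat_mult AA UNIV (Au_gen Q) (\<lambda>i j. star AA (Au_gen Q j i)) = mat_one AA"
    using gen_relations by (simp_all add: Au_relations_def Let_def)
  have s0: "star AA \<zero>\<^bsub>AA\<^esub> = \<zero>\<^bsub>AA\<^esub>" using A.star_smult[of "\<zero>\<^bsub>AA\<^esub>" 0] by simp
  have "star AA ?u \<otimes>\<^bsub>AA\<^esub> ?u = mat_mult AA UNIV (\<lambda>i j. star AA (Au_gen Q j i)) (Au_gen Q) l l"
  proof -
    have "finsum AA (\<lambda>k. star AA (Au_gen Q k l) \<otimes>\<^bsub>AA\<^esub> Au_gen Q k l) UNIV = finsum AA (\<lambda>k. if l = k then star AA (Au_gen Q k k) \<otimes>\<^bsub>AA\<^esub> Au_gen Q k k else \<zero>\<^bsub>AA\<^esub>) UNIV"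
      by (rule A.finsum_cong') (auto simp: off s0)
    then show ?thesis using A.finsum_singleton[of l UNIV "\<lambda>k. star AA (Au_gen Q k k) \<otimes>\<^bsub>AA\<^esub> Au_gen Q k k"] by (simp add: mat_mult_def Pi_def)
  qed
  then have u1: "star AA ?u \<otimes>\<^bsub>AA\<^esub> ?u = \<one>\<^bsub>AA\<^esub>" by (simp add: m mat_one_def)
  have "?u \<otimes>\<^bsub>AA\<^esub> star AA ?u = mat_mult AA UNIV (Au_gen Q) (\<lambda>i j. star AA (Au_gen Q j i)) l l"
  proof -
    have "finsum AA (\<lambda>k. Au_gen Q l k \<otimes>\<^bsub>AA\<^esub> star AA (Au_gen Q l k)) UNIV = finsum AA (\<lambda>k. if l = k then Au_gen Q k k \<otimes>\<^bsub>AA\<^esub> star AA (Au_gen Q k k) else \<zero>\<^bsub>AA\<^esub>) UNIV"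
      by (rule A.finsum_cong') (auto simp: off s0)
    then show ?thesis using A.finsum_singleton[of l UNIV "\<lambda>k. Au_gen Q k k \<otimes>\<^bsub>AA\<^esub> star AA (Au_gen Q k k)"] by (simp add: mat_mult_def Pi_def)
  qed
  then have u2: "?u \<otimes>\<^bsub>AA\<^esub> star AA ?u = \<one>\<^bsub>AA\<^esub>" by (simp add: m mat_one_def)
  have t0: "tens AA AA \<zero>\<^bsub>AA\<^esub> b = \<zero>\<^bsub>min_tensor AA AA\<^esub>" if "b \<in> carrier AA" for b
    using GG.tens_smult(1)[OF A.zero_closed that, of 0] that by simp
  have "Au_comult Q ?u = finsum (min_tensor AA AA) (\<lambda>k. if l = k then tens AA AA (Au_gen Q k k) (Au_gen Q k k) else \<zero>\<^bsub>min_tensor AA AA\<^esub>) UNIV"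
    unfolding Au_comult_gen by (rule GG.T.finsum_cong') (auto simp: off t0)
  then have d: "Au_comult Q ?u = tens AA AA ?u ?u"
    using GG.T.finsum_singleton[of l UNIV "\<lambda>k. tens AA AA (Au_gen Q k k) (Au_gen Q k k)"] by (simp add: Pi_def)
  show ?thesis unfolding representation_def
  proof (intro conjI allI impI exI[of _ "\<lambda>_ _. star AA ?u"])
    fix i j :: nat assume ij: "i < 1" "j < 1"
    show "?u \<in> carrier (Au Q)" "star AA ?u \<in> carrier (Au Q)" by (simp_all add: Au_def)
    show "mat_mult (Au Q) {..<1} (\<lambda>_ _. ?u) (\<lambda>_ _. star AA ?u) i j = mat_one (Au Q) i j"
      "mat_mult (Au Q) {..<1} (\<lambda>_ _. star AA ?u) (\<lambda>_ _. ?u) i j = mat_one (Au Q) i j"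
      using ij by (simp_all add: Au_def mat_mult_def mat_one_def one u1 u2)
    show "comult (Au Q) ?u = finsum (min_tensor (Au Q) (Au Q)) (\<lambda>k. tens (Au Q) (Au Q) ?u ?u) {..<1 :: nat}"
      by (simp add: Au_def one d)
  qed
qed

text \<open>
  In either case for the kernel of the quotient map onto the circle, the coordinate function \<open>z\<close>
  would be a scalar; its values at the angles 0 and \<open>\<pi>\<close> differ.
\<close>

lemma not_simple: "\<not> simple_cqg (Au Q)"
proof
  assume s: "simple_cqg (Au Q)"
  define l where "l = (undefined :: 'n)"
  let ?u = "Au_gen Q l l"
  have pu: "proj ?u = circle_gen" by (simp add: proj_gen_entry)
  have not_scalar: False if "circle_gen = c \<odot>\<^bsub>CT\<^esub> (\<one>\<^bsub>CT\<^esub> :: 'n Au_elem)" for c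
  proof -
    have "val (circle_gen :: 'n Au_elem) \<theta> = c" for \<theta> unfolding that by (simp add: val_hom)
    then have "val (circle_gen :: 'n Au_elem) 0 = val (circle_gen :: 'n Au_elem) pi" by simp
    moreover have "val (circle_gen :: 'n Au_elem) \<theta> = cis \<theta>" for \<theta> by (simp add: circle_gen_def)
    ultimately show False by simp
  qed
  have "trivial_quantum_subgroup (Au Q) circle_cqg proj"
    using s circle_normal circle_connected unfolding simple_cqg_def by blast
  then consider "a_kernel (Au Q) circle_cqg proj = a_kernel (Au Q) (Au Q) id"
    | \<epsilon> where "counit (Au Q) \<epsilon>" "a_kernel (Au Q) circle_cqg proj = a_kernel (Au Q) complex_cstar \<epsilon>"
    unfolding trivial_quantum_subgroup_def by blast
  then show False
  proof cases
    case 1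
    have ker: "b = \<zero>\<^bsub>AA\<^esub>" if "b \<in> carrier AA" "proj b = \<zero>\<^bsub>CT\<^esub>" for b
    proof -
      have "b \<in> a_kernel (Au Q) circle_cqg proj" using that by (simp add: a_kernel_def' Au_def circle_cqg_def)
      then show ?thesis unfolding 1 by (simp add: a_kernel_def' Au_def)
    qed
    have "Au_gen Q i j = \<zero>\<^bsub>AA\<^esub>" if "i \<noteq> j" for i j
      using that by (intro ker) (simp_all add: proj_gen_entry)
    then have "representation (Au Q) 1 (\<lambda>_ _. ?u)" by (rule generator_one_dimensional)
    then have "trivial_representation (Au Q) 1 (\<lambda>_ _. ?u)" using s unfolding simple_cqg_def by blast
    then have "?u = \<one>\<^bsub>AA\<^esub>" by (simp add: trivial_representation_def Au_def)
    then have "circle_gen = (\<one>\<^bsub>CT\<^esub> :: 'n Au_elem)" using pu proj_one by simp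
    then show False using not_scalar[of 1] by simp
  next
    case (2 \<epsilon>)
    then have \<epsilon>: "star_hom AA complex_cstar \<epsilon>" "\<epsilon> \<one>\<^bsub>AA\<^esub> = 1"
      by (simp_all add: counit_def unital_star_hom_def Au_def)
    let ?b = "?u \<oplus>\<^bsub>AA\<^esub> (- \<epsilon> ?u) \<odot>\<^bsub>AA\<^esub> \<one>\<^bsub>AA\<^esub>"
    have b: "?b \<in> carrier AA" by simp
    have "\<epsilon> ?b = 0" using star_homD(2)[OF \<epsilon>(1)] star_homD(4)[OF \<epsilon>(1)] \<epsilon>(2) by simp
    then have "?b \<in> a_kernel (Au Q) complex_cstar \<epsilon>" using b by (simp add: a_kernel_def' Au_def)
    then have "proj ?b = \<zero>\<^bsub>CT\<^esub>" unfolding 2(2)[symmetric] by (simp add: a_kernel_def' circle_cqg_def)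
    moreover have "proj ?b = circle_gen \<oplus>\<^bsub>CT\<^esub> (-1) \<odot>\<^bsub>CT\<^esub> (\<epsilon> ?u \<odot>\<^bsub>CT\<^esub> \<one>\<^bsub>CT\<^esub>)"
      using star_homD(2)[OF proj_hom] star_homD(4)[OF proj_hom] pu proj_one by (simp add: CT.sm_assoc)
    ultimately have "dst CT circle_gen (\<epsilon> ?u \<odot>\<^bsub>CT\<^esub> (\<one>\<^bsub>CT\<^esub> :: 'n Au_elem)) = 0" by (simp add: dst_def)
    then have "circle_gen = \<epsilon> ?u \<odot>\<^bsub>CT\<^esub> (\<one>\<^bsub>CT\<^esub> :: 'n Au_elem)" by (subst (asm) CT.dst_zero_iff) simp_all
    then show False by (rule not_scalar)
  qed
qed

end

theorem proposition4p5:
  fixes Q :: "complex ^ 'n ^ 'n"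
  assumes "invertible Q"
  shows "\<not> simple_cqg (Au Q)"
proof -
  interpret Au_setting Q by (rule Au_setting.intro[OF assms])
  show ?thesis by (rule not_simple)
qed

end
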